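(* Let $\Omega\subset\mathbb{R}^N$ ($N\ge 2$) be a bounded domain, $s_1\in(0,1)$, $p\in(1,2)$ and $s_p\in\left(\frac{p-1}{p},1\right)$. Suppose that $u$ is a locally bounded weak solution of $(-\Delta_1)^{s_1}u+(-\Delta_p)^{s_p}u=0$ in $\Omega$. Then $u\in W^{1,q}_{\mathrm{loc}}(\Omega)$ for any $q\ge p$. Moreover, there exist constants $C$ and $\kappa$ depending on $N,p,q,s_1,s_p$ such that for any ball $B_R\equiv B_R(x_0)\subset\subset\Omega$ with $R\in(0,1)$ and any $r\in(0,R)$, \[ \|\nabla u\|^q_{L^q(B_r)}\le \frac{C\left(\mathcal{T}+[u]_{W^{s_p,p}(B_R)}+1\right)^q}{(R-r)^{\kappa}},\qquad \mathcal{T}:=\|u\|_{L^\infty(B_R(x_0))}+\mathrm{Tail}(u;x_0,R). \]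
   Context: For $\gamma\in(0,1)$, $q\ge1$ and an open set $U$, $[w]_{W^{\gamma,q}(U)}:=\left(\int_U\int_U\frac{|w(x)-w(y)|^q}{|x-y|^{N+\gamma q}}dxdy\right)^{1/q}$. $W^{1,q}_{\mathrm{loc}}(\Omega)$ is the usual local Sobolev space. The tail space $L^{p-1}_{s_pp}(\mathbb{R}^N)$ consists of $w\in L^p_{\mathrm{loc}}(\mathbb{R}^N)$ with $\int_{\mathbb{R}^N}\frac{|w|^{p-1}}{(1+|x|)^{N+s_pp}}dx<\infty$, and $\mathrm{Tail}(u;x_0,R):=\left(R^{s_pp}\int_{\mathbb{R}^N\setminus B_R(x_0)}\frac{|u|^{p-1}}{|x-x_0|^{N+s_pp}}dx\right)^{1/(p-1)}$. A weak solution is a function $u\in W^{s_1,1}_{\mathrm{loc}}(\Omega)\cap W^{s_p,p}_{\mathrm{loc}}(\Omega)\cap L^{p-1}_{s_pp}(\mathbb{R}^N)$ for which there exists $Z\in L^\infty(\mathbb{R}^N\times\mathbb{R}^N)$ with $Z(x,y)\in\mathrm{sgn}(u(x)-u(y))$ (where $\mathrm{sgn}(t)=\{t/|t|\}$ for $t\ne0$ and $\mathrm{sgn}(0)=[-1,1]$) such that for every $\varphi\in W^{s_1,1}_0(\Omega)\cap W^{s_p,p}_0(\Omega)$, \[0=\int_{\mathbb{R}^N}\int_{\mathbb{R}^N}Z\frac{\varphi(x)-\varphi(y)}{|x-y|^{N+s_1}}dxdy+\int_{\mathbb{R}^N}\int_{\mathbb{R}^N}\frac{|u(x)-u(y)|^{p-2}(u(x)-u(y))(\varphi(x)-\varphi(y))}{|x-y|^{N+s_pp}}dxdy.\]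 Locally bounded means $u\in L^\infty(B)$ for every ball $B\subset\subset\Omega$. *)

theory Defs
  imports "HOL-Analysis.Analysis"
begin

definition cc_subset :: "'a::euclidean_space set \<Rightarrow> 'a set \<Rightarrow> bool" where
  "cc_subset U \<Omega> \<longleftrightarrow> compact (closure U) \<and> closure U \<subseteq> \<Omega>"

definition gagliardo_pow :: "real \<Rightarrow> real \<Rightarrow> 'a::euclidean_space set \<Rightarrow> ('a \<Rightarrow> real) \<Rightarrow> ennreal" where
  "gagliardo_pow \<gamma> q U w =
     (\<integral>\<^sup>+ z. ennreal (\<bar>w (fst z) - w (snd z)\<bar> powr q /
                 norm (fst z - snd z) powr (real DIM('a) + \<gamma> * q)) * indicator (U \<times> U) z
        \<partial>(lebesgue \<Otimes>\<^sub>M lebesgue))"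

definition gagliardo :: "real \<Rightarrow> real \<Rightarrow> 'a::euclidean_space set \<Rightarrow> ('a \<Rightarrow> real) \<Rightarrow> real" where
  "gagliardo \<gamma> q U w = enn2real (gagliardo_pow \<gamma> q U w) powr (1 / q)"

definition Lq_on :: "real \<Rightarrow> 'a::euclidean_space set \<Rightarrow> ('a \<Rightarrow> real) \<Rightarrow> bool" where
  "Lq_on q U w \<longleftrightarrow> set_borel_measurable lebesgue U w \<and>
     (\<integral>\<^sup>+ x. ennreal (\<bar>w x\<bar> powr q) * indicator U x \<partial>lebesgue) < \<infinity>"

definition frac_sobolev :: "real \<Rightarrow> real \<Rightarrow> 'a::euclidean_space set \<Rightarrow> ('a \<Rightarrow> real) \<Rightarrow> bool" where
  "frac_sobolev \<gamma> q U w \<longleftrightarrow> Lq_on q U w \<and> gagliardo_pow \<gamma> q U w < \<infinity>"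

definition frac_sobolev_loc :: "real \<Rightarrow> real \<Rightarrow> 'a::euclidean_space set \<Rightarrow> ('a \<Rightarrow> real) \<Rightarrow> bool" where
  "frac_sobolev_loc \<gamma> q \<Omega> w \<longleftrightarrow> (\<forall>U. open U \<and> cc_subset U \<Omega> \<longrightarrow> frac_sobolev \<gamma> q U w)"

definition frac_sobolev0 :: "real \<Rightarrow> real \<Rightarrow> 'a::euclidean_space set \<Rightarrow> ('a \<Rightarrow> real) \<Rightarrow> bool" where
  "frac_sobolev0 \<gamma> q \<Omega> w \<longleftrightarrow> frac_sobolev \<gamma> q UNIV w \<and> (AE x in lebesgue. x \<notin> \<Omega> \<longrightarrow> w x = 0)"

definition tail_space :: "real \<Rightarrow> real \<Rightarrow> ('a::euclidean_space \<Rightarrow> real) \<Rightarrow> bool" where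
  "tail_space s p w \<longleftrightarrow> (\<forall>K. compact K \<longrightarrow> Lq_on p K w) \<and>
     (\<integral>\<^sup>+ x. ennreal (\<bar>w x\<bar> powr (p - 1) / (1 + norm x) powr (real DIM('a) + s * p)) \<partial>lebesgue) < \<infinity>"

definition Tail :: "real \<Rightarrow> real \<Rightarrow> ('a::euclidean_space \<Rightarrow> real) \<Rightarrow> 'a \<Rightarrow> real \<Rightarrow> real" where
  "Tail s p u x0 R =
     (R powr (s * p) * enn2real (\<integral>\<^sup>+ x. ennreal (\<bar>u x\<bar> powr (p - 1) /
          norm (x - x0) powr (real DIM('a) + s * p)) * indicator (UNIV - ball x0 R) x \<partial>lebesgue))
     powr (1 / (p - 1))"

definition in_sgn :: "real \<Rightarrow> real \<Rightarrow> bool" where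
  "in_sgn z t \<longleftrightarrow> (if t = 0 then \<bar>z\<bar> \<le> 1 else z = sgn t)"

definition weak_solution ::
  "real \<Rightarrow> real \<Rightarrow> real \<Rightarrow> 'a::euclidean_space set \<Rightarrow> ('a \<Rightarrow> real) \<Rightarrow> bool" where
  "weak_solution s1 sp p \<Omega> u \<longleftrightarrow>
     frac_sobolev_loc s1 1 \<Omega> u \<and> frac_sobolev_loc sp p \<Omega> u \<and> tail_space sp p u \<and>
     (\<exists>Z :: 'a \<times> 'a \<Rightarrow> real.
        Z \<in> borel_measurable (lebesgue \<Otimes>\<^sub>M lebesgue) \<and>
        (\<exists>M. AE z in lebesgue \<Otimes>\<^sub>M lebesgue. \<bar>Z z\<bar> \<le> M) \<and>
        (AE z in lebesgue \<Otimes>\<^sub>M lebesgue. in_sgn (Z z) (u (fst z) - u (snd z))) \<and>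
        (\<forall>\<phi>. frac_sobolev0 s1 1 \<Omega> \<phi> \<and> frac_sobolev0 sp p \<Omega> \<phi> \<longrightarrow>
           0 = (\<integral> z. Z z * (\<phi> (fst z) - \<phi> (snd z)) /
                      norm (fst z - snd z) powr (real DIM('a) + s1) \<partial>(lebesgue \<Otimes>\<^sub>M lebesgue))
             + (\<integral> z. \<bar>u (fst z) - u (snd z)\<bar> powr (p - 2) * (u (fst z) - u (snd z)) *
                      (\<phi> (fst z) - \<phi> (snd z)) /
                      norm (fst z - snd z) powr (real DIM('a) + sp * p) \<partial>(lebesgue \<Otimes>\<^sub>M lebesgue))))"

definition Linf_on :: "'a::euclidean_space set \<Rightarrow> ('a \<Rightarrow> real) \<Rightarrow> bool" where
  "Linf_on B u \<longleftrightarrow> set_borel_measurable lebesgue B u \<and> (\<exists>M. AE x in lebesgue. x \<in> B \<longrightarrow> \<bar>u x\<bar> \<le> M)"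

definition locally_bounded :: "'a::euclidean_space set \<Rightarrow> ('a \<Rightarrow> real) \<Rightarrow> bool" where
  "locally_bounded \<Omega> u \<longleftrightarrow> (\<forall>x R. cc_subset (ball x R) \<Omega> \<longrightarrow> Linf_on (ball x R) u)"

definition Linf_norm :: "'a::euclidean_space set \<Rightarrow> ('a \<Rightarrow> real) \<Rightarrow> real" where
  "Linf_norm B u = Inf {M. 0 \<le> M \<and> (AE x in lebesgue. x \<in> B \<longrightarrow> \<bar>u x\<bar> \<le> M)}"

definition test_fun :: "'a::euclidean_space set \<Rightarrow> ('a \<Rightarrow> real) \<Rightarrow> ('a \<Rightarrow> 'a) \<Rightarrow> bool" where
  "test_fun \<Omega> \<phi> \<phi>' \<longleftrightarrow> (\<forall>x. (\<phi> has_derivative (\<lambda>h. \<phi>' x \<bullet> h)) (at x)) \<and> continuous_on UNIV \<phi>' \<and>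
     (\<exists>K. compact K \<and> K \<subseteq> \<Omega> \<and> (\<forall>x. x \<notin> K \<longrightarrow> \<phi> x = 0))"

definition weak_gradient :: "'a::euclidean_space set \<Rightarrow> ('a \<Rightarrow> real) \<Rightarrow> ('a \<Rightarrow> 'a) \<Rightarrow> bool" where
  "weak_gradient \<Omega> u G \<longleftrightarrow> G \<in> borel_measurable lebesgue \<and>
     (\<forall>K. compact K \<and> K \<subseteq> \<Omega> \<longrightarrow> set_integrable lebesgue K G) \<and>
     (\<forall>\<phi> \<phi>'. test_fun \<Omega> \<phi> \<phi>' \<longrightarrow>
        (\<integral> x. u x *\<^sub>R \<phi>' x \<partial>lebesgue) = - (\<integral> x. \<phi> x *\<^sub>R G x \<partial>lebesgue))"

definition sobolev1_loc :: "real \<Rightarrow> 'a::euclidean_space set \<Rightarrow> ('a \<Rightarrow> real) \<Rightarrow> bool" where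
  "sobolev1_loc q \<Omega> u \<longleftrightarrow> (\<forall>K. compact K \<and> K \<subseteq> \<Omega> \<longrightarrow> Lq_on q K u) \<and>
     (\<exists>G. weak_gradient \<Omega> u G \<and>
        (\<forall>K. compact K \<and> K \<subseteq> \<Omega> \<longrightarrow> Lq_on q K (\<lambda>x. norm (G x))))"

end

theory Submission
  imports Defs
begin

text \<open>Write \<open>\<tau>\<^sub>h u (x) = u (x + h) - u x\<close> and \<open>m = q + 1 - p\<close>. Subtract the equation from its translate by
  \<open>h\<close> and test with \<open>\<eta>\<^sup>2 |\<tau>\<^sub>h u|\<^bsup>m-1\<^esup> \<tau>\<^sub>h u\<close> for a cut-off function \<open>\<eta>\<close>. The sign being monotone, the
  1-Laplacian only contributes cut-off errors, and the \<open>p\<close>-Laplacian controls the double integral of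
  \<open>w\<^bsup>p-2\<^esup> e\<^bsup>m+1\<^esup> / |x - y|\<^bsup>N + s p\<^esup>\<close>, where \<open>e = |\<tau>\<^sub>h u x - \<tau>\<^sub>h u y|\<close> and
  \<open>w = |u (x + h) - u (y + h)| + |u x - u y|\<close>, by \<open>\<integral> |\<tau>\<^sub>h u|\<^sup>m\<close>, the supremum and the tail of \<open>u\<close>.

  Comparing \<open>w\<close> with \<open>|h|\<^bsup>-\<beta>\<^esup> e\<close> and averaging over \<open>|x - y| \<le> |h|\<close> turns this into a bound of order
  \<open>g + \<beta>\<close> for \<open>\<tau>\<^sub>h \<tau>\<^sub>h u\<close> in \<open>L\<^sup>q\<close>, if \<open>\<tau>\<^sub>h u\<close> is of order \<open>g \<le> 1\<close>, as long as \<open>\<beta> (q + 2 - p) \<le> s p - (p - 1)\<close>;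
  the right-hand side is positive exactly because \<open>s > (p - 1) / p\<close>. Below order \<open>1\<close>, the identity
  \<open>2 \<tau>\<^sub>h = \<tau>\<^bsub>2h\<^esub> - \<tau>\<^sub>h \<tau>\<^sub>h\<close> leads back to first differences. After finitely many rounds the second differences
  have order greater than \<open>1\<close>, so the dyadic difference quotients converge geometrically in \<open>L\<^sup>q\<close>, and
  their limits are the weak derivatives.\<close>

section \<open>The product of Lebesgue measure with itself\<close>

text \<open>The obstacle is the singular range p < 2: the weight w^(p-2) is small where w is large
  compared with e, so the energy does not control e in L^q. Where w > l e only e < w / l is left,
  and w is paid for by the first differences themselves. The exponent m is fixed by homogeneity, (p
  - 2) + (m + 1) = q, and q >= p gives m >= 1, so that powers of order m are locally Lipschitz. One
  round turns an integral of m-th powers into one of q-th powers. The missing power q - m = p - 1 of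
  the first differences costs g (p - 1) <= p - 1 orders of |h|, which the kernel has to supply;
  hence the comparison of s p with p - 1. Two features of the formal statement shape the rest.
  Solutions are only Lebesgue measurable, while Fubini is applied to Borel integrands: u is replaced
  by a Borel representative, and Z, which stays merely measurable for \<open>lebesgue2\<close>,
  enters only through its sign and the bound 1. And the estimate is claimed for every weak gradient,
  so besides constructing one, its uniqueness is proved.\<close>

abbreviation lebesgue2 :: "('a::euclidean_space \<times> 'a) measure" where
  "lebesgue2 \<equiv> lebesgue \<Otimes>\<^sub>M lebesgue"

text \<open>A countable Borel cover by sets of finite measure survives the completion of
  \<open>lborel\<close>. This makes Fubini available on \<open>lebesgue2\<close>.\<close>

lemma sigma_finite_lebesgue: "sigma_finite_measure (lebesgue :: 'a::euclidean_space measure)"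
proof -
  obtain A :: "'a set set" where A: "countable A" "A \<subseteq> sets lborel" "\<Union>A = space lborel"
    "\<forall>a\<in>A. emeasure lborel a \<noteq> \<infinity>"
    using lborel.sigma_finite_countable by metis
  show ?thesis
    by standard (use A in \<open>auto intro!: exI[of _ A] simp: subset_eq\<close>)
qed

lemma fst_borel_measurable_lebesgue2 [measurable]: "fst \<in> lebesgue2 \<rightarrow>\<^sub>M (borel :: 'a::euclidean_space measure)"
  by (rule measurable_compose[OF measurable_fst]) (simp add: measurable_completion)

lemma snd_borel_measurable_lebesgue2 [measurable]: "snd \<in> lebesgue2 \<rightarrow>\<^sub>M (borel :: 'a::euclidean_space measure)"
  by (rule measurable_compose[OF measurable_snd]) (simp add: measurable_completion)

lemma borel_measurable_lebesgue2:
  fixes f :: "'a::euclidean_space \<times> 'a \<Rightarrow> 'b::topological_space"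
  assumes f: "f \<in> borel_measurable borel"
  shows "f \<in> borel_measurable lebesgue2"
proof -
  have "(\<lambda>z::'a \<times> 'a. (fst z, snd z)) \<in> lebesgue2 \<rightarrow>\<^sub>M borel \<Otimes>\<^sub>M borel" by measurable
  then have "(\<lambda>z::'a \<times> 'a. z) \<in> lebesgue2 \<rightarrow>\<^sub>M borel" by (simp add: borel_prod)
  from measurable_compose[OF this f] show ?thesis .
qed

lemma nn_integral_lebesgue2:
  fixes f :: "'a::euclidean_space \<times> 'a \<Rightarrow> ennreal"
  assumes f[measurable]: "f \<in> borel_measurable borel"
  shows "(\<integral>\<^sup>+ z. f z \<partial>lebesgue2) = (\<integral>\<^sup>+ x. \<integral>\<^sup>+ y. f (x, y) \<partial>lborel \<partial>lborel)"
proof -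
  interpret sigma_finite_measure "lebesgue :: 'a measure" by (rule sigma_finite_lebesgue)
  show ?thesis
    by (simp add: nn_integral_fst[OF borel_measurable_lebesgue2[OF f], symmetric] nn_integral_completion)
qed

lemma nn_integral_lborel_swap:
  fixes f :: "'a::euclidean_space \<Rightarrow> 'b::euclidean_space \<Rightarrow> ennreal"
  assumes [measurable]: "case_prod f \<in> borel_measurable borel"
  shows "(\<integral>\<^sup>+ x. \<integral>\<^sup>+ y. f x y \<partial>lborel \<partial>lborel) = (\<integral>\<^sup>+ y. \<integral>\<^sup>+ x. f x y \<partial>lborel \<partial>lborel)"
  by (rule lborel_pair.Fubini'[symmetric]) (use assms in \<open>simp add: lborel_prod\<close>)

lemma nn_integral_lebesgue2_swap:
  fixes f :: "'a::euclidean_space \<times> 'a \<Rightarrow> ennreal"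
  assumes f: "f \<in> borel_measurable borel"
  shows "(\<integral>\<^sup>+ z. f (snd z, fst z) \<partial>lebesgue2) = (\<integral>\<^sup>+ z. f z \<partial>lebesgue2)"
proof -
  have s: "(\<lambda>z::'a \<times> 'a. f (snd z, fst z)) \<in> borel_measurable borel"
    using f unfolding borel_prod[symmetric] by measurable
  have c: "case_prod (\<lambda>x y. f (x, y)) \<in> borel_measurable borel" using f by simp
  show ?thesis
    unfolding nn_integral_lebesgue2[OF s] nn_integral_lebesgue2[OF f] fst_conv snd_conv
    by (rule nn_integral_lborel_swap[OF c, symmetric])
qed

lemma nn_integral_lborel_shift:
  fixes f :: "'a::euclidean_space \<Rightarrow> ennreal"
  assumes [measurable]: "f \<in> borel_measurable borel"
  shows "(\<integral>\<^sup>+ x. f (x + h) \<partial>lborel) = (\<integral>\<^sup>+ x. f x \<partial>lborel)"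
proof -
  have "(\<integral>\<^sup>+ x. f x \<partial>lborel) = (\<integral>\<^sup>+ x. f x \<partial>(distr lborel borel ((+) h)))"
    by (simp add: lborel_distr_plus)
  also have "\<dots> = (\<integral>\<^sup>+ x. f (h + x) \<partial>lborel)"
    by (subst nn_integral_distr) auto
  finally show ?thesis by (simp add: add.commute)
qed

lemma nn_integral_lborel_reflect:
  fixes f :: "'a::euclidean_space \<Rightarrow> ennreal"
  assumes [measurable]: "f \<in> borel_measurable borel"
  shows "(\<integral>\<^sup>+ y. f (x - y) \<partial>lborel) = (\<integral>\<^sup>+ y. f y \<partial>lborel)"
proof -
  have *: "distr lborel borel (\<lambda>y::'a. x + (-1) *\<^sub>R y) = lborel"
    using lborel_affine[of "-1" x] by (simp add: density_1)
  have "(\<integral>\<^sup>+ y. f y \<partial>lborel) = (\<integral>\<^sup>+ y. f y \<partial>distr lborel borel (\<lambda>y::'a. x + (-1) *\<^sub>R y))"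
    by (subst *) (rule refl)
  also have "\<dots> = (\<integral>\<^sup>+ y. f (x - y) \<partial>lborel)"
    by (subst nn_integral_distr) auto
  finally show ?thesis by simp
qed

text \<open>Invariance is wanted for \<open>lebesgue\<close> itself: the tested equation that is
  translated later contains \<open>Z\<close>, which need not be Borel.\<close>

lemma distr_lebesgue_shift: "distr lebesgue lebesgue (\<lambda>x::'a::euclidean_space. x + h) = lebesgue"
  and shift_measurable_lebesgue: "(\<lambda>x::'a. x + h) \<in> lebesgue \<rightarrow>\<^sub>M lebesgue"
proof -
  have *: "(\<lambda>x::'a. h + (\<Sum>j\<in>Basis. (1 * (x \<bullet> j)) *\<^sub>R j)) = (\<lambda>x. x + h)"
    by (simp add: euclidean_representation add.commute)
  show "distr lebesgue lebesgue (\<lambda>x::'a. x + h) = lebesgue"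
    using lebesgue_affine_euclidean[of "\<lambda>_. 1" h, unfolded *]
    by (simp add: density_1)
  show "(\<lambda>x::'a. x + h) \<in> lebesgue \<rightarrow>\<^sub>M lebesgue"
    using lebesgue_affine_measurable[of "\<lambda>_. 1" h, unfolded *] by simp
qed

lemma distr_lebesgue2_shift:
  "distr lebesgue2 lebesgue2 (\<lambda>z::'a::euclidean_space \<times> 'a. (fst z + h, snd z + h)) = lebesgue2"
  using pair_measure_distr[OF shift_measurable_lebesgue shift_measurable_lebesgue, of h h]
  by (simp add: distr_lebesgue_shift sigma_finite_lebesgue case_prod_beta')

lemma shift_measurable_lebesgue2 [measurable]:
  "(\<lambda>z::'a::euclidean_space \<times> 'a. (fst z + h, snd z + h)) \<in> lebesgue2 \<rightarrow>\<^sub>M lebesgue2"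
  by (intro measurable_Pair measurable_compose[OF measurable_fst shift_measurable_lebesgue]
      measurable_compose[OF measurable_snd shift_measurable_lebesgue])

lemma integral_lebesgue2_shift:
  fixes f :: "'a::euclidean_space \<times> 'a \<Rightarrow> real"
  assumes [measurable]: "f \<in> borel_measurable lebesgue2"
  shows "(\<integral> z. f (fst z + h, snd z + h) \<partial>lebesgue2) = (\<integral> z. f z \<partial>lebesgue2)"
  by (subst (2) distr_lebesgue2_shift[of h, symmetric], subst integral_distr) auto

lemma integrable_lebesgue2_shift:
  fixes f :: "'a::euclidean_space \<times> 'a \<Rightarrow> real"
  assumes [measurable]: "f \<in> borel_measurable lebesgue2"
  shows "integrable lebesgue2 (\<lambda>z. f (fst z + h, snd z + h)) \<longleftrightarrow> integrable lebesgue2 f"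
  by (subst (2) distr_lebesgue2_shift[of h, symmetric], subst integrable_distr_eq) auto

lemma nn_integral_lebesgue2_shift:
  fixes f :: "'a::euclidean_space \<times> 'a \<Rightarrow> ennreal"
  assumes [measurable]: "f \<in> borel_measurable lebesgue2"
  shows "(\<integral>\<^sup>+ z. f (fst z + h, snd z + h) \<partial>lebesgue2) = (\<integral>\<^sup>+ z. f z \<partial>lebesgue2)"
  by (subst (2) distr_lebesgue2_shift[of h, symmetric], subst nn_integral_distr) auto

text \<open>The positive and the negative part of \<open>\<Phi>\<close> have the same finite
  integral, which can be cancelled. Writing the pointwise inequality with both parts in
  \<open>ennreal\<close> allows the integrals of \<open>X\<close> and \<open>E\<close> to be
  infinite, so the energy can be estimated before it is known to be finite.\<close>

lemma nn_integral_le_of_integral_eq_0: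
  fixes \<Phi> :: "'b \<Rightarrow> real" and X E :: "'b \<Rightarrow> ennreal"
  assumes int: "integrable M \<Phi>" and 0: "integral\<^sup>L M \<Phi> = 0"
    and [measurable]: "X \<in> borel_measurable M" "E \<in> borel_measurable M"
    and le: "\<And>z. z \<in> space M \<Longrightarrow> X z + ennreal (- \<Phi> z) \<le> E z + ennreal (\<Phi> z)"
  shows "(\<integral>\<^sup>+ z. X z \<partial>M) \<le> (\<integral>\<^sup>+ z. E z \<partial>M)"
proof -
  have [measurable]: "\<Phi> \<in> borel_measurable M" using int by simp
  have fin: "(\<integral>\<^sup>+ z. ennreal (\<Phi> z) \<partial>M) < \<infinity>" "(\<integral>\<^sup>+ z. ennreal (- \<Phi> z) \<partial>M) < \<infinity>"
    using int by (auto simp: real_integrable_def top.not_eq_extremum)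
  have "enn2real (\<integral>\<^sup>+ z. ennreal (\<Phi> z) \<partial>M) = enn2real (\<integral>\<^sup>+ z. ennreal (- \<Phi> z) \<partial>M)"
    using 0 real_lebesgue_integral_def[OF int] by simp
  then have eq: "(\<integral>\<^sup>+ z. ennreal (\<Phi> z) \<partial>M) = (\<integral>\<^sup>+ z. ennreal (- \<Phi> z) \<partial>M)"
    using fin by (metis ennreal_enn2real infinity_ennreal_def)
  have "(\<integral>\<^sup>+ z. X z \<partial>M) + (\<integral>\<^sup>+ z. ennreal (- \<Phi> z) \<partial>M) = (\<integral>\<^sup>+ z. X z + ennreal (- \<Phi> z) \<partial>M)"
    by (subst nn_integral_add) auto
  also have "\<dots> \<le> (\<integral>\<^sup>+ z. E z + ennreal (\<Phi> z) \<partial>M)" by (rule nn_integral_mono) (rule le)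
  also have "\<dots> = (\<integral>\<^sup>+ z. E z \<partial>M) + (\<integral>\<^sup>+ z. ennreal (\<Phi> z) \<partial>M)"
    by (subst nn_integral_add) auto
  finally show ?thesis using fin eq by (auto simp: ennreal_add_left_cancel_le add.commute)
qed

section \<open>Elementary inequalities\<close>

text \<open>The odd power |t|^(\<alpha>-1) t, with value 0 at 0. For \<alpha> = p - 1 it is the
  nonlinearity of the p-Laplacian, for \<alpha> = m it occurs in the test function.\<close>

definition spow :: "real \<Rightarrow> real \<Rightarrow> real" where
  "spow \<alpha> t = sgn t * \<bar>t\<bar> powr \<alpha>"

lemma spow_minus: "spow \<alpha> (- t) = - spow \<alpha> t"
  by (simp add: spow_def sgn_minus)

lemma spow_nonneg: "0 \<le> t \<Longrightarrow> spow \<alpha> t = t powr \<alpha>"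
  by (cases "t = 0") (auto simp: spow_def)

lemma spow_nonpos: "t \<le> 0 \<Longrightarrow> spow \<alpha> t = - ((- t) powr \<alpha>)"
  using spow_nonneg[of "- t" \<alpha>] by (simp add: spow_minus)

lemma abs_spow: "\<bar>spow \<alpha> t\<bar> = \<bar>t\<bar> powr \<alpha>"
  by (auto simp: spow_def abs_mult abs_sgn_eq)

lemma borel_measurable_spow [measurable]: "spow \<alpha> \<in> borel_measurable borel"
  unfolding spow_def[abs_def] by measurable

lemma abs_powr_mult_eq_spow: "\<bar>t\<bar> powr (p - 2) * t = spow (p - 1) t"
proof (cases "t = 0")
  case False
  then have "\<bar>t\<bar> powr (p - 1) = \<bar>t\<bar> powr (p - 2) * \<bar>t\<bar>"
    using powr_add[of "\<bar>t\<bar>" "p - 2" 1] by simp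
  then show ?thesis by (simp add: spow_def mult.assoc mult.commute abs_mult_sgn)
qed (simp add: spow_def)

text \<open>Inequalities between odd powers are invariant under joint negation and under exchange.
  Up to these symmetries only two configurations exist, and in both all bases of powers are
  nonnegative.\<close>

lemma sign_wlog [case_names flip swap same opposite]:
  fixes P :: "real \<Rightarrow> real \<Rightarrow> bool"
  assumes "\<And>a b. P (- a) (- b) \<Longrightarrow> P a b" "\<And>a b. P b a \<Longrightarrow> P a b"
    and "\<And>a b. 0 \<le> b \<Longrightarrow> b \<le> a \<Longrightarrow> P a b"
    and "\<And>a b. 0 \<le> a \<Longrightarrow> b \<le> 0 \<Longrightarrow> P a b"
  shows "P a b"
proof (cases "0 \<le> a"; cases "0 \<le> b")
  assume "0 \<le> a" "0 \<le> b" then show ?thesis by (cases "b \<le> a") (auto intro: assms(3) assms(2)[OF assms(3)])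
next
  assume "\<not> 0 \<le> a" "\<not> 0 \<le> b"
  then have "P (- a) (- b)" if "a \<le> b" using that by (intro assms(3)) auto
  moreover have "P (- a) (- b)" if "b \<le> a"
    using that \<open>\<not> 0 \<le> a\<close> by (intro assms(2)[OF assms(3)]) auto
  ultimately have "P (- a) (- b)" by (cases "a \<le> b") simp_all
  then show ?thesis by (rule assms(1))
next
  assume "0 \<le> a" "\<not> 0 \<le> b" then show ?thesis by (intro assms(4)) auto
next
  assume "\<not> 0 \<le> a" "0 \<le> b" then show ?thesis by (intro assms(2)[OF assms(4)]) auto
qed

text \<open>After division by x + y the two terms lie in [0, 1] and sum to 1, and there z <=
  z^\<alpha>.\<close>

lemma powr_add_le:
  fixes x y \<alpha> :: real
  assumes "0 \<le> x" "0 \<le> y" "0 < \<alpha>" "\<alpha> \<le> 1"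
  shows "(x + y) powr \<alpha> \<le> x powr \<alpha> + y powr \<alpha>"
proof (cases "x + y = 0")
  case False
  then have s: "x + y > 0" using assms by simp
  have *: "z / (x + y) \<le> (z / (x + y)) powr \<alpha>" if "0 \<le> z" "z \<le> x + y" for z
  proof (cases "z = 0")
    case False
    have "(z / (x + y)) powr 1 \<le> (z / (x + y)) powr \<alpha>"
      using assms s that False by (intro powr_mono') auto
    then show ?thesis using that False s by simp
  qed simp
  have "1 = x / (x + y) + y / (x + y)" using s by (simp add: add_divide_distrib[symmetric])
  also have "\<dots> \<le> (x / (x + y)) powr \<alpha> + (y / (x + y)) powr \<alpha>"
    using assms by (intro add_mono *) auto
  also have "\<dots> = (x powr \<alpha> + y powr \<alpha>) / (x + y) powr \<alpha>"
    using assms s by (simp add: powr_divide add_divide_distrib)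
  finally show ?thesis using s by (simp add: field_simps)
qed (use assms in simp)

lemma powr_add_le_2powr:
  fixes x y q :: real
  assumes "0 \<le> x" "0 \<le> y" "0 \<le> q"
  shows "(x + y) powr q \<le> 2 powr q * (x powr q + y powr q)"
proof -
  have "(x + y) powr q \<le> (2 * max x y) powr q" using assms by (intro powr_mono2) auto
  also have "\<dots> = 2 powr q * max x y powr q" using assms by (simp add: powr_mult)
  also have "\<dots> \<le> 2 powr q * (x powr q + y powr q)" by (auto simp: max_def)
  finally show ?thesis .
qed

lemma abs_diff_powr_le:
  fixes a b q :: real
  assumes "0 \<le> q"
  shows "\<bar>a - b\<bar> powr q \<le> 2 powr q * (\<bar>a\<bar> powr q + \<bar>b\<bar> powr q)"
proof -
  have "\<bar>a - b\<bar> powr q \<le> (\<bar>a\<bar> + \<bar>b\<bar>) powr q" using assms by (intro powr_mono2) auto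
  also have "\<dots> \<le> 2 powr q * (\<bar>a\<bar> powr q + \<bar>b\<bar> powr q)" using assms by (intro powr_add_le_2powr) auto
  finally show ?thesis .
qed

text \<open>Equal signs are covered by subadditivity of the power. The factor 2 is due to opposite
  signs, where each of the two powers is bounded by |a - b|^\<alpha>.\<close>

lemma spow_diff_le:
  assumes "0 < \<alpha>" "\<alpha> \<le> 1"
  shows "\<bar>spow \<alpha> a - spow \<alpha> b\<bar> \<le> 2 * \<bar>a - b\<bar> powr \<alpha>"
proof (induct a b rule: sign_wlog)
  case (same a b)
  have "a powr \<alpha> \<le> b powr \<alpha> + (a - b) powr \<alpha>"
    using powr_add_le[of b "a - b" \<alpha>] same assms by simp
  moreover have "b powr \<alpha> \<le> a powr \<alpha>" using same assms by (intro powr_mono2) auto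
  ultimately have "\<bar>spow \<alpha> a - spow \<alpha> b\<bar> \<le> \<bar>a - b\<bar> powr \<alpha>" using same by (simp add: spow_nonneg)
  then show ?case by (smt (verit) powr_ge_zero)
next
  case (opposite a b)
  have "a powr \<alpha> \<le> \<bar>a - b\<bar> powr \<alpha>" "(- b) powr \<alpha> \<le> \<bar>a - b\<bar> powr \<alpha>"
    using opposite assms by (auto intro!: powr_mono2)
  then show ?case using opposite by (simp add: spow_nonneg spow_nonpos)
qed (simp_all add: spow_minus abs_minus_commute)

text \<open>Monotonicity in the form of an equation: it says that the two factors have the same
  sign, and \<open>mult_eq_abs_mult\<close> can transfer this between different odd powers of the
  same increment.\<close>

lemma spow_diff_sgn:
  assumes "0 < \<alpha>"
  shows "(spow \<alpha> a - spow \<alpha> b) * (a - b) = \<bar>spow \<alpha> a - spow \<alpha> b\<bar> * \<bar>a - b\<bar>"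
proof (induct a b rule: sign_wlog)
  case (same a b)
  have "b powr \<alpha> \<le> a powr \<alpha>" using same assms by (intro powr_mono2) auto
  then show ?case using same by (simp add: spow_nonneg)
next
  case (opposite a b)
  then show ?case by (simp add: spow_nonneg spow_nonpos)
qed (simp_all add: spow_minus abs_minus_commute algebra_simps)

lemma powr_diff_MVT:
  fixes a b \<alpha> :: real
  assumes "0 < b" "b < a"
  obtains \<xi> where "b < \<xi>" "\<xi> < a" "a powr \<alpha> - b powr \<alpha> = (a - b) * (\<alpha> * \<xi> powr (\<alpha> - 1))"
proof -
  have "\<And>x. b \<le> x \<Longrightarrow> x \<le> a \<Longrightarrow> ((\<lambda>x. x powr \<alpha>) has_real_derivative \<alpha> * x powr (\<alpha> - 1)) (at x)"
    using assms by (auto intro!: derivative_eq_intros simp: powr_diff)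
  from MVT2[OF assms(2), of "\<lambda>x. x powr \<alpha>", OF this] show thesis using that by auto
qed

text \<open>For equal signs the mean value theorem applies, and since \<alpha> - 1 <= 0 the
  derivative at the intermediate point is at least the one at |a| + |b|; for opposite signs
  subadditivity does. With \<alpha> = p - 1 this is the source of the weight w^(p-2).\<close>

lemma spow_diff_ge:
  assumes "0 < \<alpha>" "\<alpha> \<le> 1"
  shows "\<alpha> * (\<bar>a\<bar> + \<bar>b\<bar>) powr (\<alpha> - 1) * \<bar>a - b\<bar> \<le> \<bar>spow \<alpha> a - spow \<alpha> b\<bar>"
proof (induct a b rule: sign_wlog)
  case (same a b)
  have "\<alpha> * (a + b) powr (\<alpha> - 1) * (a - b) \<le> a powr \<alpha> - b powr \<alpha>"
  proof (cases "b = 0 \<or> a = b")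
    case True
    have "a powr (\<alpha> - 1) * a = a powr \<alpha>" using powr_mult_base[of a "\<alpha> - 1"] same by (simp add: mult.commute)
    moreover have "\<alpha> * a powr \<alpha> \<le> 1 * a powr \<alpha>" using assms by (intro mult_right_mono) auto
    ultimately show ?thesis using True by (auto simp: mult.assoc)
  next
    case False
    then have ab: "0 < b" "b < a" using same by auto
    obtain \<xi> where x: "b < \<xi>" "\<xi> < a" "a powr \<alpha> - b powr \<alpha> = (a - b) * (\<alpha> * \<xi> powr (\<alpha> - 1))"
      by (rule powr_diff_MVT[OF ab])
    have "(a + b) powr (\<alpha> - 1) \<le> \<xi> powr (\<alpha> - 1)"
      using x ab assms by (intro powr_mono2') auto
    then have "(a - b) * (\<alpha> * (a + b) powr (\<alpha> - 1)) \<le> (a - b) * (\<alpha> * \<xi> powr (\<alpha> - 1))"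
      using ab assms by (intro mult_left_mono) auto
    then show ?thesis using x(3) by (simp add: mult_ac)
  qed
  then show ?case using same by (simp add: spow_nonneg)
next
  case (opposite a b)
  have "(a - b) powr \<alpha> \<le> a powr \<alpha> + (- b) powr \<alpha>" using powr_add_le[of a "- b" \<alpha>] opposite assms by simp
  moreover have "(a - b) powr (\<alpha> - 1) * (a - b) = (a - b) powr \<alpha>"
    using powr_mult_base[of "a - b" "\<alpha> - 1"] opposite by (simp add: mult.commute)
  moreover have "\<alpha> * (a - b) powr \<alpha> \<le> 1 * (a - b) powr \<alpha>" using assms by (intro mult_right_mono) auto
  ultimately show ?case using opposite by (simp add: spow_nonneg spow_nonpos mult.assoc)
qed (simp_all add: spow_minus abs_minus_commute add.commute)

text \<open>For t >= s >= 0 the difference of the powers is at least (t - s) t^(m-1). For opposite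
  signs the two powers add up, and the constant 2^(-m) is that of
  \<open>powr_add_le_2powr\<close>.\<close>

lemma spow_diff_ge':
  assumes "1 \<le> m"
  shows "2 powr (- m) * (\<bar>t\<bar> + \<bar>s\<bar>) powr (m - 1) * \<bar>t - s\<bar> \<le> \<bar>spow m t - spow m s\<bar>"
proof (induct t s rule: sign_wlog)
  case (same t s)
  have *: "z powr m = z * z powr (m - 1)" if "0 \<le> z" for z :: real
    using powr_mult_base[of z "m - 1"] that assms by simp
  have "2 powr (- m) * (t + s) powr (m - 1) \<le> 2 powr (- m) * (2 * t) powr (m - 1)"
    using same assms by (intro mult_left_mono powr_mono2) auto
  also have "\<dots> = 2 powr (- 1) * t powr (m - 1)"
    using same by (simp add: powr_mult powr_diff powr_minus)
  also have "\<dots> \<le> 1 * t powr (m - 1)" by (intro mult_right_mono) auto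
  finally have "2 powr (- m) * (t + s) powr (m - 1) * (t - s) \<le> 1 * t powr (m - 1) * (t - s)"
    using same by (intro mult_right_mono) auto
  also have "\<dots> = t powr m - s * t powr (m - 1)" using same by (simp add: * algebra_simps)
  also have "\<dots> \<le> t powr m - s powr m"
    unfolding *[OF same(1)] using same assms by (intro diff_left_mono mult_left_mono powr_mono2) auto
  finally show ?case using same by (simp add: spow_nonneg)
next
  case (opposite t s)
  have *: "z powr m = z * z powr (m - 1)" if "0 \<le> z" for z :: real
    using powr_mult_base[of z "m - 1"] that assms by simp
  have "(t + - s) powr m \<le> 2 powr m * (t powr m + (- s) powr m)"
    using opposite assms by (intro powr_add_le_2powr) auto
  then have "2 powr (- m) * (t - s) powr m \<le> t powr m + (- s) powr m"
    by (simp add: powr_minus field_simps)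
  then show ?case using opposite *[of "t - s"] by (simp add: spow_nonneg spow_nonpos mult_ac)
qed (simp_all add: spow_minus abs_minus_commute add.commute)

lemma spow_lipschitz:
  assumes "1 \<le> m" "\<bar>t\<bar> \<le> L" "\<bar>s\<bar> \<le> L"
  shows "\<bar>spow m t - spow m s\<bar> \<le> m * L powr (m - 1) * \<bar>t - s\<bar>"
  using assms(2,3)
proof (induct t s rule: sign_wlog)
  case (same t s)
  have *: "z powr m = z * z powr (m - 1)" if "0 \<le> z" for z :: real
    using powr_mult_base[of z "m - 1"] that assms by simp
  have mono: "s powr m \<le> t powr m" using same assms by (intro powr_mono2) auto
  have "t powr m - s powr m \<le> m * L powr (m - 1) * (t - s)"
  proof (cases "s = 0 \<or> t = s")
    case True
    have "t powr m \<le> t * L powr (m - 1)" unfolding *[OF order_trans[OF same(1,2)]]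
      using same assms by (intro mult_left_mono powr_mono2) auto
    also have "\<dots> \<le> m * (t * L powr (m - 1))" using assms same mult_right_mono[of 1 m "t * L powr (m - 1)"] by simp
    finally show ?thesis using True by (auto simp: mult_ac)
  next
    case False
    then have ab: "0 < s" "s < t" using same by auto
    obtain \<xi> where x: "s < \<xi>" "\<xi> < t" "t powr m - s powr m = (t - s) * (m * \<xi> powr (m - 1))"
      by (rule powr_diff_MVT[OF ab])
    have "\<xi> powr (m - 1) \<le> L powr (m - 1)" using x ab assms same by (intro powr_mono2) auto
    then have "(t - s) * (m * \<xi> powr (m - 1)) \<le> (t - s) * (m * L powr (m - 1))"
      using ab assms by (intro mult_left_mono) auto
    then show ?thesis using x(3) by (simp add: mult_ac)
  qed
  then show ?case using same mono by (simp add: spow_nonneg)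
next
  case (opposite t s)
  have *: "z powr m = z * z powr (m - 1)" if "0 \<le> z" for z :: real
    using powr_mult_base[of z "m - 1"] that assms by simp
  have "z powr m \<le> m * L powr (m - 1) * z" if "0 \<le> z" "z \<le> L" for z
  proof -
    have "z powr m \<le> z * L powr (m - 1)" unfolding *[OF that(1)] using that assms by (intro mult_left_mono powr_mono2) auto
    also have "\<dots> \<le> m * (z * L powr (m - 1))" using assms that mult_right_mono[of 1 m "z * L powr (m - 1)"] by simp
    finally show ?thesis by (simp add: mult_ac)
  qed
  from this[of t] this[of "- s"] opposite show ?case by (simp add: spow_nonneg spow_nonpos algebra_simps)
qed (simp_all add: spow_minus abs_minus_commute)

text \<open>Split at the threshold \<open>\<mu>\<close>. If \<open>\<mu>\<close> has the size of the
  L^q norm, both terms scale alike after integration, so on sets of bounded measure this does the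
  work of Hoelder's inequality.\<close>

lemma powr_le_sum_powr:
  fixes t \<mu> m q :: real
  assumes "0 \<le> t" "0 < \<mu>" "0 \<le> m" "m \<le> q"
  shows "t powr m \<le> \<mu> powr m + \<mu> powr (m - q) * t powr q"
proof (cases "t \<le> \<mu>")
  case True
  then have "t powr m \<le> \<mu> powr m" using assms by (intro powr_mono2) auto
  then show ?thesis by (smt (verit) powr_ge_zero mult_nonneg_nonneg)
next
  case False
  have "t powr m = t powr (m - q) * t powr q" using False assms by (simp add: powr_add[symmetric])
  also have "\<dots> \<le> \<mu> powr (m - q) * t powr q"
    using False assms by (intro mult_right_mono powr_mono2') auto
  finally show ?thesis by (smt (verit) powr_ge_zero)
qed

text \<open>If w <= l e, then w^(p-2) >= (l e)^(p-2) because p - 2 is negative, and q = (p - 2) + (m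
  + 1) gives the first term. Otherwise e < w / l, which gives the second. In the application l is
  |h|^(-\<beta>).\<close>

lemma powr_diff_split:
  fixes e w l m p q :: real
  assumes "0 \<le> e" "e \<le> w" "0 < l" "1 < p" "p < 2" "q = m + p - 1" "1 \<le> m"
  shows "e powr q \<le> l powr (2 - p) * (w powr (p - 2) * e powr (m + 1)) + l powr (- q) * w powr q"
proof (cases "e = 0")
  case True
  then show ?thesis using assms by simp
next
  case False
  show ?thesis
  proof (cases "w \<le> l * e")
    case True
    have "q = (p - 2) + (m + 1)" using assms by simp
    then have "e powr q = e powr (p - 2) * e powr (m + 1)" by (simp only: powr_add)
    then have "e powr q = l powr (2 - p) * ((l * e) powr (p - 2) * e powr (m + 1))"
      using assms False by (simp add: powr_mult mult.assoc[symmetric] powr_add[of l, symmetric])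
    also have "\<dots> \<le> l powr (2 - p) * (w powr (p - 2) * e powr (m + 1))"
      using assms False True by (intro mult_left_mono mult_right_mono powr_mono2') auto
    finally show ?thesis by (smt (verit) powr_ge_zero mult_nonneg_nonneg)
  next
    case False
    then have "e powr q \<le> (l powr (- 1) * w) powr q"
      using assms by (intro powr_mono2) (auto simp: powr_minus field_simps)
    also have "\<dots> = l powr (- q) * w powr q"
      using assms powr_powr[of l "- 1" q] by (simp only: powr_mult powr_ge_zero) simp
    finally show ?thesis by (smt (verit) powr_ge_zero mult_nonneg_nonneg)
  qed
qed

text \<open>Minkowski's inequality, obtained from the convexity of the power with weights \<open>\<alpha> / (\<alpha> + \<beta>)\<close>
  and \<open>\<beta> / (\<alpha> + \<beta>)\<close>.\<close>
lemma nn_integral_powr_add: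
  fixes f g :: "'b \<Rightarrow> real"
  assumes [measurable]: "f \<in> borel_measurable M" "g \<in> borel_measurable M"
    and ab: "0 < \<alpha>" "0 < \<beta>" and q: "1 \<le> q"
    and f: "(\<integral>\<^sup>+ x. ennreal (\<bar>f x\<bar> powr q) * indicator S x \<partial>M) \<le> ennreal (\<alpha> powr q)"
    and g: "(\<integral>\<^sup>+ x. ennreal (\<bar>g x\<bar> powr q) * indicator S x \<partial>M) \<le> ennreal (\<beta> powr q)"
    and [measurable]: "S \<in> sets M"
  shows "(\<integral>\<^sup>+ x. ennreal (\<bar>f x + g x\<bar> powr q) * indicator S x \<partial>M) \<le> ennreal ((\<alpha> + \<beta>) powr q)"
proof -
  define \<theta> where "\<theta> = \<alpha> / (\<alpha> + \<beta>)"
  have th: "0 < \<theta>" "0 < 1 - \<theta>" "1 - \<theta> = \<beta> / (\<alpha> + \<beta>)" using ab by (auto simp: \<theta>_def field_simps)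
  have conv: "convex_on {0<..} (\<lambda>x. x powr q)" using q by (rule powr_convex)
  \<comment> \<open>Convexity is used for positive arguments only; if one argument vanishes, it is
    enough that both weights are at least 1.\<close>
  have ge1: "1 \<le> \<theta> powr (1 - q)" "1 \<le> (1 - \<theta>) powr (1 - q)"
    using powr_mono2'[of "1 - q" \<theta> 1] powr_mono2'[of "1 - q" "1 - \<theta>" 1] th q by auto
  have pw: "\<bar>x + y\<bar> powr q \<le> \<theta> powr (1 - q) * \<bar>x\<bar> powr q + (1 - \<theta>) powr (1 - q) * \<bar>y\<bar> powr q" for x y :: real
  proof (cases "x = 0 \<or> y = 0")
    case True
    then show ?thesis
      using mult_right_mono[OF ge1(1), of "\<bar>x\<bar> powr q"] mult_right_mono[OF ge1(2), of "\<bar>y\<bar> powr q"] by auto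
  next
    case False
    have "\<bar>x + y\<bar> powr q \<le> ((1 - \<theta>) *\<^sub>R (\<bar>y\<bar> / (1 - \<theta>)) + \<theta> *\<^sub>R (\<bar>x\<bar> / \<theta>)) powr q"
      using th(1,2) q by (intro powr_mono2) auto
    also have "\<dots> \<le> (1 - \<theta>) * (\<bar>y\<bar> / (1 - \<theta>)) powr q + \<theta> * (\<bar>x\<bar> / \<theta>) powr q"
      using convex_onD[OF conv, of \<theta> "\<bar>y\<bar> / (1 - \<theta>)" "\<bar>x\<bar> / \<theta>"] th(1,2) False by simp
    also have "\<dots> = \<theta> powr (1 - q) * \<bar>x\<bar> powr q + (1 - \<theta>) powr (1 - q) * \<bar>y\<bar> powr q"
      using th(1,2) by (simp add: powr_divide powr_diff)
    finally show ?thesis .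
  qed
  have "(\<integral>\<^sup>+ x. ennreal (\<bar>f x + g x\<bar> powr q) * indicator S x \<partial>M)
     \<le> (\<integral>\<^sup>+ x. ennreal (\<theta> powr (1 - q)) * (ennreal (\<bar>f x\<bar> powr q) * indicator S x)
         + ennreal ((1 - \<theta>) powr (1 - q)) * (ennreal (\<bar>g x\<bar> powr q) * indicator S x) \<partial>M)"
    by (intro nn_integral_mono) (auto split: split_indicator simp: ennreal_mult[symmetric] ennreal_plus[symmetric] pw simp del: ennreal_plus)
  also have "\<dots> = ennreal (\<theta> powr (1 - q)) * (\<integral>\<^sup>+ x. ennreal (\<bar>f x\<bar> powr q) * indicator S x \<partial>M)
         + ennreal ((1 - \<theta>) powr (1 - q)) * (\<integral>\<^sup>+ x. ennreal (\<bar>g x\<bar> powr q) * indicator S x \<partial>M)"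
    by (subst nn_integral_add) (auto simp: nn_integral_cmult)
  also have "\<dots> \<le> ennreal (\<theta> powr (1 - q)) * ennreal (\<alpha> powr q) + ennreal ((1 - \<theta>) powr (1 - q)) * ennreal (\<beta> powr q)"
    by (intro add_mono mult_left_mono f g) auto
  also have "\<dots> = ennreal (\<theta> powr (1 - q) * \<alpha> powr q + (1 - \<theta>) powr (1 - q) * \<beta> powr q)"
    by (simp add: ennreal_mult)
  also have "\<theta> powr (1 - q) * \<alpha> powr q + (1 - \<theta>) powr (1 - q) * \<beta> powr q = (\<alpha> + \<beta>) powr (q - 1) * (\<alpha> + \<beta>)"
  proof -
    have "(a / (\<alpha> + \<beta>)) powr (1 - q) * a powr q = (\<alpha> + \<beta>) powr (q - 1) * a" if "0 < a" for a
    proof -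
      have "a powr (1 - q) * a powr q = a" using that by (simp add: powr_add[symmetric])
      moreover have "inverse ((\<alpha> + \<beta>) powr (1 - q)) = (\<alpha> + \<beta>) powr (q - 1)"
        by (simp add: powr_minus[symmetric])
      moreover have "(a / (\<alpha> + \<beta>)) powr (1 - q) = a powr (1 - q) / (\<alpha> + \<beta>) powr (1 - q)"
        using that ab by (simp add: powr_divide)
      then have "(a / (\<alpha> + \<beta>)) powr (1 - q) * a powr q = (a powr (1 - q) * a powr q) * inverse ((\<alpha> + \<beta>) powr (1 - q))"
        by (simp add: divide_inverse mult_ac)
      ultimately show ?thesis by (simp only: mult.commute)
    qed
    from this[OF ab(1)] this[OF ab(2)] show ?thesis
      unfolding th(3) unfolding \<theta>_def by (simp add: distrib_left)
  qed
  also have "\<dots> = (\<alpha> + \<beta>) powr q" using ab by (simp add: powr_diff)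
  finally show ?thesis .
qed

section \<open>Integrability of the kernels\<close>

lemma ennreal_powr_le_suminf:
  fixes j :: nat
  assumes "x \<le> f j" "\<And>i. 0 \<le> f i"
  shows "ennreal x \<le> (\<Sum>i. ennreal (f i))"
proof -
  have "ennreal x \<le> ennreal (f j)" using assms(1) by (rule ennreal_leI)
  also have "\<dots> = (\<Sum>i\<in>{j}. ennreal (f i))" by simp
  also have "\<dots> \<le> (\<Sum>i. ennreal (f i))" by (rule sum_le_suminf) auto
  finally show ?thesis .
qed

text \<open>Both kernels are compared with a geometric sum over dyadic balls.\<close>
lemma nn_integral_dyadic:
  fixes f :: "'a::euclidean_space \<Rightarrow> real" and a \<rho> :: "nat \<Rightarrow> real"
  assumes a: "\<And>j. 0 \<le> a j" and \<rho>: "\<And>j. 0 \<le> \<rho> j"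
    and dom: "\<And>z. \<exists>j. f z \<le> a j * indicator (ball 0 (\<rho> j)) z"
    and s: "summable (\<lambda>j. a j * \<rho> j ^ DIM('a))"
  shows "(\<integral>\<^sup>+ z. ennreal (f z) \<partial>lborel) < \<infinity>"
proof -
  have le: "ennreal (f z) \<le> (\<Sum>j. ennreal (a j * indicator (ball 0 (\<rho> j)) z))" for z
  proof -
    obtain j where "f z \<le> a j * indicator (ball 0 (\<rho> j)) z" using dom by blast
    then show ?thesis by (rule ennreal_powr_le_suminf) (simp add: a)
  qed
  have [measurable]: "ball (0::'a) (\<rho> i) \<in> sets borel" for i by simp
  have "(\<integral>\<^sup>+ z. ennreal (f z) \<partial>lborel)
      \<le> (\<integral>\<^sup>+ z. (\<Sum>j. ennreal (a j * indicator (ball 0 (\<rho> j)) (z::'a))) \<partial>lborel)"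
    by (intro nn_integral_mono le)
  also have "\<dots> = (\<Sum>j. \<integral>\<^sup>+ z. ennreal (a j) * indicator (ball 0 (\<rho> j)) (z::'a) \<partial>lborel)"
    by (subst nn_integral_suminf) (auto simp: a ennreal_mult ennreal_indicator)
  also have "\<dots> = (\<Sum>j. ennreal (unit_ball_vol DIM('a) * (a j * \<rho> j ^ DIM('a))))"
    using a \<rho> by (intro suminf_cong) (simp add: nn_integral_cmult_indicator emeasure_ball ennreal_mult[symmetric] mult_ac)
  also have "\<dots> < \<infinity>"
    using s a \<rho> by (subst suminf_ennreal_eq[OF _ summable_sums[OF summable_mult[OF s]]]) auto
  finally show ?thesis .
qed

lemma nn_integral_far_kernel:
  fixes \<sigma> :: real
  assumes "0 < \<sigma>"
  shows "(\<integral>\<^sup>+ z. ennreal (1 / (1 + norm z) powr (real DIM('a) + \<sigma>)) \<partial>(lborel :: 'a::euclidean_space measure)) < \<infinity>"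
proof (rule nn_integral_dyadic)
  let ?N = "real DIM('a)"
  show "\<exists>j. 1 / (1 + norm z) powr (?N + \<sigma>)
      \<le> (2 powr (- real j * (?N + \<sigma>))) * indicator (ball 0 (2 ^ Suc j)) z" for z :: 'a
  proof -
    \<comment> \<open>The dyadic shell of z: 2^j <= 1 + |z| < 2^(j+1).\<close>
    define j where "j = nat \<lfloor>log 2 (1 + norm z)\<rfloor>"
    have l: "0 \<le> log 2 (1 + norm z)" using norm_ge_zero[of z] by (subst zero_le_log_cancel_iff) linarith+
    have pos: "0 < 1 + norm z" using norm_ge_zero[of z] by linarith
    have j: "real j \<le> log 2 (1 + norm z)" "log 2 (1 + norm z) < real j + 1"
      using l unfolding j_def by linarith+
    have lo: "2 powr real j \<le> 1 + norm z"
      using j(1) pos by (subst (asm) le_log_iff) auto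
    have "1 + norm z < 2 powr (real j + 1)"
      using j(2) pos by (subst (asm) log_less_iff) auto
    then have hi: "norm z < 2 ^ Suc j" by (simp add: powr_add powr_realpow)
    have "1 / (1 + norm z) powr (?N + \<sigma>) \<le> 1 / (2 powr real j) powr (?N + \<sigma>)"
      using lo assms pos by (intro divide_left_mono powr_mono2 mult_pos_pos) auto
    also have "\<dots> = 2 powr (- real j * (?N + \<sigma>))" by (simp add: powr_powr powr_minus_divide)
    finally show ?thesis using hi by (intro exI[of _ j]) auto
  qed
  have "(\<lambda>j. 2 powr (- real j * (?N + \<sigma>)) * (2 ^ Suc j) ^ DIM('a)) = (\<lambda>j. 2 ^ DIM('a) * (2 powr (- \<sigma>)) ^ j)"
  proof
    fix j :: nat
    have "((2::real) ^ Suc j) ^ DIM('a) = (2 powr real (Suc j)) powr ?N"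
      by (simp only: powr_realpow zero_less_numeral zero_less_power)
    then have "((2::real) ^ Suc j) ^ DIM('a) = 2 powr (real (Suc j) * ?N)" by (simp only: powr_powr)
    moreover have "(2 powr (- \<sigma>)) ^ j = 2 powr (- \<sigma> * real j)"
      using powr_realpow[of "2 powr (- \<sigma>)" j] by (simp add: powr_powr)
    moreover have "(2::real) ^ DIM('a) = 2 powr ?N" by (simp add: powr_realpow)
    ultimately show "2 powr (- real j * (?N + \<sigma>)) * (2 ^ Suc j) ^ DIM('a) = 2 ^ DIM('a) * (2 powr (- \<sigma>)) ^ j"
      by (simp only: powr_add[symmetric]) (simp add: algebra_simps)
  qed
  moreover have "norm (2 powr (- \<sigma>)) < 1" using assms by (simp add: powr_less_one)
  ultimately show "summable (\<lambda>j. 2 powr (- real j * (?N + \<sigma>)) * (2 ^ Suc j) ^ DIM('a))"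
    by (simp add: summable_geometric summable_mult)
qed auto

lemma nn_integral_near_kernel:
  fixes \<theta> :: real
  assumes "0 < \<theta>" "\<theta> < real DIM('a)"
  shows "(\<integral>\<^sup>+ z. ennreal (norm z powr (\<theta> - real DIM('a)) * indicator (cball 0 2) z) \<partial>(lborel :: 'a::euclidean_space measure)) < \<infinity>"
proof (rule nn_integral_dyadic)
  let ?N = "real DIM('a)"
  show "\<exists>j. norm z powr (\<theta> - ?N) * indicator (cball 0 2) z
      \<le> (2 powr (- real j * (\<theta> - ?N))) * indicator (ball 0 (2 powr (2 - real j))) z" for z :: 'a
  proof (cases "z = 0 \<or> z \<notin> cball 0 2")
    case True then show ?thesis by auto
  next
    case False
    then have z: "0 < norm z" "norm z \<le> 2" by auto
    \<comment> \<open>The shell 2^(-j) < |z| <= 2^(1-j). The shift by 1 keeps the index nonnegative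
      up to |z| = 2, and the radius is doubled to 2^(2-j) because the balls are open.\<close>
    define j where "j = nat \<lfloor>1 - log 2 (norm z)\<rfloor>"
    have "log 2 (norm z) \<le> 1" using z by (subst log_le_iff) auto
    then have j: "real j \<le> 1 - log 2 (norm z)" "1 - log 2 (norm z) < real j + 1"
      unfolding j_def by linarith+
    have lo: "2 powr (- real j) \<le> norm z"
      using j(2) z by (intro less_imp_le) (subst less_log_iff[symmetric], auto)
    have hi: "norm z < 2 powr (2 - real j)"
      using j(1) z by (subst log_less_iff[symmetric]) auto
    have "norm z powr (\<theta> - ?N) \<le> (2 powr (- real j)) powr (\<theta> - ?N)"
      using lo assms z by (intro powr_mono2') auto
    also have "\<dots> = 2 powr (- real j * (\<theta> - ?N))" by (simp add: powr_powr)
    finally show ?thesis using hi z by (intro exI[of _ j]) auto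
  qed
  have "(\<lambda>j. 2 powr (- real j * (\<theta> - ?N)) * (2 powr (2 - real j)) ^ DIM('a)) = (\<lambda>j. 4 ^ DIM('a) * (2 powr (- \<theta>)) ^ j)"
  proof
    fix j :: nat
    have "(2 powr (2 - real j)) ^ DIM('a) = 2 powr ((2 - real j) * ?N)"
      using powr_realpow[of "2 powr (2 - real j)" "DIM('a)"] by (simp only: powr_powr powr_gt_zero)
    moreover have "(2 powr (- \<theta>)) ^ j = 2 powr (- \<theta> * real j)"
      using powr_realpow[of "2 powr (- \<theta>)" j] by (simp add: powr_powr)
    moreover have "(4::real) ^ DIM('a) = 2 powr (2 * ?N)"
      using powr_powr[of 2 2 ?N] powr_realpow[of 4 "DIM('a)"] by simp
    ultimately show "2 powr (- real j * (\<theta> - ?N)) * (2 powr (2 - real j)) ^ DIM('a) = 4 ^ DIM('a) * (2 powr (- \<theta>)) ^ j"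
      by (simp only: powr_add[symmetric]) (simp add: algebra_simps)
  qed
  moreover have "norm (2 powr (- \<theta>)) < 1" using assms by (simp add: powr_less_one)
  ultimately show "summable (\<lambda>j. 2 powr (- real j * (\<theta> - ?N)) * (2 powr (2 - real j)) ^ DIM('a))"
    by (simp add: summable_geometric summable_mult)
qed auto

section \<open>Pointwise lower bounds for the tested equation\<close>

text \<open>The discrete product rule: mean times difference plus difference times mean. With
  squared cut-off values for x and y, the first term is the monotone main part and the second the
  cut-off error.\<close>

lemma two_products:
  fixes x y g h k :: real
  shows "k * (x * g - y * h) = (x + y) / 2 * (k * (g - h)) + (x - y) / 2 * (g + h) * k"
  by (simp add: field_simps)

lemma mult_eq_abs_mult:
  fixes x y d :: real
  assumes "x * d = \<bar>x\<bar> * \<bar>d\<bar>" "y * d = \<bar>y\<bar> * \<bar>d\<bar>" "d \<noteq> 0"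
  shows "x * y = \<bar>x\<bar> * \<bar>y\<bar>"
proof (cases "0 < d")
  case True
  then have "x = \<bar>x\<bar>" "y = \<bar>y\<bar>" using assms by auto
  then show ?thesis by metis
next
  case False
  then have "x * d = (- \<bar>x\<bar>) * d" "y * d = (- \<bar>y\<bar>) * d" using assms by auto
  then have "x = - \<bar>x\<bar>" "y = - \<bar>y\<bar>" using assms(3) mult_right_cancel by blast+
  then show ?thesis by (metis minus_mult_minus)
qed

text \<open>The two alternatives correspond to the sizes of \<open>\<delta> S\<close> and \<open>H e\<close>: either the main part
  absorbs the cut-off error, or it is itself dominated by \<open>\<delta>\<^sup>p S\<^sup>q\<close>.\<close>
lemma tested_p_growth_ge:
  fixes a b t s \<eta>x \<eta>y \<delta> m p q :: real
  assumes p: "1 < p" "p < 2" and m: "1 \<le> m" "q = m + p - 1"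
    and ts: "t - s = a - b"
    and eta: "0 \<le> \<eta>x" "\<eta>x \<le> 1" "0 \<le> \<eta>y" "\<eta>y \<le> 1" "\<bar>\<eta>x - \<eta>y\<bar> \<le> \<delta>"
  defines "c \<equiv> 2 powr (- m) / 8"
  shows "c * (p - 1) * (\<eta>x + \<eta>y)\<^sup>2 * ((\<bar>a\<bar> + \<bar>b\<bar>) powr (p - 2) * \<bar>a - b\<bar> powr (m + 1))
      \<le> (spow (p - 1) a - spow (p - 1) b) * (\<eta>x\<^sup>2 * spow m t - \<eta>y\<^sup>2 * spow m s)
        + 8 * (1 / c) powr p * (\<delta> powr p * (\<bar>t\<bar> + \<bar>s\<bar>) powr q)"
    (is "?L \<le> ?M + ?R")
proof -
  define H e S D where "H = \<eta>x + \<eta>y" and "e = \<bar>a - b\<bar>" and "S = \<bar>t\<bar> + \<bar>s\<bar>"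
    and "D = \<bar>spow (p - 1) a - spow (p - 1) b\<bar>"
  define w where "w = \<bar>a\<bar> + \<bar>b\<bar>"
  have nn: "0 \<le> H" "H \<le> 2" "0 \<le> e" "0 \<le> S" "0 \<le> D" "0 \<le> \<delta>" "e \<le> S" "e \<le> w"
    using eta ts by (auto simp: H_def e_def S_def D_def w_def)
  have c: "0 < c" "c \<le> 1" "8 * c = 2 powr (- m)"
    using m powr_mono[of "- m" 0 "2::real"] by (auto simp: c_def)
  have g: "8 * c * S powr (m - 1) * e \<le> \<bar>spow m t - spow m s\<bar>"
    using spow_diff_ge'[OF m(1), of t s] ts by (simp add: S_def e_def c)
  have D_ge: "(p - 1) * w powr (p - 2) * e \<le> D"
    using spow_diff_ge[of "p - 1" a b] p by (simp add: w_def e_def D_def)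
  have D_le: "D \<le> 2 * e powr (p - 1)"
    using spow_diff_le[of "p - 1" a b] p by (simp add: D_def e_def)
  \<comment> \<open>Both increments have the sign of a - b = t - s, so the product of the two
    differences is nonnegative.\<close>
  have prod: "(spow (p - 1) a - spow (p - 1) b) * (spow m t - spow m s) = D * \<bar>spow m t - spow m s\<bar>"
    using mult_eq_abs_mult[OF spow_diff_sgn[of "p - 1" a b] spow_diff_sgn[of m t s, unfolded ts]] p m ts
    by (cases "a = b") (auto simp: D_def)
  have sq: "H\<^sup>2 / 2 \<le> \<eta>x\<^sup>2 + \<eta>y\<^sup>2" using sum_squares_bound[of \<eta>x \<eta>y] by (simp add: H_def power2_sum)
  have Sm: "\<bar>spow m t + spow m s\<bar> \<le> 2 * S powr m"
  proof -
    have "\<bar>t\<bar> powr m \<le> S powr m" "\<bar>s\<bar> powr m \<le> S powr m" using m by (auto intro!: powr_mono2 simp: S_def)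
    then show ?thesis using abs_triangle_ineq[of "spow m t" "spow m s"] by (simp add: abs_spow)
  qed
  have cross: "\<bar>(\<eta>x\<^sup>2 - \<eta>y\<^sup>2) / 2 * (spow m t + spow m s) * (spow (p - 1) a - spow (p - 1) b)\<bar> \<le> \<delta> * H * S powr m * D"
  proof -
    have "\<bar>\<eta>x\<^sup>2 - \<eta>y\<^sup>2\<bar> = \<bar>\<eta>x - \<eta>y\<bar> * H" using eta by (simp add: power2_eq_square square_diff_square_factored abs_mult H_def mult.commute)
    also have "\<dots> \<le> \<delta> * H" using eta nn by (intro mult_right_mono) auto
    finally have "\<bar>\<eta>x\<^sup>2 - \<eta>y\<^sup>2\<bar> / 2 * \<bar>spow m t + spow m s\<bar> * D \<le> (\<delta> * H) / 2 * (2 * S powr m) * D"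
      using Sm nn by (intro mult_mono) auto
    then show ?thesis by (simp add: abs_mult D_def)
  qed
  \<comment> \<open>The factor 8 in the denominator of \<open>c\<close> is spent here: the halves in
    \<open>sq\<close> and in the product rule use up 4, and the remaining 2 leaves one share of
    \<open>c\<close> to absorb the cut-off error and one to keep.\<close>
  have main: "2 * c * H\<^sup>2 * S powr (m - 1) * e * D \<le> (\<eta>x\<^sup>2 + \<eta>y\<^sup>2) / 2 * (D * \<bar>spow m t - spow m s\<bar>)"
  proof -
    have "(H\<^sup>2 / 2) / 2 * (D * (8 * c * S powr (m - 1) * e)) \<le> (\<eta>x\<^sup>2 + \<eta>y\<^sup>2) / 2 * (D * \<bar>spow m t - spow m s\<bar>)"
      using sq g nn c by (intro mult_mono) auto
    then show ?thesis by (simp add: mult_ac)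
  qed
  have "?M = (\<eta>x\<^sup>2 + \<eta>y\<^sup>2) / 2 * ((spow (p - 1) a - spow (p - 1) b) * (spow m t - spow m s))
      + (\<eta>x\<^sup>2 - \<eta>y\<^sup>2) / 2 * (spow m t + spow m s) * (spow (p - 1) a - spow (p - 1) b)"
    by (rule two_products)
  then have M: "2 * c * H\<^sup>2 * S powr (m - 1) * e * D - \<delta> * H * S powr m * D \<le> ?M"
    using main cross unfolding prod by linarith
  have Sm1: "S powr m = S powr (m - 1) * S" using powr_mult_base[of S "m - 1"] nn by (simp add: mult.commute)
  have L: "?L \<le> c * H\<^sup>2 * D * e powr m"
  proof -
    have "e powr (m + 1) = e * e powr m" using powr_mult_base[of e m] nn by (simp add: add.commute)
    then have "?L = (c * H\<^sup>2 * e powr m) * ((p - 1) * w powr (p - 2) * e)"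
      by (simp add: H_def w_def e_def mult_ac)
    also have "\<dots> \<le> (c * H\<^sup>2 * e powr m) * D" using D_ge c nn by (intro mult_left_mono) auto
    finally show ?thesis by (simp add: mult_ac)
  qed
  have R0: "0 \<le> ?R" by simp
  show ?thesis
  proof (cases "\<delta> * S \<le> c * (H * e)")
    case True
    have "\<delta> * H * S powr m * D = (\<delta> * S) * (H * S powr (m - 1) * D)" by (simp add: Sm1 mult_ac)
    also have "\<dots> \<le> (c * (H * e)) * (H * S powr (m - 1) * D)" using True nn by (intro mult_right_mono) auto
    also have "\<dots> = c * H\<^sup>2 * S powr (m - 1) * e * D" by (simp add: power2_eq_square mult_ac)
    finally have "c * H\<^sup>2 * S powr (m - 1) * e * D \<le> ?M" using M by simp
    moreover have "c * H\<^sup>2 * D * e powr m \<le> c * H\<^sup>2 * D * (S powr (m - 1) * e)"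
    proof -
      have "e powr m = e powr (m - 1) * e" using powr_mult_base[of e "m - 1"] nn by (simp add: mult.commute)
      also have "\<dots> \<le> S powr (m - 1) * e" using nn m by (intro mult_right_mono powr_mono2) auto
      finally show ?thesis using nn c by (intro mult_left_mono) auto
    qed
    moreover have "c * H\<^sup>2 * D * (S powr (m - 1) * e) = c * H\<^sup>2 * S powr (m - 1) * e * D" by simp
    ultimately show ?thesis using L R0 by linarith
  next
    case False
    \<comment> \<open>In this case H e <= Y, so every occurrence of H e can be exchanged for
      \<delta> S / c, and both the main part and the cut-off error become multiples of Y^p
      S^(q-p).\<close>
    define Y where "Y = \<delta> * S / c"
    have Y: "H * e \<le> Y" "0 \<le> Y" using False nn c by (auto simp: Y_def field_simps)
    have H2: "H powr (2 - p) \<le> 2"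
    proof -
      have "H powr (2 - p) \<le> 2 powr (2 - p)" using nn p by (intro powr_mono2) auto
      also have "\<dots> \<le> 2 powr 1" using p by (intro powr_mono) auto
      finally show ?thesis by simp
    qed
    have H1: "H * e powr (p - 1) \<le> 2 * Y powr (p - 1)"
    proof -
      \<comment> \<open>The error carries H only to the first power but e to the power p - 1. Since
        H <= 2, the surplus H^(2-p) is bounded, and only (H e)^(p-1) remains.\<close>
      have "H = H powr (2 - p) * H powr (p - 1)" using nn p by (cases "H = 0") (auto simp: powr_add[symmetric])
      then have "H * e powr (p - 1) = H powr (2 - p) * (H * e) powr (p - 1)"
        using nn by (simp add: powr_mult mult.assoc)
      also have "\<dots> \<le> 2 * Y powr (p - 1)" using H2 Y nn p by (intro mult_mono powr_mono2) auto
      finally show ?thesis .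
    qed
    have Yp: "Y powr p = (1 / c) powr p * (\<delta> powr p * S powr p)"
      using nn c by (simp add: Y_def powr_mult powr_divide)
    have Sq: "S powr p * S powr (q - p) = S powr q" by (simp add: powr_add[symmetric])
    have "\<delta> * H * S powr m * D \<le> \<delta> * H * S powr m * (2 * e powr (p - 1))"
      using D_le nn by (intro mult_left_mono) auto
    also have "\<dots> = 2 * \<delta> * S powr m * (H * e powr (p - 1))" by (simp add: mult_ac)
    also have "\<dots> \<le> 2 * \<delta> * S powr m * (2 * Y powr (p - 1))" using H1 nn by (intro mult_left_mono) auto
    also have "\<dots> \<le> 4 * (Y powr p * S powr (q - p))"
    proof -
      have "\<delta> * S powr m = c * (Y * S powr (m - 1))" using c by (simp add: Sm1 Y_def)
      then have "2 * \<delta> * S powr m * (2 * Y powr (p - 1)) = 4 * c * ((Y * Y powr (p - 1)) * S powr (m - 1))"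
        by simp
      also have "Y * Y powr (p - 1) = Y powr p" using powr_mult_base[of Y "p - 1"] Y by simp
      also have "4 * c * (Y powr p * S powr (m - 1)) \<le> 4 * 1 * (Y powr p * S powr (m - 1))"
        using c by (intro mult_right_mono) auto
      finally show ?thesis using m by simp
    qed
    finally have cr: "\<delta> * H * S powr m * D \<le> 4 * (Y powr p * S powr (q - p))" .
    have "c * H\<^sup>2 * D * e powr m \<le> 1 * H\<^sup>2 * (2 * e powr (p - 1)) * e powr m"
      using D_le c nn by (intro mult_mono) auto
    also have "\<dots> = 2 * H * (H * e powr (p - 1)) * e powr m" by (simp add: power2_eq_square mult_ac)
    also have "\<dots> \<le> 2 * H * (2 * Y powr (p - 1)) * e powr m" using H1 nn by (intro mult_right_mono mult_left_mono) auto
    also have "\<dots> = 4 * Y powr (p - 1) * (H * e powr m)" by simp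
    also have "\<dots> \<le> 4 * Y powr (p - 1) * (Y * S powr (m - 1))"
    proof -
      have "H * e powr m = (H * e) * e powr (m - 1)" using powr_mult_base[of e "m - 1"] nn by simp
      also have "\<dots> \<le> Y * S powr (m - 1)" using Y nn m by (intro mult_mono powr_mono2) auto
      finally show ?thesis by (intro mult_left_mono) auto
    qed
    also have "\<dots> = 4 * (Y powr p * S powr (q - p))" using powr_mult_base[of Y "p - 1"] Y m by (simp add: mult_ac)
    finally have "?L \<le> 4 * (Y powr p * S powr (q - p))" using L by linarith
    moreover have "?R = 8 * (Y powr p * S powr (q - p))"
      unfolding Yp S_def[symmetric] by (simp add: Sq[symmetric] mult_ac)
    moreover have "0 \<le> 2 * c * H\<^sup>2 * S powr (m - 1) * e * D" using c nn by simp
    ultimately show ?thesis using cr M by linarith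
  qed
qed

lemma in_sgn_abs_le: "in_sgn z t \<Longrightarrow> \<bar>z\<bar> \<le> 1"
  by (auto simp: in_sgn_def sgn_if split: if_splits)

lemma in_sgn_mono:
  assumes "in_sgn z a" "in_sgn z' b" "b < a"
  shows "z' \<le> z"
  using assms by (auto simp: in_sgn_def sgn_if abs_le_iff split: if_splits)

text \<open>In the main part of the product rule both factors have the sign of a - b. At a = b the
  selections z and z' are unrelated, but then t = s and the other factor vanishes. What remains is
  the cut-off error, bounded by |z - z'| <= 2.\<close>

lemma tested_sgn_ge:
  fixes a b t s \<eta>x \<eta>y \<delta> m z z' :: real
  assumes m: "1 \<le> m" and ts: "t - s = a - b" and z: "in_sgn z a" "in_sgn z' b"
    and eta: "0 \<le> \<eta>x" "\<eta>x \<le> 1" "0 \<le> \<eta>y" "\<eta>y \<le> 1" "\<bar>\<eta>x - \<eta>y\<bar> \<le> \<delta>"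
  shows "- (4 * \<delta> * (\<bar>t\<bar> + \<bar>s\<bar>) powr m) \<le> (z - z') * (\<eta>x\<^sup>2 * spow m t - \<eta>y\<^sup>2 * spow m s)"
proof -
  have Sm: "\<bar>spow m t + spow m s\<bar> \<le> 2 * (\<bar>t\<bar> + \<bar>s\<bar>) powr m"
  proof -
    have "\<bar>t\<bar> powr m \<le> (\<bar>t\<bar> + \<bar>s\<bar>) powr m" "\<bar>s\<bar> powr m \<le> (\<bar>t\<bar> + \<bar>s\<bar>) powr m" using m by (auto intro!: powr_mono2)
    then show ?thesis using abs_triangle_ineq[of "spow m t" "spow m s"] by (simp add: abs_spow)
  qed
  have "0 \<le> (z - z') * (spow m t - spow m s)"
  proof (cases "b < a")
    case True
    have "0 \<le> (spow m t - spow m s) * (t - s)" using spow_diff_sgn[of m t s] m by simp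
    then have "0 \<le> spow m t - spow m s" using True ts by (auto simp: zero_le_mult_iff)
    then show ?thesis using in_sgn_mono[OF z True] by simp
  next
    case False
    have "0 \<le> (spow m t - spow m s) * (t - s)" using spow_diff_sgn[of m t s] m by simp
    then have "spow m t - spow m s \<le> 0" using False ts by (cases "t = s") (auto simp: zero_le_mult_iff)
    moreover have "z \<le> z' \<or> a = b" using in_sgn_mono[OF z(2,1)] False by linarith
    ultimately show ?thesis using ts by (cases "a = b") (auto simp: mult_nonpos_nonpos)
  qed
  then have main: "0 \<le> (\<eta>x\<^sup>2 + \<eta>y\<^sup>2) / 2 * ((z - z') * (spow m t - spow m s))" by simp
  have "\<bar>\<eta>x\<^sup>2 - \<eta>y\<^sup>2\<bar> = \<bar>\<eta>x - \<eta>y\<bar> * (\<eta>x + \<eta>y)"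
    using eta by (simp add: power2_eq_square square_diff_square_factored abs_mult mult.commute)
  also have "\<dots> \<le> \<delta> * 2" using eta by (intro mult_mono) auto
  finally have "\<bar>\<eta>x\<^sup>2 - \<eta>y\<^sup>2\<bar> / 2 * \<bar>spow m t + spow m s\<bar> * \<bar>z - z'\<bar> \<le> (\<delta> * 2) / 2 * (2 * (\<bar>t\<bar> + \<bar>s\<bar>) powr m) * 2"
    using Sm in_sgn_abs_le[OF z(1)] in_sgn_abs_le[OF z(2)] eta by (intro mult_mono) auto
  then have "\<bar>(\<eta>x\<^sup>2 - \<eta>y\<^sup>2) / 2 * (spow m t + spow m s) * (z - z')\<bar> \<le> 4 * \<delta> * (\<bar>t\<bar> + \<bar>s\<bar>) powr m"
    by (simp add: abs_mult)
  moreover have "(z - z') * (\<eta>x\<^sup>2 * spow m t - \<eta>y\<^sup>2 * spow m s) = (\<eta>x\<^sup>2 + \<eta>y\<^sup>2) / 2 * ((z - z') * (spow m t - spow m s))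
      + (\<eta>x\<^sup>2 - \<eta>y\<^sup>2) / 2 * (spow m t + spow m s) * (z - z')"
    by (rule two_products)
  ultimately show ?thesis using main by linarith
qed

text \<open>Shows that the test function oscillates no more than u, its translate and a Lipschitz
  function do, which is what \<open>frac_sobolev_cutoff\<close> asks for.\<close>

lemma sq_spow_diff_le:
  fixes t s \<eta>x \<eta>y \<delta> m L :: real
  assumes m: "1 \<le> m" and L: "\<bar>t\<bar> \<le> L" "\<bar>s\<bar> \<le> L"
    and eta: "0 \<le> \<eta>x" "\<eta>x \<le> 1" "0 \<le> \<eta>y" "\<eta>y \<le> 1" "\<bar>\<eta>x - \<eta>y\<bar> \<le> \<delta>"
  shows "\<bar>\<eta>x\<^sup>2 * spow m t - \<eta>y\<^sup>2 * spow m s\<bar> \<le> m * L powr (m - 1) * \<bar>t - s\<bar> + 2 * L powr m * \<delta>"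
proof -
  have "\<eta>x\<^sup>2 * spow m t - \<eta>y\<^sup>2 * spow m s = \<eta>x\<^sup>2 * (spow m t - spow m s) + (\<eta>x\<^sup>2 - \<eta>y\<^sup>2) * spow m s"
    by (simp add: algebra_simps)
  moreover have "\<bar>\<eta>x\<^sup>2 * (spow m t - spow m s)\<bar> \<le> 1 * (m * L powr (m - 1) * \<bar>t - s\<bar>)"
    unfolding abs_mult using spow_lipschitz[OF m L] eta by (intro mult_mono) (auto simp: power_le_one)
  moreover have "\<bar>(\<eta>x\<^sup>2 - \<eta>y\<^sup>2) * spow m s\<bar> \<le> (\<delta> * 2) * L powr m"
  proof -
    have "\<bar>\<eta>x\<^sup>2 - \<eta>y\<^sup>2\<bar> = \<bar>\<eta>x - \<eta>y\<bar> * (\<eta>x + \<eta>y)"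
      using eta by (simp add: power2_eq_square square_diff_square_factored abs_mult mult.commute)
    also have "\<dots> \<le> \<delta> * 2" using eta by (intro mult_mono) auto
    finally show ?thesis using L m eta unfolding abs_mult abs_spow by (intro mult_mono powr_mono2) auto
  qed
  ultimately show ?thesis by (simp add: mult_ac)
qed

section \<open>Double integrals\<close>

lemma fst_borel_measurable [measurable]: "(fst :: 'a::euclidean_space \<times> 'b::euclidean_space \<Rightarrow> 'a) \<in> borel_measurable borel"
  by (intro borel_measurable_continuous_onI continuous_intros)

lemma snd_borel_measurable [measurable]: "(snd :: 'a::euclidean_space \<times> 'b::euclidean_space \<Rightarrow> 'b) \<in> borel_measurable borel"
  by (intro borel_measurable_continuous_onI continuous_intros)

lemma Pair_borel_measurable [measurable]:
  "(\<lambda>y. (x, y)) \<in> borel \<rightarrow>\<^sub>M (borel :: ('a::euclidean_space \<times> 'b::euclidean_space) measure)"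
  by (rule borel_measurable_Pair) auto

definition dint :: "('a::euclidean_space \<Rightarrow> 'a \<Rightarrow> real) \<Rightarrow> ennreal" where
  "dint f = (\<integral>\<^sup>+ z. ennreal (f (fst z) (snd z)) \<partial>lebesgue2)"

abbreviation borel2 :: "('a::euclidean_space \<Rightarrow> 'a \<Rightarrow> real) \<Rightarrow> bool" where
  "borel2 f \<equiv> (\<lambda>z. f (fst z) (snd z)) \<in> borel_measurable borel"

lemma borel2_sections:
  fixes f :: "'a::euclidean_space \<Rightarrow> 'a \<Rightarrow> real"
  assumes "borel2 f"
  shows "(\<lambda>y. f x y) \<in> borel_measurable borel"
proof -
  have "(\<lambda>y::'a. (x, y)) \<in> borel \<rightarrow>\<^sub>M borel" by (rule Pair_borel_measurable)
  from measurable_compose[OF this assms] show ?thesis by simp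
qed

lemma dint_mono: "(\<And>x y. f x y \<le> g x y) \<Longrightarrow> dint f \<le> dint g"
  unfolding dint_def by (intro nn_integral_mono ennreal_leI)

lemma dint_add_le:
  assumes "borel2 f" "borel2 g" "\<And>x y. 0 \<le> f x y" "\<And>x y. 0 \<le> g x y"
  shows "dint (\<lambda>x y. f x y + g x y) = dint f + dint g"
  unfolding dint_def using assms
  by (subst nn_integral_add[symmetric]) (auto simp: borel_measurable_lebesgue2)

lemma dint_cmult:
  assumes "borel2 f" "0 \<le> c"
  shows "dint (\<lambda>x y. c * f x y) = ennreal c * dint f"
  unfolding dint_def using assms
  by (subst nn_integral_cmult[symmetric]) (auto simp: borel_measurable_lebesgue2 ennreal_mult')

lemma dint_swap:
  assumes "borel2 f"
  shows "dint (\<lambda>x y. f y x) = dint f"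
  using nn_integral_lebesgue2_swap[of "\<lambda>z. ennreal (f (fst z) (snd z))"] assms by (simp add: dint_def)

lemma dint_shift:
  assumes "borel2 f"
  shows "dint (\<lambda>x y. f (x + h) (y + h)) = dint f"
  using nn_integral_lebesgue2_shift[of "\<lambda>z. ennreal (f (fst z) (snd z))" h] assms
  by (simp add: dint_def borel_measurable_lebesgue2)

lemma dint_iterated:
  assumes "borel2 f"
  shows "dint f = (\<integral>\<^sup>+ x. \<integral>\<^sup>+ y. ennreal (f x y) \<partial>lborel \<partial>lborel)"
  unfolding dint_def using assms by (subst nn_integral_lebesgue2) auto

text \<open>Tonelli, with the bound on the inner integral demanded only where \<open>g\<close> does
  not vanish. In the application these are the points with enough distance to the sphere of radius
  R.\<close>

lemma dint_weight_le:
  assumes [measurable]: "g \<in> borel_measurable borel" "borel2 w"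
    and nn: "\<And>x. 0 \<le> g x"
    and bd: "\<And>x. g x \<noteq> 0 \<Longrightarrow> (\<integral>\<^sup>+ y. ennreal (w x y) \<partial>lborel) \<le> C"
  shows "dint (\<lambda>x y. g x * w x y) \<le> C * (\<integral>\<^sup>+ x. ennreal (g x) \<partial>lborel)"
proof -
  have "dint (\<lambda>x y. g x * w x y) = (\<integral>\<^sup>+ x. \<integral>\<^sup>+ y. ennreal (g x) * ennreal (w x y) \<partial>lborel \<partial>lborel)"
    using nn by (subst dint_iterated) (simp_all add: ennreal_mult')
  also have "\<dots> = (\<integral>\<^sup>+ x. ennreal (g x) * (\<integral>\<^sup>+ y. ennreal (w x y) \<partial>lborel) \<partial>lborel)"
    using borel2_sections[OF assms(2)] by (intro nn_integral_cong nn_integral_cmult) auto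
  also have "\<dots> \<le> (\<integral>\<^sup>+ x. C * ennreal (g x) \<partial>lborel)"
  proof (intro nn_integral_mono)
    fix x show "ennreal (g x) * (\<integral>\<^sup>+ y. ennreal (w x y) \<partial>lborel) \<le> C * ennreal (g x)"
      using bd[of x] by (cases "g x = 0") (auto simp: mult.commute[of C] intro!: mult_left_mono)
  qed
  also have "\<dots> = C * (\<integral>\<^sup>+ x. ennreal (g x) \<partial>lborel)" by (intro nn_integral_cmult) auto
  finally show ?thesis .
qed

lemma gagliardo_pow_eq_dint:
  fixes w :: "'a::euclidean_space \<Rightarrow> real"
  shows "gagliardo_pow \<gamma> q U w = dint (\<lambda>x y. \<bar>w x - w y\<bar> powr q / norm (x - y) powr (real DIM('a) + \<gamma> * q) * (indicator U x * indicator U y))"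
  unfolding gagliardo_pow_def dint_def
  by (intro nn_integral_cong) (auto simp: indicator_def ennreal_mult'[symmetric])

text \<open>On the diagonal \<open>0 powr _ = 0\<close> and division by 0 give the value 0, so pairs
  with x = y contribute nothing.\<close>

definition kernel :: "real \<Rightarrow> 'a::euclidean_space \<Rightarrow> 'a \<Rightarrow> real" where
  "kernel \<sigma> x y = 1 / norm (x - y) powr (real DIM('a) + \<sigma>)"

lemma kernel_nonneg [simp]: "0 \<le> kernel \<sigma> x y"
  by (simp add: kernel_def)

lemma kernel_shift [simp]: "kernel \<sigma> (x + h) (y + h) = kernel \<sigma> x y"
  by (simp add: kernel_def)

lemma kernel_commute: "kernel \<sigma> y x = kernel \<sigma> x y"
  by (simp add: kernel_def norm_minus_commute)

lemma borel_measurable_kernel [measurable (raw)]: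
  fixes f g :: "'b \<Rightarrow> 'a::euclidean_space"
  assumes [measurable]: "f \<in> borel_measurable M" "g \<in> borel_measurable M"
  shows "(\<lambda>x. kernel \<sigma> (f x) (g x)) \<in> borel_measurable M"
  unfolding kernel_def by measurable

lemma borel_measurable_indicator_ball [measurable (raw)]:
  fixes f :: "'b \<Rightarrow> 'a::euclidean_space"
  assumes [measurable]: "f \<in> borel_measurable M"
  shows "(\<lambda>x. indicator (ball c r) (f x) :: real) \<in> borel_measurable M"
  by (rule measurable_compose[OF assms borel_measurable_indicator]) simp

text \<open>For |x - y| >= D with D <= 1 one has 1 + |x - y| <= (2 / D) |x - y|, so away from the
  diagonal the singular kernel is dominated by the regular one.\<close>

lemma far_kernel_le:
  fixes x :: "'a::euclidean_space"
  assumes \<sigma>: "0 < \<sigma>" and D: "0 < D" "D \<le> 1"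
    and k: "(\<integral>\<^sup>+ z. ennreal (1 / (1 + norm z) powr (real DIM('a) + \<sigma>)) \<partial>(lborel :: 'a measure)) \<le> ennreal k" "0 \<le> k"
  shows "(\<integral>\<^sup>+ y. ennreal (kernel \<sigma> x y * of_bool (D \<le> norm (x - y))) \<partial>lborel) \<le> ennreal (k * (2 / D) powr (real DIM('a) + \<sigma>))"
proof -
  let ?N = "real DIM('a) + \<sigma>"
  have pw: "kernel \<sigma> x y * of_bool (D \<le> norm (x - y)) \<le> (2 / D) powr ?N * (1 / (1 + norm (x - y)) powr ?N)" for y
  proof (cases "D \<le> norm (x - y)")
    case True
    have n: "0 < norm (x - y)" using True D by linarith
    have "1 + norm (x - y) \<le> 2 / D * norm (x - y)"
    proof -
      have "D * (1 + norm (x - y)) \<le> 2 * norm (x - y)"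
        using True D mult_right_mono[of D 1 "norm (x - y)"] by (simp add: distrib_left)
      then show ?thesis using D by (simp add: field_simps)
    qed
    then have "(1 + norm (x - y)) powr ?N \<le> (2 / D * norm (x - y)) powr ?N"
      using \<sigma> by (intro powr_mono2) auto
    also have "\<dots> = (2 / D) powr ?N * norm (x - y) powr ?N" using D by (subst powr_mult) auto
    finally have *: "(1 + norm (x - y)) powr ?N \<le> (2 / D) powr ?N * norm (x - y) powr ?N" .
    have "1 + norm (x - y) \<noteq> 0" using n by linarith
    then have "0 < (1 + norm (x - y)) powr ?N" by simp
    moreover have "0 < norm (x - y) powr ?N" using n by simp
    ultimately show ?thesis using * True by (simp add: kernel_def field_simps)
  qed simp
  have "(\<integral>\<^sup>+ y. ennreal (kernel \<sigma> x y * of_bool (D \<le> norm (x - y))) \<partial>lborel)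
      \<le> (\<integral>\<^sup>+ y. ennreal ((2 / D) powr ?N) * ennreal (1 / (1 + norm (x - y)) powr ?N) \<partial>lborel)"
    by (intro nn_integral_mono, subst ennreal_mult'[symmetric], simp, intro ennreal_leI pw)
  also have "\<dots> = ennreal ((2 / D) powr ?N) * (\<integral>\<^sup>+ y. ennreal (1 / (1 + norm (x - y)) powr ?N) \<partial>lborel)"
    by (rule nn_integral_cmult) measurable
  also have "(\<integral>\<^sup>+ y. ennreal (1 / (1 + norm (x - y)) powr ?N) \<partial>lborel) = (\<integral>\<^sup>+ y. ennreal (1 / (1 + norm y) powr ?N) \<partial>(lborel :: 'a measure))"
    by (rule nn_integral_lborel_reflect[of "\<lambda>z. ennreal (1 / (1 + norm z) powr ?N)" x]) measurable
  also have "ennreal ((2 / D) powr ?N) * \<dots> \<le> ennreal ((2 / D) powr ?N) * ennreal k"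
    by (intro mult_left_mono k) auto
  finally show ?thesis using k by (simp add: ennreal_mult'[symmetric] mult.commute)
qed

text \<open>A factor |x - y|^\<tau> from a Lipschitz bound lowers the singularity of the kernel. It
  is used with \<tau> = 1 and \<tau> = p, where 1 - s1 and p - s p are positive.\<close>

lemma near_kernel_le:
  fixes x :: "'a::euclidean_space"
  assumes k: "(\<integral>\<^sup>+ z. ennreal (norm z powr (\<theta> - real DIM('a)) * indicator (cball 0 2) z) \<partial>(lborel :: 'a measure)) \<le> K"
    and t: "\<tau> - \<sigma> = \<theta>"
  shows "(\<integral>\<^sup>+ y. ennreal (norm (x - y) powr \<tau> * kernel \<sigma> x y * of_bool (norm (x - y) \<le> 2)) \<partial>lborel) \<le> K"
proof -
  have [measurable]: "cball (0::'a) 2 \<in> sets borel" by simp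
  have "(\<integral>\<^sup>+ y. ennreal (norm (x - y) powr \<tau> * kernel \<sigma> x y * of_bool (norm (x - y) \<le> 2)) \<partial>lborel)
     = (\<integral>\<^sup>+ y. ennreal (norm (x - y) powr (\<theta> - real DIM('a)) * indicator (cball 0 2) (x - y)) \<partial>lborel)"
    unfolding t[symmetric]
    by (intro nn_integral_cong) (auto simp: kernel_def indicator_def powr_diff powr_add)
  also have "\<dots> = (\<integral>\<^sup>+ z. ennreal (norm z powr (\<theta> - real DIM('a)) * indicator (cball 0 2) z) \<partial>(lborel :: 'a measure))"
    by (rule nn_integral_lborel_reflect) measurable
  finally show ?thesis using k by simp
qed

section \<open>Local solutions with pointwise hypotheses\<close>

text \<open>The constant \<open>k\<close> bounds the kernel integrals; all constants below depend on it and on the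
  exponents only. The hypotheses on \<open>u\<close> and \<open>Z\<close> hold everywhere, which is achieved by changing
  them on null sets.\<close>
locale local_solution =
  fixes u :: "'a::euclidean_space \<Rightarrow> real" and Z :: "'a \<times> 'a \<Rightarrow> real" and x0 :: 'a
    and R M s1 sp p k :: real
  assumes dim: "2 \<le> DIM('a)"
    and s1: "0 < s1" "s1 < 1" and p: "1 < p" "p < 2" and sp: "0 < sp" "sp < 1"
    and R: "0 < R" "R < 1" and M: "1 \<le> M" and k: "1 \<le> k"
    and far1: "(\<integral>\<^sup>+ z. ennreal (1 / (1 + norm z) powr (real DIM('a) + s1)) \<partial>(lborel :: 'a measure)) \<le> ennreal k"
    and farp: "(\<integral>\<^sup>+ z. ennreal (1 / (1 + norm z) powr (real DIM('a) + sp * p)) \<partial>(lborel :: 'a measure)) \<le> ennreal k"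
    and near1: "(\<integral>\<^sup>+ z. ennreal (norm z powr (1 - s1 - real DIM('a)) * indicator (cball 0 2) z) \<partial>(lborel :: 'a measure)) \<le> ennreal k"
    and nearp: "(\<integral>\<^sup>+ z. ennreal (norm z powr (p - sp * p - real DIM('a)) * indicator (cball 0 2) z) \<partial>(lborel :: 'a measure)) \<le> ennreal k"
    and u_borel [measurable]: "u \<in> borel_measurable borel"
    and Z_meas [measurable]: "Z \<in> borel_measurable lebesgue2"
    and Z_sgn: "\<And>x y. in_sgn (Z (x, y)) (u x - u y)"
    and u_bound: "\<And>x. x \<in> ball x0 R \<Longrightarrow> \<bar>u x\<bar> \<le> M"
    and gag1: "gagliardo_pow s1 1 (ball x0 R) u < \<infinity>"
    and gagp: "gagliardo_pow sp p (ball x0 R) u < \<infinity>"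
    and tail: "(\<integral>\<^sup>+ x. ennreal (\<bar>u x\<bar> powr (p - 1) * kernel (sp * p) x x0) * indicator (- ball x0 R) x \<partial>lborel)
        \<le> ennreal (M powr (p - 1) / R powr (sp * p))"
    and eqn: "\<And>\<phi>. \<lbrakk>\<phi> \<in> borel_measurable borel; frac_sobolev s1 1 UNIV \<phi>; frac_sobolev sp p UNIV \<phi>;
        \<And>x. x \<notin> ball x0 R \<Longrightarrow> \<phi> x = 0\<rbrakk> \<Longrightarrow>
        0 = (\<integral> z. Z z * (\<phi> (fst z) - \<phi> (snd z)) * kernel s1 (fst z) (snd z) \<partial>lebesgue2)
          + (\<integral> z. spow (p - 1) (u (fst z) - u (snd z)) * (\<phi> (fst z) - \<phi> (snd z)) * kernel (sp * p) (fst z) (snd z) \<partial>lebesgue2)"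
begin

lemma sp_p: "0 < sp * p" "sp * p < p"
  using p sp by auto

lemma M_powr: "1 \<le> M powr (p - 1)"
  using M p by (intro ge_one_powr_ge_zero) auto

text \<open>Moves the centre of the tail from x0 to x: outside the large ball |y - x0| <= (2 / D) |x
  - y|, inside it |u| <= M. The exponent has s p twice because the factor R^(-s p) in the bound
  \<open>tail\<close> is also absorbed into a power of 2 / D.\<close>

lemma far_tail:
  assumes x: "x \<in> ball x0 \<rho>" and D: "0 < D" "D \<le> R - \<rho>"
  shows "(\<integral>\<^sup>+ y. ennreal (\<bar>u y\<bar> powr (p - 1) * kernel (sp * p) x y * of_bool (D \<le> norm (x - y))) \<partial>lborel)
      \<le> ennreal (2 * k * M powr (p - 1) * (2 / D) powr (real DIM('a) + 2 * (sp * p)))" (is "?I \<le> _")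
proof -
  let ?s = "sp * p" let ?N = "real DIM('a) + ?s"
  have rho: "0 < \<rho>" using x by (metis mem_ball zero_le_dist le_less_trans)
  have D1: "D \<le> R" "D \<le> 1" "1 \<le> 2 / D" using D R rho by auto
  have pw: "\<bar>u y\<bar> powr (p - 1) * kernel ?s x y * of_bool (D \<le> norm (x - y))
     \<le> M powr (p - 1) * (kernel ?s x y * of_bool (D \<le> norm (x - y)))
      + (2 / D) powr ?N * (\<bar>u y\<bar> powr (p - 1) * kernel ?s y x0 * indicator (- ball x0 R) y)" for y
  proof (cases "y \<in> ball x0 R")
    case True
    have "\<bar>u y\<bar> powr (p - 1) \<le> M powr (p - 1)" using u_bound[OF True] p by (intro powr_mono2) auto
    then have "\<bar>u y\<bar> powr (p - 1) * (kernel ?s x y * of_bool (D \<le> norm (x - y))) \<le> M powr (p - 1) * (kernel ?s x y * of_bool (D \<le> norm (x - y)))"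
      by (intro mult_right_mono) auto
    then show ?thesis using True by (simp add: mult.assoc)
  next
    case False
    have far: "R \<le> norm (y - x0)" using False by (simp add: dist_norm norm_minus_commute)
    have n0: "0 < norm (y - x0)" using far R by linarith
    have "kernel ?s x y * of_bool (D \<le> norm (x - y)) \<le> (2 / D) powr ?N * kernel ?s y x0"
    proof (cases "D \<le> norm (x - y)")
      case True
      have n: "0 < norm (x - y)" using True D by linarith
      have "norm (y - x0) \<le> norm (x - y) + norm (x - x0)"
        using norm_triangle_ineq[of "y - x" "x - x0"] by (simp add: norm_minus_commute)
      also have "\<dots> \<le> norm (x - y) + 1" using x D R by (simp add: dist_norm norm_minus_commute)
      also have "D * \<dots> \<le> 2 * norm (x - y)"
        using True D1 mult_right_mono[of D 1 "norm (x - y)"] by (simp add: distrib_left)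
      finally have "norm (y - x0) \<le> 2 / D * norm (x - y)" using D by (simp add: field_simps)
      then have "norm (y - x0) powr ?N \<le> (2 / D * norm (x - y)) powr ?N"
        using sp_p by (intro powr_mono2) auto
      also have "\<dots> = (2 / D) powr ?N * norm (x - y) powr ?N" using D by (subst powr_mult) auto
      finally have *: "norm (y - x0) powr ?N \<le> (2 / D) powr ?N * norm (x - y) powr ?N" .
      have "0 < norm (y - x0) powr ?N" "0 < norm (x - y) powr ?N" using n n0 by simp_all
      then show ?thesis using * True by (simp add: kernel_def field_simps)
    qed simp
    then have "\<bar>u y\<bar> powr (p - 1) * (kernel ?s x y * of_bool (D \<le> norm (x - y))) \<le> \<bar>u y\<bar> powr (p - 1) * ((2 / D) powr ?N * kernel ?s y x0)"
      by (intro mult_left_mono) auto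
    moreover have "0 \<le> M powr (p - 1) * (kernel ?s x y * of_bool (D \<le> norm (x - y)))" by simp
    moreover have "(2 / D) powr ?N * (\<bar>u y\<bar> powr (p - 1) * kernel ?s y x0 * indicator (- ball x0 R) y) = \<bar>u y\<bar> powr (p - 1) * ((2 / D) powr ?N * kernel ?s y x0)"
      using False by simp
    ultimately show ?thesis by (simp only: mult.assoc)
  qed
  have "?I \<le> (\<integral>\<^sup>+ y. ennreal (M powr (p - 1)) * ennreal (kernel ?s x y * of_bool (D \<le> norm (x - y)))
      + ennreal ((2 / D) powr ?N) * (ennreal (\<bar>u y\<bar> powr (p - 1) * kernel ?s y x0) * indicator (- ball x0 R) y) \<partial>lborel)"
  proof (intro nn_integral_mono)
    fix y
    have of_bool_nn: "0 \<le> (of_bool (D \<le> norm (x - y)) :: real)" by simp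
    have "ennreal (M powr (p - 1)) * ennreal (kernel ?s x y * of_bool (D \<le> norm (x - y)))
        + ennreal ((2 / D) powr ?N) * (ennreal (\<bar>u y\<bar> powr (p - 1) * kernel ?s y x0) * indicator (- ball x0 R) y)
      = ennreal (M powr (p - 1) * (kernel ?s x y * of_bool (D \<le> norm (x - y)))
        + (2 / D) powr ?N * (\<bar>u y\<bar> powr (p - 1) * kernel ?s y x0 * indicator (- ball x0 R) y))"
      by (simp only: ennreal_indicator[symmetric] ennreal_mult'[symmetric] powr_ge_zero mult_nonneg_nonneg kernel_nonneg of_bool_nn indicator_pos_le
          ennreal_plus[symmetric])
    then show "ennreal (\<bar>u y\<bar> powr (p - 1) * kernel ?s x y * of_bool (D \<le> norm (x - y))) \<le> ennreal (M powr (p - 1)) * ennreal (kernel ?s x y * of_bool (D \<le> norm (x - y)))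
        + ennreal ((2 / D) powr ?N) * (ennreal (\<bar>u y\<bar> powr (p - 1) * kernel ?s y x0) * indicator (- ball x0 R) y)"
      using pw[of y] by (simp only: ennreal_leI)
  qed
  also have "\<dots> = ennreal (M powr (p - 1)) * (\<integral>\<^sup>+ y. ennreal (kernel ?s x y * of_bool (D \<le> norm (x - y))) \<partial>lborel)
     + ennreal ((2 / D) powr ?N) * (\<integral>\<^sup>+ y. ennreal (\<bar>u y\<bar> powr (p - 1) * kernel ?s y x0) * indicator (- ball x0 R) y \<partial>lborel)"
    by (subst nn_integral_add, measurable, subst nn_integral_cmult, measurable, subst nn_integral_cmult, measurable)
  also have "\<dots> \<le> ennreal (M powr (p - 1)) * ennreal (k * (2 / D) powr ?N) + ennreal ((2 / D) powr ?N) * ennreal (M powr (p - 1) / R powr ?s)"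
    using far_kernel_le[OF sp_p(1) D(1) D1(2) farp] k by (intro add_mono mult_left_mono tail) auto
  also have "\<dots> = ennreal (M powr (p - 1) * (2 / D) powr ?N * (k + 1 / R powr ?s))"
    using k by (simp add: ennreal_mult'[symmetric] ennreal_plus[symmetric] algebra_simps del: ennreal_plus)
  also have "\<dots> \<le> ennreal (M powr (p - 1) * (2 / D) powr ?N * (2 * k * (2 / D) powr ?s))"
  proof -
    have "1 / R powr ?s = (1 / R) powr ?s" using R by (simp add: powr_divide)
    also have "\<dots> \<le> (2 / D) powr ?s" using D1 D R sp_p by (intro powr_mono2) (auto simp: field_simps)
    also have "\<dots> \<le> k * (2 / D) powr ?s" using k mult_right_mono[of 1 k "(2 / D) powr ?s"] by simp
    finally have "1 / R powr ?s \<le> k * (2 / D) powr ?s" .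
    moreover have "k * 1 \<le> k * (2 / D) powr ?s" using k D1 sp_p by (intro mult_left_mono ge_one_powr_ge_zero) auto
    ultimately show ?thesis by (intro ennreal_leI mult_left_mono) auto
  qed
  also have "M powr (p - 1) * (2 / D) powr ?N * (2 * k * (2 / D) powr ?s) = 2 * k * M powr (p - 1) * (2 / D) powr (real DIM('a) + 2 * ?s)"
    by (simp add: powr_add[symmetric] mult_ac add_ac)
  finally show ?thesis .
qed

end

section \<open>Admissible test functions and integrability of the tested equation\<close>

lemma dint_add_finite:
  assumes "borel2 f" "borel2 g" "\<And>x y. 0 \<le> f x y" "\<And>x y. 0 \<le> g x y" "dint f < \<infinity>" "dint g < \<infinity>"
  shows "dint (\<lambda>x y. f x y + g x y) < \<infinity>"
  using assms by (subst dint_add_le) auto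

lemma dint_cmult_finite:
  assumes "borel2 f" "0 \<le> c" "dint f < \<infinity>"
  shows "dint (\<lambda>x y. c * f x y) < \<infinity>"
  using assms by (subst dint_cmult) (auto simp: ennreal_mult_less_top)

lemma nn_integral_indicator_ball_finite:
  "(\<integral>\<^sup>+ x. ennreal (c * indicator (ball x0 \<rho>) x) \<partial>(lborel :: 'a::euclidean_space measure)) < \<infinity>"
proof -
  have "(\<integral>\<^sup>+ x. ennreal (c * indicator (ball x0 \<rho>) x) \<partial>(lborel :: 'a measure))
      = (\<integral>\<^sup>+ x. ennreal c * indicator (ball x0 \<rho>) x \<partial>lborel)"
    by (intro nn_integral_cong) (auto simp: indicator_def)
  also have "\<dots> = ennreal c * emeasure lborel (ball x0 \<rho>)" by (rule nn_integral_cmult_indicator) auto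
  also have "\<dots> < \<infinity>" using emeasure_bounded_finite[of "ball x0 \<rho>"] by (auto simp: ennreal_mult_less_top)
  finally show ?thesis .
qed

lemma dint_ball_weight_finite:
  fixes x0 :: "'a::euclidean_space"
  assumes "borel2 w" "0 \<le> c" "\<And>x. x \<in> ball x0 \<rho> \<Longrightarrow> (\<integral>\<^sup>+ y. ennreal (w x y) \<partial>lborel) \<le> ennreal C"
  shows "dint (\<lambda>x y. c * indicator (ball x0 \<rho>) x * w x y) < \<infinity>"
proof -
  have "dint (\<lambda>x y. c * indicator (ball x0 \<rho>) x * w x y) \<le> ennreal C * (\<integral>\<^sup>+ x. ennreal (c * indicator (ball x0 \<rho>) x) \<partial>lborel)"
    by (rule dint_weight_le) (use assms in \<open>auto simp: indicator_def split: if_splits\<close>)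
  also have "\<dots> < \<infinity>" using nn_integral_indicator_ball_finite[of c x0 \<rho>] by (auto simp: ennreal_mult_less_top)
  finally show ?thesis .
qed

lemma Lq_on_UNIV_bounded:
  fixes \<phi> :: "'a::euclidean_space \<Rightarrow> real"
  assumes [measurable]: "\<phi> \<in> borel_measurable borel" and q: "0 \<le> q"
    and B: "\<And>x. \<bar>\<phi> x\<bar> \<le> B" and supp: "\<And>x. x \<notin> ball x0 \<rho> \<Longrightarrow> \<phi> x = 0"
  shows "Lq_on q UNIV \<phi>"
proof -
  have "\<bar>\<phi> x\<bar> powr q \<le> B powr q * indicator (ball x0 \<rho>) x" for x
    using B[of x] supp[of x] q by (cases "x \<in> ball x0 \<rho>") (auto intro!: powr_mono2)
  then have "(\<integral>\<^sup>+ x. ennreal (\<bar>\<phi> x\<bar> powr q) \<partial>lborel) \<le> (\<integral>\<^sup>+ x. ennreal (B powr q * indicator (ball x0 \<rho>) x) \<partial>lborel)"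
    by (intro nn_integral_mono ennreal_leI)
  also have "\<dots> < \<infinity>" by (rule nn_integral_indicator_ball_finite)
  finally show ?thesis
    unfolding Lq_on_def set_borel_measurable_def by (simp add: nn_integral_completion measurable_completion)
qed

lemma powr_add3_le:
  fixes x y z q :: real
  assumes "0 \<le> x" "0 \<le> y" "0 \<le> z" "0 \<le> q"
  shows "(x + y + z) powr q \<le> 4 powr q * (x powr q + y powr q + z powr q)"
proof -
  have "(x + y + z) powr q \<le> 2 powr q * ((x + y) powr q + z powr q)"
    using assms by (intro powr_add_le_2powr) auto
  also have "\<dots> \<le> 2 powr q * (2 powr q * (x powr q + y powr q) + 2 powr q * z powr q)"
    using assms powr_add_le_2powr[of x y q] ge_one_powr_ge_zero[of 2 q] mult_right_mono[of 1 "2 powr q" "z powr q"]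
    by (intro mult_left_mono add_mono) auto
  also have "\<dots> = 4 powr q * (x powr q + y powr q + z powr q)"
    using powr_mult[of 2 2 q] by (simp add: algebra_simps)
  finally show ?thesis .
qed

text \<open>Pairs inside the ball of radius \<rho> + D are controlled by the seminorm of u, that of
  its translate, and the near kernel for the Lipschitz part; the room D + |h| keeps all points
  involved in the ball of radius R. Any other pair with a point in the support is separated by D,
  where boundedness and the far kernel suffice. The remaining pairs contribute 0.\<close>

lemma frac_sobolev_cutoff:
  fixes \<phi> u :: "'a::euclidean_space \<Rightarrow> real"
  assumes [measurable]: "\<phi> \<in> borel_measurable borel" "u \<in> borel_measurable borel"
    and q: "1 \<le> q" and \<gamma>: "0 < \<gamma>" and k: "0 \<le> k"
    and far: "(\<integral>\<^sup>+ z. ennreal (1 / (1 + norm z) powr (real DIM('a) + \<gamma> * q)) \<partial>(lborel :: 'a measure)) \<le> ennreal k"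
    and near: "(\<integral>\<^sup>+ z. ennreal (norm z powr (q - \<gamma> * q - real DIM('a)) * indicator (cball 0 2) z) \<partial>(lborel :: 'a measure)) \<le> ennreal k"
    and gag: "gagliardo_pow \<gamma> q (ball x0 R) u < \<infinity>"
    and B: "\<And>x. \<bar>\<phi> x\<bar> \<le> B" and supp: "\<And>x. x \<notin> ball x0 \<rho> \<Longrightarrow> \<phi> x = 0"
    and D: "0 < D" "D \<le> 1" "R \<le> 1" "\<rho> + D + norm h \<le> R"
    and osc: "\<And>x y. \<lbrakk>x \<in> ball x0 (\<rho> + D); y \<in> ball x0 (\<rho> + D)\<rbrakk> \<Longrightarrow>
        \<bar>\<phi> x - \<phi> y\<bar> \<le> B * (\<bar>u (x + h) - u (y + h)\<bar> + \<bar>u x - u y\<bar> + norm (x - y))"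
  shows "frac_sobolev \<gamma> q UNIV \<phi>"
proof -
  let ?s = "\<gamma> * q" let ?K = "kernel (\<gamma> * q) :: 'a \<Rightarrow> 'a \<Rightarrow> real" let ?U = "ball x0 R"
  define G where "G x y = \<bar>u x - u y\<bar> powr q / norm (x - y) powr (real DIM('a) + ?s) * (indicator ?U x * indicator ?U y)" for x y :: 'a
  define N where "N x y = 1 * indicator ?U x * (norm (x - y) powr q * ?K x y * of_bool (norm (x - y) \<le> 2))" for x y :: 'a
  define A where "A x y = B powr q * indicator (ball x0 \<rho>) x * (?K x y * of_bool (D \<le> norm (x - y)))" for x y :: 'a
  define c where "c = (4 * B) powr q"
  have B0: "0 \<le> B" using B[of x0] by linarith
  have [measurable]: "borel2 G" "borel2 N" "borel2 A" unfolding G_def N_def A_def by measurable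
  have [measurable]: "borel2 (\<lambda>x y. G (x + h) (y + h))" unfolding G_def by measurable
  have [measurable]: "borel2 (\<lambda>x y. A y x)" unfolding A_def by measurable
  have nn: "0 \<le> G x y" "0 \<le> N x y" "0 \<le> A x y" for x y unfolding G_def N_def A_def by auto
  have pw: "\<bar>\<phi> x - \<phi> y\<bar> powr q / norm (x - y) powr (real DIM('a) + ?s) * (indicator UNIV x * indicator UNIV y)
     \<le> c * (G (x + h) (y + h) + (G x y + N x y)) + (A x y + A y x)" (is "?L x y \<le> c * ?X + ?Y") for x y
  proof -
    have X0: "0 \<le> c * ?X" "0 \<le> A x y" "0 \<le> A y x" using nn by (auto simp: c_def)
    have A: "?L x y \<le> A x y" if "x \<in> ball x0 \<rho>" "y \<notin> ball x0 (\<rho> + D)" for x y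
    proof -
      have "norm (x - y) \<ge> D" using that dist_triangle[of x0 y x] by (simp add: dist_norm)
      moreover have "\<phi> y = 0" using that D by (intro supp) auto
      then have "\<bar>\<phi> x - \<phi> y\<bar> powr q \<le> B powr q" using B[of x] q by (intro powr_mono2) auto
      ultimately show ?thesis using that by (simp add: A_def kernel_def divide_right_mono)
    qed
    consider (a) "x \<in> ball x0 (\<rho> + D)" "y \<in> ball x0 (\<rho> + D)" | (b) "x \<in> ball x0 \<rho>" "y \<notin> ball x0 (\<rho> + D)"
      | (c) "y \<in> ball x0 \<rho>" "x \<notin> ball x0 (\<rho> + D)" | (d) "x \<notin> ball x0 \<rho>" "y \<notin> ball x0 \<rho>"
      using D by (cases "x \<in> ball x0 (\<rho> + D)"; cases "y \<in> ball x0 (\<rho> + D)") auto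
    then show ?thesis
    proof cases
      case a
      let ?a = "\<bar>u (x + h) - u (y + h)\<bar>" let ?b = "\<bar>u x - u y\<bar>"
      have U: "x \<in> ?U" "y \<in> ?U" "x + h \<in> ?U" "y + h \<in> ?U"
        using a D norm_triangle_ineq4[of "x0 - x" h] norm_triangle_ineq4[of "x0 - y" h] norm_ge_zero[of h]
        by (auto simp: dist_norm algebra_simps simp del: norm_ge_zero)
      have "norm (x - y) \<le> 2"
        using U D dist_triangle[of x y x0] by (simp add: dist_norm norm_minus_commute)
      then have N: "N x y = norm (x - y) powr q * ?K x y" using U by (simp add: N_def)
      have "\<bar>\<phi> x - \<phi> y\<bar> powr q \<le> (B * (?a + ?b + norm (x - y))) powr q"
        using osc[OF a] q by (intro powr_mono2) auto
      also have "\<dots> = B powr q * (?a + ?b + norm (x - y)) powr q" using B0 by (simp add: powr_mult)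
      also have "\<dots> \<le> B powr q * (4 powr q * (?a powr q + ?b powr q + norm (x - y) powr q))"
        using q by (intro mult_left_mono powr_add3_le) auto
      also have "\<dots> = c * (?a powr q + ?b powr q + norm (x - y) powr q)" using B0 by (simp add: c_def powr_mult)
      finally have "\<bar>\<phi> x - \<phi> y\<bar> powr q * ?K x y \<le> c * (?a powr q + ?b powr q + norm (x - y) powr q) * ?K x y"
        by (intro mult_right_mono) auto
      also have "\<dots> = c * ?X" using U unfolding N by (simp add: G_def kernel_def add_divide_distrib distrib_left add_ac)
      finally have "?L x y \<le> c * ?X" by (simp add: kernel_def)
      then show ?thesis using X0 by linarith
    next
      case b then show ?thesis using A[OF b] X0 by linarith
    next
      case c
      have "?L x y = \<bar>\<phi> y - \<phi> x\<bar> powr q / norm (y - x) powr (real DIM('a) + ?s) * (indicator UNIV y * indicator UNIV x)"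
        by (simp add: abs_minus_commute norm_minus_commute)
      then show ?thesis using A[OF c] X0 by linarith
    next
      case d then show ?thesis using supp X0 q by simp
    qed
  qed
  have finG: "dint G < \<infinity>" using gag unfolding gagliardo_pow_eq_dint G_def .
  have finG': "dint (\<lambda>x y. G (x + h) (y + h)) < \<infinity>" using finG by (subst dint_shift) auto
  have finN: "dint N < \<infinity>" unfolding N_def
    by (rule dint_ball_weight_finite[where C = k]) (measurable, simp, rule near_kernel_le[OF near], simp)
  have finA: "dint A < \<infinity>" unfolding A_def
    by (rule dint_ball_weight_finite) (measurable, simp, rule far_kernel_le[OF _ D(1,2) far k], use \<gamma> q in simp)
  have finA': "dint (\<lambda>x y. A y x) < \<infinity>" using finA by (subst dint_swap) auto
  have "dint (\<lambda>x y. c * (G (x + h) (y + h) + (G x y + N x y)) + (A x y + A y x)) < \<infinity>"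
    by (intro dint_add_finite dint_cmult_finite finG finG' finN finA finA' add_nonneg_nonneg mult_nonneg_nonneg nn)
      (measurable, simp_all add: c_def)
  from le_less_trans[OF dint_mono this] have "gagliardo_pow \<gamma> q UNIV \<phi> < \<infinity>"
    unfolding gagliardo_pow_eq_dint using pw .
  then show ?thesis unfolding frac_sobolev_def using Lq_on_UNIV_bounded[OF assms(1) _ B supp, of q] q by simp
qed

lemma frac_sobolev_shift:
  fixes \<phi> :: "'a::euclidean_space \<Rightarrow> real"
  assumes [measurable]: "\<phi> \<in> borel_measurable borel" and f: "frac_sobolev \<gamma> q UNIV \<phi>"
  shows "frac_sobolev \<gamma> q UNIV (\<lambda>x. \<phi> (x + h))"
proof -
  have "gagliardo_pow \<gamma> q UNIV (\<lambda>x. \<phi> (x + h)) = gagliardo_pow \<gamma> q UNIV \<phi>"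
    unfolding gagliardo_pow_eq_dint
    using dint_shift[of "\<lambda>x y. \<bar>\<phi> x - \<phi> y\<bar> powr q / norm (x - y) powr (real DIM('a) + \<gamma> * q) * (indicator UNIV x * indicator UNIV y)" h]
    by simp
  moreover have "(\<integral>\<^sup>+ x. ennreal (\<bar>\<phi> (x + h)\<bar> powr q) \<partial>lborel) = (\<integral>\<^sup>+ x. ennreal (\<bar>\<phi> x\<bar> powr q) \<partial>lborel)"
    by (rule nn_integral_lborel_shift) measurable
  ultimately show ?thesis using f
    unfolding frac_sobolev_def Lq_on_def set_borel_measurable_def by (simp add: nn_integral_completion measurable_completion)
qed

context local_solution
begin

text \<open>The sum in the integrand bounds the difference of the two p-Laplacian fluxes at (x + h,
  y + h) and (x, y) when |u| <= M at x and x + h. The term |h| in the condition on D leaves room for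
  the translated tail, which is centred at x + h.\<close>

lemma far_mass:
  assumes x: "x \<in> ball x0 \<rho>" and D: "0 < D" "D \<le> R - \<rho> - norm h"
  shows "(\<integral>\<^sup>+ y. ennreal ((2 * M powr (p - 1) + \<bar>u (y + h)\<bar> powr (p - 1) + \<bar>u y\<bar> powr (p - 1)) * kernel (sp * p) x y * of_bool (D \<le> norm (x - y))) \<partial>lborel)
      \<le> ennreal (6 * k * M powr (p - 1) * (2 / D) powr (real DIM('a) + 2 * (sp * p)))" (is "_ \<le> ennreal ?b")
proof -
  let ?N = "real DIM('a)" let ?s = "sp * p" let ?K = "\<lambda>x y. kernel ?s x y * of_bool (D \<le> norm (x - y))"
  let ?c = "k * M powr (p - 1) * (2 / D) powr (?N + 2 * ?s)"
  have rho: "0 < \<rho>" using x by (metis mem_ball zero_le_dist le_less_trans)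
  have "D \<le> 1" using D R rho norm_ge_zero[of h] by linarith
  then have D1: "D \<le> 1" "1 \<le> 2 / D" using D by (auto simp: field_simps)
  have 1: "(\<integral>\<^sup>+ y. ennreal (?K x y) \<partial>lborel) \<le> ennreal (k * (2 / D) powr (?N + 2 * ?s))"
  proof -
    have "k * (2 / D) powr (?N + ?s) \<le> k * (2 / D) powr (?N + 2 * ?s)"
      using sp_p(1) D1 k by (intro mult_left_mono powr_mono) linarith+
    then show ?thesis using far_kernel_le[OF sp_p(1) D(1) D1(1) farp, of x] k by (meson ennreal_leI order_trans zero_le_one)
  qed
  have xh: "x + h \<in> ball x0 (\<rho> + norm h)"
    using x norm_triangle_ineq4[of "x0 - x" h] by (simp add: dist_norm algebra_simps)
  have 2: "(\<integral>\<^sup>+ y. ennreal (\<bar>u (y + h)\<bar> powr (p - 1) * ?K x y) \<partial>lborel) \<le> ennreal (2 * ?c)"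
  proof -
    have "(\<integral>\<^sup>+ y. ennreal (\<bar>u (y + h)\<bar> powr (p - 1) * ?K x y) \<partial>lborel)
        = (\<integral>\<^sup>+ y. ennreal (\<bar>u (y + h)\<bar> powr (p - 1) * kernel ?s (x + h) (y + h) * of_bool (D \<le> norm ((x + h) - (y + h)))) \<partial>lborel)"
      by (intro nn_integral_cong) (simp add: mult.assoc)
    also have "\<dots> = (\<integral>\<^sup>+ y. ennreal (\<bar>u y\<bar> powr (p - 1) * kernel ?s (x + h) y * of_bool (D \<le> norm ((x + h) - y))) \<partial>lborel)"
      by (rule nn_integral_lborel_shift) measurable
    also have "\<dots> \<le> ennreal (2 * k * M powr (p - 1) * (2 / D) powr (?N + 2 * ?s))"
      by (rule far_tail[OF xh D(1)]) (use D in simp)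
    finally show ?thesis by (simp add: mult.assoc)
  qed
  have 3: "(\<integral>\<^sup>+ y. ennreal (\<bar>u y\<bar> powr (p - 1) * ?K x y) \<partial>lborel) \<le> ennreal (2 * ?c)"
    using far_tail[OF x D(1)] D norm_ge_zero[of h] by (simp add: mult.assoc)
  have "(\<integral>\<^sup>+ y. ennreal ((2 * M powr (p - 1) + \<bar>u (y + h)\<bar> powr (p - 1) + \<bar>u y\<bar> powr (p - 1)) * kernel ?s x y * of_bool (D \<le> norm (x - y))) \<partial>lborel)
     = (\<integral>\<^sup>+ y. ennreal (2 * M powr (p - 1)) * ennreal (?K x y) + (ennreal (\<bar>u (y + h)\<bar> powr (p - 1) * ?K x y) + ennreal (\<bar>u y\<bar> powr (p - 1) * ?K x y)) \<partial>lborel)"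
    by (intro nn_integral_cong, subst ennreal_mult'[symmetric], simp,
        subst ennreal_plus[symmetric], simp, simp, subst ennreal_plus[symmetric], simp, simp, simp only: distrib_right mult.assoc add.assoc)
  also have "\<dots> = ennreal (2 * M powr (p - 1)) * (\<integral>\<^sup>+ y. ennreal (?K x y) \<partial>lborel)
     + ((\<integral>\<^sup>+ y. ennreal (\<bar>u (y + h)\<bar> powr (p - 1) * ?K x y) \<partial>lborel) + (\<integral>\<^sup>+ y. ennreal (\<bar>u y\<bar> powr (p - 1) * ?K x y) \<partial>lborel))"
    by (subst nn_integral_add, measurable, subst nn_integral_add, measurable, subst nn_integral_cmult, measurable)
  also have "\<dots> \<le> ennreal (2 * M powr (p - 1)) * ennreal (k * (2 / D) powr (?N + 2 * ?s)) + (ennreal (2 * ?c) + ennreal (2 * ?c))"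
    by (intro add_mono mult_left_mono 1 2 3) auto
  also have "\<dots> = ennreal ?b"
    using k by (simp add: ennreal_mult'[symmetric] ennreal_plus[symmetric] mult_ac del: ennreal_plus)
  finally show ?thesis .
qed

lemma abs_spow_diff_le:
  "\<bar>spow (p - 1) (a - b)\<bar> \<le> \<bar>a\<bar> powr (p - 1) + \<bar>b\<bar> powr (p - 1)"
proof -
  have "\<bar>a - b\<bar> powr (p - 1) \<le> (\<bar>a\<bar> + \<bar>b\<bar>) powr (p - 1)" using p by (intro powr_mono2) auto
  also have "\<dots> \<le> \<bar>a\<bar> powr (p - 1) + \<bar>b\<bar> powr (p - 1)" using p by (intro powr_add_le) auto
  finally show ?thesis by (simp add: abs_spow)
qed

lemma Z_abs_le: "\<bar>Z z\<bar> \<le> 1"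
  using in_sgn_abs_le[OF Z_sgn[of "fst z" "snd z"]] by simp

text \<open>The weak formulation is an equation between Bochner integrals, which are 0 for
  integrands that are not integrable; integrability of both integrands is what allows them to be
  merged into one, and later translated and subtracted. For the p-term Young's inequality handles
  pairs inside the ball of radius R, and \<open>far_mass\<close> handles pairs with one point
  outside.\<close>

lemma tested_integrable:
  assumes [measurable]: "\<phi> \<in> borel_measurable borel"
    and f1: "frac_sobolev s1 1 UNIV \<phi>" and fp: "frac_sobolev sp p UNIV \<phi>"
    and B: "\<And>x. \<bar>\<phi> x\<bar> \<le> B" and supp: "\<And>x. x \<notin> ball x0 \<rho> \<Longrightarrow> \<phi> x = 0" and \<rho>: "\<rho> < R"
  shows "integrable lebesgue2 (\<lambda>z. Z z * (\<phi> (fst z) - \<phi> (snd z)) * kernel s1 (fst z) (snd z)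
      + spow (p - 1) (u (fst z) - u (snd z)) * (\<phi> (fst z) - \<phi> (snd z)) * kernel (sp * p) (fst z) (snd z))" (is "integrable _ (\<lambda>z. ?I1 z + ?Ip z)")
    and "(\<integral> z. Z z * (\<phi> (fst z) - \<phi> (snd z)) * kernel s1 (fst z) (snd z)
      + spow (p - 1) (u (fst z) - u (snd z)) * (\<phi> (fst z) - \<phi> (snd z)) * kernel (sp * p) (fst z) (snd z) \<partial>lebesgue2) = 0"
proof -
  let ?K = "kernel (sp * p) :: 'a \<Rightarrow> 'a \<Rightarrow> real" let ?U = "ball x0 R"
  have B0: "0 \<le> B" using B[of x0] by linarith
  have i1: "integrable lebesgue2 ?I1"
  proof (rule integrableI_bounded)
    have "(\<integral>\<^sup>+ z. ennreal (norm (?I1 z)) \<partial>lebesgue2) \<le> gagliardo_pow s1 1 UNIV \<phi>"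
      unfolding gagliardo_pow_eq_dint dint_def
    proof (intro nn_integral_mono ennreal_leI)
      fix z
      have "norm (?I1 z) = \<bar>Z z\<bar> * \<bar>\<phi> (fst z) - \<phi> (snd z)\<bar> * kernel s1 (fst z) (snd z)"
        by (simp add: abs_mult)
      also have "\<dots> \<le> 1 * \<bar>\<phi> (fst z) - \<phi> (snd z)\<bar> * kernel s1 (fst z) (snd z)"
        using Z_abs_le by (intro mult_right_mono) auto
      finally show "norm (?I1 z) \<le> \<bar>\<phi> (fst z) - \<phi> (snd z)\<bar> powr 1 / norm (fst z - snd z) powr (real DIM('a) + s1 * 1) * (indicator UNIV (fst z) * indicator UNIV (snd z))"
        by (simp add: kernel_def)
    qed
    then show "(\<integral>\<^sup>+ z. ennreal (norm (?I1 z)) \<partial>lebesgue2) < \<infinity>"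
      using f1 unfolding frac_sobolev_def by (auto intro: le_less_trans)
  qed measurable
  define D where "D = R - \<rho>"
  have D: "0 < D" "D \<le> R - \<rho> - norm (0::'a)" using \<rho> by (auto simp: D_def)
  define G where "G w x y = \<bar>w x - w y\<bar> powr p / norm (x - y) powr (real DIM('a) + sp * p) * (indicator ?U x * indicator ?U y)" for w :: "'a \<Rightarrow> real" and x y :: 'a
  \<comment> \<open>Written with \<open>y + 0\<close> so that \<open>far_mass\<close> applies
    literally with h = 0.\<close>
  define A where "A x y = B * indicator (ball x0 \<rho>) x * ((2 * M powr (p - 1) + \<bar>u (y + 0)\<bar> powr (p - 1) + \<bar>u y\<bar> powr (p - 1)) * ?K x y * of_bool (D \<le> norm (x - y)))" for x y :: 'a
  define F where "F x y = \<bar>\<phi> x - \<phi> y\<bar> powr p / norm (x - y) powr (real DIM('a) + sp * p) * (indicator UNIV x * indicator UNIV y)" for x y :: 'a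
  have [measurable]: "borel2 (G u)" "borel2 F" "borel2 A" unfolding G_def F_def A_def by measurable
  have [measurable]: "borel2 (\<lambda>x y. A y x)" unfolding A_def by measurable
  have nn: "0 \<le> G u x y" "0 \<le> F x y" "0 \<le> A x y" for x y unfolding G_def F_def A_def using B0 by auto
  have pw: "\<bar>spow (p - 1) (u x - u y) * (\<phi> x - \<phi> y) * ?K x y\<bar> \<le> (G u x y + F x y) + (A x y + A y x)" (is "?L x y \<le> _") for x y
  proof -
    have X0: "0 \<le> G u x y + F x y" "0 \<le> A x y" "0 \<le> A y x" using nn by auto
    have A: "?L x y \<le> A x y" if "x \<in> ball x0 \<rho>" "y \<notin> ball x0 R" for x y
    proof -
      have "norm (x - y) \<ge> D" using that dist_triangle[of x0 y x] by (simp add: dist_norm D_def)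
      then have A: "A x y = ((2 * M powr (p - 1) + \<bar>u y\<bar> powr (p - 1) + \<bar>u y\<bar> powr (p - 1)) * B) * ?K x y"
        using that by (simp add: A_def)
      have "\<phi> y = 0" using that \<rho> by (intro supp) auto
      then have 1: "\<bar>\<phi> x - \<phi> y\<bar> \<le> B" using B by simp
      have "\<bar>u x\<bar> powr (p - 1) \<le> M powr (p - 1)" using that \<rho> p u_bound[of x] by (intro powr_mono2) auto
      then have 2: "\<bar>spow (p - 1) (u x - u y)\<bar> \<le> 2 * M powr (p - 1) + \<bar>u y\<bar> powr (p - 1) + \<bar>u y\<bar> powr (p - 1)"
        using abs_spow_diff_le[of "u x" "u y"] powr_ge_zero[of M "p - 1"] powr_ge_zero[of "\<bar>u y\<bar>" "p - 1"] by linarith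
      show ?thesis unfolding A abs_mult using 1 2 by (intro mult_mono) auto
    qed
    consider (a) "x \<in> ?U" "y \<in> ?U" | (b) "x \<in> ball x0 \<rho>" "y \<notin> ?U"
      | (c) "y \<in> ball x0 \<rho>" "x \<notin> ?U" | (d) "x \<notin> ball x0 \<rho>" "y \<notin> ball x0 \<rho>"
      using \<rho> by (cases "x \<in> ?U"; cases "y \<in> ?U") auto
    then show ?thesis
    proof cases
      case a
      have young: "b powr (p - 1) * f \<le> b powr p + f powr p" if "0 \<le> b" "0 \<le> f" for b f :: real
      proof (cases "f \<le> b")
        case True
        then have "b powr (p - 1) * f \<le> b powr (p - 1) * b" by (intro mult_left_mono) auto
        also have "\<dots> = b powr p" using powr_mult_base[of b "p - 1"] that by (simp add: mult.commute)
        finally show ?thesis by (smt (verit) powr_ge_zero)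
      next
        case False
        then have "b powr (p - 1) * f \<le> f powr (p - 1) * f" using that p by (intro mult_right_mono powr_mono2) auto
        also have "\<dots> = f powr p" using powr_mult_base[of f "p - 1"] that by (simp add: mult.commute)
        finally show ?thesis by (smt (verit) powr_ge_zero)
      qed
      have "?L x y = \<bar>u x - u y\<bar> powr (p - 1) * \<bar>\<phi> x - \<phi> y\<bar> * ?K x y" by (simp add: abs_mult abs_spow)
      also have "\<dots> \<le> (\<bar>u x - u y\<bar> powr p + \<bar>\<phi> x - \<phi> y\<bar> powr p) * ?K x y" by (intro mult_right_mono young) auto
      also have "\<dots> = G u x y + F x y" using a by (simp add: G_def F_def kernel_def add_divide_distrib)
      finally show ?thesis using X0 by linarith
    next
      case b then show ?thesis using A[OF b] X0 by linarith
    next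
      case c
      have "?L x y = ?L y x" by (simp add: abs_mult abs_spow abs_minus_commute kernel_commute)
      then show ?thesis using A[OF c] X0 by linarith
    next
      case d then show ?thesis using supp X0 by simp
    qed
  qed
  have fin: "dint (G u) < \<infinity>" "dint F < \<infinity>"
    using gagp fp unfolding gagliardo_pow_eq_dint frac_sobolev_def G_def F_def by auto
  have finA: "dint A < \<infinity>" unfolding A_def
    by (rule dint_ball_weight_finite) (measurable, rule B0, rule far_mass[OF _ D])
  have finA': "dint (\<lambda>x y. A y x) < \<infinity>" using finA by (subst dint_swap) auto
  have "dint (\<lambda>x y. (G u x y + F x y) + (A x y + A y x)) < \<infinity>"
    by (intro dint_add_finite fin finA finA' add_nonneg_nonneg nn) measurable
  from le_less_trans[OF dint_mono this]
  have "dint (\<lambda>x y. \<bar>spow (p - 1) (u x - u y) * (\<phi> x - \<phi> y) * ?K x y\<bar>) < \<infinity>" using pw .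
  then have ip: "integrable lebesgue2 ?Ip"
    by (intro integrableI_bounded) (measurable, simp add: dint_def)
  show "integrable lebesgue2 (\<lambda>z. ?I1 z + ?Ip z)" using i1 ip by (rule Bochner_Integration.integrable_add)
  have "\<phi> x = 0" if "x \<notin> ball x0 R" for x using that \<rho> by (intro supp) auto
  from eqn[OF assms(1) f1 fp this] show "(\<integral> z. ?I1 z + ?Ip z \<partial>lebesgue2) = 0"
    using i1 ip by (simp add: Bochner_Integration.integral_add)
qed

end

section \<open>The energy estimate\<close>

definition cutoff :: "'a::euclidean_space \<Rightarrow> real \<Rightarrow> real \<Rightarrow> 'a \<Rightarrow> real" where
  "cutoff x0 \<rho> d x = min 1 (max 0 ((\<rho> - dist x0 x) / d))"

lemma cutoff_borel_measurable [measurable]: "cutoff x0 \<rho> d \<in> borel_measurable borel"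
  unfolding cutoff_def[abs_def] by measurable

lemma cutoff_bounds: "0 \<le> cutoff x0 \<rho> d x" "cutoff x0 \<rho> d x \<le> 1"
  by (auto simp: cutoff_def)

lemma cutoff_eq_0: "0 < d \<Longrightarrow> x \<notin> ball x0 \<rho> \<Longrightarrow> cutoff x0 \<rho> d x = 0"
  by (auto simp: cutoff_def max_def zero_le_divide_iff)

lemma cutoff_eq_1: "0 < d \<Longrightarrow> x \<in> ball x0 (\<rho> - d) \<Longrightarrow> cutoff x0 \<rho> d x = 1"
  by (auto simp: cutoff_def max_def min_def field_simps)

lemma cutoff_lipschitz:
  assumes "0 < d"
  shows "\<bar>cutoff x0 \<rho> d x - cutoff x0 \<rho> d y\<bar> \<le> norm (x - y) / d"
proof -
  have "\<bar>cutoff x0 \<rho> d x - cutoff x0 \<rho> d y\<bar> \<le> \<bar>(\<rho> - dist x0 x) / d - (\<rho> - dist x0 y) / d\<bar>"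
    unfolding cutoff_def by linarith
  also have "\<dots> = \<bar>dist x0 y - dist x0 x\<bar> / d" using assms by (simp add: diff_divide_distrib[symmetric])
  also have "\<dots> \<le> norm (x - y) / d"
    using assms dist_triangle[of x0 y x] dist_triangle[of x0 x y]
    by (intro divide_right_mono) (auto simp: dist_norm norm_minus_commute)
  finally show ?thesis .
qed

text \<open>The constants collected in \<open>energy\<close>. With c = 2^(-m) / 8, the cut-off error
  of the p-Laplacian gives 32 (1 / c)^p 2^m, that of the sign gives 4 * 2^m, and the far pairs give
  8. The last factor is 2 / (4 c (p - 1)), where 2 stems from symmetrisation.\<close>

definition energy_const :: "real \<Rightarrow> real \<Rightarrow> real \<Rightarrow> real" where
  "energy_const p m k = k * (2 powr m * (32 * (8 * 2 powr m) powr p + 4) + 8) * (4 * 2 powr m) / (p - 1)"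

text \<open>Brings a real pointwise estimate into the subtraction-free form that
  \<open>nn_integral_le_of_integral_eq_0\<close> expects.\<close>

lemma ennreal_add_le_of_real_le:
  fixes X E \<Phi> :: real
  assumes "X \<le> \<Phi> + E" "0 \<le> X" "0 \<le> E"
  shows "ennreal X + ennreal (- \<Phi>) \<le> ennreal E + ennreal \<Phi>"
proof (cases "0 \<le> \<Phi>")
  case True
  then show ?thesis using assms by (simp add: ennreal_neg ennreal_plus[symmetric] ennreal_leI add.commute del: ennreal_plus)
next
  case False
  then show ?thesis using assms by (simp add: ennreal_neg ennreal_plus[symmetric] ennreal_leI del: ennreal_plus)
qed

lemma ennreal_add_mult:
  fixes a b x y :: real
  assumes "0 \<le> a" "0 \<le> b" "0 \<le> x" "0 \<le> y"
  shows "ennreal (a * x + b * y) = ennreal a * ennreal x + ennreal b * ennreal y"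
  using assms by (simp add: ennreal_mult)

lemma ennreal_distrib_right: "0 \<le> a \<Longrightarrow> 0 \<le> b \<Longrightarrow> ennreal a * I + ennreal b * I = ennreal (a + b) * I"
  by (simp add: distrib_right)

context local_solution
begin

text \<open>A Caccioppoli estimate for the differences of u. The cut-off is 1 on the ball of radius
  r + d and vanishes outside r + 2 d; a point of its support and a point outside r + 4 d are at
  least 2 d apart; and |h| <= d / 2 keeps the translates of all these balls inside r + 8 d =
  R.\<close>

lemma energy:
  fixes h :: 'a and m q r d :: real
  assumes r: "0 < r" "r < R" and d: "d = (R - r) / 8" and h: "norm h \<le> d / 2" and m: "1 \<le> m" "q = m + p - 1"
  shows "dint (\<lambda>x y. (\<bar>u (x + h) - u (y + h)\<bar> + \<bar>u x - u y\<bar>) powr (p - 2)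
        * \<bar>(u (x + h) - u x) - (u (y + h) - u y)\<bar> powr (m + 1) * kernel (sp * p) x y
        * (indicator (ball x0 (r + d)) x * indicator (ball x0 (r + d)) y))
    \<le> ennreal (energy_const p m k * M powr (p - 1) * (1 / d) powr (real DIM('a) + 4))
      * (\<integral>\<^sup>+ x. ennreal (\<bar>u (x + h) - u x\<bar> powr m * indicator (ball x0 (r + 4 * d)) x) \<partial>lborel)"
    (is "dint ?X \<le> _ * ?I")
proof -
  let ?N = "real DIM('a)" let ?K1 = "kernel s1 :: 'a \<Rightarrow> 'a \<Rightarrow> real" let ?Kp = "kernel (sp * p) :: 'a \<Rightarrow> 'a \<Rightarrow> real"
  let ?J = "spow (p - 1)"
  have d0: "0 < d" "8 * d = R - r" "d < 1" using r R d by auto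
  define t where "t x = u (x + h) - u x" for x
  define \<eta> where "\<eta> = cutoff x0 (r + 2 * d) d"
  define \<phi> where "\<phi> x = (\<eta> x)\<^sup>2 * spow m (t x)" for x
  have [measurable]: "t \<in> borel_measurable borel" "\<eta> \<in> borel_measurable borel"
    unfolding t_def[abs_def] \<eta>_def by measurable
  have [measurable]: "\<phi> \<in> borel_measurable borel" unfolding \<phi>_def[abs_def] by measurable
  have eta: "0 \<le> \<eta> x" "\<eta> x \<le> 1" for x by (auto simp: \<eta>_def cutoff_bounds)
  have eta_lip: "\<bar>\<eta> x - \<eta> y\<bar> \<le> norm (x - y) / d" for x y unfolding \<eta>_def by (rule cutoff_lipschitz[OF d0(1)])
  have supp: "\<phi> x = 0" if "x \<notin> ball x0 (r + 2 * d)" for x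
    unfolding \<phi>_def \<eta>_def cutoff_eq_0[OF d0(1) that] by simp
  have shift_ball: "x + h \<in> ball x0 (\<rho> + norm h)" if "x \<in> ball x0 \<rho>" for x \<rho>
    using that norm_triangle_ineq4[of "x0 - x" h] by (simp add: dist_norm algebra_simps)
  have u4: "\<bar>u x\<bar> \<le> M" "\<bar>u (x + h)\<bar> \<le> M" if "x \<in> ball x0 (r + 4 * d)" for x
    using that shift_ball[OF that] h d0 by (auto intro!: u_bound)
  have t4: "\<bar>t x\<bar> \<le> 2 * M" if "x \<in> ball x0 (r + 4 * d)" for x
    using u4[OF that] unfolding t_def by linarith
  define L where "L = 2 * M"
  define B where "B = L powr m + m * L powr (m - 1) + 2 * L powr m / d"
  have B: "L powr m \<le> B" "m * L powr (m - 1) \<le> B" "2 * L powr m / d \<le> B"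
    using m d0 by (auto simp: B_def)
  have \<phi>_bd: "\<bar>\<phi> x\<bar> \<le> B" for x
  proof (cases "x \<in> ball x0 (r + 2 * d)")
    case True
    then have "\<bar>t x\<bar> powr m \<le> L powr m" using m d0 t4[of x] unfolding L_def by (intro powr_mono2) auto
    then have "(\<eta> x)\<^sup>2 * \<bar>t x\<bar> powr m \<le> 1 * L powr m" using eta[of x] by (intro mult_mono) (auto simp: power_le_one)
    then show ?thesis using B by (simp add: \<phi>_def abs_mult abs_spow)
  next
    case False then show ?thesis using supp B by (smt (verit) powr_ge_zero)
  qed
  have osc: "\<bar>\<phi> x - \<phi> y\<bar> \<le> B * (\<bar>u (x + h) - u (y + h)\<bar> + \<bar>u x - u y\<bar> + norm (x - y))"
    if "x \<in> ball x0 (r + 2 * d + d)" "y \<in> ball x0 (r + 2 * d + d)" for x y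
  proof -
    have xy: "x \<in> ball x0 (r + 4 * d)" "y \<in> ball x0 (r + 4 * d)" using that d0 by auto
    have "\<bar>\<phi> x - \<phi> y\<bar> \<le> m * L powr (m - 1) * \<bar>t x - t y\<bar> + 2 * L powr m * (norm (x - y) / d)"
      unfolding \<phi>_def using t4[OF xy(1)] t4[OF xy(2)] m
      by (intro sq_spow_diff_le eta eta_lip) (auto simp: L_def)
    also have "\<dots> \<le> B * (\<bar>u (x + h) - u (y + h)\<bar> + \<bar>u x - u y\<bar>) + B * norm (x - y)"
    proof (intro add_mono)
      show "m * L powr (m - 1) * \<bar>t x - t y\<bar> \<le> B * (\<bar>u (x + h) - u (y + h)\<bar> + \<bar>u x - u y\<bar>)"
        using B m by (intro mult_mono) (auto simp: t_def intro: order_trans[OF _ B(2)])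
      show "2 * L powr m * (norm (x - y) / d) \<le> B * norm (x - y)"
        using mult_right_mono[OF B(3), of "norm (x - y)"] by simp
    qed
    finally show ?thesis by (simp add: distrib_left)
  qed
  have fs1: "frac_sobolev s1 1 UNIV \<phi>"
    by (rule frac_sobolev_cutoff[where k = k and u = u and h = h and D = d and \<rho> = "r + 2 * d" and R = R and B = B])
      (use s1 k far1 near1 gag1 \<phi>_bd supp osc d0 h R in auto)
  have fsp: "frac_sobolev sp p UNIV \<phi>"
    by (rule frac_sobolev_cutoff[where k = k and u = u and h = h and D = d and \<rho> = "r + 2 * d" and R = R and B = B])
      (use sp p k farp nearp gagp \<phi>_bd supp osc d0 h R in auto)
  \<comment> \<open>Testing the translated equation with \<open>\<phi>\<close> amounts to testing
    the equation with this translate and changing variables. Its support lies in the ball of radius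
    r + 3 d.\<close>
  define \<phi>' where "\<phi>' x = \<phi> (x + - h)" for x
  have [measurable]: "\<phi>' \<in> borel_measurable borel" unfolding \<phi>'_def[abs_def] by measurable
  have supp': "\<phi>' x = 0" if "x \<notin> ball x0 (r + 3 * d)" for x
    unfolding \<phi>'_def
  proof (rule supp, rule notI)
    assume "x + - h \<in> ball x0 (r + 2 * d)"
    from shift_ball[OF this] h d0 that show False by auto
  qed
  define f where "f \<psi> z = Z z * (\<psi> (fst z) - \<psi> (snd z)) * ?K1 (fst z) (snd z)
      + ?J (u (fst z) - u (snd z)) * (\<psi> (fst z) - \<psi> (snd z)) * ?Kp (fst z) (snd z)" for \<psi> z
  have f\<phi>: "integrable lebesgue2 (f \<phi>)" "integral\<^sup>L lebesgue2 (f \<phi>) = 0"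
    unfolding f_def using tested_integrable[OF _ fs1 fsp \<phi>_bd supp] d0 by auto
  have fs': "frac_sobolev s1 1 UNIV \<phi>'" "frac_sobolev sp p UNIV \<phi>'"
    using frac_sobolev_shift[OF _ fs1, of "- h"] frac_sobolev_shift[OF _ fsp, of "- h"] unfolding \<phi>'_def[abs_def] by auto
  have bd': "\<bar>\<phi>' x\<bar> \<le> B" for x unfolding \<phi>'_def by (rule \<phi>_bd)
  have f\<phi>': "integrable lebesgue2 (f \<phi>')" "integral\<^sup>L lebesgue2 (f \<phi>') = 0"
    unfolding f_def using tested_integrable[OF _ fs' bd' supp'] d0 by auto
  \<comment> \<open>the translated equation minus the equation, both tested with \<open>\<phi>\<close>\<close>
  define \<Phi> where "\<Phi> z = f \<phi>' (fst z + h, snd z + h) - f \<phi> z" for z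
  have \<Phi>: "integrable lebesgue2 \<Phi>" "integral\<^sup>L lebesgue2 \<Phi> = 0"
  proof -
    have [measurable]: "f \<phi>' \<in> borel_measurable lebesgue2" using f\<phi>'(1) by simp
    have i: "integrable lebesgue2 (\<lambda>z. f \<phi>' (fst z + h, snd z + h))"
      using f\<phi>'(1) by (simp add: integrable_lebesgue2_shift)
    show "integrable lebesgue2 \<Phi>" unfolding \<Phi>_def[abs_def] using i f\<phi>(1) by (rule Bochner_Integration.integrable_diff)
    show "integral\<^sup>L lebesgue2 \<Phi> = 0" unfolding \<Phi>_def[abs_def]
      using i f\<phi> f\<phi>' by (simp add: Bochner_Integration.integral_diff integral_lebesgue2_shift)
  qed
  have \<Phi>_eq: "\<Phi> (x, y) = (Z (x + h, y + h) - Z (x, y)) * (\<phi> x - \<phi> y) * ?K1 x y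
      + (?J (u (x + h) - u (y + h)) - ?J (u x - u y)) * (\<phi> x - \<phi> y) * ?Kp x y" for x y
    by (simp add: \<Phi>_def f_def \<phi>'_def) (simp add: left_diff_distrib)
  define c where "c = 2 powr (- m) / 8"
  have c: "0 < c" "1 / c = 8 * 2 powr m" by (auto simp: c_def powr_minus field_simps)
  define c1 where "c1 = 32 * (1 / c) powr p * 2 powr m"
  have c1: "0 \<le> c1" by (simp add: c1_def)
  define g where "g x = \<bar>t x\<bar> powr m * indicator (ball x0 (r + 4 * d)) x" for x
  define g2 where "g2 x = \<bar>t x\<bar> powr m * indicator (ball x0 (r + 2 * d)) x" for x
  \<comment> \<open>\<open>W1\<close> collects the cut-off errors of near pairs and
    \<open>W2\<close> the interaction of far pairs. \<open>E x y\<close> is the part of the error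
    carried by the difference of u at x, so a pair contributes \<open>E x y + E y x\<close>.\<close>
  define W1 where "W1 x y = c1 * M powr (p - 1) * (1 / d) powr p * (norm (x - y) powr p * ?Kp x y * of_bool (norm (x - y) \<le> 2))
     + 4 * 2 powr m * (1 / d) * (norm (x - y) powr 1 * ?K1 x y * of_bool (norm (x - y) \<le> 2))" for x y :: 'a
  define V where "V y = 2 * M powr (p - 1) + \<bar>u (y + h)\<bar> powr (p - 1) + \<bar>u y\<bar> powr (p - 1)" for y
  define W2 where "W2 x y = 2 * (?K1 x y * of_bool (2 * d \<le> norm (x - y))) + V y * ?Kp x y * of_bool (2 * d \<le> norm (x - y))" for x y :: 'a
  define E where "E x y = g x * W1 x y + g2 x * W2 x y" for x y
  have [measurable]: "g \<in> borel_measurable borel" "g2 \<in> borel_measurable borel" "V \<in> borel_measurable borel"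
    unfolding g_def[abs_def] g2_def[abs_def] V_def[abs_def] by measurable
  have [measurable]: "borel2 W1" "borel2 W2" unfolding W1_def W2_def by measurable
  have mE[measurable]: "borel2 E" "borel2 (\<lambda>x y. g x * W1 x y)" "borel2 (\<lambda>x y. g2 x * W2 x y)" unfolding E_def by measurable
  have mE'[measurable]: "borel2 (\<lambda>x y. E y x)" unfolding E_def W1_def W2_def by measurable
  have mX[measurable]: "borel2 ?X" by measurable
  have V0: "0 \<le> V y" for y by (simp add: V_def)
  have nnW: "0 \<le> g x" "0 \<le> g2 x" "0 \<le> W1 x y" "0 \<le> W2 x y" for x y
    using c1 d0 V0 by (auto simp: g_def g2_def W1_def W2_def)
  have nn: "0 \<le> E x y" for x y unfolding E_def using nnW by simp
  have nnX: "0 \<le> ?X x y" for x y by simp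
  have M1: "1 \<le> M powr (p - 1)" by (rule M_powr)
  \<comment> \<open>The factor 4 is the value of \<open>(\<eta> x + \<eta> y)\<^sup>2\<close> where
    both cut-off functions are 1.\<close>
  have pw: "4 * c * (p - 1) * ?X x y \<le> \<Phi> (x, y) + (E x y + E y x)" for x y
  proof -
    let ?a = "u (x + h) - u (y + h)" let ?b = "u x - u y"
    have E0: "0 \<le> E x y" "0 \<le> E y x" using nn by auto
    \<comment> \<open>Only the point x lies in the support. No cancellation between the fluxes is
      used here: \<open>V\<close> bounds the p-part and 2 bounds the difference of the
      signs.\<close>
    have far: "\<bar>\<Phi> (x, y)\<bar> \<le> E x y" if x: "x \<in> ball x0 (r + 2 * d)" and y: "y \<notin> ball x0 (r + 4 * d)" for x y
    proof -
      have n: "2 * d \<le> norm (x - y)" using x y dist_triangle[of x0 y x] by (simp add: dist_norm)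
      have \<phi>y: "\<phi> y = 0" using y d0 by (intro supp) auto
      have x4: "x \<in> ball x0 (r + 4 * d)" using x d0 by auto
      have "(\<eta> x)\<^sup>2 * \<bar>t x\<bar> powr m \<le> 1 * \<bar>t x\<bar> powr m" using eta[of x] by (intro mult_right_mono) (auto simp: power_le_one)
      then have \<phi>x: "\<bar>\<phi> x\<bar> \<le> g2 x" using x by (simp add: \<phi>_def abs_mult abs_spow g2_def)
      have ux: "\<bar>u x\<bar> powr (p - 1) \<le> M powr (p - 1)" "\<bar>u (x + h)\<bar> powr (p - 1) \<le> M powr (p - 1)"
        using u4[OF x4] p by (auto intro!: powr_mono2)
      have J: "\<bar>?J (u (x + h) - u (y + h)) - ?J (u x - u y)\<bar> \<le> V y"
        using abs_triangle_ineq4[of "?J (u (x + h) - u (y + h))" "?J (u x - u y)"]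
          abs_spow_diff_le[of "u (x + h)" "u (y + h)"] abs_spow_diff_le[of "u x" "u y"] ux unfolding V_def by linarith
      have Z: "\<bar>Z (x + h, y + h) - Z (x, y)\<bar> \<le> 2" using Z_abs_le[of "(x + h, y + h)"] Z_abs_le[of "(x, y)"] by linarith
      have "\<bar>\<Phi> (x, y)\<bar> \<le> \<bar>Z (x + h, y + h) - Z (x, y)\<bar> * \<bar>\<phi> x\<bar> * ?K1 x y
          + \<bar>?J (u (x + h) - u (y + h)) - ?J (u x - u y)\<bar> * \<bar>\<phi> x\<bar> * ?Kp x y"
        unfolding \<Phi>_eq \<phi>y by (rule order_trans[OF abs_triangle_ineq]) (simp add: abs_mult)
      also have "\<dots> \<le> 2 * g2 x * ?K1 x y + V y * g2 x * ?Kp x y"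
        using Z J \<phi>x V0 by (intro add_mono mult_right_mono mult_mono) auto
      also have "\<dots> = g2 x * W2 x y" using n by (simp add: W2_def algebra_simps)
      also have "\<dots> \<le> E x y" unfolding E_def by (simp add: nnW)
      finally show ?thesis .
    qed
    consider (a) "x \<in> ball x0 (r + 4 * d)" "y \<in> ball x0 (r + 4 * d)" | (b) "x \<in> ball x0 (r + 2 * d)" "y \<notin> ball x0 (r + 4 * d)"
      | (c') "y \<in> ball x0 (r + 2 * d)" "x \<notin> ball x0 (r + 4 * d)"
      | (e) "x \<notin> ball x0 (r + 2 * d)" "y \<notin> ball x0 (r + 2 * d)" "x \<notin> ball x0 (r + 4 * d) \<or> y \<notin> ball x0 (r + 4 * d)"
      using d0 by (cases "x \<in> ball x0 (r + 4 * d)"; cases "y \<in> ball x0 (r + 4 * d)") auto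
    then show ?thesis
    proof cases
      case a
      define S where "S = \<bar>t x\<bar> + \<bar>t y\<bar>"
      define \<delta> where "\<delta> = norm (x - y) / d"
      let ?Y = "(\<bar>?a\<bar> + \<bar>?b\<bar>) powr (p - 2) * \<bar>?a - ?b\<bar> powr (m + 1)"
      have ts: "t x - t y = ?a - ?b" by (simp add: t_def)
      have P: "c * (p - 1) * (\<eta> x + \<eta> y)\<^sup>2 * ?Y \<le> (?J ?a - ?J ?b) * (\<phi> x - \<phi> y) + 8 * (1 / c) powr p * (\<delta> powr p * S powr q)"
        unfolding \<phi>_def c_def S_def \<delta>_def by (rule tested_p_growth_ge[OF p m ts eta eta eta_lip])
      have Q: "- (4 * \<delta> * S powr m) \<le> (Z (x + h, y + h) - Z (x, y)) * (\<phi> x - \<phi> y)"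
        unfolding \<phi>_def S_def \<delta>_def by (rule tested_sgn_ge[OF m(1) ts Z_sgn Z_sgn eta eta eta_lip])
      have n2: "norm (x - y) \<le> 2"
        using a d0 r R dist_triangle[of x y x0] by (simp add: dist_norm norm_minus_commute)
      have gx: "g x = \<bar>t x\<bar> powr m" "g y = \<bar>t y\<bar> powr m" using a by (auto simp: g_def)
      have Sm: "S powr m \<le> 2 powr m * (g x + g y)" unfolding S_def gx using m by (intro powr_add_le_2powr) auto
      have S0: "0 \<le> S" "S \<le> 4 * M" using t4[OF a(1)] t4[OF a(2)] by (auto simp: S_def)
      \<comment> \<open>Since q = (p - 1) + m, the power p - 1 of S is estimated by S <= 4 M, and
        the m-th power stays for the right-hand side.\<close>
      have Sq: "S powr q \<le> 4 * M powr (p - 1) * 2 powr m * (g x + g y)"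
      proof -
        have "q = (p - 1) + m" using m by simp
        then have "S powr q = S powr (p - 1) * S powr m" by (simp only: powr_add)
        also have "\<dots> \<le> (4 * M powr (p - 1)) * (2 powr m * (g x + g y))"
        proof (intro mult_mono Sm)
          have "S powr (p - 1) \<le> (4 * M) powr (p - 1)" using S0 p by (intro powr_mono2) auto
          also have "\<dots> = 4 powr (p - 1) * M powr (p - 1)" using M by (simp add: powr_mult)
          also have "\<dots> \<le> 4 powr 1 * M powr (p - 1)" using p by (intro mult_right_mono powr_mono) auto
          finally show "S powr (p - 1) \<le> 4 * M powr (p - 1)" by simp
        qed auto
        finally show ?thesis by (simp add: mult.assoc)
      qed
      have \<delta>p: "\<delta> powr p = (1 / d) powr p * norm (x - y) powr p" using d0 by (simp add: \<delta>_def powr_divide)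
      have "4 * c * (p - 1) * ?X x y \<le> c * (p - 1) * (\<eta> x + \<eta> y)\<^sup>2 * ?Y * ?Kp x y"
      proof (cases "x \<in> ball x0 (r + d) \<and> y \<in> ball x0 (r + d)")
        case True
        then have "\<eta> x = 1" "\<eta> y = 1" unfolding \<eta>_def using d0 by (auto intro!: cutoff_eq_1)
        then show ?thesis using True by (simp add: algebra_simps)
      next
        case False
        then have "4 * c * (p - 1) * ?X x y = 0" by (auto simp: indicator_def)
        also have "\<dots> \<le> c * (p - 1) * (\<eta> x + \<eta> y)\<^sup>2 * ?Y * ?Kp x y" using c p by simp
        finally show ?thesis .
      qed
      also have "\<dots> \<le> ((?J ?a - ?J ?b) * (\<phi> x - \<phi> y) + 8 * (1 / c) powr p * (\<delta> powr p * S powr q)) * ?Kp x y"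
        by (intro mult_right_mono P) auto
      also have "\<dots> \<le> \<Phi> (x, y) + (8 * (1 / c) powr p * (\<delta> powr p * S powr q) * ?Kp x y + 4 * \<delta> * S powr m * ?K1 x y)"
        using mult_right_mono[OF Q kernel_nonneg[of s1 x y]] unfolding \<Phi>_eq by (simp add: distrib_right)
      also have "8 * (1 / c) powr p * (\<delta> powr p * S powr q) * ?Kp x y + 4 * \<delta> * S powr m * ?K1 x y \<le> (g x + g y) * W1 x y"
      proof -
        have "8 * (1 / c) powr p * (\<delta> powr p * S powr q) * ?Kp x y \<le> 8 * (1 / c) powr p * (\<delta> powr p * (4 * M powr (p - 1) * 2 powr m * (g x + g y))) * ?Kp x y"
          by (intro mult_right_mono mult_left_mono Sq) auto
        moreover have "4 * \<delta> * S powr m * ?K1 x y \<le> 4 * \<delta> * (2 powr m * (g x + g y)) * ?K1 x y"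
          using d0 by (intro mult_right_mono mult_left_mono Sm) (auto simp: \<delta>_def)
        moreover have "(g x + g y) * W1 x y = 8 * (1 / c) powr p * (\<delta> powr p * (4 * M powr (p - 1) * 2 powr m * (g x + g y))) * ?Kp x y + 4 * \<delta> * (2 powr m * (g x + g y)) * ?K1 x y"
          unfolding W1_def \<delta>p c1_def unfolding \<delta>_def using n2 by (simp add: distrib_left mult_ac)
        ultimately show ?thesis by linarith
      qed
      also have "(g x + g y) * W1 x y \<le> E x y + E y x"
      proof -
        have "W1 y x = W1 x y" by (simp add: W1_def kernel_commute norm_minus_commute)
        then show ?thesis unfolding E_def using nnW by (simp add: distrib_right)
      qed
      finally show ?thesis by simp
    next
      case b
      then have "4 * c * (p - 1) * ?X x y = 0" using d0 by (auto simp: indicator_def)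
      then show ?thesis using far[OF b] E0 by linarith
    next
      case c'
      then have X: "4 * c * (p - 1) * ?X x y = 0" using d0 by (auto simp: indicator_def)
      have n: "2 * d \<le> norm (y - x)" using c' dist_triangle[of x0 x y] by (simp add: dist_norm)
      have \<phi>x: "\<phi> x = 0" using c' d0 by (intro supp) auto
      have y4: "y \<in> ball x0 (r + 4 * d)" using c' d0 by auto
      have "(\<eta> y)\<^sup>2 * \<bar>t y\<bar> powr m \<le> 1 * \<bar>t y\<bar> powr m" using eta[of y] by (intro mult_right_mono) (auto simp: power_le_one)
      then have \<phi>y: "\<bar>\<phi> y\<bar> \<le> g2 y" using c' by (simp add: \<phi>_def abs_mult abs_spow g2_def)
      have uy: "\<bar>u y\<bar> powr (p - 1) \<le> M powr (p - 1)" "\<bar>u (y + h)\<bar> powr (p - 1) \<le> M powr (p - 1)"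
        using u4[OF y4] p by (auto intro!: powr_mono2)
      have J: "\<bar>?J ?a - ?J ?b\<bar> \<le> V x"
        using abs_triangle_ineq4[of "?J ?a" "?J ?b"]
          abs_spow_diff_le[of "u (x + h)" "u (y + h)"] abs_spow_diff_le[of "u x" "u y"] uy unfolding V_def by linarith
      have Z: "\<bar>Z (x + h, y + h) - Z (x, y)\<bar> \<le> 2" using Z_abs_le[of "(x + h, y + h)"] Z_abs_le[of "(x, y)"] by linarith
      have "\<bar>\<Phi> (x, y)\<bar> \<le> \<bar>Z (x + h, y + h) - Z (x, y)\<bar> * \<bar>\<phi> y\<bar> * ?K1 x y + \<bar>?J ?a - ?J ?b\<bar> * \<bar>\<phi> y\<bar> * ?Kp x y"
        unfolding \<Phi>_eq \<phi>x by (rule order_trans[OF abs_triangle_ineq]) (simp add: abs_mult)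
      also have "\<dots> \<le> 2 * g2 y * ?K1 x y + V x * g2 y * ?Kp x y"
        using Z J \<phi>y V0 by (intro add_mono mult_right_mono mult_mono) auto
      also have "\<dots> = g2 y * W2 y x" using n by (simp add: W2_def algebra_simps kernel_commute)
      also have "\<dots> \<le> E y x" unfolding E_def by (simp add: nnW)
      finally show ?thesis using X E0 by linarith
    next
      case e
      then have "4 * c * (p - 1) * ?X x y = 0" using d0 by (auto simp: indicator_def)
      moreover have "\<Phi> (x, y) = 0" using e supp by (simp add: \<Phi>_eq)
      ultimately show ?thesis using E0 by linarith
    qed
  qed
  have W1_int: "(\<integral>\<^sup>+ y. ennreal (W1 x y) \<partial>lborel) \<le> ennreal (k * (c1 + 4 * 2 powr m) * M powr (p - 1) * (1 / d) powr (?N + 4))" for x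
  proof -
    have "(\<integral>\<^sup>+ y. ennreal (W1 x y) \<partial>lborel) = (\<integral>\<^sup>+ y. ennreal (c1 * M powr (p - 1) * (1 / d) powr p) * ennreal (norm (x - y) powr p * ?Kp x y * of_bool (norm (x - y) \<le> 2))
       + ennreal (4 * 2 powr m * (1 / d)) * ennreal (norm (x - y) powr 1 * ?K1 x y * of_bool (norm (x - y) \<le> 2)) \<partial>lborel)"
      unfolding W1_def by (intro nn_integral_cong ennreal_add_mult) (use c1 d0 in auto)
    also have "\<dots> = ennreal (c1 * M powr (p - 1) * (1 / d) powr p) * (\<integral>\<^sup>+ y. ennreal (norm (x - y) powr p * ?Kp x y * of_bool (norm (x - y) \<le> 2)) \<partial>lborel)
       + ennreal (4 * 2 powr m * (1 / d)) * (\<integral>\<^sup>+ y. ennreal (norm (x - y) powr 1 * ?K1 x y * of_bool (norm (x - y) \<le> 2)) \<partial>lborel)"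
      by (subst nn_integral_add, measurable, subst nn_integral_cmult, measurable, subst nn_integral_cmult, measurable)
    also have "\<dots> \<le> ennreal (c1 * M powr (p - 1) * (1 / d) powr p) * ennreal k + ennreal (4 * 2 powr m * (1 / d)) * ennreal k"
      by (intro add_mono mult_left_mono near_kernel_le[OF nearp] near_kernel_le[OF near1]) auto
    also have "\<dots> = ennreal (k * (c1 * M powr (p - 1) * (1 / d) powr p + 4 * 2 powr m * (1 / d)))"
      using k c1 d0 by (simp add: ennreal_mult'[symmetric] ennreal_plus[symmetric] distrib_left mult_ac del: ennreal_plus)
    also have "\<dots> \<le> ennreal (k * (c1 + 4 * 2 powr m) * M powr (p - 1) * (1 / d) powr (?N + 4))"
    proof -
      \<comment> \<open>As 1 / d >= 1, the exponent N + 4 dominates every power of 1 / d that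
        occurs: p and 1 here, N + s1 and N + 2 s p for the far pairs.\<close>
      have d1: "1 \<le> 1 / d" using d0 by simp
      have "(1 / d) powr p \<le> (1 / d) powr (?N + 4)" using d1 p by (intro powr_mono) auto
      then have A: "c1 * M powr (p - 1) * (1 / d) powr p \<le> c1 * M powr (p - 1) * (1 / d) powr (?N + 4)"
        using c1 by (intro mult_left_mono) auto
      have "(1 / d) powr 1 \<le> (1 / d) powr (?N + 4)" using d1 by (intro powr_mono) auto
      then have "1 * (1 / d) \<le> M powr (p - 1) * (1 / d) powr (?N + 4)" using M1 d0 by (intro mult_mono) auto
      then have B: "4 * 2 powr m * (1 * (1 / d)) \<le> 4 * 2 powr m * (M powr (p - 1) * (1 / d) powr (?N + 4))" by (intro mult_left_mono) auto
      have "k * (c1 * M powr (p - 1) * (1 / d) powr p + 4 * 2 powr m * (1 / d)) \<le> k * (c1 * M powr (p - 1) * (1 / d) powr (?N + 4) + 4 * 2 powr m * (M powr (p - 1) * (1 / d) powr (?N + 4)))"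
      proof (rule mult_left_mono[OF add_mono[OF A]])
        show "4 * 2 powr m * (1 / d) \<le> 4 * 2 powr m * (M powr (p - 1) * (1 / d) powr (?N + 4))" using B by (simp only: mult_1)
      qed (use k in simp)
      then show ?thesis by (intro ennreal_leI) (simp add: distrib_left distrib_right mult_ac)
    qed
    finally show ?thesis .
  qed
  have W2_int: "(\<integral>\<^sup>+ y. ennreal (W2 x y) \<partial>lborel) \<le> ennreal (k * 8 * M powr (p - 1) * (1 / d) powr (?N + 4))"
    if x: "x \<in> ball x0 (r + 2 * d)" for x
  proof -
    have d1: "1 \<le> 1 / d" "2 / (2 * d) = 1 / d" using d0 by simp_all
    have D: "0 < 2 * d" "2 * d \<le> R - (r + 2 * d) - norm h" using d0 h by auto
    have D2: "2 * d \<le> 1" using d0 R r by auto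
    have "(\<integral>\<^sup>+ y. ennreal (W2 x y) \<partial>lborel) = (\<integral>\<^sup>+ y. ennreal 2 * ennreal (?K1 x y * of_bool (2 * d \<le> norm (x - y)))
       + ennreal (V y * ?Kp x y * of_bool (2 * d \<le> norm (x - y))) \<partial>lborel)"
      unfolding W2_def by (intro nn_integral_cong, subst ennreal_plus, simp, simp add: V0, subst ennreal_mult', simp, rule refl)
    also have "\<dots> = ennreal 2 * (\<integral>\<^sup>+ y. ennreal (?K1 x y * of_bool (2 * d \<le> norm (x - y))) \<partial>lborel)
       + (\<integral>\<^sup>+ y. ennreal (V y * ?Kp x y * of_bool (2 * d \<le> norm (x - y))) \<partial>lborel)"
      by (subst nn_integral_add, measurable, subst nn_integral_cmult, measurable)
    also have "\<dots> \<le> ennreal 2 * ennreal (k * (2 / (2 * d)) powr (?N + s1)) + ennreal (6 * k * M powr (p - 1) * (2 / (2 * d)) powr (?N + 2 * (sp * p)))"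
      unfolding V_def using k by (intro add_mono mult_left_mono far_kernel_le[OF s1(1) D(1) D2 far1] far_mass[OF x D]) auto
    also have "\<dots> = ennreal (2 * (k * (1 / d) powr (?N + s1)) + 6 * k * M powr (p - 1) * (1 / d) powr (?N + 2 * (sp * p)))"
      unfolding d1(2) by (subst ennreal_plus, use k in simp, use k in simp, subst ennreal_mult', simp, rule refl)
    also have "\<dots> \<le> ennreal (k * 8 * M powr (p - 1) * (1 / d) powr (?N + 4))"
    proof (intro ennreal_leI)
      have "(1 / d) powr (?N + s1) \<le> (1 / d) powr (?N + 4)" using d1(1) s1 by (intro powr_mono) auto
      then have "1 * (1 / d) powr (?N + s1) \<le> M powr (p - 1) * (1 / d) powr (?N + 4)" using M1 by (intro mult_mono) auto
      then have A: "2 * (k * (1 * (1 / d) powr (?N + s1))) \<le> 2 * (k * (M powr (p - 1) * (1 / d) powr (?N + 4)))" using k by (intro mult_left_mono) auto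
      have "(1 / d) powr (?N + 2 * (sp * p)) \<le> (1 / d) powr (?N + 4)" using d1(1) sp_p p by (intro powr_mono) linarith+
      then have "6 * k * M powr (p - 1) * (1 / d) powr (?N + 2 * (sp * p)) \<le> 6 * k * M powr (p - 1) * (1 / d) powr (?N + 4)" using k by (intro mult_left_mono) auto
      then show "2 * (k * (1 / d) powr (?N + s1)) + 6 * k * M powr (p - 1) * (1 / d) powr (?N + 2 * (sp * p)) \<le> k * 8 * M powr (p - 1) * (1 / d) powr (?N + 4)"
        using A by (simp add: mult_ac)
    qed
    finally show ?thesis .
  qed
  let ?T = "M powr (p - 1) * (1 / d) powr (?N + 4)"
  have I: "(\<integral>\<^sup>+ x. ennreal (g x) \<partial>lborel) = ?I" by (simp add: g_def t_def)
  have I2: "(\<integral>\<^sup>+ x. ennreal (g2 x) \<partial>lborel) \<le> ?I" unfolding I[symmetric]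
    using d0 by (intro nn_integral_mono ennreal_leI) (auto simp: g_def g2_def indicator_def)
  have dE: "dint E \<le> ennreal (k * (c1 + 4 * 2 powr m + 8) * ?T) * ?I"
  proof -
    have "dint E = dint (\<lambda>x y. g x * W1 x y) + dint (\<lambda>x y. g2 x * W2 x y)"
      unfolding E_def using nnW by (intro dint_add_le mE) auto
    also have "\<dots> \<le> ennreal (k * (c1 + 4 * 2 powr m) * M powr (p - 1) * (1 / d) powr (?N + 4)) * (\<integral>\<^sup>+ x. ennreal (g x) \<partial>lborel)
       + ennreal (k * 8 * M powr (p - 1) * (1 / d) powr (?N + 4)) * (\<integral>\<^sup>+ x. ennreal (g2 x) \<partial>lborel)"
    proof (intro add_mono dint_weight_le nnW W1_int)
      fix x assume "g2 x \<noteq> 0"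
      then have "x \<in> ball x0 (r + 2 * d)" by (auto simp: g2_def indicator_def split: if_splits)
      then show "(\<integral>\<^sup>+ y. ennreal (W2 x y) \<partial>lborel) \<le> ennreal (k * 8 * M powr (p - 1) * (1 / d) powr (?N + 4))" by (rule W2_int)
    qed measurable
    also have "\<dots> \<le> ennreal (k * (c1 + 4 * 2 powr m) * M powr (p - 1) * (1 / d) powr (?N + 4)) * ?I
       + ennreal (k * 8 * M powr (p - 1) * (1 / d) powr (?N + 4)) * ?I"
      unfolding I by (intro add_mono mult_left_mono I2) auto
    also have "\<dots> = ennreal (k * (c1 + 4 * 2 powr m + 8) * ?T) * ?I"
      by (subst ennreal_distrib_right) (use k c1 in \<open>auto simp: algebra_simps\<close>)
    finally show ?thesis .
  qed
  have "dint (\<lambda>x y. 4 * c * (p - 1) * ?X x y) \<le> dint (\<lambda>x y. E x y + E y x)"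
    unfolding dint_def
  proof (rule nn_integral_le_of_integral_eq_0[OF \<Phi>])
    fix z
    have "0 \<le> 4 * c * (p - 1)" using c p by simp
    then show "ennreal (4 * c * (p - 1) * ?X (fst z) (snd z)) + ennreal (- \<Phi> z) \<le> ennreal (E (fst z) (snd z) + E (snd z) (fst z)) + ennreal (\<Phi> z)"
      using pw[of "fst z" "snd z"] nn[of "fst z" "snd z"] nn[of "snd z" "fst z"] nnX
      by (intro ennreal_add_le_of_real_le) (simp_all only: prod.collapse mult_nonneg_nonneg add_nonneg_nonneg)
  qed (use mX mE mE' in \<open>auto intro!: borel_measurable_lebesgue2\<close>)
  also have "\<dots> = dint E + dint E"
    using dint_swap[OF mE(1)] nn by (subst dint_add_le) auto
  also have "\<dots> \<le> ennreal (k * (c1 + 4 * 2 powr m + 8) * ?T) * ?I + ennreal (k * (c1 + 4 * 2 powr m + 8) * ?T) * ?I"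
    by (intro add_mono dE)
  also have "\<dots> = ennreal (2 * (k * (c1 + 4 * 2 powr m + 8) * ?T)) * ?I"
    using ennreal_distrib_right[of "k * (c1 + 4 * 2 powr m + 8) * ?T" "k * (c1 + 4 * 2 powr m + 8) * ?T" ?I] k c1
    unfolding mult_2 by simp
  finally have *: "ennreal (4 * c * (p - 1)) * dint ?X \<le> ennreal (2 * (k * (c1 + 4 * 2 powr m + 8) * ?T)) * ?I"
    using dint_cmult[OF mX, of "4 * c * (p - 1)"] c p by simp
  have "dint ?X = ennreal (1 / (4 * c * (p - 1))) * (ennreal (4 * c * (p - 1)) * dint ?X)"
    using c p by (simp add: mult.assoc[symmetric] ennreal_mult'[symmetric])
  also have "\<dots> \<le> ennreal (1 / (4 * c * (p - 1))) * (ennreal (2 * (k * (c1 + 4 * 2 powr m + 8) * ?T)) * ?I)"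
    by (intro mult_left_mono *) auto
  also have "\<dots> = ennreal (1 / (4 * c * (p - 1)) * (2 * (k * (c1 + 4 * 2 powr m + 8) * ?T))) * ?I"
    using c p by (simp add: mult.assoc[symmetric] ennreal_mult'[symmetric])
  also have "1 / (4 * c * (p - 1)) * (2 * (k * (c1 + 4 * 2 powr m + 8) * ?T)) = energy_const p m k * M powr (p - 1) * (1 / d) powr (?N + 4)"
  proof -
    have "1 / (4 * c * (p - 1)) * 2 = (1 / c) / (2 * (p - 1))" by simp
    also have "\<dots> = 4 * 2 powr m / (p - 1)" unfolding c(2) using p by (simp add: field_simps)
    finally have "1 / (4 * c * (p - 1)) * (2 * (k * (c1 + 4 * 2 powr m + 8) * ?T)) = 4 * 2 powr m / (p - 1) * (k * (c1 + 4 * 2 powr m + 8) * ?T)"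
      by (simp only: mult.assoc[symmetric])
    also have "\<dots> = energy_const p m k * ?T"
      unfolding energy_const_def c1_def c(2) by (simp add: algebra_simps add_divide_distrib)
    finally show ?thesis by (simp only: mult.assoc)
  qed
  finally show ?thesis .
qed

end

section \<open>Differences of second order\<close>

lemma nn_integral_ball_const:
  assumes "0 \<le> c" "0 \<le> \<rho>"
  shows "(\<integral>\<^sup>+ x. ennreal (c * indicator (ball (x0 :: 'a::euclidean_space) \<rho>) x) \<partial>lborel)
    = ennreal (c * (unit_ball_vol DIM('a) * \<rho> ^ DIM('a)))"
proof -
  have "(\<integral>\<^sup>+ x. ennreal (c * indicator (ball x0 \<rho>) x) \<partial>lborel) = (\<integral>\<^sup>+ x. ennreal c * indicator (ball x0 \<rho>) x \<partial>lborel)"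
    by (intro nn_integral_cong) (auto simp: indicator_def)
  also have "\<dots> = ennreal c * emeasure lborel (ball x0 \<rho>)" by (rule nn_integral_cmult_indicator) auto
  finally show ?thesis using assms by (simp add: emeasure_ball ennreal_mult')
qed

lemma unit_ball_vol_gt_0: "0 < unit_ball_vol (real DIM('a::euclidean_space))"
  by simp

text \<open>Substituting y = x + k and exchanging the integrals turns the pairs with |x - y| <=
  \<tau> into an average of first differences over |k| <= \<tau>. The open ball of radius 2 \<tau>
  contains these k.\<close>

lemma dint_near_diagonal_le:
  fixes u :: "'a::euclidean_space \<Rightarrow> real"
  assumes [measurable]: "u \<in> borel_measurable borel"
    and h: "0 < \<tau>" and A: "0 \<le> A" "0 \<le> g" and q: "0 \<le> q"
    and bd: "\<And>k. norm k \<le> \<tau> \<Longrightarrow> (\<integral>\<^sup>+ x. ennreal (\<bar>u (x + k) - u x\<bar> powr q * indicator (ball x0 \<rho>) x) \<partial>lborel) \<le> ennreal ((A * norm k powr g) powr q)"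
  shows "dint (\<lambda>x y. \<bar>u x - u y\<bar> powr q * (indicator (ball x0 \<rho>) x * of_bool (norm (x - y) \<le> \<tau>)))
    \<le> ennreal ((A * \<tau> powr g) powr q * (unit_ball_vol DIM('a) * (2 * \<tau>) ^ DIM('a)))" (is "dint ?T \<le> _")
proof -
  have [measurable]: "borel2 ?T" by measurable
  have m2: "case_prod (\<lambda>x k. ennreal (?T x (k + x))) \<in> borel_measurable borel"
    unfolding case_prod_beta' by measurable
  have "dint ?T = (\<integral>\<^sup>+ x. \<integral>\<^sup>+ y. ennreal (?T x y) \<partial>lborel \<partial>lborel)" by (rule dint_iterated) measurable
  also have "\<dots> = (\<integral>\<^sup>+ x. \<integral>\<^sup>+ k. ennreal (?T x (k + x)) \<partial>lborel \<partial>lborel)"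
  proof (rule nn_integral_cong)
    fix x
    have "(\<lambda>y. ennreal (?T x y)) \<in> borel_measurable borel" by measurable
    from nn_integral_lborel_shift[OF this, of x]
    show "(\<integral>\<^sup>+ y. ennreal (?T x y) \<partial>lborel) = (\<integral>\<^sup>+ k. ennreal (?T x (k + x)) \<partial>lborel)" by simp
  qed
  also have "\<dots> = (\<integral>\<^sup>+ k. \<integral>\<^sup>+ x. ennreal (?T x (k + x)) \<partial>lborel \<partial>lborel)"
    by (rule nn_integral_lborel_swap[OF m2])
  also have "\<dots> \<le> (\<integral>\<^sup>+ k. ennreal ((A * \<tau> powr g) powr q * indicator (ball 0 (2 * \<tau>)) (k :: 'a)) \<partial>lborel)"
  proof (intro nn_integral_mono)
    fix k :: 'a
    show "(\<integral>\<^sup>+ x. ennreal (?T x (k + x)) \<partial>lborel) \<le> ennreal ((A * \<tau> powr g) powr q * indicator (ball 0 (2 * \<tau>)) k)"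
    proof (cases "norm k \<le> \<tau>")
      case True
      have "(\<integral>\<^sup>+ x. ennreal (?T x (k + x)) \<partial>lborel) = (\<integral>\<^sup>+ x. ennreal (\<bar>u (x + k) - u x\<bar> powr q * indicator (ball x0 \<rho>) x) \<partial>lborel)"
        using True by (intro nn_integral_cong) (simp add: add.commute[of k] abs_minus_commute)
      also have "\<dots> \<le> ennreal ((A * norm k powr g) powr q)" by (rule bd[OF True])
      also have "\<dots> \<le> ennreal ((A * \<tau> powr g) powr q)"
      proof (rule ennreal_leI)
        have "norm k powr g \<le> \<tau> powr g" using True A by (intro powr_mono2) auto
        then show "(A * norm k powr g) powr q \<le> (A * \<tau> powr g) powr q"
          using A by (intro powr_mono2[OF q] mult_left_mono) auto
      qed
      finally show ?thesis using True h by simp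
    next
      case False
      then have "(\<integral>\<^sup>+ x. ennreal (?T x (k + x)) \<partial>lborel) = (\<integral>\<^sup>+ x. 0 \<partial>(lborel :: 'a measure))"
        by (intro nn_integral_cong) simp
      then show ?thesis by simp
    qed
  qed
  also have "\<dots> = ennreal ((A * \<tau> powr g) powr q * (unit_ball_vol DIM('a) * (2 * \<tau>) ^ DIM('a)))"
    using h by (intro nn_integral_ball_const) auto
  finally show ?thesis .
qed

lemma nn_integral_shift_fst_add:
  fixes Q :: "'a::euclidean_space \<Rightarrow> 'a \<Rightarrow> real"
  assumes Q: "borel2 Q" and c: "0 \<le> c"
  shows "(\<integral>\<^sup>+ x. \<integral>\<^sup>+ y. ennreal (c * Q (x + h) y) + ennreal (c * Q x y) \<partial>lborel \<partial>lborel) = ennreal (2 * c) * dint Q"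
proof -
  define I where "I x = (\<integral>\<^sup>+ y. ennreal (Q x y) \<partial>lborel)" for x
  have m: "(\<lambda>y. ennreal (Q x y)) \<in> borel_measurable borel" for x
    using borel2_sections[OF Q, of x] by simp
  have [measurable]: "I \<in> borel_measurable borel"
  proof -
    have "(\<lambda>x. \<integral>\<^sup>+ y. ennreal (Q x y) \<partial>lborel) \<in> borel_measurable lborel"
      using Q by (intro lborel.borel_measurable_nn_integral) (simp add: case_prod_unfold lborel_prod)
    then show ?thesis unfolding I_def[abs_def] by simp
  qed
  have "(\<integral>\<^sup>+ y. ennreal (c * Q (x + h) y) + ennreal (c * Q x y) \<partial>lborel) = ennreal c * I (x + h) + ennreal c * I x" for x
    unfolding I_def ennreal_mult'[OF c] using m by (subst nn_integral_add) (auto simp: nn_integral_cmult)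
  then have "(\<integral>\<^sup>+ x. \<integral>\<^sup>+ y. ennreal (c * Q (x + h) y) + ennreal (c * Q x y) \<partial>lborel \<partial>lborel)
      = (\<integral>\<^sup>+ x. ennreal c * I (x + h) + ennreal c * I x \<partial>lborel)" by simp
  also have "\<dots> = ennreal c * (\<integral>\<^sup>+ x. I (x + h) \<partial>lborel) + ennreal c * (\<integral>\<^sup>+ x. I x \<partial>lborel)"
    by (simp add: nn_integral_add nn_integral_cmult)
  also have "(\<integral>\<^sup>+ x. I (x + h) \<partial>lborel) = (\<integral>\<^sup>+ x. I x \<partial>lborel)" by (rule nn_integral_lborel_shift) measurable
  also have "(\<integral>\<^sup>+ x. I x \<partial>lborel) = dint Q" unfolding I_def by (rule dint_iterated[OF Q, symmetric])
  also have "ennreal c * dint Q + ennreal c * dint Q = ennreal (2 * c) * dint Q"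
    unfolding ennreal_distrib_right[OF c c] mult_2 ..
  finally show ?thesis .
qed

text \<open>Averaging \<open>|v x - v (x + h)| \<le> |v x - v y| + |v (x + h) - v y|\<close> over the ball with diameter
  \<open>[x, x + h]\<close>.\<close>
lemma nn_integral_diff_le_dint:
  fixes v :: "'a::euclidean_space \<Rightarrow> real"
  assumes [measurable]: "v \<in> borel_measurable borel" and q: "0 \<le> q" and h: "h \<noteq> 0" "norm h \<le> \<delta>"
  shows "ennreal (unit_ball_vol DIM('a) * (norm h / 2) ^ DIM('a)) * (\<integral>\<^sup>+ x. ennreal (\<bar>v (x + h) - v x\<bar> powr q * indicator (ball x0 \<rho>) x) \<partial>lborel)
    \<le> ennreal (2 * 2 powr q) * dint (\<lambda>x y. \<bar>v x - v y\<bar> powr q * (indicator (ball x0 (\<rho> + \<delta>)) x * indicator (ball x0 (\<rho> + \<delta>)) y * of_bool (norm (x - y) \<le> norm h)))"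
    (is "ennreal ?c * ?I \<le> _ * dint ?Q")
proof -
  have [measurable]: "borel2 ?Q" by measurable
  have c0: "0 \<le> ?c" by simp
  have "ennreal ?c * ?I = (\<integral>\<^sup>+ x. ennreal (\<bar>v (x + h) - v x\<bar> powr q * indicator (ball x0 \<rho>) x * ?c) \<partial>lborel)"
    by (subst nn_integral_cmult[symmetric]) (auto simp: ennreal_mult'[symmetric] mult_ac)
  also have "\<dots> \<le> (\<integral>\<^sup>+ x. \<integral>\<^sup>+ y. ennreal (2 powr q * ?Q (x + h) y) + ennreal (2 powr q * ?Q x y) \<partial>lborel \<partial>lborel)"
  proof (intro nn_integral_mono)
    fix x
    show "ennreal (\<bar>v (x + h) - v x\<bar> powr q * indicator (ball x0 \<rho>) x * ?c) \<le> (\<integral>\<^sup>+ y. ennreal (2 powr q * ?Q (x + h) y) + ennreal (2 powr q * ?Q x y) \<partial>lborel)"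
    proof (cases "x \<in> ball x0 \<rho>")
      case True
      let ?m = "x + h /\<^sub>R 2"
      have "ennreal (\<bar>v (x + h) - v x\<bar> powr q * indicator (ball x0 \<rho>) x * ?c) = ennreal (\<bar>v (x + h) - v x\<bar> powr q * ?c)" using True by simp
      also have "\<dots> = (\<integral>\<^sup>+ y. ennreal (\<bar>v (x + h) - v x\<bar> powr q * indicator (ball ?m (norm h / 2)) y) \<partial>lborel)"
        by (rule nn_integral_ball_const[symmetric]) auto
      also have "\<dots> \<le> (\<integral>\<^sup>+ y. ennreal (2 powr q * ?Q (x + h) y) + ennreal (2 powr q * ?Q x y) \<partial>lborel)"
      proof (intro nn_integral_mono)
        fix y
        have "\<bar>v (x + h) - v x\<bar> powr q * indicator (ball ?m (norm h / 2)) y \<le> 2 powr q * ?Q (x + h) y + 2 powr q * ?Q x y"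
        proof (cases "y \<in> ball ?m (norm h / 2)")
          case yb: True
          have n1: "norm (x - y) \<le> norm h"
          proof -
            have "norm (x - y) \<le> norm (x - ?m) + norm (?m - y)" using dist_triangle[of x y ?m] unfolding dist_norm .
            also have "\<dots> \<le> norm h / 2 + norm h / 2" using yb by (intro add_mono) (auto simp: dist_norm)
            finally show ?thesis by simp
          qed
          have n2: "norm (x + h - y) \<le> norm h"
          proof -
            have "norm (x + h - y) \<le> norm (x + h - ?m) + norm (?m - y)" using dist_triangle[of "x + h" y ?m] unfolding dist_norm .
            also have "x + h - ?m = h /\<^sub>R 2" by (simp add: scaleR_half_double[symmetric] algebra_simps scaleR_add_left[symmetric] del: scaleR_half_double)
            also have "norm (h /\<^sub>R 2) + norm (?m - y) \<le> norm h / 2 + norm h / 2" using yb by (intro add_mono) (auto simp: dist_norm)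
            finally show ?thesis by simp
          qed
          have b: "x \<in> ball x0 (\<rho> + \<delta>)" "y \<in> ball x0 (\<rho> + \<delta>)" "x + h \<in> ball x0 (\<rho> + \<delta>)"
          proof -
            have d: "dist x0 x < \<rho>" using True by simp
            show "x \<in> ball x0 (\<rho> + \<delta>)" using d h norm_ge_zero[of h] unfolding mem_ball by linarith
            show "y \<in> ball x0 (\<rho> + \<delta>)" using d n1 h dist_triangle[of x0 y x] unfolding mem_ball dist_norm by linarith
            show "x + h \<in> ball x0 (\<rho> + \<delta>)" using d h dist_triangle[of x0 "x + h" x] unfolding mem_ball dist_norm by simp
          qed
          have "\<bar>v (x + h) - v x\<bar> = \<bar>(v (x + h) - v y) - (v x - v y)\<bar>" by simp
          also have "\<dots> powr q \<le> 2 powr q * (\<bar>v (x + h) - v y\<bar> powr q + \<bar>v x - v y\<bar> powr q)"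
            by (rule abs_diff_powr_le[OF q])
          finally show ?thesis using b n1 n2 yb by (simp add: distrib_left)
        qed simp
        then have "ennreal (\<bar>v (x + h) - v x\<bar> powr q * indicator (ball ?m (norm h / 2)) y) \<le> ennreal (2 powr q * ?Q (x + h) y + 2 powr q * ?Q x y)"
          by (rule ennreal_leI)
        also have "\<dots> = ennreal (2 powr q * ?Q (x + h) y) + ennreal (2 powr q * ?Q x y)" by (rule ennreal_plus) auto
        finally show "ennreal (\<bar>v (x + h) - v x\<bar> powr q * indicator (ball ?m (norm h / 2)) y) \<le> ennreal (2 powr q * ?Q (x + h) y) + ennreal (2 powr q * ?Q x y)" .
      qed
      finally show ?thesis .
    qed simp
  qed
  also have "\<dots> = ennreal (2 * 2 powr q) * dint ?Q"
    using nn_integral_shift_fst_add[where Q = ?Q and h = h and c = "2 powr q"] \<open>borel2 ?Q\<close> powr_ge_zero by blast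
  finally show ?thesis .
qed

text \<open>The factor 2^n / \<omega> divides by the volume of the averaging ball of radius |h| / 2,
  and 2 * 2^q comes from the averaging itself. In the bracket, the first term is the energy and the
  second the pairs near the diagonal. The added 1 makes the constant at least 1, so that it may be
  raised to the power q.\<close>

definition diff_const :: "real \<Rightarrow> nat \<Rightarrow> real \<Rightarrow> real \<Rightarrow> real \<Rightarrow> real \<Rightarrow> real" where
  "diff_const \<omega> n p m q k = 1 + 2 ^ n / \<omega> * (2 * 2 powr q) * (energy_const p m k * (\<omega> + 1) + 2 powr q * 2 * \<omega> * 2 ^ n)"

lemma energy_const_nonneg: "1 < p \<Longrightarrow> 0 \<le> k \<Longrightarrow> 0 \<le> energy_const p m k"
  unfolding energy_const_def by (intro divide_nonneg_nonneg mult_nonneg_nonneg add_nonneg_nonneg) auto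

lemma diff_const_ge_1: "0 < \<omega> \<Longrightarrow> 1 < p \<Longrightarrow> 0 \<le> k \<Longrightarrow> 1 \<le> diff_const \<omega> n p m q k"
  unfolding diff_const_def using energy_const_nonneg[of p k m] by simp

context local_solution
begin

lemma ball_volume_le:
  assumes "0 \<le> \<rho>" "\<rho> \<le> 1"
  shows "unit_ball_vol DIM('a) * \<rho> ^ DIM('a) \<le> unit_ball_vol DIM('a)"
  using assms by (simp add: power_le_one mult_left_le)

text \<open>The case w <= l e of \<open>powr_diff_split\<close> yields |h| to the power N + s p -
  \<beta> (2 - p) + g m, where N is compensated by averaging over a ball of radius |h| / 2. This
  should be at least N + q (g + \<beta>). As q - m = p - 1 and g <= 1, the hypothesis on
  \<open>\<beta>\<close> guarantees it. In the other case l^(-q) is exactly the gain |h|^(\<beta>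
  q).\<close>

lemma second_difference:
  fixes h :: 'a and m q r d A g \<beta> :: real
  assumes r: "0 < r" "r < R" and d: "d = (R - r) / 8" and h: "h \<noteq> 0" "norm h \<le> d / 2" and m: "1 \<le> m" "q = m + p - 1"
    and A: "M \<le> A" and g: "0 \<le> g" "g \<le> 1" and \<beta>: "0 \<le> \<beta>" "\<beta> * (q + 2 - p) \<le> sp * p - (p - 1)"
    and bd: "\<And>k. norm k \<le> norm h \<Longrightarrow> (\<integral>\<^sup>+ x. ennreal (\<bar>u (x + k) - u x\<bar> powr q * indicator (ball x0 (r + 4 * d)) x) \<partial>lborel) \<le> ennreal ((A * norm k powr g) powr q)"
  shows "(\<integral>\<^sup>+ x. ennreal (\<bar>(u (x + h + h) - u (x + h)) - (u (x + h) - u x)\<bar> powr q * indicator (ball x0 r) x) \<partial>lborel)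
    \<le> ennreal ((diff_const (unit_ball_vol DIM('a)) DIM('a) p m q k * (1 / d) powr (real DIM('a) + 4) * A * norm h powr (g + \<beta>)) powr q)"
    (is "?I \<le> _")
proof -
  define N where "N = DIM('a)"
  define \<omega> where "\<omega> = unit_ball_vol (real N)"
  define a where "a = norm h"
  define l where "l = a powr (- \<beta>)"
  define P where "P = (1 / d) powr (real N + 4)"
  define Y where "Y = (A * a powr (g + \<beta>)) powr q"
  define Ce where "Ce = energy_const p m k"
  define t where "t x = u (x + h) - u x" for x
  have d0: "0 < d" "8 * d = R - r" "d < 1" using r R d by auto
  have a: "0 < a" "a \<le> 1" using h d0 by (auto simp: a_def)
  have \<omega>: "0 < \<omega>" by (simp add: \<omega>_def)
  have l: "0 < l" using a by (simp add: l_def)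
  have Ce: "0 \<le> Ce" using p k by (simp add: Ce_def energy_const_nonneg)
  have P: "1 \<le> P" unfolding P_def using d0 by (intro ge_one_powr_ge_zero) auto
  have A0: "0 < A" "1 \<le> A" using A M by auto
  have q: "p \<le> q" "1 \<le> q" "0 \<le> q" using m p by auto
  have [measurable]: "t \<in> borel_measurable borel" unfolding t_def[abs_def] by measurable
  define X where "X x y = (\<bar>u (x + h) - u (y + h)\<bar> + \<bar>u x - u y\<bar>) powr (p - 2)
        * \<bar>(u (x + h) - u x) - (u (y + h) - u y)\<bar> powr (m + 1) * kernel (sp * p) x y
        * (indicator (ball x0 (r + d)) x * indicator (ball x0 (r + d)) y)" for x y
  define T where "T x y = \<bar>u x - u y\<bar> powr q * (indicator (ball x0 (r + 2 * d)) x * of_bool (norm (x - y) \<le> a))" for x y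
  define Q where "Q x y = \<bar>t x - t y\<bar> powr q * (indicator (ball x0 (r + d)) x * indicator (ball x0 (r + d)) y * of_bool (norm (x - y) \<le> norm h))" for x y
  have mX: "borel2 X" and mT: "borel2 T" and mTh: "borel2 (\<lambda>x y. T (x + h) (y + h))" and mTT: "borel2 (\<lambda>x y. T (x + h) (y + h) + T x y)"
    unfolding X_def T_def by measurable
  have nn: "0 \<le> X x y" "0 \<le> T x y" for x y unfolding X_def T_def by auto
  have pw: "Q x y \<le> (l powr (2 - p) * a powr (real N + sp * p)) * X x y + (l powr (- q) * 2 powr q) * (T (x + h) (y + h) + T x y)" for x y
  proof (cases "x \<in> ball x0 (r + d) \<and> y \<in> ball x0 (r + d) \<and> norm (x - y) \<le> a")
    case False
    then have "Q x y = 0" by (auto simp: Q_def a_def indicator_def)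
    also have "0 \<le> (l powr (2 - p) * a powr (real N + sp * p)) * X x y + (l powr (- q) * 2 powr q) * (T (x + h) (y + h) + T x y)"
      using nn by (intro add_nonneg_nonneg mult_nonneg_nonneg) auto
    finally show ?thesis .
  next
    case True
    let ?a = "\<bar>u (x + h) - u (y + h)\<bar>" let ?b = "\<bar>u x - u y\<bar>" let ?e = "\<bar>t x - t y\<bar>"
    have w: "?e \<le> ?a + ?b" unfolding t_def by linarith
    have xh: "x + h \<in> ball x0 (r + 2 * d)" "x \<in> ball x0 (r + 2 * d)"
      using True h d0 norm_triangle_ineq4[of "x0 - x" h] by (auto simp: dist_norm algebra_simps)
    have "Q x y = ?e powr q" using True by (simp add: Q_def a_def)
    also have "\<dots> \<le> l powr (2 - p) * ((?a + ?b) powr (p - 2) * ?e powr (m + 1)) + l powr (- q) * (?a + ?b) powr q"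
      using m p l w by (intro powr_diff_split) auto
    also have "\<dots> \<le> l powr (2 - p) * (a powr (real N + sp * p) * X x y) + l powr (- q) * (2 powr q * (T (x + h) (y + h) + T x y))"
    proof (intro add_mono mult_left_mono)
      show "(?a + ?b) powr (p - 2) * ?e powr (m + 1) \<le> a powr (real N + sp * p) * X x y"
      proof (cases "x = y")
        case False
        then have n: "0 < norm (x - y)" by simp
        \<comment> \<open>For |x - y| <= a the kernel is at least a^(-(N + s p)); this inserts the
          kernel that the energy estimate contains.\<close>
        have "1 \<le> (a / norm (x - y)) powr (real N + sp * p)"
          using n True sp_p by (intro ge_one_powr_ge_zero) auto
        also have "\<dots> = a powr (real N + sp * p) * kernel (sp * p) x y"
          using a n by (simp add: kernel_def powr_divide N_def)
        finally have "(?a + ?b) powr (p - 2) * ?e powr (m + 1) * 1 \<le> (?a + ?b) powr (p - 2) * ?e powr (m + 1) * (a powr (real N + sp * p) * kernel (sp * p) x y)"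
          by (intro mult_left_mono) auto
        then show ?thesis using True by (simp add: X_def t_def mult_ac)
      qed (simp add: X_def)
      have "(?a + ?b) powr q \<le> 2 powr q * (?a powr q + ?b powr q)" using q by (intro powr_add_le_2powr) auto
      also have "?a powr q + ?b powr q = T (x + h) (y + h) + T x y" using xh True by (simp add: T_def)
      finally show "(?a + ?b) powr q \<le> 2 powr q * (T (x + h) (y + h) + T x y)" .
    qed auto
    finally show ?thesis by (simp add: mult.assoc)
  qed
  have bd2: "(\<integral>\<^sup>+ x. ennreal (\<bar>u (x + k) - u x\<bar> powr q * indicator (ball x0 (r + 2 * d)) x) \<partial>lborel) \<le> ennreal ((A * norm k powr g) powr q)"
    if "norm k \<le> a" for k
  proof -
    have "(\<integral>\<^sup>+ x. ennreal (\<bar>u (x + k) - u x\<bar> powr q * indicator (ball x0 (r + 2 * d)) x) \<partial>lborel)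
      \<le> (\<integral>\<^sup>+ x. ennreal (\<bar>u (x + k) - u x\<bar> powr q * indicator (ball x0 (r + 4 * d)) x) \<partial>lborel)"
      using d0 by (intro nn_integral_mono ennreal_leI) (auto simp: indicator_def)
    also have "\<dots> \<le> ennreal ((A * norm k powr g) powr q)" by (rule bd) (use that in \<open>simp add: a_def\<close>)
    finally show ?thesis .
  qed
  define B where "B = A * a powr g"
  have B: "0 < B" using A0 a by (simp add: B_def)
  have dT: "dint T \<le> ennreal (B powr q * (\<omega> * (2 * a) ^ N))"
    unfolding T_def B_def \<omega>_def N_def using a A0 g q by (intro dint_near_diagonal_le u_borel bd2) auto
  have dTT: "dint (\<lambda>x y. T (x + h) (y + h) + T x y) \<le> ennreal (2 * (B powr q * (\<omega> * (2 * a) ^ N)))"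
  proof -
    have "dint (\<lambda>x y. T (x + h) (y + h) + T x y) = dint T + dint T"
      using nn by (subst dint_add_le[OF mTh mT]) (auto simp: dint_shift[OF mT])
    also have "\<dots> \<le> ennreal (B powr q * (\<omega> * (2 * a) ^ N)) + ennreal (B powr q * (\<omega> * (2 * a) ^ N))" by (intro add_mono dT)
    also have "\<dots> = ennreal (2 * (B powr q * (\<omega> * (2 * a) ^ N)))" unfolding mult_2 using \<omega> a by (intro ennreal_plus[symmetric]) auto
    finally show ?thesis .
  qed
  \<comment> \<open>The energy estimate needs m-th powers while \<open>bd\<close> gives q-th powers.
    With the threshold \<open>B\<close>, which is the assumed size of the L^q norm, both parts are
    multiples of B^m; hence \<omega> + 1.\<close>
  have Im: "(\<integral>\<^sup>+ x. ennreal (\<bar>t x\<bar> powr m * indicator (ball x0 (r + 4 * d)) x) \<partial>lborel) \<le> ennreal (B powr m * (\<omega> + 1))"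
  proof -
    have "(\<integral>\<^sup>+ x. ennreal (\<bar>t x\<bar> powr m * indicator (ball x0 (r + 4 * d)) x) \<partial>lborel)
      \<le> (\<integral>\<^sup>+ x. ennreal (B powr m * indicator (ball x0 (r + 4 * d)) x) + ennreal (B powr (m - q)) * ennreal (\<bar>u (x + h) - u x\<bar> powr q * indicator (ball x0 (r + 4 * d)) x) \<partial>lborel)"
    proof (intro nn_integral_mono)
      fix x
      have "\<bar>t x\<bar> powr m * indicator (ball x0 (r + 4 * d)) x \<le> B powr m * indicator (ball x0 (r + 4 * d)) x + B powr (m - q) * (\<bar>t x\<bar> powr q * indicator (ball x0 (r + 4 * d)) x)"
        using powr_le_sum_powr[of "\<bar>t x\<bar>" B m q] B m p by (auto simp: indicator_def)
      then have "ennreal (\<bar>t x\<bar> powr m * indicator (ball x0 (r + 4 * d)) x) \<le> ennreal (B powr m * indicator (ball x0 (r + 4 * d)) x + B powr (m - q) * (\<bar>t x\<bar> powr q * indicator (ball x0 (r + 4 * d)) x))"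
        by (rule ennreal_leI)
      also have "\<dots> = ennreal (B powr m * indicator (ball x0 (r + 4 * d)) x) + ennreal (B powr (m - q)) * ennreal (\<bar>t x\<bar> powr q * indicator (ball x0 (r + 4 * d)) x)"
        by (simp add: ennreal_mult')
      finally show "ennreal (\<bar>t x\<bar> powr m * indicator (ball x0 (r + 4 * d)) x) \<le> ennreal (B powr m * indicator (ball x0 (r + 4 * d)) x) + ennreal (B powr (m - q)) * ennreal (\<bar>u (x + h) - u x\<bar> powr q * indicator (ball x0 (r + 4 * d)) x)"
        unfolding t_def .
    qed
    also have "\<dots> = (\<integral>\<^sup>+ x. ennreal (B powr m * indicator (ball x0 (r + 4 * d)) x) \<partial>lborel)
        + ennreal (B powr (m - q)) * (\<integral>\<^sup>+ x. ennreal (\<bar>u (x + h) - u x\<bar> powr q * indicator (ball x0 (r + 4 * d)) x) \<partial>lborel)"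
      by (subst nn_integral_add, measurable, subst nn_integral_cmult, measurable)
    also have "\<dots> \<le> ennreal (B powr m * \<omega>) + ennreal (B powr (m - q)) * ennreal (B powr q)"
    proof (intro add_mono mult_left_mono)
      have "(\<integral>\<^sup>+ x. ennreal (B powr m * indicator (ball x0 (r + 4 * d)) x) \<partial>lborel) = ennreal (B powr m * (unit_ball_vol DIM('a) * (r + 4 * d) ^ DIM('a)))"
        using r d0 by (intro nn_integral_ball_const) auto
      also have "\<dots> \<le> ennreal (B powr m * \<omega>)" unfolding \<omega>_def N_def
        using r d0 R by (intro ennreal_leI mult_left_mono ball_volume_le) auto
      finally show "(\<integral>\<^sup>+ x. ennreal (B powr m * indicator (ball x0 (r + 4 * d)) x) \<partial>lborel) \<le> ennreal (B powr m * \<omega>)" .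
      show "(\<integral>\<^sup>+ x. ennreal (\<bar>u (x + h) - u x\<bar> powr q * indicator (ball x0 (r + 4 * d)) x) \<partial>lborel) \<le> ennreal (B powr q)"
        unfolding B_def a_def by (rule bd) simp
    qed auto
    also have "\<dots> = ennreal (B powr m * (\<omega> + 1))"
      using \<omega> by (simp add: ennreal_mult'[symmetric] ennreal_plus[symmetric] powr_add[symmetric] distrib_left del: ennreal_plus)
    finally show ?thesis .
  qed
  have dX: "dint X \<le> ennreal (Ce * M powr (p - 1) * P * (B powr m * (\<omega> + 1)))"
  proof -
    have "dint X \<le> ennreal (Ce * M powr (p - 1) * P) * (\<integral>\<^sup>+ x. ennreal (\<bar>t x\<bar> powr m * indicator (ball x0 (r + 4 * d)) x) \<partial>lborel)"
      unfolding X_def Ce_def P_def t_def N_def by (rule energy[OF r d h(2) m])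
    also have "\<dots> \<le> ennreal (Ce * M powr (p - 1) * P) * ennreal (B powr m * (\<omega> + 1))" by (intro mult_left_mono Im) auto
    also have "\<dots> = ennreal (Ce * M powr (p - 1) * P * (B powr m * (\<omega> + 1)))" using Ce P by (intro ennreal_mult'[symmetric]) auto
    finally show ?thesis .
  qed
  have e1: "l powr (2 - p) * a powr (real N + sp * p) * (Ce * M powr (p - 1) * P * (B powr m * (\<omega> + 1))) \<le> a ^ N * (P * (Ce * (\<omega> + 1)) * Y)"
  proof -
    \<comment> \<open>The comparison of exponents announced by the hypothesis on
      \<open>\<beta>\<close>. Since a <= 1, the larger exponent gives the smaller power.\<close>
    have "q * (g + \<beta>) \<le> - \<beta> * (2 - p) + sp * p + g * m"
    proof -
      have "g * (p - 1) \<le> 1 * (p - 1)" using g p by (intro mult_right_mono) auto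
      then show ?thesis using \<beta>(2) unfolding m(2) by (simp add: algebra_simps)
    qed
    then have ex: "a powr (- \<beta> * (2 - p) + sp * p + g * m) \<le> a powr (q * (g + \<beta>))" using a by (intro powr_mono') auto
    have MA: "M powr (p - 1) * A powr m \<le> A powr q"
    proof -
      have "M powr (p - 1) * A powr m \<le> A powr (p - 1) * A powr m" using A M p by (intro mult_right_mono powr_mono2) auto
      also have "\<dots> = A powr ((p - 1) + m)" by (simp only: powr_add)
      also have "(p - 1) + m = q" using m by simp
      finally show ?thesis .
    qed
    have "l powr (2 - p) * a powr (real N + sp * p) * (Ce * M powr (p - 1) * P * (B powr m * (\<omega> + 1)))
      = (P * (Ce * (\<omega> + 1))) * (a powr real N * ((M powr (p - 1) * A powr m) * (a powr (- \<beta> * (2 - p)) * a powr (sp * p) * a powr (g * m))))"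
      using A0 a by (simp add: B_def l_def powr_mult powr_powr powr_add mult_ac)
    also have "a powr (- \<beta> * (2 - p)) * a powr (sp * p) * a powr (g * m) = a powr (- \<beta> * (2 - p) + sp * p + g * m)" by (simp only: powr_add)
    also have "(P * (Ce * (\<omega> + 1))) * (a powr real N * ((M powr (p - 1) * A powr m) * a powr (- \<beta> * (2 - p) + sp * p + g * m)))
      \<le> (P * (Ce * (\<omega> + 1))) * (a powr real N * (A powr q * a powr (q * (g + \<beta>))))"
      using P Ce \<omega> by (intro mult_left_mono mult_mono MA ex) auto
    also have "A powr q * a powr (q * (g + \<beta>)) = Y" unfolding Y_def using A0 a by (simp add: powr_mult powr_powr mult.commute)
    also have "a powr real N = a ^ N" using a by (simp add: powr_realpow)
    finally show ?thesis by (simp only: mult_ac)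
  qed
  have e2: "l powr (- q) * 2 powr q * (2 * (B powr q * (\<omega> * (2 * a) ^ N))) = a ^ N * (2 powr q * 2 * \<omega> * 2 ^ N * Y)"
  proof -
    have "l powr (- q) * B powr q = Y" unfolding l_def B_def Y_def using A0 a by (simp add: powr_mult powr_powr powr_add[symmetric] distrib_left distrib_right mult_ac add_ac)
    then show ?thesis by (simp add: power_mult_distrib mult_ac)
  qed
  have Y0: "0 \<le> Y" by (simp add: Y_def)
  define S where "S = Ce * (\<omega> + 1) + 2 powr q * 2 * \<omega> * 2 ^ N"
  have S: "0 \<le> S" using Ce \<omega> by (simp add: S_def)
  have dQ: "dint Q \<le> ennreal (a ^ N * (P * S * Y))"
  proof -
    let ?c1 = "l powr (2 - p) * a powr (real N + sp * p)" and ?c2 = "l powr (- q) * 2 powr q"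
    have "dint Q \<le> dint (\<lambda>x y. ?c1 * X x y + ?c2 * (T (x + h) (y + h) + T x y))" using pw by (rule dint_mono)
    also have "\<dots> = ennreal ?c1 * dint X + ennreal ?c2 * dint (\<lambda>x y. T (x + h) (y + h) + T x y)"
      using nn mX mTT by (subst dint_add_le) (auto simp: dint_cmult)
    also have "\<dots> \<le> ennreal ?c1 * ennreal (Ce * M powr (p - 1) * P * (B powr m * (\<omega> + 1))) + ennreal ?c2 * ennreal (2 * (B powr q * (\<omega> * (2 * a) ^ N)))"
      by (intro add_mono mult_left_mono dX dTT) auto
    also have "\<dots> = ennreal (?c1 * (Ce * M powr (p - 1) * P * (B powr m * (\<omega> + 1))) + ?c2 * (2 * (B powr q * (\<omega> * (2 * a) ^ N))))"
      using Ce P \<omega> a by (intro ennreal_add_mult[symmetric]) auto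
    also have "\<dots> \<le> ennreal (a ^ N * (P * S * Y))"
    proof (rule ennreal_leI)
      have "1 * (2 powr q * 2 * \<omega> * 2 ^ N * Y) \<le> P * (2 powr q * 2 * \<omega> * 2 ^ N * Y)" using P Y0 \<omega> by (intro mult_right_mono) auto
      then have "a ^ N * (2 powr q * 2 * \<omega> * 2 ^ N * Y) \<le> a ^ N * (P * (2 powr q * 2 * \<omega> * 2 ^ N * Y))" using a by (intro mult_left_mono) auto
      moreover have "a ^ N * (P * S * Y) = a ^ N * (P * (Ce * (\<omega> + 1)) * Y) + a ^ N * (P * (2 powr q * 2 * \<omega> * 2 ^ N * Y))"
        by (simp add: S_def algebra_simps)
      ultimately show "?c1 * (Ce * M powr (p - 1) * P * (B powr m * (\<omega> + 1))) + ?c2 * (2 * (B powr q * (\<omega> * (2 * a) ^ N))) \<le> a ^ N * (P * S * Y)"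
        using e1 unfolding e2 by linarith
    qed
    finally show ?thesis .
  qed
  define c where "c = \<omega> * (a / 2) ^ N"
  have c: "0 < c" using \<omega> a by (simp add: c_def)
  have "ennreal c * ?I \<le> ennreal (2 * 2 powr q) * dint Q"
    unfolding Q_def c_def \<omega>_def a_def N_def
    using nn_integral_diff_le_dint[of t q h d x0 r] q h d0 by (simp add: t_def)
  also have "\<dots> \<le> ennreal (2 * 2 powr q) * ennreal (a ^ N * (P * S * Y))" by (intro mult_left_mono dQ) auto
  finally have *: "ennreal c * ?I \<le> ennreal (2 * 2 powr q * (a ^ N * (P * S * Y)))" by (simp add: ennreal_mult')
  have "?I = ennreal (1 / c) * (ennreal c * ?I)" using c by (simp add: mult.assoc[symmetric] ennreal_mult'[symmetric])
  also have "\<dots> \<le> ennreal (1 / c) * ennreal (2 * 2 powr q * (a ^ N * (P * S * Y)))" by (intro mult_left_mono *) auto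
  also have "\<dots> = ennreal (1 / c * (2 * 2 powr q * (a ^ N * (P * S * Y))))" using c by (intro ennreal_mult'[symmetric]) auto
  also have "\<dots> \<le> ennreal ((diff_const \<omega> N p m q k * P * A * a powr (g + \<beta>)) powr q)"
  proof (rule ennreal_leI)
    let ?C = "diff_const \<omega> N p m q k"
    have C1: "1 \<le> ?C" using \<omega> p k by (intro diff_const_ge_1) auto
    have "1 / c * (2 * 2 powr q * (a ^ N * (P * S * Y))) = (2 ^ N / \<omega> * (2 * 2 powr q) * S) * P * Y"
      using a \<omega> by (simp add: c_def power_divide field_simps)
    also have "\<dots> \<le> ?C * P * Y" using P Y0 unfolding diff_const_def S_def Ce_def by (intro mult_right_mono) auto
    also have "\<dots> \<le> (?C * P) powr q * Y"
    \<comment> \<open>The product is at least 1 and q >= 1, so it can be moved under the q-th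
      power.\<close>
    proof (intro mult_right_mono Y0)
      have "1 \<le> ?C * P" using C1 P mult_mono[of 1 ?C 1 P] by simp
      then show "?C * P \<le> (?C * P) powr q" using q powr_mono[of 1 q "?C * P"] by simp
    qed
    also have "\<dots> = (?C * P * A * a powr (g + \<beta>)) powr q"
      unfolding Y_def using C1 P A0 a by (simp add: powr_mult mult.assoc)
    finally show "1 / c * (2 * 2 powr q * (a ^ N * (P * S * Y))) \<le> (?C * P * A * a powr (g + \<beta>)) powr q" .
  qed
  finally show ?thesis unfolding \<omega>_def a_def P_def N_def .
qed

text \<open>The start of the iteration, order 0, from boundedness alone. The base 1 + \<omega>
  instead of \<omega> is at least 1, so it dominates the volume after raising to the power
  q.\<close>

lemma trivial_difference:
  assumes r: "0 < r" "norm h \<le> R - r" and q: "1 \<le> q"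
  shows "(\<integral>\<^sup>+ x. ennreal (\<bar>u (x + h) - u x\<bar> powr q * indicator (ball x0 r) x) \<partial>lborel)
    \<le> ennreal ((2 * M * (1 + unit_ball_vol DIM('a))) powr q)"
proof -
  let ?\<omega> = "unit_ball_vol DIM('a)"
  have rR: "r \<le> R" using r norm_ge_zero[of h] by linarith
  have "(\<integral>\<^sup>+ x. ennreal (\<bar>u (x + h) - u x\<bar> powr q * indicator (ball x0 r) x) \<partial>lborel)
     \<le> (\<integral>\<^sup>+ x. ennreal ((2 * M) powr q * indicator (ball x0 r) x) \<partial>lborel)"
  proof (intro nn_integral_mono ennreal_leI)
    fix x
    show "\<bar>u (x + h) - u x\<bar> powr q * indicator (ball x0 r) x \<le> (2 * M) powr q * indicator (ball x0 r) x"
    proof (cases "x \<in> ball x0 r")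
      case True
      then have "x \<in> ball x0 R" "x + h \<in> ball x0 R"
        using r rR norm_triangle_ineq4[of "x0 - x" h] by (auto simp: dist_norm algebra_simps)
      then have "\<bar>u (x + h) - u x\<bar> \<le> 2 * M" using u_bound[of x] u_bound[of "x + h"] by linarith
      then show ?thesis using True q by (auto intro!: powr_mono2)
    qed simp
  qed
  also have "\<dots> = ennreal ((2 * M) powr q * (?\<omega> * r ^ DIM('a)))" using r by (intro nn_integral_ball_const) auto
  also have "\<dots> \<le> ennreal ((2 * M) powr q * (1 + ?\<omega>) powr q)"
  proof (intro ennreal_leI mult_left_mono)
    have "?\<omega> * r ^ DIM('a) \<le> ?\<omega>" using r rR R by (intro ball_volume_le) auto
    also have "\<dots> \<le> (1 + ?\<omega>) powr 1" by simp
    also have "\<dots> \<le> (1 + ?\<omega>) powr q" using q by (intro powr_mono) auto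
    finally show "?\<omega> * r ^ DIM('a) \<le> (1 + ?\<omega>) powr q" .
  qed simp
  also have "(2 * M) powr q * (1 + ?\<omega>) powr q = (2 * M * (1 + ?\<omega>)) powr q" using M by (simp add: powr_mult)
  finally show ?thesis .
qed

end

section \<open>From second to first differences\<close>

lemma ennreal_mult_indicator: "ennreal (v * indicator S x) = ennreal v * indicator S x"
  by (auto simp: indicator_def)

text \<open>Minkowski's inequality must enter with constant 1 here: the step is repeated for every
  doubling of h, and any fixed loss would accumulate.\<close>

lemma first_from_second_step:
  fixes u :: "'a::euclidean_space \<Rightarrow> real"
  assumes [measurable]: "u \<in> borel_measurable borel" and q: "1 \<le> q" and ab: "0 < \<alpha>" "0 < \<beta>"
    and 1: "(\<integral>\<^sup>+ x. ennreal (\<bar>u (x + (h + h)) - u x\<bar> powr q * indicator (ball x0 r) x) \<partial>lborel) \<le> ennreal (\<alpha> powr q)"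
    and 2: "(\<integral>\<^sup>+ x. ennreal (\<bar>(u (x + h + h) - u (x + h)) - (u (x + h) - u x)\<bar> powr q * indicator (ball x0 r) x) \<partial>lborel) \<le> ennreal (\<beta> powr q)"
  shows "(\<integral>\<^sup>+ x. ennreal (\<bar>u (x + h) - u x\<bar> powr q * indicator (ball x0 r) x) \<partial>lborel) \<le> ennreal (((\<alpha> + \<beta>) / 2) powr q)"
proof -
  have [measurable]: "ball x0 r \<in> sets borel" by simp
  let ?F = "\<lambda>x. u (x + (h + h)) - u x" and ?G = "\<lambda>x. - ((u (x + h + h) - u (x + h)) - (u (x + h) - u x))"
  have "\<bar>u (x + h) - u x\<bar> powr q = (1 / 2) powr q * \<bar>?F x + ?G x\<bar> powr q" for x
  proof -
    have *: "?F x + ?G x = 2 * (u (x + h) - u x)" by (simp add: add.assoc)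
    have "\<bar>z\<bar> powr q = (1 / 2) powr q * \<bar>2 * z\<bar> powr q" for z :: real
      by (simp add: abs_mult powr_mult[symmetric])
    then show ?thesis unfolding * .
  qed
  then have "(\<integral>\<^sup>+ x. ennreal (\<bar>u (x + h) - u x\<bar> powr q * indicator (ball x0 r) x) \<partial>lborel)
     = (\<integral>\<^sup>+ x. ennreal ((1 / 2) powr q) * (ennreal (\<bar>?F x + ?G x\<bar> powr q) * indicator (ball x0 r) x) \<partial>lborel)"
    by (simp only: ennreal_mult_indicator[symmetric] ennreal_mult'[symmetric] powr_ge_zero mult.assoc)
  also have "\<dots> = ennreal ((1 / 2) powr q) * (\<integral>\<^sup>+ x. ennreal (\<bar>?F x + ?G x\<bar> powr q) * indicator (ball x0 r) x \<partial>lborel)"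
    by (rule nn_integral_cmult) measurable
  also have "\<dots> \<le> ennreal ((1 / 2) powr q) * ennreal ((\<alpha> + \<beta>) powr q)"
  proof (intro mult_left_mono nn_integral_powr_add ab q)
    show "(\<integral>\<^sup>+ x. ennreal (\<bar>?F x\<bar> powr q) * indicator (ball x0 r) x \<partial>lborel) \<le> ennreal (\<alpha> powr q)"
      using 1 by (simp only: ennreal_mult_indicator)
    show "(\<integral>\<^sup>+ x. ennreal (\<bar>?G x\<bar> powr q) * indicator (ball x0 r) x \<partial>lborel) \<le> ennreal (\<beta> powr q)"
      using 2 by (simp only: ennreal_mult_indicator abs_minus_cancel)
    show "ball x0 r \<in> sets (lborel :: 'a measure)" by simp
  qed auto
  also have "\<dots> = ennreal (((\<alpha> + \<beta>) / 2) powr q)" using ab by (simp add: ennreal_mult'[symmetric] powr_mult[symmetric])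
  finally show ?thesis .
qed

context local_solution
begin

text \<open>Double h until its norm exceeds \<rho> / 2, where boundedness suffices; this gives the
  first summand of the constant. One step back turns A into (A 2^\<gamma> + D) / 2, which is at most
  A once A (2 - 2^\<gamma>) >= D. Hence \<gamma> < 1 and the summand 1 / (2 - 2^\<gamma>).\<close>

lemma first_from_second:
  assumes r: "0 < r" "r < R" and \<rho>: "\<rho> = (R - r) / 32" and \<gamma>: "0 \<le> \<gamma>" "\<gamma> < 1" and D: "M \<le> D" and q: "1 \<le> q"
    and sec: "\<And>h. h \<noteq> 0 \<Longrightarrow> norm h \<le> \<rho> \<Longrightarrow> (\<integral>\<^sup>+ x. ennreal (\<bar>(u (x + h + h) - u (x + h)) - (u (x + h) - u x)\<bar> powr q * indicator (ball x0 r) x) \<partial>lborel)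
      \<le> ennreal ((D * norm h powr \<gamma>) powr q)"
    and h: "norm h \<le> 2 * \<rho>"
  shows "(\<integral>\<^sup>+ x. ennreal (\<bar>u (x + h) - u x\<bar> powr q * indicator (ball x0 r) x) \<partial>lborel)
    \<le> ennreal ((D * (2 * (1 + unit_ball_vol DIM('a)) * (2 / \<rho>) + 1 / (2 - 2 powr \<gamma>)) * norm h powr \<gamma>) powr q)"
proof -
  let ?\<omega> = "unit_ball_vol DIM('a)"
  define A where "A = D * (2 * (1 + ?\<omega>) * (2 / \<rho>) + 1 / (2 - 2 powr \<gamma>))"
  have \<rho>0: "0 < \<rho>" "\<rho> < 1" using r R \<rho> by auto
  have g2: "2 powr \<gamma> < 2" using \<gamma> powr_less_mono[of \<gamma> 1 2] by simp
  have D0: "1 \<le> D" using D M by simp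
  have A1: "D * (2 * (1 + ?\<omega>) * (2 / \<rho>)) \<le> A" using g2 D0 unfolding A_def by (intro mult_left_mono) auto
  have A2: "D * (1 / (2 - 2 powr \<gamma>)) \<le> A" using \<rho>0 D0 unfolding A_def by (intro mult_left_mono) auto
  have A0: "0 < A"
  proof -
    have "0 < D * (1 / (2 - 2 powr \<gamma>))" using D0 g2 by (intro mult_pos_pos) auto
    then show ?thesis using A2 by linarith
  qed
  have A3: "D + A * 2 powr \<gamma> \<le> 2 * A"
  proof -
    have "D \<le> A * (2 - 2 powr \<gamma>)" using A2 g2 by (simp add: divide_le_eq)
    then show ?thesis by (simp add: algebra_simps)
  qed
  have base: "(\<integral>\<^sup>+ x. ennreal (\<bar>u (x + h) - u x\<bar> powr q * indicator (ball x0 r) x) \<partial>lborel) \<le> ennreal ((A * norm h powr \<gamma>) powr q)"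
    if h: "norm h \<le> 2 * \<rho>" "\<rho> / 2 < norm h" for h
  proof -
    have "2 * M * (1 + ?\<omega>) \<le> A * norm h powr \<gamma>"
    proof -
      have "(\<rho> / 2) powr 1 \<le> (\<rho> / 2) powr \<gamma>" using \<rho>0 \<gamma> by (intro powr_mono') auto
      also have "\<dots> \<le> norm h powr \<gamma>" using h \<gamma> \<rho>0 by (intro powr_mono2) auto
      finally have n: "\<rho> / 2 \<le> norm h powr \<gamma>" using \<rho>0 by simp
      have "2 * M * (1 + ?\<omega>) \<le> 2 * D * (1 + ?\<omega>)" using D by (intro mult_right_mono) auto
      also have "\<dots> = D * (2 * (1 + ?\<omega>) * (2 / \<rho>)) * (\<rho> / 2)" using \<rho>0 by simp
      also have "\<dots> \<le> A * norm h powr \<gamma>" using A1 n A0 \<rho>0 by (intro mult_mono) auto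
      finally show ?thesis .
    qed
    then have "(2 * M * (1 + ?\<omega>)) powr q \<le> (A * norm h powr \<gamma>) powr q" using M q by (intro powr_mono2) auto
    moreover have "norm h \<le> R - r" using h \<rho> r by simp
    ultimately show ?thesis using order_trans[OF trivial_difference[OF r(1) _ q] ennreal_leI] by blast
  qed
  have "(\<integral>\<^sup>+ x. ennreal (\<bar>u (x + h) - u x\<bar> powr q * indicator (ball x0 r) x) \<partial>lborel) \<le> ennreal ((A * norm h powr \<gamma>) powr q)"
    if "h \<noteq> 0" "norm h \<le> 2 * \<rho>" "\<rho> / 2 < 2 ^ n * norm h" for h n
    using that
  proof (induction n arbitrary: h)
    case 0 then show ?case using base by simp
  next
    case (Suc n)
    show ?case
    proof (cases "\<rho> / 2 < norm h")
      case True then show ?thesis using base Suc by simp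
    next
      case False
      have n2: "norm (h + h) = 2 * norm h" by (simp add: scaleR_2[symmetric])
      have hh: "h + h \<noteq> 0" using Suc.prems(1) by (simp add: scaleR_2[symmetric])
      have h0: "0 < norm h" using Suc by simp
      have "(\<integral>\<^sup>+ x. ennreal (\<bar>u (x + (h + h)) - u x\<bar> powr q * indicator (ball x0 r) x) \<partial>lborel) \<le> ennreal ((A * norm (h + h) powr \<gamma>) powr q)"
        using False Suc.prems \<rho>0 by (intro Suc.IH hh) (auto simp: n2)
      moreover have "(\<integral>\<^sup>+ x. ennreal (\<bar>(u (x + h + h) - u (x + h)) - (u (x + h) - u x)\<bar> powr q * indicator (ball x0 r) x) \<partial>lborel)
          \<le> ennreal ((D * norm h powr \<gamma>) powr q)" using False \<rho>0 by (intro sec Suc.prems(1)) auto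
      ultimately have "(\<integral>\<^sup>+ x. ennreal (\<bar>u (x + h) - u x\<bar> powr q * indicator (ball x0 r) x) \<partial>lborel)
         \<le> ennreal (((A * norm (h + h) powr \<gamma> + D * norm h powr \<gamma>) / 2) powr q)"
        using A0 D0 h0 by (intro first_from_second_step u_borel q) (auto simp: n2)
      also have "\<dots> \<le> ennreal ((A * norm h powr \<gamma>) powr q)"
      proof (intro ennreal_leI powr_mono2)
        have "A * norm (h + h) powr \<gamma> + D * norm h powr \<gamma> = (D + A * 2 powr \<gamma>) * norm h powr \<gamma>"
          using h0 by (simp add: n2 powr_mult algebra_simps)
        also have "\<dots> \<le> (2 * A) * norm h powr \<gamma>" by (intro mult_right_mono A3) auto
        finally show "(A * norm (h + h) powr \<gamma> + D * norm h powr \<gamma>) / 2 \<le> A * norm h powr \<gamma>" by simp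
      qed (use A0 D0 q in auto)
      finally show ?thesis .
    qed
  qed
  moreover obtain n where "\<rho> / 2 < 2 ^ n * norm h" if "h \<noteq> 0"
  proof (cases "h = 0")
    case False
    then obtain n where "(\<rho> / 2) / norm h < 2 ^ n" using real_arch_pow[of 2 "(\<rho> / 2) / norm h"] by auto
    then show ?thesis using that False by (auto simp: field_simps)
  qed (use that in auto)
  ultimately have "h \<noteq> 0 \<Longrightarrow> ?thesis" unfolding A_def[symmetric] using h by blast
  then show ?thesis by (cases "h = 0") (simp_all add: zero_ennreal_def[symmetric])
qed

end

text \<open>For \<open>h = 0\<close> the factor \<open>norm h powr g\<close> is \<open>0\<close> even if \<open>g = 0\<close>, which is harmless because
  the difference vanishes.\<close>
definition first_diff_bound :: "'a::euclidean_space itself \<Rightarrow> real \<Rightarrow> real \<Rightarrow> real \<Rightarrow> real \<Rightarrow> real \<Rightarrow> real \<Rightarrow> bool" where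
  "first_diff_bound T s1 sp p k q g \<longleftrightarrow> (\<exists>C \<kappa>. 1 \<le> C \<and> 0 \<le> \<kappa> \<and>
     (\<forall>(u :: 'a \<Rightarrow> real) Z x0 R M r h. local_solution u Z x0 R M s1 sp p k \<and> 0 < r \<and> r < R \<and> norm h \<le> (R - r) / 16 \<longrightarrow>
       (\<integral>\<^sup>+ x. ennreal (\<bar>u (x + h) - u x\<bar> powr q * indicator (ball x0 r) x) \<partial>lborel)
       \<le> ennreal ((C * M * (1 / (R - r)) powr \<kappa> * norm h powr g) powr q)))"

definition second_diff_bound :: "'a::euclidean_space itself \<Rightarrow> real \<Rightarrow> real \<Rightarrow> real \<Rightarrow> real \<Rightarrow> real \<Rightarrow> real \<Rightarrow> bool" where
  "second_diff_bound T s1 sp p k q g \<longleftrightarrow> (\<exists>C \<kappa>. 1 \<le> C \<and> 0 \<le> \<kappa> \<and>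
     (\<forall>(u :: 'a \<Rightarrow> real) Z x0 R M r h. local_solution u Z x0 R M s1 sp p k \<and> 0 < r \<and> r < R \<and> h \<noteq> 0 \<and> norm h \<le> (R - r) / 32 \<longrightarrow>
       (\<integral>\<^sup>+ x. ennreal (\<bar>(u (x + h + h) - u (x + h)) - (u (x + h) - u x)\<bar> powr q * indicator (ball x0 r) x) \<partial>lborel)
       \<le> ennreal ((C * M * (1 / (R - r)) powr \<kappa> * norm h powr g) powr q)))"

lemma first_diff_bound_0:
  assumes q: "1 \<le> q"
  shows "first_diff_bound TYPE('a::euclidean_space) s1 sp p k q 0"
  unfolding first_diff_bound_def
proof (rule exI[of _ "2 * (1 + unit_ball_vol DIM('a))"], rule exI[of _ "0::real"], intro conjI allI impI)
  fix u :: "'a \<Rightarrow> real" and Z x0 R M r and h :: 'a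
  assume A: "local_solution u Z x0 R M s1 sp p k \<and> 0 < r \<and> r < R \<and> norm h \<le> (R - r) / 16"
  then interpret local_solution u Z x0 R M s1 sp p k by simp
  show "(\<integral>\<^sup>+ x. ennreal (\<bar>u (x + h) - u x\<bar> powr q * indicator (ball x0 r) x) \<partial>lborel)
       \<le> ennreal ((2 * (1 + unit_ball_vol DIM('a)) * M * (1 / (R - r)) powr 0 * norm h powr 0) powr q)"
  proof (cases "h = 0")
    case False
    have "norm h \<le> R - r" using A by auto
    from trivial_difference[OF _ this q] show ?thesis using A False by (simp add: mult_ac)
  qed (simp add: zero_ennreal_def[symmetric])
qed simp_all

text \<open>First differences are used on the ball of radius r + 4 d, whose distance to the outer
  sphere is (R - r) / 2. This halves the admissible step size from (R - r) / 16 to (R - r) / 32 and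
  causes the factor 2^\<kappa>; the factor 8^(N+4) comes from d = (R - r) / 8.\<close>

lemma second_diff_bound_step:
  assumes q: "p \<le> q" "1 < p" and g: "0 \<le> g" "g \<le> 1" and \<beta>: "0 \<le> \<beta>" "\<beta> * (q + 2 - p) \<le> sp * p - (p - 1)" and k: "1 \<le> k"
    and first: "first_diff_bound TYPE('a::euclidean_space) s1 sp p k q g"
  shows "second_diff_bound TYPE('a) s1 sp p k q (g + \<beta>)"
proof -
  obtain C \<kappa> where C: "1 \<le> C" "0 \<le> \<kappa>" and bd: "\<And>(u :: 'a \<Rightarrow> real) Z x0 R M r h. local_solution u Z x0 R M s1 sp p k \<Longrightarrow> 0 < r \<Longrightarrow> r < R \<Longrightarrow> norm h \<le> (R - r) / 16 \<Longrightarrow>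
       (\<integral>\<^sup>+ x. ennreal (\<bar>u (x + h) - u x\<bar> powr q * indicator (ball x0 r) x) \<partial>lborel)
       \<le> ennreal ((C * M * (1 / (R - r)) powr \<kappa> * norm h powr g) powr q)"
    using first unfolding first_diff_bound_def by blast
  let ?N = "real DIM('a)"
  let ?C2 = "diff_const (unit_ball_vol DIM('a)) DIM('a) p (q + 1 - p) q k"
  have C2: "1 \<le> ?C2" using q k by (intro diff_const_ge_1) auto
  show ?thesis unfolding second_diff_bound_def
  proof (rule exI[of _ "?C2 * 8 powr (?N + 4) * 2 powr \<kappa> * C"], rule exI[of _ "\<kappa> + (?N + 4)"], intro conjI allI impI)
    have "1 \<le> 8 powr (?N + 4) * 2 powr \<kappa>" using C mult_mono[of 1 "8 powr (?N + 4)" 1 "2 powr \<kappa>"] by (simp add: ge_one_powr_ge_zero)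
    then have "1 \<le> (8 powr (?N + 4) * 2 powr \<kappa>) * C" using C mult_mono[of 1 "8 powr (?N + 4) * 2 powr \<kappa>" 1 C] by simp
    then show "1 \<le> ?C2 * 8 powr (?N + 4) * 2 powr \<kappa> * C" using C2 mult_mono[of 1 ?C2 1 "(8 powr (?N + 4) * 2 powr \<kappa>) * C"] by (simp add: mult.assoc)
    show "0 \<le> \<kappa> + (?N + 4)" using C by simp
  next
    fix u :: "'a \<Rightarrow> real" and Z x0 R M r and h :: 'a
    assume H: "local_solution u Z x0 R M s1 sp p k \<and> 0 < r \<and> r < R \<and> h \<noteq> 0 \<and> norm h \<le> (R - r) / 32"
    then interpret local_solution u Z x0 R M s1 sp p k by simp
    define d where "d = (R - r) / 8"
    define A where "A = C * M * (1 / (R - (r + 4 * d))) powr \<kappa>"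
    have r': "r + 4 * d < R" "R - (r + 4 * d) = (R - r) / 2" "0 < r + 4 * d" "norm h \<le> d / 2" "0 < R - r" "R - r < 1"
      using H R by (auto simp: d_def field_simps)
    have "1 \<le> (1 / (R - (r + 4 * d))) powr \<kappa>" unfolding r'(2) using C r' by (intro ge_one_powr_ge_zero) auto
    then have "1 * M * 1 \<le> A" unfolding A_def using C M by (intro mult_mono) auto
    then have MA: "M \<le> A" by simp
    have "(\<integral>\<^sup>+ x. ennreal (\<bar>(u (x + h + h) - u (x + h)) - (u (x + h) - u x)\<bar> powr q * indicator (ball x0 r) x) \<partial>lborel)
      \<le> ennreal ((?C2 * (1 / d) powr (?N + 4) * A * norm h powr (g + \<beta>)) powr q)"
    proof (rule second_difference[OF _ _ d_def _ _ _ _ MA g \<beta>])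
      fix l :: 'a assume "norm l \<le> norm h"
      then show "(\<integral>\<^sup>+ x. ennreal (\<bar>u (x + l) - u x\<bar> powr q * indicator (ball x0 (r + 4 * d)) x) \<partial>lborel) \<le> ennreal ((A * norm l powr g) powr q)"
        unfolding A_def using H r' by (intro bd local_solution_axioms) auto
    qed (use H q r' in auto)
    also have "?C2 * (1 / d) powr (?N + 4) * A = ?C2 * 8 powr (?N + 4) * 2 powr \<kappa> * C * M * (1 / (R - r)) powr (\<kappa> + (?N + 4))"
    proof -
      have "(1 / d) powr (?N + 4) = 8 powr (?N + 4) * (1 / (R - r)) powr (?N + 4)"
        using r' powr_mult[of 8 "1 / (R - r)"] by (simp add: d_def)
      moreover have "(1 / (R - (r + 4 * d))) powr \<kappa> = 2 powr \<kappa> * (1 / (R - r)) powr \<kappa>"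
        unfolding r'(2) using r' powr_mult[of 2 "1 / (R - r)"] by simp
      ultimately show ?thesis unfolding A_def powr_add by (simp only: mult_ac)
    qed
    finally show "(\<integral>\<^sup>+ x. ennreal (\<bar>(u (x + h + h) - u (x + h)) - (u (x + h) - u x)\<bar> powr q * indicator (ball x0 r) x) \<partial>lborel)
       \<le> ennreal ((?C2 * 8 powr (?N + 4) * 2 powr \<kappa> * C * M * (1 / (R - r)) powr (\<kappa> + (?N + 4)) * norm h powr (g + \<beta>)) powr q)" .
  qed
qed

text \<open>The doubling argument regains the range of step sizes: second differences are known up
  to \<rho> = (R - r) / 32, and first differences follow up to 2 \<rho>. So the two steps can
  alternate.\<close>

lemma first_diff_bound_step:
  assumes q: "1 \<le> q" and \<gamma>: "0 \<le> \<gamma>" "\<gamma> < 1"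
    and second: "second_diff_bound TYPE('a::euclidean_space) s1 sp p k q \<gamma>"
  shows "first_diff_bound TYPE('a) s1 sp p k q \<gamma>"
proof -
  obtain C \<kappa> where C: "1 \<le> C" "0 \<le> \<kappa>" and bd: "\<And>(u :: 'a \<Rightarrow> real) Z x0 R M r h. local_solution u Z x0 R M s1 sp p k \<Longrightarrow> 0 < r \<Longrightarrow> r < R \<Longrightarrow> h \<noteq> 0 \<Longrightarrow> norm h \<le> (R - r) / 32 \<Longrightarrow>
       (\<integral>\<^sup>+ x. ennreal (\<bar>(u (x + h + h) - u (x + h)) - (u (x + h) - u x)\<bar> powr q * indicator (ball x0 r) x) \<partial>lborel)
       \<le> ennreal ((C * M * (1 / (R - r)) powr \<kappa> * norm h powr \<gamma>) powr q)"
    using second unfolding second_diff_bound_def by blast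
  \<comment> \<open>Here 128 = 2 * 2 * 32, from 2 (2 / \<rho>) with \<rho> = (R - r) / 32.\<close>
  let ?c = "128 * (1 + unit_ball_vol DIM('a)) + 1 / (2 - 2 powr \<gamma>)"
  have g2: "2 powr \<gamma> < 2" using \<gamma> powr_less_mono[of \<gamma> 1 2] by simp
  show ?thesis unfolding first_diff_bound_def
  proof (rule exI[of _ "C * ?c"], rule exI[of _ "\<kappa> + 1"], intro conjI allI impI)
    have "0 < 1 / (2 - 2 powr \<gamma>)" using g2 by simp
    then have "1 \<le> ?c" using unit_ball_vol_gt_0[where 'a = 'a] by (simp add: add_increasing2 distrib_left)
    then show "1 \<le> C * ?c" using C mult_mono[of 1 C 1 ?c] by simp
    show "0 \<le> \<kappa> + 1" using C by simp
  next
    fix u :: "'a \<Rightarrow> real" and Z x0 R M r and h :: 'a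
    assume H: "local_solution u Z x0 R M s1 sp p k \<and> 0 < r \<and> r < R \<and> norm h \<le> (R - r) / 16"
    then interpret local_solution u Z x0 R M s1 sp p k by simp
    define \<rho> where "\<rho> = (R - r) / 32"
    define D where "D = C * M * (1 / (R - r)) powr \<kappa>"
    have r': "0 < R - r" "R - r < 1" using H R by auto
    have "1 \<le> (1 / (R - r)) powr \<kappa>" using C r' by (intro ge_one_powr_ge_zero) auto
    then have "1 * M * 1 \<le> D" unfolding D_def using C M by (intro mult_mono) auto
    then have MD: "M \<le> D" by simp
    have "(\<integral>\<^sup>+ x. ennreal (\<bar>u (x + h) - u x\<bar> powr q * indicator (ball x0 r) x) \<partial>lborel)
      \<le> ennreal ((D * (2 * (1 + unit_ball_vol DIM('a)) * (2 / \<rho>) + 1 / (2 - 2 powr \<gamma>)) * norm h powr \<gamma>) powr q)"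
      by (rule first_from_second[OF _ _ \<rho>_def \<gamma> MD q])
        (use H bd[OF local_solution_axioms] in \<open>auto simp: \<rho>_def D_def\<close>)
    also have "\<dots> \<le> ennreal ((C * ?c * M * (1 / (R - r)) powr (\<kappa> + 1) * norm h powr \<gamma>) powr q)"
    proof (intro ennreal_leI powr_mono2 mult_right_mono)
      have "2 * (1 + unit_ball_vol DIM('a)) * (2 / \<rho>) + 1 / (2 - 2 powr \<gamma>) \<le> ?c * (1 / (R - r))"
      proof -
        have "1 / (2 - 2 powr \<gamma>) * 1 \<le> 1 / (2 - 2 powr \<gamma>) * (1 / (R - r))" using g2 r' by (intro mult_left_mono) auto
        moreover have "2 * (1 + unit_ball_vol DIM('a)) * (2 / \<rho>) = 128 * (1 + unit_ball_vol DIM('a)) * (1 / (R - r))"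
          by (simp add: \<rho>_def)
        ultimately show ?thesis unfolding distrib_right[of "128 * (1 + unit_ball_vol DIM('a))"] by linarith
      qed
      then have "D * (2 * (1 + unit_ball_vol DIM('a)) * (2 / \<rho>) + 1 / (2 - 2 powr \<gamma>)) \<le> D * (?c * (1 / (R - r)))"
        using MD M by (intro mult_left_mono) auto
      also have "\<dots> = C * ?c * M * (1 / (R - r)) powr (\<kappa> + 1)"
        unfolding D_def using r' by (simp add: powr_add)
      finally show "D * (2 * (1 + unit_ball_vol DIM('a)) * (2 / \<rho>) + 1 / (2 - 2 powr \<gamma>)) \<le> C * ?c * M * (1 / (R - r)) powr (\<kappa> + 1)" .
      show "0 \<le> D * (2 * (1 + unit_ball_vol DIM('a)) * (2 / \<rho>) + 1 / (2 - 2 powr \<gamma>)) * norm h powr \<gamma>"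
        using MD M g2 r' by (intro mult_nonneg_nonneg add_nonneg_nonneg) (auto simp: \<rho>_def)
    qed (use q in auto)
    finally show "(\<integral>\<^sup>+ x. ennreal (\<bar>u (x + h) - u x\<bar> powr q * indicator (ball x0 r) x) \<partial>lborel)
       \<le> ennreal ((C * ?c * M * (1 / (R - r)) powr (\<kappa> + 1) * norm h powr \<gamma>) powr q)" .
  qed
qed

text \<open>Each step gains the order \<open>\<beta>\<close>. With \<open>\<beta> = 1 / (n + 1/2)\<close> the orders \<open>i \<beta>\<close> avoid \<open>1\<close>, and the
  last step yields second differences of order greater than \<open>1\<close>.\<close>
lemma higher_differentiability:
  assumes p: "1 < p" "(p - 1) / p < sp" and q: "p \<le> q" and k: "1 \<le> k"
  shows "\<exists>g>1. second_diff_bound TYPE('a::euclidean_space) s1 sp p k q g"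
proof -
  define b where "b = (sp * p - (p - 1)) / (q + 2 - p)"
  have b: "0 < b" using p q by (auto simp: b_def divide_less_eq intro!: divide_pos_pos)
  obtain n where n: "1 / b < real n" using reals_Archimedean2 by blast
  define \<beta> where "\<beta> = 1 / (real n + 1 / 2)"
  have \<beta>: "0 < \<beta>" "\<beta> \<le> b"
  proof -
    have "1 / b \<le> real n + 1 / 2" using n by simp
    then show "\<beta> \<le> b" using b by (simp add: \<beta>_def field_simps)
  qed (simp add: \<beta>_def add_nonneg_pos)
  have \<beta>2: "\<beta> * (q + 2 - p) \<le> sp * p - (p - 1)"
    using \<beta>(2) q unfolding b_def by (simp add: le_divide_eq)
  have lt: "real i * \<beta> < 1" if "i \<le> n" for i
    using that by (simp add: \<beta>_def divide_less_eq add_nonneg_pos)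
  have "first_diff_bound TYPE('a) s1 sp p k q (real i * \<beta>)" if "i \<le> n" for i
    using that
  proof (induction i)
    case 0
    show ?case using first_diff_bound_0[of q] p q by simp
  next
    case (Suc i)
    have "second_diff_bound TYPE('a) s1 sp p k q (real i * \<beta> + \<beta>)"
      using Suc \<beta> lt[of i] by (intro second_diff_bound_step q p \<beta>2 k) auto
    then show ?case using lt[OF Suc.prems] \<beta> p q by (intro first_diff_bound_step) (auto simp: algebra_simps)
  qed
  then have "second_diff_bound TYPE('a) s1 sp p k q (real n * \<beta> + \<beta>)"
    using \<beta> lt[of n] by (intro second_diff_bound_step q p \<beta>2 k) auto
  moreover have "1 < real n * \<beta> + \<beta>" 
  proof -
    have "real n * \<beta> + \<beta> = (real n + 1 / 2) * \<beta> + \<beta> / 2" by (simp add: algebra_simps)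
    also have "(real n + 1 / 2) * \<beta> = 1" by (simp add: \<beta>_def add_nonneg_pos less_imp_neq[THEN not_sym])
    finally show ?thesis using \<beta>(1) by simp
  qed
  ultimately show ?thesis by blast
qed

section \<open>Limits of difference quotients\<close>

text \<open>The passage from L^q to L^1 with the threshold \<open>\<mu>\<close>: the small values
  contribute at most \<open>\<mu>\<close> times the volume, the large ones at most
  \<open>\<mu>\<close>.\<close>

lemma nn_integral_le_of_powr_le:
  fixes f :: "'a::euclidean_space \<Rightarrow> real"
  assumes [measurable]: "f \<in> borel_measurable borel" "S \<in> sets borel" and q: "1 \<le> q" and \<mu>: "0 < \<mu>"
    and V: "emeasure lborel S \<le> ennreal V" "0 \<le> V"
    and f: "(\<integral>\<^sup>+ x. ennreal (\<bar>f x\<bar> powr q) * indicator S x \<partial>lborel) \<le> ennreal (\<mu> powr q)"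
  shows "(\<integral>\<^sup>+ x. ennreal \<bar>f x\<bar> * indicator S x \<partial>lborel) \<le> ennreal (\<mu> * (V + 1))"
proof -
  have pw: "\<bar>f x\<bar> \<le> \<mu> + \<mu> powr (1 - q) * \<bar>f x\<bar> powr q" for x
    using powr_le_sum_powr[of "\<bar>f x\<bar>" \<mu> 1 q] q \<mu> by simp
  have "(\<integral>\<^sup>+ x. ennreal \<bar>f x\<bar> * indicator S x \<partial>lborel)
      \<le> (\<integral>\<^sup>+ x. ennreal \<mu> * indicator S x + ennreal (\<mu> powr (1 - q)) * (ennreal (\<bar>f x\<bar> powr q) * indicator S x) \<partial>lborel)"
  proof (intro nn_integral_mono)
    fix x
    have "ennreal \<bar>f x\<bar> \<le> ennreal \<mu> + ennreal (\<mu> powr (1 - q)) * ennreal (\<bar>f x\<bar> powr q)"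
      using pw[of x] \<mu> by (simp add: ennreal_mult'[symmetric] ennreal_plus[symmetric] ennreal_leI del: ennreal_plus)
    then show "ennreal \<bar>f x\<bar> * indicator S x \<le> ennreal \<mu> * indicator S x + ennreal (\<mu> powr (1 - q)) * (ennreal (\<bar>f x\<bar> powr q) * indicator S x)"
      by (simp add: indicator_def)
  qed
  also have "\<dots> = ennreal \<mu> * emeasure lborel S + ennreal (\<mu> powr (1 - q)) * (\<integral>\<^sup>+ x. ennreal (\<bar>f x\<bar> powr q) * indicator S x \<partial>lborel)"
    by (subst nn_integral_add) (auto simp: nn_integral_cmult nn_integral_cmult_indicator)
  also have "\<dots> \<le> ennreal \<mu> * ennreal V + ennreal (\<mu> powr (1 - q)) * ennreal (\<mu> powr q)"
    by (intro add_mono mult_left_mono V f) auto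
  also have "\<dots> = ennreal (\<mu> * V + \<mu> powr (1 - q) * \<mu> powr q)"
    using \<mu> V by (intro ennreal_add_mult[symmetric]) auto
  also have "\<mu> powr (1 - q) * \<mu> powr q = \<mu>" using \<mu> by (simp add: powr_add[symmetric])
  finally show ?thesis by (simp add: distrib_left)
qed

lemma AE_summable_of_nn_integral:
  fixes d :: "nat \<Rightarrow> 'a::euclidean_space \<Rightarrow> real"
  assumes [measurable]: "\<And>n. d n \<in> borel_measurable borel" "S \<in> sets borel"
    and fin: "(\<Sum>n. \<integral>\<^sup>+ x. ennreal \<bar>d n x\<bar> * indicator S x \<partial>lborel) < \<infinity>"
  shows "AE x in lborel. x \<in> S \<longrightarrow> summable (\<lambda>n. \<bar>d n x\<bar>)"
proof -
  have "(\<integral>\<^sup>+ x. (\<Sum>n. ennreal \<bar>d n x\<bar> * indicator S x) \<partial>lborel) \<noteq> \<infinity>"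
    using fin by (subst nn_integral_suminf) auto
  then have "AE x in lborel. (\<Sum>n. ennreal \<bar>d n x\<bar> * indicator S x) \<noteq> \<infinity>"
    by (intro nn_integral_PInf_AE) auto
  then show ?thesis
    by eventually_elim (auto intro!: summable_suminf_not_top)
qed

lemma liminf_ennreal_powr:
  fixes a :: "nat \<Rightarrow> real"
  assumes "a \<longlonglongrightarrow> b" "0 < q"
  shows "liminf (\<lambda>n. ennreal (\<bar>a n\<bar> powr q)) = ennreal (\<bar>b\<bar> powr q)"
proof (rule lim_imp_Liminf)
  have "(\<lambda>n. \<bar>a n\<bar> powr q) \<longlonglongrightarrow> \<bar>b\<bar> powr q"
    by (rule tendsto_powr2[OF tendsto_rabs[OF assms(1)] tendsto_const]) (use assms in simp_all)
  then show "(\<lambda>n. ennreal (\<bar>a n\<bar> powr q)) \<longlonglongrightarrow> ennreal (\<bar>b\<bar> powr q)" by (rule tendsto_ennrealI)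
qed simp

lemma tendsto_0_of_le:
  fixes f g :: "nat \<Rightarrow> ennreal"
  assumes "\<And>n. f n \<le> g n" "g \<longlonglongrightarrow> 0"
  shows "f \<longlonglongrightarrow> 0"
  by (rule tendsto_sandwich[OF _ _ tendsto_const assms(2)]) (simp_all add: assms(1))

text \<open>The increments are summable in L^1, so the telescoping series converges absolutely
  almost everywhere on S, and its remainders give convergence in L^1. The partial sums are bounded
  in L^q by Minkowski's inequality, and Fatou's lemma passes the bound to the limit.\<close>

lemma Lq_geometric_limit:
  fixes f :: "nat \<Rightarrow> 'a::euclidean_space \<Rightarrow> real"
  assumes m[measurable]: "\<And>n. f n \<in> borel_measurable borel" "S \<in> sets borel" and q: "1 \<le> q"
    and A: "0 < A" "0 < F" "0 < \<rho>" "\<rho> < 1" and V: "emeasure lborel S \<le> ennreal V" "0 \<le> V"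
    and f0: "(\<integral>\<^sup>+ x. ennreal (\<bar>f 0 x\<bar> powr q) * indicator S x \<partial>lborel) \<le> ennreal (F powr q)"
    and step: "\<And>n. (\<integral>\<^sup>+ x. ennreal (\<bar>f (Suc n) x - f n x\<bar> powr q) * indicator S x \<partial>lborel) \<le> ennreal ((A * \<rho> ^ n) powr q)"
  shows "(\<integral>\<^sup>+ x. ennreal (\<bar>lim (\<lambda>n. f n x)\<bar> powr q) * indicator S x \<partial>lborel) \<le> ennreal ((F + A / (1 - \<rho>)) powr q)"
    and "(\<lambda>n. \<integral>\<^sup>+ x. ennreal \<bar>f n x - lim (\<lambda>n. f n x)\<bar> * indicator S x \<partial>lborel) \<longlonglongrightarrow> 0"
proof -
  define G where "G x = lim (\<lambda>n. f n x)" for x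
  define d where "d n x = f (Suc n) x - f n x" for n x
  have [measurable]: "G \<in> borel_measurable borel" unfolding G_def[abs_def] by measurable
  have md[measurable]: "d n \<in> borel_measurable borel" for n unfolding d_def[abs_def] by measurable
  have step1: "(\<integral>\<^sup>+ x. ennreal \<bar>d n x\<bar> * indicator S x \<partial>lborel) \<le> ennreal (A * (V + 1) * \<rho> ^ n)" for n
    using nn_integral_le_of_powr_le[OF md m(2) q _ V, of "A * \<rho> ^ n" n] step[of n] A unfolding d_def by (simp add: mult_ac)
  have sums: "(\<lambda>n. A * (V + 1) * \<rho> ^ (n + k)) sums (A * (V + 1) * \<rho> ^ k * (1 / (1 - \<rho>)))" for k
  proof -
    have "(\<lambda>n. (A * (V + 1) * \<rho> ^ k) * \<rho> ^ n) sums (A * (V + 1) * \<rho> ^ k * (1 / (1 - \<rho>)))"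
      using A by (intro sums_mult geometric_sums) auto
    then show ?thesis by (simp add: power_add mult_ac)
  qed
  have tail: "(\<Sum>n. \<integral>\<^sup>+ x. ennreal \<bar>d (n + k) x\<bar> * indicator S x \<partial>lborel) \<le> ennreal (A * (V + 1) * \<rho> ^ k * (1 / (1 - \<rho>)))" for k
  proof -
    have "(\<Sum>n. \<integral>\<^sup>+ x. ennreal \<bar>d (n + k) x\<bar> * indicator S x \<partial>lborel) \<le> (\<Sum>n. ennreal (A * (V + 1) * \<rho> ^ (n + k)))"
      by (intro suminf_le step1) auto
    also have "\<dots> = ennreal (A * (V + 1) * \<rho> ^ k * (1 / (1 - \<rho>)))"
      using A V by (intro suminf_ennreal_eq sums) auto
    finally show ?thesis .
  qed
  have "(\<Sum>n. \<integral>\<^sup>+ x. ennreal \<bar>d n x\<bar> * indicator S x \<partial>lborel) < \<infinity>"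
    using tail[of 0] by (simp add: order.strict_trans1)
  then have sm: "AE x in lborel. x \<in> S \<longrightarrow> summable (\<lambda>n. \<bar>d n x\<bar>)"
    by (intro AE_summable_of_nn_integral) auto
  have lim: "AE x in lborel. x \<in> S \<longrightarrow> (\<lambda>n. f n x) \<longlonglongrightarrow> G x \<and> (\<forall>k. ennreal \<bar>f k x - G x\<bar> \<le> (\<Sum>n. ennreal \<bar>d (n + k) x\<bar>))"
    using sm
  proof eventually_elim
    case (elim x)
    show ?case
    proof (intro impI conjI allI)
      assume "x \<in> S"
      then have s: "summable (\<lambda>n. \<bar>d n x\<bar>)" using elim by simp
      have tel: "f n x = f 0 x + (\<Sum>i<n. d i x)" for n by (induction n) (auto simp: d_def)
      have "(\<lambda>n. f 0 x + (\<Sum>i<n. d i x)) \<longlonglongrightarrow> f 0 x + (\<Sum>i. d i x)"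
        by (intro tendsto_add tendsto_const summable_LIMSEQ summable_rabs_cancel[OF s])
      then have "convergent (\<lambda>n. f n x)" unfolding tel[symmetric] by (rule convergentI)
      then show l: "(\<lambda>n. f n x) \<longlonglongrightarrow> G x" unfolding G_def by (rule convergent_LIMSEQ_iff[THEN iffD1])
      fix k
      have sk: "summable (\<lambda>n. \<bar>d (n + k) x\<bar>)" using s by (subst summable_iff_shift)
      have telk: "f (n + k) x - f k x = (\<Sum>i<n. d (i + k) x)" for n by (induction n) (auto simp: d_def)
      have "(\<lambda>n. \<Sum>i<n. d (i + k) x) \<longlonglongrightarrow> G x - f k x"
        unfolding telk[symmetric] using l by (intro tendsto_diff tendsto_const LIMSEQ_ignore_initial_segment)
      then have "G x - f k x = (\<Sum>n. d (n + k) x)" by (intro sums_unique) (simp add: sums_def)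
      then have "\<bar>f k x - G x\<bar> \<le> (\<Sum>n. \<bar>d (n + k) x\<bar>)" using summable_rabs[OF sk] by (simp add: abs_minus_commute)
      then have "ennreal \<bar>f k x - G x\<bar> \<le> ennreal (\<Sum>n. \<bar>d (n + k) x\<bar>)" by (rule ennreal_leI)
      also have "\<dots> = (\<Sum>n. ennreal \<bar>d (n + k) x\<bar>)" by (rule suminf_ennreal_eq[symmetric, OF _ summable_sums[OF sk]]) simp
      finally show "ennreal \<bar>f k x - G x\<bar> \<le> (\<Sum>n. ennreal \<bar>d (n + k) x\<bar>)" .
    qed
  qed
  have L1: "(\<integral>\<^sup>+ x. ennreal \<bar>f k x - G x\<bar> * indicator S x \<partial>lborel) \<le> ennreal (A * (V + 1) * \<rho> ^ k * (1 / (1 - \<rho>)))" for k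
  proof -
    have "(\<integral>\<^sup>+ x. ennreal \<bar>f k x - G x\<bar> * indicator S x \<partial>lborel) \<le> (\<integral>\<^sup>+ x. (\<Sum>n. ennreal \<bar>d (n + k) x\<bar> * indicator S x) \<partial>lborel)"
      using lim by (intro nn_integral_mono_AE) (auto simp: indicator_def)
    also have "\<dots> = (\<Sum>n. \<integral>\<^sup>+ x. ennreal \<bar>d (n + k) x\<bar> * indicator S x \<partial>lborel)"
      by (rule nn_integral_suminf) measurable
    finally show ?thesis using tail[of k] by (rule order_trans)
  qed
  have "(\<lambda>k. A * (V + 1) * \<rho> ^ k * (1 / (1 - \<rho>))) \<longlonglongrightarrow> A * (V + 1) * 0 * (1 / (1 - \<rho>))"
    using A by (intro tendsto_intros LIMSEQ_realpow_zero) auto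
  then have "(\<lambda>k. ennreal (A * (V + 1) * \<rho> ^ k * (1 / (1 - \<rho>)))) \<longlonglongrightarrow> ennreal 0" by (intro tendsto_ennrealI) simp
  then show "(\<lambda>n. \<integral>\<^sup>+ x. ennreal \<bar>f n x - lim (\<lambda>n. f n x)\<bar> * indicator S x \<partial>lborel) \<longlonglongrightarrow> 0"
    unfolding G_def[symmetric] by (intro tendsto_0_of_le[OF L1]) simp
  have part: "(\<integral>\<^sup>+ x. ennreal (\<bar>f n x\<bar> powr q) * indicator S x \<partial>lborel) \<le> ennreal ((F + (\<Sum>i<n. A * \<rho> ^ i)) powr q)" for n
  proof (induction n)
    case (Suc n)
    have "0 < F + (\<Sum>i<n. A * \<rho> ^ i)" using A by (intro add_pos_nonneg sum_nonneg) auto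
    from nn_integral_powr_add[OF _ _ this _ q Suc step[of n]] A
    show ?case by (simp add: add.assoc)
  qed (use f0 in simp)
  have bd: "(\<integral>\<^sup>+ x. ennreal (\<bar>f n x\<bar> powr q) * indicator S x \<partial>lborel) \<le> ennreal ((F + A / (1 - \<rho>)) powr q)" for n
  proof -
    have s: "(\<lambda>i. A * \<rho> ^ i) sums (A * (1 / (1 - \<rho>)))" using A by (intro sums_mult geometric_sums) auto
    have "(\<Sum>i<n. A * \<rho> ^ i) \<le> A * (1 / (1 - \<rho>))"
      using sum_le_suminf[OF sums_summable[OF s], of "{..<n}"] sums_unique[OF s] A by simp
    moreover have "0 \<le> (\<Sum>i<n. A * \<rho> ^ i)" using A by (intro sum_nonneg) auto
    ultimately have "(F + (\<Sum>i<n. A * \<rho> ^ i)) powr q \<le> (F + A / (1 - \<rho>)) powr q" using A q by (intro powr_mono2) auto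
    from order_trans[OF part ennreal_leI[OF this]] show ?thesis .
  qed
  have fatou: "AE x in lborel. ennreal (\<bar>G x\<bar> powr q) * indicator S x \<le> liminf (\<lambda>n. ennreal (\<bar>f n x\<bar> powr q) * indicator S x)"
    using lim
  proof (rule AE_mp, intro AE_I2 impI)
    fix x assume l: "x \<in> S \<longrightarrow> (\<lambda>n. f n x) \<longlonglongrightarrow> G x \<and> (\<forall>k. ennreal \<bar>f k x - G x\<bar> \<le> (\<Sum>n. ennreal \<bar>d (n + k) x\<bar>))"
    show "ennreal (\<bar>G x\<bar> powr q) * indicator S x \<le> liminf (\<lambda>n. ennreal (\<bar>f n x\<bar> powr q) * indicator S x)"
    proof (cases "x \<in> S")
      case True
      then have "(\<lambda>n. f n x) \<longlonglongrightarrow> G x" using l by blast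
      from liminf_ennreal_powr[OF this, of q] show ?thesis using True q by simp
    qed (simp add: Liminf_const)
  qed
  have "(\<integral>\<^sup>+ x. ennreal (\<bar>G x\<bar> powr q) * indicator S x \<partial>lborel) \<le> (\<integral>\<^sup>+ x. liminf (\<lambda>n. ennreal (\<bar>f n x\<bar> powr q) * indicator S x) \<partial>lborel)"
    by (rule nn_integral_mono_AE[OF fatou])
  also have "\<dots> \<le> liminf (\<lambda>n. \<integral>\<^sup>+ x. ennreal (\<bar>f n x\<bar> powr q) * indicator S x \<partial>lborel)"
    by (rule nn_integral_liminf) measurable
  also have "\<dots> \<le> liminf (\<lambda>_. ennreal ((F + A / (1 - \<rho>)) powr q))"
    by (intro Liminf_mono always_eventually allI bd)
  also have "\<dots> = ennreal ((F + A / (1 - \<rho>)) powr q)" by (simp add: Liminf_const)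
  finally show "(\<integral>\<^sup>+ x. ennreal (\<bar>lim (\<lambda>n. f n x)\<bar> powr q) * indicator S x \<partial>lborel) \<le> ennreal ((F + A / (1 - \<rho>)) powr q)"
    unfolding G_def .
qed

section \<open>Weak gradients\<close>

definition loc_integrable :: "'a::euclidean_space set \<Rightarrow> ('a \<Rightarrow> real) \<Rightarrow> bool" where
  "loc_integrable \<Omega> f \<longleftrightarrow> (\<forall>K. compact K \<and> K \<subseteq> \<Omega> \<longrightarrow> (\<integral>\<^sup>+ x. ennreal \<bar>f x\<bar> * indicator K x \<partial>lborel) < \<infinity>)"

lemma integrable_mult_compact_support:
  fixes f \<phi> :: "'a::euclidean_space \<Rightarrow> real"
  assumes [measurable]: "f \<in> borel_measurable borel" "\<phi> \<in> borel_measurable borel"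
    and f: "loc_integrable \<Omega> f" and K: "compact K" "K \<subseteq> \<Omega>" and B: "\<And>x. \<bar>\<phi> x\<bar> \<le> B" "\<And>x. x \<notin> K \<Longrightarrow> \<phi> x = 0"
  shows "integrable lborel (\<lambda>x. \<phi> x * f x)"
proof (rule integrableI_bounded)
  have [measurable]: "K \<in> sets borel" using K by (simp add: borel_compact)
  have "(\<integral>\<^sup>+ x. ennreal (norm (\<phi> x * f x)) \<partial>lborel) \<le> (\<integral>\<^sup>+ x. ennreal B * (ennreal \<bar>f x\<bar> * indicator K x) \<partial>lborel)"
  proof (intro nn_integral_mono)
    fix x
    show "ennreal (norm (\<phi> x * f x)) \<le> ennreal B * (ennreal \<bar>f x\<bar> * indicator K x)"
      using B(1)[of x] B(2)[of x] by (cases "x \<in> K") (auto simp: abs_mult ennreal_mult'[symmetric] ennreal_mult''[symmetric] intro!: ennreal_leI mult_right_mono)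
  qed
  also have "\<dots> = ennreal B * (\<integral>\<^sup>+ x. ennreal \<bar>f x\<bar> * indicator K x \<partial>lborel)" by (rule nn_integral_cmult) measurable
  also have "\<dots> < \<infinity>" using f K unfolding loc_integrable_def by (auto simp: ennreal_mult_less_top)
  finally show "(\<integral>\<^sup>+ x. ennreal (norm (\<phi> x * f x)) \<partial>lborel) < \<infinity>" .
qed measurable

text \<open>The complement of the support set is open and the function vanishes on it, so its
  gradient vanishes there as well. The Lipschitz bound is the mean value inequality on the whole
  space.\<close>

lemma test_fun_bounded:
  assumes "test_fun \<Omega> \<phi> \<phi>'"
  obtains K B where "compact K" "K \<subseteq> \<Omega>" "0 \<le> B" "\<And>x. x \<notin> K \<Longrightarrow> \<phi> x = 0" "\<And>x. x \<notin> K \<Longrightarrow> \<phi>' x = 0"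
    "\<And>x. \<bar>\<phi> x\<bar> \<le> B" "\<And>x. norm (\<phi>' x) \<le> B" "\<And>x y. \<bar>\<phi> x - \<phi> y\<bar> \<le> B * norm (x - y)"
    "continuous_on UNIV \<phi>" "continuous_on UNIV \<phi>'"
proof -
  obtain K where K: "compact K" "K \<subseteq> \<Omega>" "\<And>x. x \<notin> K \<Longrightarrow> \<phi> x = 0"
    and d: "\<And>x. (\<phi> has_derivative (\<lambda>h. \<phi>' x \<bullet> h)) (at x)" and c: "continuous_on UNIV \<phi>'"
    using assms unfolding test_fun_def by blast
  have c0: "continuous_on UNIV \<phi>" using d by (meson has_derivative_continuous continuous_at_imp_continuous_on)
  have 0: "\<phi>' x = 0" if "x \<notin> K" for x
  proof -
    have "open (- K)" using K by (simp add: compact_imp_closed open_Compl)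
    then have "(\<phi> has_derivative (\<lambda>h. 0)) (at x)"
      by (rule has_derivative_transform_within_open[OF has_derivative_const[of 0]]) (use that K in auto)
    from has_derivative_unique[OF d this] have "\<phi>' x \<bullet> \<phi>' x = 0" by metis
    then show ?thesis by simp
  qed
  obtain B1 where B1: "\<And>x. x \<in> K \<Longrightarrow> norm (\<phi> x) \<le> B1"
    using compact_imp_bounded[OF compact_continuous_image[OF continuous_on_subset[OF c0] K(1)]] by (auto simp: bounded_iff)
  obtain B2 where B2: "\<And>x. x \<in> K \<Longrightarrow> norm (\<phi>' x) \<le> B2"
    using compact_imp_bounded[OF compact_continuous_image[OF continuous_on_subset[OF c] K(1)]] by (auto simp: bounded_iff)
  define B where "B = \<bar>B1\<bar> + \<bar>B2\<bar>"
  have b: "\<bar>\<phi> x\<bar> \<le> B" "norm (\<phi>' x) \<le> B" for x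
  proof -
    show "\<bar>\<phi> x\<bar> \<le> B" using B1[of x] K(3)[of x] by (cases "x \<in> K") (auto simp: B_def)
    show "norm (\<phi>' x) \<le> B" using B2[of x] 0[of x] by (cases "x \<in> K") (auto simp: B_def)
  qed
  have "\<bar>\<phi> x - \<phi> y\<bar> \<le> B * norm (x - y)" for x y
  proof -
    have "onorm (\<lambda>h. \<phi>' z \<bullet> h) \<le> B" for z
    proof (rule onorm_le)
      fix h
      have "\<bar>\<phi>' z \<bullet> h\<bar> \<le> norm (\<phi>' z) * norm h" by (rule Cauchy_Schwarz_ineq2)
      also have "\<dots> \<le> B * norm h" by (intro mult_right_mono b) auto
      finally show "norm (\<phi>' z \<bullet> h) \<le> B * norm h" by simp
    qed
    then have "norm (\<phi> x - \<phi> y) \<le> B * norm (x - y)"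
      by (intro differentiable_bound[of UNIV \<phi> "\<lambda>x h. \<phi>' x \<bullet> h"]) (auto intro: d)
    then show ?thesis by simp
  qed
  then show ?thesis using that[of K B] K 0 b c0 c by (auto simp: B_def)
qed

text \<open>Discrete integration by parts: a change of variables moves the difference quotient from
  u to the test function. One side converges because the quotients of u converge in L^1 on the
  support, the other by dominated convergence, as the quotients of a test function are uniformly
  bounded.\<close>

lemma weak_derivative_of_quotients:
  fixes u G :: "'a::euclidean_space \<Rightarrow> real"
  assumes [measurable]: "u \<in> borel_measurable borel" "G \<in> borel_measurable borel"
    and u: "loc_integrable UNIV u" and G: "loc_integrable \<Omega> G"
    and conv: "\<And>K. compact K \<Longrightarrow> K \<subseteq> \<Omega> \<Longrightarrow>
      (\<lambda>n. \<integral>\<^sup>+ x. ennreal \<bar>2 ^ n * (u (x + (1 / 2) ^ n *\<^sub>R e) - u x) - G x\<bar> * indicator K x \<partial>lborel) \<longlonglongrightarrow> 0"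
    and e: "norm e = 1" and t: "test_fun \<Omega> \<phi> \<phi>'"
  shows "(\<integral> x. u x * (\<phi>' x \<bullet> e) \<partial>lborel) = - (\<integral> x. \<phi> x * G x \<partial>lborel)"
proof -
  obtain K B where K: "compact K" "K \<subseteq> \<Omega>" "0 \<le> B" "\<And>x. x \<notin> K \<Longrightarrow> \<phi> x = 0" "\<And>x. x \<notin> K \<Longrightarrow> \<phi>' x = 0"
    "\<And>x. \<bar>\<phi> x\<bar> \<le> B" "\<And>x. norm (\<phi>' x) \<le> B" "\<And>x y. \<bar>\<phi> x - \<phi> y\<bar> \<le> B * norm (x - y)"
    and c: "continuous_on UNIV \<phi>" "continuous_on UNIV \<phi>'"
    using test_fun_bounded[OF t] by blast
  have [measurable]: "\<phi> \<in> borel_measurable borel" "\<phi>' \<in> borel_measurable borel" "K \<in> sets borel"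
    using c K by (auto intro: borel_measurable_continuous_onI borel_compact)
  define h where "h n = (1 / 2) ^ n *\<^sub>R e" for n
  define D where "D n x = 2 ^ n * (u (x + h n) - u x)" for n x
  have hn: "norm (h n) = (1 / 2) ^ n" "norm (h n) \<le> 1" for n using e by (auto simp: h_def power_le_one)
  have mD[measurable]: "D n \<in> borel_measurable borel" for n unfolding D_def[abs_def] by measurable
  obtain b where b: "\<And>x. x \<in> K \<Longrightarrow> norm x \<le> b" using compact_imp_bounded[OF K(1)] by (auto simp: bounded_iff)
  \<comment> \<open>All steps have norm at most 1, so this ball contains the supports of all
    translates. It may leave \<open>\<Omega>\<close>, hence local integrability of u on the whole
    space.\<close>
  define K' where "K' = cball (0::'a) (b + 1)"
  have K': "compact K'" by (simp add: K'_def)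
  have inK': "x \<in> K'" if "x - h n \<in> K \<or> x \<in> K" for x n
    using b[of x] b[of "x - h n"] that norm_triangle_ineq[of "x - h n" "h n"] hn(2)[of n] by (auto simp: K'_def)
  define \<psi> where "\<psi> n x = 2 ^ n * (\<phi> (x - h n) - \<phi> x)" for n x
  have [measurable]: "\<psi> n \<in> borel_measurable borel" for n unfolding \<psi>_def[abs_def] by measurable
  have \<psi>b: "\<bar>\<psi> n x\<bar> \<le> B" for n x
  proof -
    have "\<bar>\<psi> n x\<bar> \<le> 2 ^ n * (B * (1 / 2) ^ n)"
      unfolding \<psi>_def using K(8)[of "x - h n" x] hn(1)[of n] by (simp add: abs_mult)
    then show ?thesis by (simp add: power_one_over)
  qed
  have \<psi>0: "\<psi> n x = 0" if "x \<notin> K'" for n x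
  proof -
    have "\<phi> (x - h n) = 0" "\<phi> x = 0" using that inK'[of x n] by (auto intro: K(4))
    then show ?thesis by (simp add: \<psi>_def)
  qed
  have int_u: "integrable lborel (\<lambda>x. \<phi> (x - h n) * u x)" for n
    by (rule integrable_mult_compact_support[OF _ _ u K' _ K(6)]) (use inK' K(4) in auto)
  have int_u0: "integrable lborel (\<lambda>x. \<phi> x * u x)"
    by (rule integrable_mult_compact_support[OF _ _ u K(1) _ K(6,4)]) auto
  have shift: "integrable lborel (\<lambda>x. \<phi> x * u (x + h n)) \<and> (\<integral> x. \<phi> x * u (x + h n) \<partial>lborel) = (\<integral> x. \<phi> (x - h n) * u x \<partial>lborel)" for n
  proof -
    let ?g = "\<lambda>x. \<phi> (x - h n) * u x"
    have eq: "(\<lambda>x. \<phi> x * u (x + h n)) = (\<lambda>x. ?g (h n + x))" by (simp add: add.commute)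
    have "integrable (distr lborel borel ((+) (h n))) ?g" using int_u by (simp add: lborel_distr_plus)
    then have "integrable lborel (\<lambda>x. ?g (h n + x))" by (subst (asm) integrable_distr_eq) auto
    moreover have "(\<integral> x. ?g x \<partial>lborel) = (\<integral> x. ?g x \<partial>distr lborel borel ((+) (h n)))" by (simp add: lborel_distr_plus)
    then have "(\<integral> x. ?g x \<partial>lborel) = (\<integral> x. ?g (h n + x) \<partial>lborel)" by (subst (asm) integral_distr) auto
    ultimately show ?thesis unfolding eq by simp
  qed
  have eqD: "(\<lambda>x. \<phi> x * D n x) = (\<lambda>x. 2 ^ n * (\<phi> x * u (x + h n) - \<phi> x * u x))" for n
    by (simp add: D_def algebra_simps)
  have int_D: "integrable lborel (\<lambda>x. \<phi> x * D n x)" for n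
    unfolding eqD using shift int_u0 by (intro integrable_mult_right Bochner_Integration.integrable_diff) auto
  have "(\<integral> x. \<phi> x * D n x \<partial>lborel) = (\<integral> x. \<psi> n x * u x \<partial>lborel)" for n
  proof -
    have "(\<integral> x. \<phi> x * D n x \<partial>lborel) = 2 ^ n * ((\<integral> x. \<phi> (x - h n) * u x \<partial>lborel) - (\<integral> x. \<phi> x * u x \<partial>lborel))"
      unfolding eqD using shift[of n] int_u0 by (simp add: Bochner_Integration.integral_diff)
    also have "\<dots> = (\<integral> x. 2 ^ n * (\<phi> (x - h n) * u x - \<phi> x * u x) \<partial>lborel)"
      using int_u[of n] int_u0 by (simp add: Bochner_Integration.integral_diff)
    finally show ?thesis by (simp add: \<psi>_def algebra_simps)
  qed
  moreover have "(\<lambda>n. \<integral> x. \<phi> x * D n x \<partial>lborel) \<longlonglongrightarrow> (\<integral> x. \<phi> x * G x \<partial>lborel)"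
  proof (rule tendsto_L1_int[OF int_D])
    show "integrable lborel (\<lambda>x. \<phi> x * G x)" by (rule integrable_mult_compact_support[OF _ _ G K(1,2,6,4)]) auto
    have lim0: "(\<lambda>n. ennreal B * (\<integral>\<^sup>+ x. ennreal \<bar>D n x - G x\<bar> * indicator K x \<partial>lborel)) \<longlonglongrightarrow> ennreal B * 0"
      using conv[OF K(1,2)] unfolding D_def h_def by (intro ennreal_tendsto_cmult) auto
    have le: "(\<integral>\<^sup>+ x. ennreal (norm (\<phi> x * D n x - \<phi> x * G x)) \<partial>lborel) \<le> ennreal B * (\<integral>\<^sup>+ x. ennreal \<bar>D n x - G x\<bar> * indicator K x \<partial>lborel)" for n
    proof -
      have "(\<integral>\<^sup>+ x. ennreal (norm (\<phi> x * D n x - \<phi> x * G x)) \<partial>lborel) \<le> (\<integral>\<^sup>+ x. ennreal B * (ennreal \<bar>D n x - G x\<bar> * indicator K x) \<partial>lborel)"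
      proof (intro nn_integral_mono)
        fix x
        have "norm (\<phi> x * D n x - \<phi> x * G x) = \<bar>\<phi> x\<bar> * \<bar>D n x - G x\<bar>" by (simp add: abs_mult right_diff_distrib[symmetric])
        then show "ennreal (norm (\<phi> x * D n x - \<phi> x * G x)) \<le> ennreal B * (ennreal \<bar>D n x - G x\<bar> * indicator K x)"
          using K(4)[of x] K(6)[of x] by (cases "x \<in> K") (auto simp: ennreal_mult''[symmetric] intro!: ennreal_leI mult_right_mono)
      qed
      also have "\<dots> = ennreal B * (\<integral>\<^sup>+ x. ennreal \<bar>D n x - G x\<bar> * indicator K x \<partial>lborel)" by (rule nn_integral_cmult) measurable
      finally show ?thesis .
    qed
    show "(\<lambda>n. \<integral>\<^sup>+ x. ennreal (norm (\<phi> x * D n x - \<phi> x * G x)) \<partial>lborel) \<longlonglongrightarrow> 0"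
      by (rule tendsto_0_of_le[OF le]) (use lim0 in simp)
  qed
  ultimately have 1: "(\<lambda>n. \<integral> x. \<psi> n x * u x \<partial>lborel) \<longlonglongrightarrow> (\<integral> x. \<phi> x * G x \<partial>lborel)" by simp
  have 2: "(\<lambda>n. \<integral> x. \<psi> n x * u x \<partial>lborel) \<longlonglongrightarrow> (\<integral> x. - (\<phi>' x \<bullet> e) * u x \<partial>lborel)"
  proof (rule integral_dominated_convergence[where w = "\<lambda>x. B * (indicator K' x * \<bar>u x\<bar>)"])
    have [measurable]: "K' \<in> sets borel" using K' by (rule borel_compact)
    show "integrable lborel (\<lambda>x. B * (indicator K' x * \<bar>u x\<bar>))"
    proof (rule integrable_mult_right, rule integrableI_bounded)
      have "(\<integral>\<^sup>+ x. ennreal (norm (indicator K' x * \<bar>u x\<bar>)) \<partial>lborel) = (\<integral>\<^sup>+ x. ennreal \<bar>u x\<bar> * indicator K' x \<partial>lborel)"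
        by (intro nn_integral_cong) (auto simp: indicator_def)
      then show "(\<integral>\<^sup>+ x. ennreal (norm (indicator K' x * \<bar>u x\<bar>)) \<partial>lborel) < \<infinity>" using u K' by (auto simp: loc_integrable_def)
    qed measurable
    show "AE x in lborel. norm (\<psi> n x * u x) \<le> B * (indicator K' x * \<bar>u x\<bar>)" for n
    proof (rule AE_I2)
      fix x
      show "norm (\<psi> n x * u x) \<le> B * (indicator K' x * \<bar>u x\<bar>)"
        using mult_right_mono[OF \<psi>b[of n x], of "\<bar>u x\<bar>"] \<psi>0[of x n] by (cases "x \<in> K'") (simp_all add: abs_mult)
    qed
    have "(\<lambda>n. \<psi> n x) \<longlonglongrightarrow> - (\<phi>' x \<bullet> e)" for x
    proof -
      \<comment> \<open>The sign in the limit arises because the translation has moved to the test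
        function with the opposite sign, so it is differentiated in the direction - e.\<close>
      have eq: "(\<lambda>s. \<phi>' x \<bullet> (s *\<^sub>R (- e))) = (*) (- (\<phi>' x \<bullet> e))" by (auto simp: mult.commute)
      have "(\<phi> has_derivative (\<lambda>h. \<phi>' x \<bullet> h)) (at (x + 0 *\<^sub>R (- e)))" using t by (simp add: test_fun_def)
      moreover have "((\<lambda>s. x + s *\<^sub>R (- e)) has_derivative (\<lambda>s. s *\<^sub>R (- e))) (at 0)" by (auto intro!: derivative_eq_intros)
      ultimately have "((\<lambda>s. \<phi> (x + s *\<^sub>R (- e))) has_derivative (\<lambda>s. \<phi>' x \<bullet> (s *\<^sub>R (- e)))) (at 0)"
        by (rule has_derivative_compose[rotated])
      then have "((\<lambda>s. \<phi> (x + s *\<^sub>R (- e))) has_derivative (*) (- (\<phi>' x \<bullet> e))) (at 0)" unfolding eq .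
      then have "((\<lambda>s. \<phi> (x + s *\<^sub>R (- e))) has_real_derivative - (\<phi>' x \<bullet> e)) (at 0)"
        unfolding has_field_derivative_def by simp
      then have "((\<lambda>s. (\<phi> (x + s *\<^sub>R (- e)) - \<phi> x) / s) \<longlongrightarrow> - (\<phi>' x \<bullet> e)) (at 0)"
        by (simp add: DERIV_def)
      moreover have "filterlim (\<lambda>n. (1 / 2) ^ n :: real) (at 0) sequentially"
        unfolding filterlim_at by (auto intro!: LIMSEQ_realpow_zero)
      ultimately have "(\<lambda>n. (\<phi> (x + ((1 / 2) ^ n) *\<^sub>R (- e)) - \<phi> x) / (1 / 2) ^ n) \<longlonglongrightarrow> - (\<phi>' x \<bullet> e)"
        by (rule filterlim_compose)
      then show ?thesis by (simp add: \<psi>_def h_def power_one_over field_simps)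
    qed
    then show "AE x in lborel. (\<lambda>n. \<psi> n x * u x) \<longlonglongrightarrow> - (\<phi>' x \<bullet> e) * u x" by (intro AE_I2 tendsto_mult_right)
  qed measurable
  from LIMSEQ_unique[OF 1 2] show ?thesis by (simp add: mult.commute)
qed

section \<open>Uniqueness of weak gradients\<close>

definition C1 :: "('a::euclidean_space \<Rightarrow> real) \<Rightarrow> ('a \<Rightarrow> 'a) \<Rightarrow> bool" where
  "C1 f f' \<longleftrightarrow> (\<forall>x. (f has_derivative (\<lambda>h. f' x \<bullet> h)) (at x)) \<and> continuous_on UNIV f'"

lemma C1_continuous: "C1 f f' \<Longrightarrow> continuous_on UNIV f"
  unfolding C1_def by (meson has_derivative_continuous continuous_at_imp_continuous_on)

lemma C1_compose:
  assumes f: "C1 f f'" and g: "\<And>x. (g has_real_derivative g' (f x)) (at (f x))" and c: "continuous_on UNIV (\<lambda>x. g' (f x))"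
  shows "C1 (\<lambda>x. g (f x)) (\<lambda>x. g' (f x) *\<^sub>R f' x)"
  unfolding C1_def
proof (intro conjI allI)
  fix x
  have "((\<lambda>x. g (f x)) has_derivative (\<lambda>h. g' (f x) * (f' x \<bullet> h))) (at x)"
    using f has_derivative_compose[of f "\<lambda>h. f' x \<bullet> h" x UNIV g "(*) (g' (f x))"] g[of x]
    by (simp add: C1_def has_field_derivative_def)
  then show "((\<lambda>x. g (f x)) has_derivative (\<lambda>h. (g' (f x) *\<^sub>R f' x) \<bullet> h)) (at x)" by simp
  show "continuous_on UNIV (\<lambda>x. g' (f x) *\<^sub>R f' x)"
    using f c by (intro continuous_intros) (auto simp: C1_def)
qed

lemma C1_mult:
  assumes f: "C1 f f'" and g: "C1 g g'"
  shows "C1 (\<lambda>x. f x * g x) (\<lambda>x. f x *\<^sub>R g' x + g x *\<^sub>R f' x)"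
  unfolding C1_def
proof (intro conjI allI)
  fix x
  have "((\<lambda>x. f x * g x) has_derivative (\<lambda>h. f x * (g' x \<bullet> h) + (f' x \<bullet> h) * g x)) (at x)"
    using f g by (intro has_derivative_mult) (auto simp: C1_def)
  then show "((\<lambda>x. f x * g x) has_derivative (\<lambda>h. (f x *\<^sub>R g' x + g x *\<^sub>R f' x) \<bullet> h)) (at x)"
    by (simp add: inner_add_left mult.commute)
  show "continuous_on UNIV (\<lambda>x. f x *\<^sub>R g' x + g x *\<^sub>R f' x)"
    using f g C1_continuous[OF f] C1_continuous[OF g] by (intro continuous_intros) (auto simp: C1_def)
qed

lemma C1_prod:
  fixes f :: "'i \<Rightarrow> 'a::euclidean_space \<Rightarrow> real"
  assumes "finite I" "\<And>i. i \<in> I \<Longrightarrow> \<exists>f'. C1 (f i) f'"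
  shows "\<exists>F'. C1 (\<lambda>x. \<Prod>i\<in>I. f i x) F'"
  using assms
proof (induction I rule: finite_induct)
  case empty
  have "C1 (\<lambda>x. 1) (\<lambda>x. 0 :: 'a)" by (simp add: C1_def)
  then show ?case by auto
next
  case (insert i I)
  obtain f' where f': "C1 (f i) f'" using insert.prems[of i] by auto
  obtain F' where F': "C1 (\<lambda>x. \<Prod>i\<in>I. f i x) F'" using insert.IH insert.prems by auto
  have "C1 (\<lambda>x. \<Prod>i\<in>insert i I. f i x) (\<lambda>x. f i x *\<^sub>R F' x + (\<Prod>i\<in>I. f i x) *\<^sub>R f' x)"
    using C1_mult[OF f' F'] insert.hyps by simp
  then show ?case by blast
qed

text \<open>Squaring removes the corner of the positive part at 0, which gives the continuous
  differentiability that \<open>test_fun\<close> asks for.\<close>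

lemma max_0_sq_has_derivative: "((\<lambda>t. (max 0 t)\<^sup>2) has_real_derivative 2 * max 0 t) (at t)"
proof -
  consider "t < 0" | "t = 0" | "0 < t" by linarith
  then show ?thesis
  proof cases
    case 1
    have "((\<lambda>t. (max 0 t)\<^sup>2) has_real_derivative 0) (at t)"
      by (rule has_field_derivative_transform_within_open[where S = "{..<0}", OF DERIV_const[of 0]]) (use 1 in auto)
    then show ?thesis using 1 by simp
  next
    case 2
    have "((\<lambda>h. (max 0 h)\<^sup>2 / h) \<longlongrightarrow> 0) (at (0::real))"
    proof (rule Lim_null_comparison)
      show "\<forall>\<^sub>F h in at 0. norm ((max 0 h)\<^sup>2 / h) \<le> \<bar>h\<bar>"
        by (rule always_eventually) (auto simp: max_def power2_eq_square)
      show "((\<lambda>h::real. \<bar>h\<bar>) \<longlongrightarrow> 0) (at 0)" by (auto intro: tendsto_eq_intros)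
    qed
    then show ?thesis using 2 by (simp add: DERIV_def)
  next
    case 3
    have "((\<lambda>t. t\<^sup>2) has_real_derivative 2 * t) (at t)" by (auto intro!: derivative_eq_intros)
    then have "((\<lambda>t. (max 0 t)\<^sup>2) has_real_derivative 2 * t) (at t)"
      by (rule has_field_derivative_transform_within_open[where S = "{0<..}"]) (use 3 in auto)
    then show ?thesis using 3 by simp
  qed
qed

text \<open>Each factor is the squared positive part of a parabola in one coordinate, positive
  exactly between its zeros; the product is positive exactly on the open box.\<close>

lemma C1_box_function:
  fixes a b :: "'a::euclidean_space"
  assumes ab: "\<And>i. i \<in> Basis \<Longrightarrow> a \<bullet> i < b \<bullet> i"
  obtains f f' where "C1 f f'" "\<And>x. 0 \<le> f x" "\<And>x. 0 < f x \<longleftrightarrow> x \<in> box a b"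
proof -
  define g where "g i x = (x \<bullet> i - a \<bullet> i) * (b \<bullet> i - x \<bullet> i)" for i x :: 'a
  define f where "f x = (\<Prod>i\<in>Basis. (max 0 (g i x))\<^sup>2)" for x
  have "\<exists>f'. C1 (\<lambda>x. (max 0 (g i x))\<^sup>2) f'" if "i \<in> Basis" for i
  proof -
    have g: "C1 (g i) (\<lambda>x. ((b \<bullet> i - x \<bullet> i) - (x \<bullet> i - a \<bullet> i)) *\<^sub>R i)"
      unfolding C1_def g_def[abs_def]
      by (auto intro!: derivative_eq_intros continuous_intros simp: algebra_simps inner_commute)
    have "continuous_on UNIV (\<lambda>x. 2 * max 0 (g i x))"
      by (intro continuous_intros C1_continuous[OF g])
    from C1_compose[OF g max_0_sq_has_derivative this] show ?thesis by blast
  qed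
  then obtain f' where f': "C1 f f'" using C1_prod[of Basis "\<lambda>i x. (max 0 (g i x))\<^sup>2"] unfolding f_def[abs_def] by auto
  have "0 \<le> f x" for x unfolding f_def by (intro prod_nonneg) auto
  moreover have "0 < f x \<longleftrightarrow> x \<in> box a b" for x
  proof -
    have pos: "0 < g i x \<longleftrightarrow> a \<bullet> i < x \<bullet> i \<and> x \<bullet> i < b \<bullet> i" if "i \<in> Basis" for i
      using ab[OF that] unfolding g_def by (auto simp: zero_less_mult_iff)
    have "f x \<noteq> 0 \<longleftrightarrow> (\<forall>i\<in>Basis. 0 < g i x)" unfolding f_def by (auto simp: max_def)
    then show ?thesis using \<open>0 \<le> f x\<close> pos by (auto simp: mem_box)
  qed
  ultimately show ?thesis using that[OF f'] by blast
qed

text \<open>The functions \<open>n f / (1 + n f)\<close> increase to the indicator of \<open>{f > 0}\<close>.\<close>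
lemma integral_box_eq_0:
  fixes F :: "'a::euclidean_space \<Rightarrow> 'a"
  assumes ab: "\<And>i. i \<in> Basis \<Longrightarrow> a \<bullet> i < b \<bullet> i" and F: "integrable lebesgue F"
    and 0: "\<And>\<phi> \<phi>'. test_fun (cbox a b) \<phi> \<phi>' \<Longrightarrow> (\<integral> x. \<phi> x *\<^sub>R F x \<partial>lebesgue) = 0"
  shows "(\<integral> x. indicator (box a b) x *\<^sub>R F x \<partial>lebesgue) = 0"
proof -
  obtain f f' where f: "C1 f f'" "\<And>x. 0 \<le> f x" "\<And>x. 0 < f x \<longleftrightarrow> x \<in> box a b"
    using C1_box_function[OF ab] by blast
  define \<phi> where "\<phi> n x = real n * f x / (1 + real n * f x)" for n :: nat and x
  have nz: "1 + real n * f x > 0" for n x using f(2)[of x] by (simp add: add_pos_nonneg)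
  have f0: "f x = 0" if "x \<notin> box a b" for x using f(2)[of x] f(3)[of x] that by linarith
  have tf: "\<exists>\<phi>'. test_fun (cbox a b) (\<phi> n) \<phi>'" for n
  proof -
    have "C1 (\<phi> n) (\<lambda>x. (real n / (1 + real n * f x)\<^sup>2) *\<^sub>R f' x)"
      unfolding \<phi>_def[abs_def]
    proof (rule C1_compose[OF f(1)])
      fix x
      show "((\<lambda>s. real n * s / (1 + real n * s)) has_real_derivative real n / (1 + real n * f x)\<^sup>2) (at (f x))"
        using nz[of n x] by (auto intro!: derivative_eq_intros simp: power2_eq_square algebra_simps)
      show "continuous_on UNIV (\<lambda>x. real n / (1 + real n * f x)\<^sup>2)"
        using nz[of n] by (intro continuous_intros C1_continuous[OF f(1)]) (metis less_irrefl power_not_zero)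
    qed
    moreover have "\<phi> n x = 0" if "x \<notin> cbox a b" for x
      using f0[of x] that box_subset_cbox[of a b] by (auto simp: \<phi>_def)
    ultimately show ?thesis unfolding test_fun_def C1_def
      by (intro exI[of _ "\<lambda>x. (real n / (1 + real n * f x)\<^sup>2) *\<^sub>R f' x"] conjI exI[of _ "cbox a b"]) auto
  qed
  have m: "\<phi> n \<in> borel_measurable lebesgue" for n
  proof -
    have "f \<in> borel_measurable borel" using C1_continuous[OF f(1)] by (rule borel_measurable_continuous_onI)
    then have "\<phi> n \<in> borel_measurable borel" unfolding \<phi>_def[abs_def] by measurable
    then show ?thesis by (simp add: measurable_completion)
  qed
  have bd: "\<bar>\<phi> n x\<bar> \<le> 1" for n x
    using nz[of n x] f(2)[of x] by (simp add: \<phi>_def abs_mult)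
  have "(\<lambda>n. \<integral> x. \<phi> n x *\<^sub>R F x \<partial>lebesgue) \<longlonglongrightarrow> (\<integral> x. indicator (box a b) x *\<^sub>R F x \<partial>lebesgue)"
  proof (rule integral_dominated_convergence[where w = "\<lambda>x. norm (F x)"])
    have [measurable]: "F \<in> borel_measurable lebesgue" using F by simp
    show "(\<lambda>x. indicator (box a b) x *\<^sub>R F x) \<in> borel_measurable lebesgue"
      by (intro borel_measurable_scaleR borel_measurable_indicator) auto
    show "(\<lambda>x. \<phi> n x *\<^sub>R F x) \<in> borel_measurable lebesgue" for n
      by (intro borel_measurable_scaleR m) auto
    show "integrable lebesgue (\<lambda>x. norm (F x))" using F by simp
    show "AE x in lebesgue. norm (\<phi> n x *\<^sub>R F x) \<le> norm (F x)" for n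
      using bd mult_right_mono[OF bd norm_ge_zero] by (intro AE_I2) auto
    have "(\<lambda>n. \<phi> n x) \<longlonglongrightarrow> indicator (box a b) x" for x
    proof (cases "x \<in> box a b")
      case True
      then have fx: "0 < f x" using f by simp
      have "filterlim (\<lambda>n. real n * f x) at_top sequentially"
        by (rule filterlim_at_top_mult_tendsto_pos[OF tendsto_const fx filterlim_real_sequentially])
      then have "filterlim (\<lambda>n. 1 + real n * f x) at_top sequentially"
        by (rule filterlim_tendsto_add_at_top[OF tendsto_const])
      then have "(\<lambda>n. 1 - inverse (1 + real n * f x)) \<longlonglongrightarrow> 1 - 0"
        by (intro tendsto_diff tendsto_const tendsto_inverse_0_at_top)
      moreover have "1 - inverse (1 + real n * f x) = \<phi> n x" for n
        using nz[of n x] by (simp add: \<phi>_def field_simps)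
      ultimately show ?thesis using True by simp
    next
      case False then show ?thesis using f0 by (simp add: \<phi>_def)
    qed
    then show "AE x in lebesgue. (\<lambda>n. \<phi> n x *\<^sub>R F x) \<longlonglongrightarrow> indicator (box a b) x *\<^sub>R F x"
      by (intro AE_I2 tendsto_scaleR tendsto_const)
  qed
  moreover have "(\<integral> x. \<phi> n x *\<^sub>R F x \<partial>lebesgue) = 0" for n using tf[of n] 0 by blast
  ultimately show ?thesis by (simp add: LIMSEQ_const_iff)
qed

lemma weak_gradient_integrable:
  fixes G :: "'a::euclidean_space \<Rightarrow> 'a"
  assumes G: "weak_gradient \<Omega> u G" and K: "compact K" "K \<subseteq> \<Omega>" and c: "continuous_on UNIV \<phi>"
    and B: "\<And>x. \<bar>\<phi> x\<bar> \<le> B" "\<And>x. x \<notin> K \<Longrightarrow> \<phi> x = 0"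
  shows "integrable lebesgue (\<lambda>x. \<phi> x *\<^sub>R G x)"
proof (rule Bochner_Integration.integrable_bound)
  have i: "integrable lebesgue (\<lambda>x. indicator K x *\<^sub>R G x)"
    using G K unfolding weak_gradient_def set_integrable_def by auto
  then show "integrable lebesgue (\<lambda>x. B *\<^sub>R (indicator K x *\<^sub>R G x))" by (rule integrable_scaleR_right)
  have "\<phi> \<in> borel_measurable lebesgue" using borel_measurable_continuous_onI[OF c] by (simp add: measurable_completion)
  then show "(\<lambda>x. \<phi> x *\<^sub>R G x) \<in> borel_measurable lebesgue"
    using G by (intro borel_measurable_scaleR) (auto simp: weak_gradient_def)
  show "AE x in lebesgue. norm (\<phi> x *\<^sub>R G x) \<le> norm (B *\<^sub>R (indicator K x *\<^sub>R G x))"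
  proof (rule AE_I2)
    fix x
    have "0 \<le> B" using B(1)[of x] by linarith
    then show "norm (\<phi> x *\<^sub>R G x) \<le> norm (B *\<^sub>R (indicator K x *\<^sub>R G x))"
      using B(1)[of x] B(2)[of x] by (cases "x \<in> K") (auto intro!: mult_right_mono)
  qed
qed

text \<open>Both gradients have the same integrals against test functions, hence over all boxes in
  the closed ball, and Lebesgue differentiation recovers the difference from its box
  integrals.\<close>

lemma weak_gradient_unique:
  fixes G G' :: "'a::euclidean_space \<Rightarrow> 'a"
  assumes G: "weak_gradient \<Omega> u G" and G': "weak_gradient \<Omega> u G'" and sub: "cball x0 R \<subseteq> \<Omega>"
  shows "AE x in lebesgue. x \<in> ball x0 R \<longrightarrow> G x = G' x"
proof -
  \<comment> \<open>Extension by 0 makes the difference integrable on the whole space.\<close>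
  define F where "F x = indicator (cball x0 R) x *\<^sub>R (G x - G' x)" for x
  have F: "integrable lebesgue F"
  proof -
    have "integrable lebesgue (\<lambda>x. indicator (cball x0 R) x *\<^sub>R G x)" "integrable lebesgue (\<lambda>x. indicator (cball x0 R) x *\<^sub>R G' x)"
      using G G' sub unfolding weak_gradient_def set_integrable_def by auto
    then show ?thesis unfolding F_def[abs_def] scaleR_diff_right by (rule Bochner_Integration.integrable_diff)
  qed
  have box0: "integral (cbox a b) F = 0" if ab: "\<And>i. i \<in> Basis \<Longrightarrow> a \<bullet> i < b \<bullet> i" and sb: "cbox a b \<subseteq> cball x0 R" for a b
  proof -
    have "(\<integral> x. indicator (box a b) x *\<^sub>R F x \<partial>lebesgue) = 0"
    proof (rule integral_box_eq_0[OF ab F])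
      fix \<phi> \<phi>' assume t: "test_fun (cbox a b) \<phi> \<phi>'"
      obtain K B where K: "compact K" "K \<subseteq> cbox a b" "\<And>x. x \<notin> K \<Longrightarrow> \<phi> x = 0" "\<And>x. \<bar>\<phi> x\<bar> \<le> B" and c: "continuous_on UNIV \<phi>"
        by (rule test_fun_bounded[OF t]) (rule that, assumption+)
      have KO: "K \<subseteq> \<Omega>" using K sb sub by blast
      have tO: "test_fun \<Omega> \<phi> \<phi>'" 
      proof -
        have "cbox a b \<subseteq> \<Omega>" using sb sub by simp
        then show ?thesis using t unfolding test_fun_def by fast
      qed
      have "(\<integral> x. \<phi> x *\<^sub>R G x \<partial>lebesgue) = (\<integral> x. \<phi> x *\<^sub>R G' x \<partial>lebesgue)"
      proof -
        have "(\<integral> x. u x *\<^sub>R \<phi>' x \<partial>lebesgue) = - (\<integral> x. \<phi> x *\<^sub>R G x \<partial>lebesgue)"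
          "(\<integral> x. u x *\<^sub>R \<phi>' x \<partial>lebesgue) = - (\<integral> x. \<phi> x *\<^sub>R G' x \<partial>lebesgue)"
          using G G' tO unfolding weak_gradient_def by blast+
        then show ?thesis by simp
      qed
      moreover have "\<phi> x *\<^sub>R F x = \<phi> x *\<^sub>R G x - \<phi> x *\<^sub>R G' x" for x
        using K(3)[of x] K(2) sb by (cases "x \<in> K") (auto simp: F_def scaleR_diff_right)
      ultimately show "(\<integral> x. \<phi> x *\<^sub>R F x \<partial>lebesgue) = 0"
        using weak_gradient_integrable[OF G K(1) KO c K(4,3)] weak_gradient_integrable[OF G' K(1) KO c K(4,3)]
        by (simp add: Bochner_Integration.integral_diff)
    qed auto
    moreover have "set_integrable lebesgue (box a b) F"
      unfolding set_integrable_def using F by (intro integrable_mult_indicator) auto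
    ultimately have "integral (box a b) F = 0"
      using set_lebesgue_integral_eq_integral(2)[of "box a b" F] by (simp add: set_lebesgue_integral_def)
    then show ?thesis by (simp add: integral_open_interval)
  qed
  have int: "F integrable_on cbox a b" for a b
  proof -
    have "set_integrable lebesgue (cbox a b) F"
      unfolding set_integrable_def using F by (intro integrable_mult_indicator) auto
    then show ?thesis by (rule set_lebesgue_integral_eq_integral(1))
  qed
  \<comment> \<open>Lebesgue differentiation along cubes that have x as their lower corner.\<close>
  obtain N where N: "negligible N" and diff: "\<And>x e. \<lbrakk>x \<notin> N; 0 < e\<rbrakk> \<Longrightarrow>
      \<exists>d>0. \<forall>h. 0 < h \<and> h < d \<longrightarrow> norm (integral (cbox x (x + h *\<^sub>R One)) F /\<^sub>R h ^ DIM('a) - F x) < e"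
    using integrable_ccontinuous_explicit[of F, OF int] by blast
  have "G x = G' x" if xN: "x \<notin> N" and xb: "x \<in> ball x0 R" for x
  proof (rule ccontr)
    assume "G x \<noteq> G' x"
    then have "0 < norm (F x)" using xb by (simp add: F_def)
    from diff[OF xN this] obtain d where d: "0 < d" "\<And>h. 0 < h \<Longrightarrow> h < d \<Longrightarrow> norm (integral (cbox x (x + h *\<^sub>R One)) F /\<^sub>R h ^ DIM('a) - F x) < norm (F x)"
      by blast
    define \<delta> where "\<delta> = R - dist x0 x"
    have \<delta>: "0 < \<delta>" using xb by (simp add: \<delta>_def)
    \<comment> \<open>By the l1 bound every point of the cube has distance at most
      \<open>h * DIM('a)\<close> from x, so this choice keeps the cube in the ball.\<close>
    define h where "h = min (d / 2) (\<delta> / (2 * DIM('a)))"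
    have h: "0 < h" "h < d" "h * DIM('a) < \<delta>"
    proof -
      show "0 < h" "h < d" using d \<delta> by (auto simp: h_def)
      have "h * DIM('a) \<le> \<delta> / (2 * DIM('a)) * DIM('a)" by (intro mult_right_mono) (auto simp: h_def)
      also have "\<dots> < \<delta>" using \<delta> by simp
      finally show "h * DIM('a) < \<delta>" .
    qed
    have "integral (cbox x (x + h *\<^sub>R One)) F = 0"
    proof (rule box0)
      show "x \<bullet> i < (x + h *\<^sub>R One) \<bullet> i" if "i \<in> Basis" for i using that h by (simp add: inner_add_left)
      show "cbox x (x + h *\<^sub>R One) \<subseteq> cball x0 R"
      proof
        fix y assume y: "y \<in> cbox x (x + h *\<^sub>R One)"
        have "norm (y - x) \<le> (\<Sum>i\<in>Basis. \<bar>(y - x) \<bullet> i\<bar>)" by (rule norm_le_l1)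
        also have "\<dots> \<le> (\<Sum>i\<in>(Basis::'a set). h)"
          using y by (intro sum_mono) (auto simp: mem_box inner_diff_left inner_add_left)
        also have "\<dots> = h * DIM('a)" by simp
        finally have "dist x y < \<delta>" using h(3) by (simp add: dist_norm norm_minus_commute)
        then show "y \<in> cball x0 R" using dist_triangle[of x0 y x] by (simp add: \<delta>_def)
      qed
    qed
    then show False using d(2)[OF h(1,2)] by simp
  qed
  moreover have "AE x in lebesgue. x \<notin> N" using N by (simp add: negligible_iff_null_sets AE_not_in)
  ultimately show ?thesis by auto
qed

section \<open>From weak solutions to local solutions\<close>

lemma AE_lebesgue2_fst:
  assumes "AE x in (lebesgue :: 'a::euclidean_space measure). P x"
  shows "AE z in (lebesgue2 :: ('a \<times> 'a) measure). P (fst z)"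
proof -
  interpret sigma_finite_measure "lebesgue :: 'a measure" by (rule sigma_finite_lebesgue)
  obtain N where N: "{x \<in> space (lebesgue :: 'a measure). \<not> P x} \<subseteq> N" "N \<in> null_sets (lebesgue :: 'a measure)"
    using assms by (auto elim!: AE_E3 intro: that)
  then have "N \<times> space (lebesgue :: 'a measure) \<in> null_sets lebesgue2" by (intro times_in_null_sets1) auto
  then show ?thesis by (rule AE_I') (use N in auto)
qed

lemma AE_lebesgue2_snd:
  assumes "AE x in (lebesgue :: 'a::euclidean_space measure). P x"
  shows "AE z in (lebesgue2 :: ('a \<times> 'a) measure). P (snd z)"
proof -
  interpret sigma_finite_measure "lebesgue :: 'a measure" by (rule sigma_finite_lebesgue)
  obtain N where N: "{x \<in> space (lebesgue :: 'a measure). \<not> P x} \<subseteq> N" "N \<in> null_sets (lebesgue :: 'a measure)"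
    using assms by (auto elim!: AE_E3 intro: that)
  then have "space (lebesgue :: 'a measure) \<times> N \<in> null_sets lebesgue2" by (intro times_in_null_sets2) auto
  then show ?thesis by (rule AE_I') (use N in auto)
qed

lemma kernel_constant_exists:
  assumes dim: "2 \<le> DIM('a::euclidean_space)" and s1: "0 < s1" "s1 < 1" and p: "1 < p" "p < 2" and sp: "0 < sp" "sp < 1"
  obtains k where "1 \<le> k"
    "(\<integral>\<^sup>+ z. ennreal (1 / (1 + norm z) powr (real DIM('a) + s1)) \<partial>(lborel :: 'a measure)) \<le> ennreal k"
    "(\<integral>\<^sup>+ z. ennreal (1 / (1 + norm z) powr (real DIM('a) + sp * p)) \<partial>(lborel :: 'a measure)) \<le> ennreal k"
    "(\<integral>\<^sup>+ z. ennreal (norm z powr (1 - s1 - real DIM('a)) * indicator (cball 0 2) z) \<partial>(lborel :: 'a measure)) \<le> ennreal k"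
    "(\<integral>\<^sup>+ z. ennreal (norm z powr (p - sp * p - real DIM('a)) * indicator (cball 0 2) z) \<partial>(lborel :: 'a measure)) \<le> ennreal k"
proof -
  have spp: "0 < sp * p" "sp * p < p" using p sp by auto
  define I1 where "I1 = (\<integral>\<^sup>+ z. ennreal (1 / (1 + norm z) powr (real DIM('a) + s1)) \<partial>(lborel :: 'a measure))"
  define I2 where "I2 = (\<integral>\<^sup>+ z. ennreal (1 / (1 + norm z) powr (real DIM('a) + sp * p)) \<partial>(lborel :: 'a measure))"
  define I3 where "I3 = (\<integral>\<^sup>+ z. ennreal (norm z powr (1 - s1 - real DIM('a)) * indicator (cball 0 2) z) \<partial>(lborel :: 'a measure))"
  define I4 where "I4 = (\<integral>\<^sup>+ z. ennreal (norm z powr (p - sp * p - real DIM('a)) * indicator (cball 0 2) z) \<partial>(lborel :: 'a measure))"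
  have fin: "I1 < top" "I2 < top" "I3 < top" "I4 < top"
    unfolding I1_def I2_def I3_def I4_def
    using nn_integral_far_kernel[OF s1(1), where 'a = 'a] nn_integral_far_kernel[OF spp(1), where 'a = 'a]
      nn_integral_near_kernel[of "1 - s1", where 'a = 'a] nn_integral_near_kernel[of "p - sp * p", where 'a = 'a] s1 spp p dim by auto
  define k where "k = 1 + enn2real I1 + enn2real I2 + enn2real I3 + enn2real I4"
  have le: "I \<le> ennreal k" if "I < top" "enn2real I \<le> k" for I
    using ennreal_leI[OF that(2)] that(1) by simp
  have "enn2real I1 \<le> k" "enn2real I2 \<le> k" "enn2real I3 \<le> k" "enn2real I4 \<le> k" "1 \<le> k"
    by (auto simp: k_def add_nonneg_nonneg add_increasing)
  with fin le have "I1 \<le> ennreal k" "I2 \<le> ennreal k" "I3 \<le> ennreal k" "I4 \<le> ennreal k" "1 \<le> k" by auto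
  then show ?thesis using that[of k] unfolding I1_def I2_def I3_def I4_def by blast
qed

text \<open>The tail space provides measurability on compact sets; u is the limit of its
  restrictions to growing balls.\<close>

lemma tail_space_measurable:
  fixes u :: "'a::euclidean_space \<Rightarrow> real"
  assumes "tail_space s p u"
  shows "u \<in> borel_measurable lebesgue"
proof (rule borel_measurable_LIMSEQ_metric)
  fix n :: nat
  have "Lq_on p (cball 0 (real n)) u" using assms compact_cball unfolding tail_space_def by blast
  then show "(\<lambda>x. indicator (cball 0 (real n)) x *\<^sub>R u x) \<in> borel_measurable lebesgue"
    unfolding Lq_on_def set_borel_measurable_def by simp
next
  fix x :: 'a
  obtain m :: nat where m: "norm x \<le> real m" using real_arch_simple by blast
  have "\<forall>\<^sub>F n in sequentially. indicator (cball 0 (real n)) x *\<^sub>R u x = u x"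
    using eventually_ge_at_top[of m] by eventually_elim (use m in auto)
  then show "(\<lambda>n. indicator (cball 0 (real n)) x *\<^sub>R u x) \<longlonglongrightarrow> u x" by (rule tendsto_eventually)
qed

text \<open>\<open>Tail\<close> is defined through \<open>enn2real\<close>, which sends an infinite
  integral to 0. A bound on \<open>Tail\<close> becomes a bound on the integral only after its
  finiteness has been derived from the tail space, by comparing |x - x0| with 1 + |x| outside the
  ball.\<close>

lemma tail_integral_le:
  fixes u :: "'a::euclidean_space \<Rightarrow> real"
  assumes u: "tail_space s p u" and R: "0 < R" and p: "1 < p" and s: "0 < s" and T: "Tail s p u x0 R \<le> M"
  shows "(\<integral>\<^sup>+ x. ennreal (\<bar>u x\<bar> powr (p - 1) / norm (x - x0) powr (real DIM('a) + s * p)) * indicator (UNIV - ball x0 R) x \<partial>lebesgue)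
    \<le> ennreal (M powr (p - 1) / R powr (s * p))"
proof -
  let ?N = "real DIM('a) + s * p"
  define I where "I = (\<integral>\<^sup>+ x. ennreal (\<bar>u x\<bar> powr (p - 1) / norm (x - x0) powr ?N) * indicator (UNIV - ball x0 R) x \<partial>lebesgue)"
  have [measurable]: "u \<in> borel_measurable lebesgue" by (rule tail_space_measurable[OF u])
  define c where "c = (1 + norm x0) / R + 1"
  have c: "0 < c" using R by (simp add: c_def add_pos_nonneg add_nonneg_pos)
  have sp0: "0 < s * p" using s p by simp
  have m: "(\<lambda>x. ennreal (\<bar>u x\<bar> powr (p - 1) / (1 + norm x) powr ?N)) \<in> borel_measurable lebesgue"
  proof -
    have [measurable]: "(\<lambda>x::'a. (1 + norm x) powr ?N) \<in> borel_measurable lebesgue"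
      by (rule measurable_completion) measurable
    show ?thesis by measurable
  qed
  have pw: "ennreal (\<bar>u x\<bar> powr (p - 1) / norm (x - x0) powr ?N) * indicator (UNIV - ball x0 R) x
     \<le> ennreal (c powr ?N) * ennreal (\<bar>u x\<bar> powr (p - 1) / (1 + norm x) powr ?N)" for x
  proof (cases "x \<in> ball x0 R")
    case False
    then have n: "R \<le> norm (x - x0)" by (simp add: dist_norm norm_minus_commute)
    have n0: "0 < norm (x - x0)" using n R by linarith
    have "1 + norm x \<le> (1 + norm x0) * 1 + norm (x - x0)" using norm_triangle_ineq[of "x - x0" x0] by simp
    also have "\<dots> \<le> (1 + norm x0) * (norm (x - x0) / R) + norm (x - x0)"
      using n R by (intro add_right_mono mult_left_mono) (auto simp: field_simps)
    also have "\<dots> = c * norm (x - x0)" by (simp add: c_def distrib_right)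
    finally have "(1 + norm x) powr ?N \<le> (c * norm (x - x0)) powr ?N" using sp0 by (intro powr_mono2) auto
    also have "\<dots> = c powr ?N * norm (x - x0) powr ?N" using c by (simp add: powr_mult)
    finally have *: "(1 + norm x) powr ?N \<le> c powr ?N * norm (x - x0) powr ?N" .
    have "1 + norm x \<noteq> 0" using norm_ge_zero[of x] by linarith
    then have "0 < (1 + norm x) powr ?N" "0 < norm (x - x0) powr ?N" using n0 by simp_all
    then have "1 / norm (x - x0) powr ?N \<le> c powr ?N * (1 / (1 + norm x) powr ?N)" using * by (simp add: field_simps)
    then have "\<bar>u x\<bar> powr (p - 1) * (1 / norm (x - x0) powr ?N) \<le> \<bar>u x\<bar> powr (p - 1) * (c powr ?N * (1 / (1 + norm x) powr ?N))"
      by (intro mult_left_mono) auto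
    then show ?thesis using False by (simp add: ennreal_mult'[symmetric] ennreal_leI mult_ac)
  qed simp
  have "I \<le> (\<integral>\<^sup>+ x. ennreal (c powr ?N) * ennreal (\<bar>u x\<bar> powr (p - 1) / (1 + norm x) powr ?N) \<partial>lebesgue)"
    unfolding I_def by (intro nn_integral_mono pw)
  also have "\<dots> = ennreal (c powr ?N) * (\<integral>\<^sup>+ x. ennreal (\<bar>u x\<bar> powr (p - 1) / (1 + norm x) powr ?N) \<partial>lebesgue)"
    by (rule nn_integral_cmult[OF m])
  also have "\<dots> < top" using u unfolding tail_space_def by (auto simp: ennreal_mult_less_top)
  finally have fin: "I < top" .
  define y where "y = R powr (s * p) * enn2real I"
  have y: "0 \<le> y" by (simp add: y_def)
  have "y powr (1 / (p - 1)) \<le> M" using T unfolding Tail_def y_def I_def .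
  then have "(y powr (1 / (p - 1))) powr (p - 1) \<le> M powr (p - 1)" using p by (intro powr_mono2) auto
  then have "y \<le> M powr (p - 1)" using p y by (simp add: powr_powr)
  then have "enn2real I \<le> M powr (p - 1) / R powr (s * p)" using R by (simp add: y_def field_simps)
  then have "ennreal (enn2real I) \<le> ennreal (M powr (p - 1) / R powr (s * p))" by (rule ennreal_leI)
  then show ?thesis using fin unfolding I_def[symmetric] by simp
qed

text \<open>The modified function \<open>v\<close> depends on the ball and on its bound
  \<open>M\<close>. Its agreement with the fixed representative \<open>u0\<close> is what later
  links the estimates on different balls.\<close>

lemma local_solution_of_weak_solution:
  fixes u u0 :: "'a::euclidean_space \<Rightarrow> real"
  assumes dim: "2 \<le> DIM('a)" and s1: "0 < s1" "s1 < 1" and p: "1 < p" "p < 2" and sp: "0 < sp" "sp < 1" and k1: "1 \<le> k"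
    and k: "(\<integral>\<^sup>+ z. ennreal (1 / (1 + norm z) powr (real DIM('a) + s1)) \<partial>(lborel :: 'a measure)) \<le> ennreal k"
      "(\<integral>\<^sup>+ z. ennreal (1 / (1 + norm z) powr (real DIM('a) + sp * p)) \<partial>(lborel :: 'a measure)) \<le> ennreal k"
      "(\<integral>\<^sup>+ z. ennreal (norm z powr (1 - s1 - real DIM('a)) * indicator (cball 0 2) z) \<partial>(lborel :: 'a measure)) \<le> ennreal k"
      "(\<integral>\<^sup>+ z. ennreal (norm z powr (p - sp * p - real DIM('a)) * indicator (cball 0 2) z) \<partial>(lborel :: 'a measure)) \<le> ennreal k"
    and sol: "weak_solution s1 sp p \<Omega> u" and cc: "cc_subset (ball x0 R) \<Omega>" and R: "0 < R" "R < 1"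
    and u0: "u0 \<in> borel_measurable borel" "AE x in lebesgue. u x = u0 x"
    and M: "1 \<le> M" "AE x in lebesgue. x \<in> ball x0 R \<longrightarrow> \<bar>u x\<bar> \<le> M" "Tail sp p u x0 R \<le> M"
  shows "\<exists>v Z. local_solution v Z x0 R M s1 sp p k \<and> (AE x in lborel. v x = u0 x)"
proof -
  have tl: "tail_space sp p u" and f1: "frac_sobolev_loc s1 1 \<Omega> u" and fp: "frac_sobolev_loc sp p \<Omega> u"
    using sol by (auto simp: weak_solution_def)
  have um[measurable]: "u \<in> borel_measurable lebesgue" by (rule tail_space_measurable[OF tl])
  obtain Z where Zm[measurable]: "Z \<in> borel_measurable lebesgue2" and Zs: "AE z in lebesgue2. in_sgn (Z z) (u (fst z) - u (snd z))"
    and eq: "\<And>\<phi>. frac_sobolev0 s1 1 \<Omega> \<phi> \<Longrightarrow> frac_sobolev0 sp p \<Omega> \<phi> \<Longrightarrow>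
           0 = (\<integral> z. Z z * (\<phi> (fst z) - \<phi> (snd z)) / norm (fst z - snd z) powr (real DIM('a) + s1) \<partial>lebesgue2)
             + (\<integral> z. \<bar>u (fst z) - u (snd z)\<bar> powr (p - 2) * (u (fst z) - u (snd z)) *
                      (\<phi> (fst z) - \<phi> (snd z)) / norm (fst z - snd z) powr (real DIM('a) + sp * p) \<partial>lebesgue2)"
    using sol unfolding weak_solution_def by blast
  \<comment> \<open>Inside the ball the representative is replaced by 0 where it exceeds
    \<open>M\<close>, which happens only on a null set.\<close>
  define v where "v x = (if x \<in> ball x0 R \<and> M < \<bar>u0 x\<bar> then 0 else u0 x)" for x
  have vm[measurable]: "v \<in> borel_measurable borel"
  proof -
    have [measurable]: "ball x0 R \<in> sets borel" by simp
    show ?thesis unfolding v_def[abs_def] using u0(1) by measurable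
  qed
  have vu: "AE x in lebesgue. v x = u x" using u0(2) M(2) by eventually_elim (auto simp: v_def)
  have vu0: "AE x in lborel. v x = u0 x" using vu u0(2) unfolding AE_completion_iff by eventually_elim simp
  have vu2: "AE z in lebesgue2. v (fst z) = u (fst z) \<and> v (snd z) = u (snd z)"
    using AE_lebesgue2_fst[OF vu] AE_lebesgue2_snd[OF vu] by eventually_elim simp
  \<comment> \<open>The sign condition now holds at every pair: off the coincidence set the value is
    forced, and on it values of \<open>Z\<close> outside [-1, 1] are replaced by 0.\<close>
  define Z' where "Z' z = (if v (fst z) = v (snd z) then (if \<bar>Z z\<bar> \<le> 1 then Z z else 0) else sgn (v (fst z) - v (snd z)))" for z
  have Z'm[measurable]: "Z' \<in> borel_measurable lebesgue2" unfolding Z'_def[abs_def] by measurable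
  have Z'Z: "AE z in lebesgue2. Z' z = Z z"
    using vu2 Zs by eventually_elim (auto simp: Z'_def in_sgn_def split: if_splits)
  have uf: "(\<lambda>z. u (fst z)) \<in> borel_measurable lebesgue2" "(\<lambda>z. u (snd z)) \<in> borel_measurable lebesgue2"
    by (rule measurable_compose[OF measurable_fst um], rule measurable_compose[OF measurable_snd um])
  have gag: "gagliardo_pow \<gamma> r (ball x0 R) v = gagliardo_pow \<gamma> r (ball x0 R) u" for \<gamma> r
    unfolding gagliardo_pow_def by (intro nn_integral_cong_AE) (use vu2 in \<open>eventually_elim, simp\<close>)
  have U: "open (ball x0 R)" by simp
  have "local_solution v Z' x0 R M s1 sp p k"
  proof
    show "in_sgn (Z' (x, y)) (v x - v y)" for x y by (auto simp: Z'_def in_sgn_def)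
    show "\<bar>v x\<bar> \<le> M" if "x \<in> ball x0 R" for x using that M(1) by (auto simp: v_def)
    show "gagliardo_pow s1 1 (ball x0 R) v < \<infinity>" unfolding gag using f1 cc U by (simp add: frac_sobolev_loc_def frac_sobolev_def)
    show "gagliardo_pow sp p (ball x0 R) v < \<infinity>" unfolding gag using fp cc U by (simp add: frac_sobolev_loc_def frac_sobolev_def)
    have "(\<integral>\<^sup>+ x. ennreal (\<bar>v x\<bar> powr (p - 1) * kernel (sp * p) x x0) * indicator (- ball x0 R) x \<partial>lborel)
       = (\<integral>\<^sup>+ x. ennreal (\<bar>u x\<bar> powr (p - 1) / norm (x - x0) powr (real DIM('a) + sp * p)) * indicator (UNIV - ball x0 R) x \<partial>lebesgue)"
      unfolding nn_integral_completion[symmetric, of lborel] kernel_def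
      by (intro nn_integral_cong_AE) (use vu in \<open>eventually_elim, simp add: Compl_eq_Diff_UNIV\<close>)
    also have "\<dots> \<le> ennreal (M powr (p - 1) / R powr (sp * p))"
      using tl R p sp M by (intro tail_integral_le) auto
    finally show "(\<integral>\<^sup>+ x. ennreal (\<bar>v x\<bar> powr (p - 1) * kernel (sp * p) x x0) * indicator (- ball x0 R) x \<partial>lborel)
       \<le> ennreal (M powr (p - 1) / R powr (sp * p))" .
  next
    fix \<phi> :: "'a \<Rightarrow> real"
    assume m[measurable]: "\<phi> \<in> borel_measurable borel" and 1: "frac_sobolev s1 1 UNIV \<phi>" and 2: "frac_sobolev sp p UNIV \<phi>"
      and 0: "\<And>x. x \<notin> ball x0 R \<Longrightarrow> \<phi> x = 0"
    have sub: "ball x0 R \<subseteq> \<Omega>" using cc closure_subset[of "ball x0 R"] unfolding cc_subset_def by blast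
    then have "AE x in lebesgue. x \<notin> \<Omega> \<longrightarrow> \<phi> x = 0" using 0 by (intro AE_I2) blast
    then have e: "0 = (\<integral> z. Z z * (\<phi> (fst z) - \<phi> (snd z)) / norm (fst z - snd z) powr (real DIM('a) + s1) \<partial>lebesgue2)
             + (\<integral> z. \<bar>u (fst z) - u (snd z)\<bar> powr (p - 2) * (u (fst z) - u (snd z)) *
                      (\<phi> (fst z) - \<phi> (snd z)) / norm (fst z - snd z) powr (real DIM('a) + sp * p) \<partial>lebesgue2)"
      using 1 2 by (intro eq) (auto simp: frac_sobolev0_def)
    let ?d = "\<lambda>z. \<phi> (fst z) - \<phi> (snd z)" and ?n = "\<lambda>z::'a \<times> 'a. norm (fst z - snd z)" and ?N = "real DIM('a)"
    have "(\<lambda>z. ?d z) \<in> borel_measurable lebesgue2" by measurable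
    moreover have "(\<lambda>z. ?n z powr c) \<in> borel_measurable lebesgue2" for c by measurable
    moreover have "(\<lambda>z. kernel c (fst z) (snd z)) \<in> borel_measurable (lebesgue2 :: ('a \<times> 'a) measure)" for c by measurable
    moreover have "(\<lambda>z. spow (p - 1) (v (fst z) - v (snd z))) \<in> borel_measurable lebesgue2" by measurable
    moreover have "(\<lambda>z. \<bar>u (fst z) - u (snd z)\<bar> powr (p - 2) * (u (fst z) - u (snd z))) \<in> borel_measurable lebesgue2"
    proof -
      have "(\<lambda>t::real. \<bar>t\<bar> powr (p - 2) * t) \<in> borel_measurable borel" by measurable
      from measurable_compose[OF borel_measurable_diff[OF uf] this] show ?thesis .
    qed
    ultimately have ms:
      "(\<lambda>z. Z' z * ?d z * kernel s1 (fst z) (snd z)) \<in> borel_measurable lebesgue2"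
      "(\<lambda>z. Z z * ?d z / ?n z powr (?N + s1)) \<in> borel_measurable lebesgue2"
      "(\<lambda>z. spow (p - 1) (v (fst z) - v (snd z)) * ?d z * kernel (sp * p) (fst z) (snd z)) \<in> borel_measurable lebesgue2"
      "(\<lambda>z. \<bar>u (fst z) - u (snd z)\<bar> powr (p - 2) * (u (fst z) - u (snd z)) * ?d z / ?n z powr (?N + sp * p)) \<in> borel_measurable lebesgue2"
      using Zm Z'm by (auto intro!: borel_measurable_times borel_measurable_divide)
    have "(\<integral> z. Z' z * ?d z * kernel s1 (fst z) (snd z) \<partial>lebesgue2) = (\<integral> z. Z z * ?d z / ?n z powr (?N + s1) \<partial>lebesgue2)"
      by (rule integral_cong_AE[OF ms(1,2)]) (use Z'Z in \<open>eventually_elim, simp add: kernel_def\<close>)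
    moreover have "(\<integral> z. spow (p - 1) (v (fst z) - v (snd z)) * ?d z * kernel (sp * p) (fst z) (snd z) \<partial>lebesgue2)
        = (\<integral> z. \<bar>u (fst z) - u (snd z)\<bar> powr (p - 2) * (u (fst z) - u (snd z)) * ?d z / ?n z powr (?N + sp * p) \<partial>lebesgue2)"
      by (rule integral_cong_AE[OF ms(3,4)]) (use vu2 in \<open>eventually_elim, simp add: kernel_def abs_powr_mult_eq_spow\<close>)
    ultimately show "0 = (\<integral> z. Z' z * (\<phi> (fst z) - \<phi> (snd z)) * kernel s1 (fst z) (snd z) \<partial>lebesgue2)
          + (\<integral> z. spow (p - 1) (v (fst z) - v (snd z)) * (\<phi> (fst z) - \<phi> (snd z)) * kernel (sp * p) (fst z) (snd z) \<partial>lebesgue2)"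
      using e by simp
  qed (use dim s1 p sp R M k1 k in simp_all)
  then show ?thesis using vu0 by blast
qed

section \<open>The gradient estimate\<close>

lemma AE_lborel_shift:
  assumes "AE x in (lborel :: 'a::euclidean_space measure). P x"
  shows "AE x in lborel. P (x + h)"
proof -
  have "AE x in distr lborel borel ((+) h). P x" using assms by (subst lborel_distr_plus)
  from AE_distrD[OF _ this] show ?thesis by (simp add: add.commute)
qed

lemma exists_power_2_between:
  fixes y :: real
  assumes "1 \<le> y"
  obtains n :: nat where "y \<le> 2 ^ n" "2 ^ n \<le> 2 * y"
proof -
  define n where "n = (LEAST n. y \<le> 2 ^ n)"
  have ex: "\<exists>n. y \<le> 2 ^ n" using real_arch_pow[of 2 y] by (auto intro: less_imp_le)
  have 1: "y \<le> 2 ^ n" unfolding n_def by (rule LeastI_ex[OF ex])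
  have 2: "2 ^ n \<le> 2 * y"
  proof (cases n)
    case 0 then show ?thesis using assms by simp
  next
    case (Suc m)
    then have "\<not> y \<le> 2 ^ m" unfolding n_def by (intro not_less_Least) simp
    then show ?thesis using Suc by simp
  qed
  show ?thesis using that 1 2 by blast
qed

section \<open>Dyadic difference quotients and their limits\<close>

definition diff_quotient :: "('a::euclidean_space \<Rightarrow> real) \<Rightarrow> 'a \<Rightarrow> nat \<Rightarrow> 'a \<Rightarrow> real" where
  "diff_quotient u e n x = 2 ^ n * (u (x + (1 / 2) ^ n *\<^sub>R e) - u x)"

text \<open>Where the difference quotients diverge, this is an unspecified value; that happens only on a
  null set.\<close>
definition dyadic_derivative :: "('a::euclidean_space \<Rightarrow> real) \<Rightarrow> 'a \<Rightarrow> 'a \<Rightarrow> real" where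
  "dyadic_derivative u e x = lim (\<lambda>n. diff_quotient u e n x)"

lemma diff_quotient_measurable [measurable]:
  assumes [measurable]: "u \<in> borel_measurable borel"
  shows "diff_quotient u e n \<in> borel_measurable borel"
  unfolding diff_quotient_def[abs_def] by measurable

lemma dyadic_derivative_measurable [measurable]:
  assumes [measurable]: "u \<in> borel_measurable borel"
  shows "dyadic_derivative u e \<in> borel_measurable borel"
  unfolding dyadic_derivative_def[abs_def] by measurable

text \<open>\<open>lim\<close> depends only on which numbers are limits of the sequence, so dropping
  initial terms does not change it, even at points of divergence.\<close>

lemma dyadic_derivative_shift: "dyadic_derivative u e x = lim (\<lambda>n. diff_quotient u e (n + k) x)"
proof -
  have "(\<lambda>n. diff_quotient u e (n + k) x) \<longlonglongrightarrow> L \<longleftrightarrow> (\<lambda>n. diff_quotient u e n x) \<longlonglongrightarrow> L" for L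
    using LIMSEQ_offset[of "\<lambda>n. diff_quotient u e n x" k L] LIMSEQ_ignore_initial_segment[of "\<lambda>n. diff_quotient u e n x" L k] by blast
  then show ?thesis unfolding dyadic_derivative_def t2_space_class.Lim_def by simp
qed

text \<open>Halving the step changes the quotient by a second difference with the new step. This is
  the reason for using dyadic steps.\<close>

lemma diff_quotient_Suc:
  "diff_quotient u e (Suc j) x - diff_quotient u e j x
    = - (2 ^ j) * ((u (x + (1 / 2) ^ Suc j *\<^sub>R e + (1 / 2) ^ Suc j *\<^sub>R e) - u (x + (1 / 2) ^ Suc j *\<^sub>R e)) - (u (x + (1 / 2) ^ Suc j *\<^sub>R e) - u x))"
proof -
  have "(1 / 2) ^ Suc j *\<^sub>R e + (1 / 2) ^ Suc j *\<^sub>R e = (1 / 2 :: real) ^ j *\<^sub>R e"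
    by (simp add: scaleR_add_left[symmetric])
  then have "x + (1 / 2) ^ Suc j *\<^sub>R e + (1 / 2) ^ Suc j *\<^sub>R e = x + (1 / 2) ^ j *\<^sub>R e"
    by (simp only: add.assoc)
  then show ?thesis unfolding diff_quotient_def by (simp only:) (simp add: algebra_simps)
qed

lemma nn_integral_scaled_le:
  fixes f g :: "'a::euclidean_space \<Rightarrow> real"
  assumes [measurable]: "f \<in> borel_measurable borel" and c: "0 \<le> c" and Y: "0 \<le> Y"
    and eq: "AE x in lborel. \<bar>g x\<bar> = c * \<bar>f x\<bar>"
    and f: "(\<integral>\<^sup>+ x. ennreal (\<bar>f x\<bar> powr q * indicator (ball x0 r) x) \<partial>lborel) \<le> ennreal (Y powr q)"
  shows "(\<integral>\<^sup>+ x. ennreal (\<bar>g x\<bar> powr q) * indicator (ball x0 r) x \<partial>lborel) \<le> ennreal ((c * Y) powr q)"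
proof -
  have "(\<integral>\<^sup>+ x. ennreal (\<bar>g x\<bar> powr q) * indicator (ball x0 r) x \<partial>lborel)
      = (\<integral>\<^sup>+ x. ennreal (c powr q) * ennreal (\<bar>f x\<bar> powr q * indicator (ball x0 r) x) \<partial>lborel)"
  proof (rule nn_integral_cong_AE, use eq in eventually_elim)
    fix x assume "\<bar>g x\<bar> = c * \<bar>f x\<bar>"
    then show "ennreal (\<bar>g x\<bar> powr q) * indicator (ball x0 r) x = ennreal (c powr q) * ennreal (\<bar>f x\<bar> powr q * indicator (ball x0 r) x)"
      using c by (simp add: powr_mult ennreal_mult_indicator ennreal_mult' mult.assoc)
  qed
  also have "\<dots> = ennreal (c powr q) * (\<integral>\<^sup>+ x. ennreal (\<bar>f x\<bar> powr q * indicator (ball x0 r) x) \<partial>lborel)"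
    by (rule nn_integral_cmult) measurable
  also have "\<dots> \<le> ennreal (c powr q) * ennreal (Y powr q)" by (intro mult_left_mono f) auto
  also have "\<dots> = ennreal ((c * Y) powr q)" using c Y by (simp add: powr_mult ennreal_mult'[symmetric])
  finally show ?thesis .
qed

text \<open>The estimates are available for \<open>v\<close>, while the quotients are those of
  \<open>u0\<close>; the two differ on a null set, also after translation. The first summand of the
  constant bounds the initial quotient, the second the geometric series of the increments.\<close>

lemma dyadic_derivative_local:
  fixes u0 v :: "'a::euclidean_space \<Rightarrow> real"
  assumes C: "1 \<le> C" "0 \<le> \<kappa>" and g: "1 < g" and q: "1 \<le> q"
    and bd: "\<And>(u :: 'a \<Rightarrow> real) Z x0 R M r h. local_solution u Z x0 R M s1 sp p k \<Longrightarrow> 0 < r \<Longrightarrow> r < R \<Longrightarrow> h \<noteq> 0 \<Longrightarrow> norm h \<le> (R - r) / 32 \<Longrightarrow>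
       (\<integral>\<^sup>+ x. ennreal (\<bar>(u (x + h + h) - u (x + h)) - (u (x + h) - u x)\<bar> powr q * indicator (ball x0 r) x) \<partial>lborel)
       \<le> ennreal ((C * M * (1 / (R - r)) powr \<kappa> * norm h powr g) powr q)"
    and sol: "local_solution v Z x0 R M s1 sp p k" and vu: "AE x in lborel. v x = u0 x"
    and u0[measurable]: "u0 \<in> borel_measurable borel" and r: "0 < r" "r < R" and e: "norm e = 1"
  shows "(\<integral>\<^sup>+ x. ennreal (\<bar>dyadic_derivative u0 e x\<bar> powr q) * indicator (ball x0 r) x \<partial>lborel)
      \<le> ennreal (((128 * (1 + unit_ball_vol DIM('a)) + C / (1 - 2 powr (1 - g))) * M * (1 / (R - r)) powr (\<kappa> + 1)) powr q)" (is ?A)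
    and "(\<lambda>n. \<integral>\<^sup>+ x. ennreal \<bar>diff_quotient u0 e n x - dyadic_derivative u0 e x\<bar> * indicator (ball x0 r) x \<partial>lborel) \<longlonglongrightarrow> 0" (is ?B)
proof -
  interpret local_solution v Z x0 R M s1 sp p k by (rule sol)
  let ?\<omega> = "unit_ball_vol DIM('a)"
  define X where "X = 1 / (R - r)"
  have X: "1 \<le> X" "0 < R - r" using r R by (auto simp: X_def)
  define \<rho> where "\<rho> = 2 powr (1 - g)"
  have \<rho>: "0 < \<rho>" "\<rho> < 1" using g by (auto simp: \<rho>_def powr_less_one)
  \<comment> \<open>From this index on the steps are admissible, 2^(-n0) <= (R - r) / 32, while the
    upper bound on 2^n0 keeps the initial quotient of order 1 / (R - r).\<close>
  obtain n0 where n0: "32 * X \<le> 2 ^ n0" "2 ^ n0 \<le> 2 * (32 * X)"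
    using exists_power_2_between[of "32 * X"] X by auto
  have h0: "(1 / 2) ^ n0 \<le> (R - r) / 32"
  proof -
    have "1 / 2 ^ n0 \<le> 1 / (32 * X)" using n0 X by (intro divide_left_mono) auto
    then show ?thesis using X by (simp add: X_def power_one_over)
  qed
  define f where "f n = diff_quotient u0 e (n + n0)" for n
  define A where "A = C * M * X powr \<kappa>"
  define F where "F = 2 ^ n0 * (2 * M * (1 + ?\<omega>))"
  have A0: "0 < A" using C M X by (simp add: A_def)
  have F0: "0 < F" unfolding F_def using M by (intro mult_pos_pos add_pos_nonneg) auto
  have [measurable]: "f n \<in> borel_measurable borel" for n unfolding f_def by measurable
  have f0: "(\<integral>\<^sup>+ x. ennreal (\<bar>f 0 x\<bar> powr q) * indicator (ball x0 r) x \<partial>lborel) \<le> ennreal (F powr q)"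
    unfolding F_def
  proof (rule nn_integral_scaled_le)
    let ?h = "(1 / 2) ^ n0 *\<^sub>R e"
    show "AE x in lborel. \<bar>f 0 x\<bar> = 2 ^ n0 * \<bar>v (x + ?h) - v x\<bar>"
      using vu AE_lborel_shift[OF vu, of ?h] by eventually_elim (simp add: f_def diff_quotient_def abs_mult)
    show "(\<integral>\<^sup>+ x. ennreal (\<bar>v (x + ?h) - v x\<bar> powr q * indicator (ball x0 r) x) \<partial>lborel) \<le> ennreal ((2 * M * (1 + ?\<omega>)) powr q)"
      using h0 X e by (intro trivial_difference r q) auto
  qed (use M in auto)
  have step: "(\<integral>\<^sup>+ x. ennreal (\<bar>f (Suc n) x - f n x\<bar> powr q) * indicator (ball x0 r) x \<partial>lborel) \<le> ennreal ((A * \<rho> ^ n) powr q)" for n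
  proof -
    define j where "j = n + n0"
    define h where "h = (1 / 2) ^ Suc j *\<^sub>R e"
    have nh: "norm h = (1 / 2) ^ Suc j" using e by (simp add: h_def)
    have "(1 / 2 :: real) ^ Suc j \<le> (1 / 2) ^ n0" unfolding j_def by (intro power_decreasing) auto
    then have h: "h \<noteq> 0" "norm h \<le> (R - r) / 32" using h0 nh e by (auto simp: h_def)
    have "(\<integral>\<^sup>+ x. ennreal (\<bar>f (Suc n) x - f n x\<bar> powr q) * indicator (ball x0 r) x \<partial>lborel) \<le> ennreal ((2 ^ j * (C * M * X powr \<kappa> * norm h powr g)) powr q)"
    proof (rule nn_integral_scaled_le)
      show "AE x in lborel. \<bar>f (Suc n) x - f n x\<bar> = 2 ^ j * \<bar>(v (x + h + h) - v (x + h)) - (v (x + h) - v x)\<bar>"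
        using vu AE_lborel_shift[OF vu, of h] AE_lborel_shift[OF AE_lborel_shift[OF vu, of h], of h]
      proof eventually_elim
        case (elim x)
        have "f (Suc n) x - f n x = - (2 ^ j) * ((u0 (x + h + h) - u0 (x + h)) - (u0 (x + h) - u0 x))"
          unfolding f_def h_def j_def using diff_quotient_Suc[of u0 e "n + n0" x] by simp
        then show ?case using elim by (simp add: abs_mult)
      qed
      show "(\<integral>\<^sup>+ x. ennreal (\<bar>(v (x + h + h) - v (x + h)) - (v (x + h) - v x)\<bar> powr q * indicator (ball x0 r) x) \<partial>lborel) \<le> ennreal ((C * M * X powr \<kappa> * norm h powr g) powr q)"
        unfolding X_def by (rule bd[OF sol r h])
    qed (use C M in auto)
    also have "\<dots> \<le> ennreal ((A * \<rho> ^ n) powr q)"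
    proof (intro ennreal_leI powr_mono2)
      \<comment> \<open>Each halving of the step multiplies the estimate by \<rho> = 2^(1-g), which
        is less than 1 because g > 1.\<close>
      have "2 ^ j * norm h powr g \<le> \<rho> ^ n"
      proof -
        have "(2::real) ^ j = 2 powr real j" by (simp add: powr_realpow)
        moreover have "norm h powr g = 2 powr (- (real j + 1) * g)"
        proof -
          have "norm h = 2 powr (- (real j + 1))"
            unfolding nh power_one_over powr_minus using powr_realpow[of 2 "Suc j"] by (simp add: field_simps)
          then show ?thesis by (simp add: powr_powr)
        qed
        ultimately have "2 ^ j * norm h powr g = 2 powr (real j - (real j + 1) * g)" by (simp add: powr_add[symmetric] algebra_simps)
        also have "\<dots> \<le> 2 powr ((1 - g) * real n)"
        proof (intro powr_mono)
          have "(1 - g) * real j \<le> (1 - g) * real n" using g by (intro mult_left_mono_neg) (auto simp: j_def)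
          then show "real j - (real j + 1) * g \<le> (1 - g) * real n" using g by (simp add: algebra_simps)
        qed auto
        also have "\<dots> = \<rho> ^ n" using powr_realpow[of \<rho> n] \<rho>(1) by (simp add: \<rho>_def powr_powr)
        finally show ?thesis .
      qed
      then have "A * (2 ^ j * norm h powr g) \<le> A * \<rho> ^ n" using A0 by (intro mult_left_mono) auto
      then show "2 ^ j * (C * M * X powr \<kappa> * norm h powr g) \<le> A * \<rho> ^ n" by (simp add: A_def mult_ac)
    qed (use C M q in auto)
    finally show ?thesis .
  qed
  have V: "emeasure lborel (ball x0 r) \<le> ennreal (?\<omega> * r ^ DIM('a))" "0 \<le> ?\<omega> * r ^ DIM('a)"
    using r by (auto simp: emeasure_ball)
  note lims = Lq_geometric_limit[OF _ _ q A0 F0 \<rho> V f0 step]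
  have dy: "lim (\<lambda>n. f n x) = dyadic_derivative u0 e x" for x
    unfolding f_def by (rule dyadic_derivative_shift[symmetric])
  have "(\<integral>\<^sup>+ x. ennreal (\<bar>dyadic_derivative u0 e x\<bar> powr q) * indicator (ball x0 r) x \<partial>lborel) \<le> ennreal ((F + A / (1 - \<rho>)) powr q)"
    using lims(1) unfolding dy by simp
  also have "\<dots> \<le> ennreal (((128 * (1 + ?\<omega>) + C / (1 - \<rho>)) * M * X powr (\<kappa> + 1)) powr q)"
  proof (intro ennreal_leI powr_mono2)
    have Xk: "X powr 1 \<le> X powr (\<kappa> + 1)" "X powr \<kappa> \<le> X powr (\<kappa> + 1)" using powr_mono[of 1 "\<kappa> + 1" X] powr_mono[of \<kappa> "\<kappa> + 1" X] X C by simp_all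
    \<comment> \<open>The final 128 is 64 from the bound on 2^n0, times 2 from the bound 2 M for a
      difference of two values.\<close>
    have "F \<le> 64 * X * (2 * M * (1 + ?\<omega>))" unfolding F_def using n0 M by (intro mult_right_mono) auto
    also have "\<dots> = 128 * (1 + ?\<omega>) * M * X powr 1" using X by simp
    also have "\<dots> \<le> 128 * (1 + ?\<omega>) * M * X powr (\<kappa> + 1)" using Xk M by (intro mult_left_mono) auto
    finally have 1: "F \<le> 128 * (1 + ?\<omega>) * M * X powr (\<kappa> + 1)" .
    have "A / (1 - \<rho>) = C / (1 - \<rho>) * M * X powr \<kappa>" by (simp add: A_def)
    also have "\<dots> \<le> C / (1 - \<rho>) * M * X powr (\<kappa> + 1)" using Xk M C \<rho> by (intro mult_left_mono) auto
    finally have 2: "A / (1 - \<rho>) \<le> C / (1 - \<rho>) * M * X powr (\<kappa> + 1)" .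
    show "F + A / (1 - \<rho>) \<le> (128 * (1 + ?\<omega>) + C / (1 - \<rho>)) * M * X powr (\<kappa> + 1)" using 1 2 by (simp only: distrib_right)
  qed (use A0 F0 \<rho> q in auto)
  finally show ?A unfolding X_def \<rho>_def .
  have "(\<lambda>n. \<integral>\<^sup>+ x. ennreal \<bar>diff_quotient u0 e (n + n0) x - dyadic_derivative u0 e x\<bar> * indicator (ball x0 r) x \<partial>lborel) \<longlonglongrightarrow> 0"
    using lims(2) unfolding dy unfolding f_def by simp
  then show ?B by (rule LIMSEQ_offset)
qed

section \<open>From balls to compact sets, and from directional derivatives to the gradient\<close>

lemma nn_integral_indicator_cover_le:
  fixes g :: "'a::euclidean_space \<Rightarrow> ennreal"
  assumes [measurable]: "g \<in> borel_measurable borel" and T: "finite T" "K \<subseteq> (\<Union>x\<in>T. ball x (\<rho> x))"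
  shows "(\<integral>\<^sup>+ y. g y * indicator K y \<partial>lborel) \<le> (\<Sum>x\<in>T. \<integral>\<^sup>+ y. g y * indicator (ball x (\<rho> x)) y \<partial>lborel)"
proof -
  have "g y * indicator K y \<le> (\<Sum>x\<in>T. g y * indicator (ball x (\<rho> x)) y)" for y
  proof (cases "y \<in> K")
    case True
    then obtain x where x: "x \<in> T" "y \<in> ball x (\<rho> x)" using T by auto
    have "g y * indicator K y = g y * indicator (ball x (\<rho> x)) y" using True x by simp
    also have "\<dots> \<le> (\<Sum>x\<in>T. g y * indicator (ball x (\<rho> x)) y)" using T x by (intro member_le_sum) auto
    finally show ?thesis .
  qed simp
  then have "(\<integral>\<^sup>+ y. g y * indicator K y \<partial>lborel) \<le> (\<integral>\<^sup>+ y. (\<Sum>x\<in>T. g y * indicator (ball x (\<rho> x)) y) \<partial>lborel)"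
    by (intro nn_integral_mono)
  also have "\<dots> = (\<Sum>x\<in>T. \<integral>\<^sup>+ y. g y * indicator (ball x (\<rho> x)) y \<partial>lborel)"
    by (rule nn_integral_sum) (auto intro!: borel_measurable_times_ennreal borel_measurable_indicator)
  finally show ?thesis .
qed

lemma powr_sum_le:
  fixes a :: "'i \<Rightarrow> real"
  assumes I: "finite I" "I \<noteq> {}" and a: "\<And>i. i \<in> I \<Longrightarrow> 0 \<le> a i" and q: "0 \<le> q"
  shows "(\<Sum>i\<in>I. a i) powr q \<le> real (card I) powr q * (\<Sum>i\<in>I. a i powr q)"
proof -
  obtain j where j: "j \<in> I" "\<And>i. i \<in> I \<Longrightarrow> a i \<le> a j"
  proof -
    have "Max (a ` I) \<in> a ` I" using I by (intro Max_in) auto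
    then obtain j where "j \<in> I" "a j = Max (a ` I)" by auto
    then show ?thesis using that I by (metis Max_ge finite_imageI imageI)
  qed
  have "(\<Sum>i\<in>I. a i) \<le> real (card I) * a j" using sum_bounded_above[of I a "a j"] j by simp
  then have "(\<Sum>i\<in>I. a i) powr q \<le> (real (card I) * a j) powr q" using a q by (intro powr_mono2 sum_nonneg) auto
  also have "\<dots> = real (card I) powr q * a j powr q" using a j by (simp add: powr_mult)
  also have "\<dots> \<le> real (card I) powr q * (\<Sum>i\<in>I. a i powr q)"
    using j I by (intro mult_left_mono member_le_sum) auto
  finally show ?thesis .
qed

lemma ball_const_finite: "(\<integral>\<^sup>+ x. ennreal c * indicator (ball (x0 :: 'a::euclidean_space) r) x \<partial>lborel) < \<infinity>"
  using nn_integral_indicator_ball_finite[of c x0 r] by (simp add: ennreal_mult_indicator)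

lemma nn_integral_abs_le_powr:
  fixes f :: "'a::euclidean_space \<Rightarrow> real"
  assumes [measurable]: "f \<in> borel_measurable borel" and q: "1 \<le> q"
    and f: "(\<integral>\<^sup>+ x. ennreal (\<bar>f x\<bar> powr q) * indicator (ball x0 r) x \<partial>lborel) < \<infinity>"
  shows "(\<integral>\<^sup>+ x. ennreal \<bar>f x\<bar> * indicator (ball x0 r) x \<partial>lborel) < \<infinity>"
proof -
  have [measurable]: "ball x0 r \<in> sets borel" by simp
  have "(\<integral>\<^sup>+ x. ennreal \<bar>f x\<bar> * indicator (ball x0 r) x \<partial>lborel)
     \<le> (\<integral>\<^sup>+ x. ennreal 1 * indicator (ball x0 r) x + ennreal (\<bar>f x\<bar> powr q) * indicator (ball x0 r) x \<partial>lborel)"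
  proof (intro nn_integral_mono)
    fix x
    have "\<bar>f x\<bar> \<le> 1 + \<bar>f x\<bar> powr q" using powr_le_sum_powr[of "\<bar>f x\<bar>" 1 1 q] q by simp
    then have "ennreal \<bar>f x\<bar> \<le> ennreal 1 + ennreal (\<bar>f x\<bar> powr q)"
      by (subst ennreal_plus[symmetric]) (auto intro: ennreal_leI simp del: ennreal_plus)
    then show "ennreal \<bar>f x\<bar> * indicator (ball x0 r) x \<le> ennreal 1 * indicator (ball x0 r) x + ennreal (\<bar>f x\<bar> powr q) * indicator (ball x0 r) x"
      by (simp add: indicator_def)
  qed
  also have "\<dots> = (\<integral>\<^sup>+ x. ennreal 1 * indicator (ball x0 r) x \<partial>lborel) + (\<integral>\<^sup>+ x. ennreal (\<bar>f x\<bar> powr q) * indicator (ball x0 r) x \<partial>lborel)"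
    by (rule nn_integral_add) measurable
  also have "\<dots> < \<infinity>" using f ball_const_finite[of 1 x0 r] by (simp add: less_top)
  finally show ?thesis .
qed

lemma norm_sum_Basis_powr_le:
  fixes a :: "'a::euclidean_space \<Rightarrow> real"
  assumes "0 \<le> q"
  shows "norm (\<Sum>e\<in>Basis. a e *\<^sub>R e) powr q \<le> real DIM('a) powr q * (\<Sum>e\<in>Basis. \<bar>a e\<bar> powr q)"
proof -
  have "norm (\<Sum>e\<in>Basis. a e *\<^sub>R e) \<le> (\<Sum>e\<in>Basis. \<bar>a e\<bar>)"
    by (rule order_trans[OF norm_sum]) simp
  then have "norm (\<Sum>e\<in>Basis. a e *\<^sub>R e) powr q \<le> (\<Sum>e\<in>Basis. \<bar>a e\<bar>) powr q"
    using assms by (intro powr_mono2) auto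
  also have "\<dots> \<le> real DIM('a) powr q * (\<Sum>e\<in>Basis. \<bar>a e\<bar> powr q)"
    using assms by (intro powr_sum_le) auto
  finally show ?thesis .
qed

lemma nn_integral_norm_sum_Basis_le:
  fixes G :: "'a::euclidean_space \<Rightarrow> 'a \<Rightarrow> real"
  assumes m: "\<And>e. e \<in> Basis \<Longrightarrow> G e \<in> borel_measurable borel" and S[measurable]: "S \<in> sets borel" and q: "0 \<le> q"
  shows "(\<integral>\<^sup>+ x. ennreal (norm (\<Sum>e\<in>Basis. G e x *\<^sub>R e) powr q) * indicator S x \<partial>lborel)
    \<le> ennreal (real DIM('a) powr q) * (\<Sum>e\<in>Basis. \<integral>\<^sup>+ x. ennreal (\<bar>G e x\<bar> powr q) * indicator S x \<partial>lborel)"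
proof -
  have m': "(\<lambda>x. ennreal (\<bar>G e x\<bar> powr q) * indicator S x) \<in> borel_measurable lborel" if "e \<in> Basis" for e
  proof -
    note [measurable] = m[OF that]
    show ?thesis by measurable
  qed
  have "(\<integral>\<^sup>+ x. ennreal (norm (\<Sum>e\<in>Basis. G e x *\<^sub>R e) powr q) * indicator S x \<partial>lborel)
     \<le> (\<integral>\<^sup>+ x. ennreal (real DIM('a) powr q) * (\<Sum>e\<in>Basis. ennreal (\<bar>G e x\<bar> powr q) * indicator S x) \<partial>lborel)"
  proof (intro nn_integral_mono)
    fix x
    have "ennreal (norm (\<Sum>e\<in>Basis. G e x *\<^sub>R e) powr q) \<le> ennreal (real DIM('a) powr q) * (\<Sum>e\<in>Basis. ennreal (\<bar>G e x\<bar> powr q))"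
      using ennreal_leI[OF norm_sum_Basis_powr_le[OF q, of "\<lambda>e. G e x"]] by (simp add: ennreal_mult' sum_ennreal)
    then show "ennreal (norm (\<Sum>e\<in>Basis. G e x *\<^sub>R e) powr q) * indicator S x \<le> ennreal (real DIM('a) powr q) * (\<Sum>e\<in>Basis. ennreal (\<bar>G e x\<bar> powr q) * indicator S x)"
      by (simp add: indicator_def)
  qed
  also have "\<dots> = ennreal (real DIM('a) powr q) * (\<integral>\<^sup>+ x. (\<Sum>e\<in>Basis. ennreal (\<bar>G e x\<bar> powr q) * indicator S x) \<partial>lborel)"
    by (intro nn_integral_cmult borel_measurable_sum m')
  also have "(\<integral>\<^sup>+ x. (\<Sum>e\<in>Basis. ennreal (\<bar>G e x\<bar> powr q) * indicator S x) \<partial>lborel)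
      = (\<Sum>e\<in>Basis. \<integral>\<^sup>+ x. ennreal (\<bar>G e x\<bar> powr q) * indicator S x \<partial>lborel)"
    by (intro nn_integral_sum m')
  finally show ?thesis .
qed

lemma Lq_on_of_borel:
  fixes w w0 :: "'a::euclidean_space \<Rightarrow> real"
  assumes w0[measurable]: "w0 \<in> borel_measurable borel" and w: "w \<in> borel_measurable lebesgue" and eq: "AE x in lebesgue. w x = w0 x"
    and K: "K \<in> sets borel" and fin: "(\<integral>\<^sup>+ x. ennreal (\<bar>w0 x\<bar> powr q) * indicator K x \<partial>lborel) < \<infinity>"
  shows "Lq_on q K w"
proof -
  have "(\<integral>\<^sup>+ x. ennreal (\<bar>w x\<bar> powr q) * indicator K x \<partial>lebesgue) = (\<integral>\<^sup>+ x. ennreal (\<bar>w0 x\<bar> powr q) * indicator K x \<partial>lebesgue)"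
    by (intro nn_integral_cong_AE) (use eq in \<open>eventually_elim, simp\<close>)
  moreover have "K \<in> sets lebesgue" using K by (simp add: sets_completionI_sets)
  then have "(\<lambda>x. indicator K x *\<^sub>R w x) \<in> borel_measurable lebesgue"
    using w by (intro borel_measurable_scaleR borel_measurable_indicator)
  ultimately show ?thesis
    unfolding Lq_on_def set_borel_measurable_def using fin by (simp add: nn_integral_completion)
qed

text \<open>Both vector-valued integrals are expanded in the basis; each coordinate is a directional
  derivative. Test functions see only compact subsets of \<open>\<Omega>\<close>, where u and all
  components are integrable.\<close>

lemma weak_gradient_of_derivatives:
  fixes u u0 :: "'a::euclidean_space \<Rightarrow> real" and G :: "'a \<Rightarrow> 'a \<Rightarrow> real"
  assumes u0[measurable]: "u0 \<in> borel_measurable borel" and uu: "AE x in lebesgue. u x = u0 x" and u: "u \<in> borel_measurable lebesgue"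
    and ui: "loc_integrable UNIV u0"
    and G: "\<And>e. e \<in> Basis \<Longrightarrow> G e \<in> borel_measurable borel" "\<And>e. e \<in> Basis \<Longrightarrow> loc_integrable \<Omega> (G e)"
    and der: "\<And>e \<phi> \<phi>'. e \<in> Basis \<Longrightarrow> test_fun \<Omega> \<phi> \<phi>' \<Longrightarrow> (\<integral> x. u0 x * (\<phi>' x \<bullet> e) \<partial>lborel) = - (\<integral> x. \<phi> x * G e x \<partial>lborel)"
  shows "weak_gradient \<Omega> u (\<lambda>x. \<Sum>e\<in>Basis. G e x *\<^sub>R e)"
  unfolding weak_gradient_def
proof (intro conjI allI impI)
  have Gm: "(\<lambda>x. \<Sum>e\<in>Basis. G e x *\<^sub>R e) \<in> borel_measurable borel"
    using G(1) by (intro borel_measurable_sum borel_measurable_scaleR) auto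
  then show "(\<lambda>x. \<Sum>e\<in>Basis. G e x *\<^sub>R e) \<in> borel_measurable lebesgue" by (simp add: measurable_completion)
  show "set_integrable lebesgue K (\<lambda>x. \<Sum>e\<in>Basis. G e x *\<^sub>R e)" if K: "compact K \<and> K \<subseteq> \<Omega>" for K
  proof -
    have Kb[measurable]: "K \<in> sets borel" using K by (simp add: borel_compact)
    have "integrable lborel (\<lambda>x. indicator K x * G e x)" if e: "e \<in> Basis" for e
      by (rule integrable_mult_compact_support[OF G(1)[OF e] _ G(2)[OF e] conjunct1[OF K] conjunct2[OF K], of _ 1]) (auto simp: indicator_def)
    then have "integrable lborel (\<lambda>x. \<Sum>e\<in>Basis. (indicator K x * G e x) *\<^sub>R e)"
      by (intro Bochner_Integration.integrable_sum integrable_scaleR_left) auto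
    moreover have "(\<lambda>x. \<Sum>e\<in>Basis. (indicator K x * G e x) *\<^sub>R e) = (\<lambda>x. indicator K x *\<^sub>R (\<Sum>e\<in>Basis. G e x *\<^sub>R e))"
      by (simp add: scaleR_sum_right)
    ultimately have i: "integrable lborel (\<lambda>x. indicator K x *\<^sub>R (\<Sum>e\<in>Basis. G e x *\<^sub>R e))" by simp
    then have "(\<lambda>x. indicator K x *\<^sub>R (\<Sum>e\<in>Basis. G e x *\<^sub>R e)) \<in> borel_measurable lborel" by (rule borel_measurable_integrable)
    from integrable_completion[OF this] i show ?thesis unfolding set_integrable_def by simp
  qed
  fix \<phi> \<phi>' assume t: "test_fun \<Omega> \<phi> \<phi>'"
  obtain K B where K: "compact K" "K \<subseteq> \<Omega>" "\<And>x. x \<notin> K \<Longrightarrow> \<phi> x = 0" "\<And>x. x \<notin> K \<Longrightarrow> \<phi>' x = 0"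
    "\<And>x. \<bar>\<phi> x\<bar> \<le> B" "\<And>x. norm (\<phi>' x) \<le> B" and c: "continuous_on UNIV \<phi>" "continuous_on UNIV \<phi>'"
    by (rule test_fun_bounded[OF t]) (rule that, assumption+)
  have m[measurable]: "\<phi> \<in> borel_measurable borel" "\<phi>' \<in> borel_measurable borel"
    using c by (auto intro: borel_measurable_continuous_onI)
  have iG: "integrable lborel (\<lambda>x. \<phi> x * G e x)" if e: "e \<in> Basis" for e
    by (rule integrable_mult_compact_support[OF G(1)[OF e] m(1) G(2)[OF e] K(1,2,5,3)])
  have iu: "integrable lborel (\<lambda>x. (\<phi>' x \<bullet> e) * u0 x)" if e: "e \<in> Basis" for e
  proof (rule integrable_mult_compact_support[OF u0 _ ui K(1)])
    show "\<bar>\<phi>' x \<bullet> e\<bar> \<le> B" for x using Basis_le_norm[OF e, of "\<phi>' x"] K(6)[of x] by linarith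
  qed (use K in auto)
  have "(\<integral> x. u x *\<^sub>R \<phi>' x \<partial>lebesgue) = (\<integral> x. u0 x *\<^sub>R \<phi>' x \<partial>lebesgue)"
  proof (rule integral_cong_AE)
    have "\<phi>' \<in> borel_measurable lebesgue" by (simp add: measurable_completion)
    then show "(\<lambda>x. u x *\<^sub>R \<phi>' x) \<in> borel_measurable lebesgue" using u by (rule borel_measurable_scaleR[rotated])
    show "(\<lambda>x. u0 x *\<^sub>R \<phi>' x) \<in> borel_measurable lebesgue" by (rule measurable_completion) simp
  qed (use uu in \<open>eventually_elim, simp\<close>)
  also have "\<dots> = (\<integral> x. u0 x *\<^sub>R \<phi>' x \<partial>lborel)" by (rule integral_completion) simp
  also have "\<dots> = (\<integral> x. (\<Sum>e\<in>Basis. ((\<phi>' x \<bullet> e) * u0 x) *\<^sub>R e) \<partial>lborel)"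
  proof (rule Bochner_Integration.integral_cong[OF refl])
    fix x
    have "u0 x *\<^sub>R \<phi>' x = u0 x *\<^sub>R (\<Sum>e\<in>Basis. (\<phi>' x \<bullet> e) *\<^sub>R e)" by (simp add: euclidean_representation)
    then show "u0 x *\<^sub>R \<phi>' x = (\<Sum>e\<in>Basis. ((\<phi>' x \<bullet> e) * u0 x) *\<^sub>R e)"
      by (simp add: scaleR_sum_right mult.commute del: euclidean_representation)
  qed
  also have "\<dots> = (\<Sum>e\<in>Basis. (\<integral> x. (\<phi>' x \<bullet> e) * u0 x \<partial>lborel) *\<^sub>R e)"
    using iu by (subst Bochner_Integration.integral_sum) (auto intro!: sum.cong)
  also have "\<dots> = (\<Sum>e\<in>Basis. - (\<integral> x. \<phi> x * G e x \<partial>lborel) *\<^sub>R e)"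
    using der[OF _ t] by (intro sum.cong) (simp_all add: mult.commute)
  also have "\<dots> = - (\<Sum>e\<in>Basis. (\<integral> x. \<phi> x * G e x \<partial>lborel) *\<^sub>R e)" by (simp add: sum_negf)
  also have "(\<Sum>e\<in>Basis. (\<integral> x. \<phi> x * G e x \<partial>lborel) *\<^sub>R e) = (\<integral> x. (\<Sum>e\<in>Basis. (\<phi> x * G e x) *\<^sub>R e) \<partial>lborel)"
    using iG by (subst Bochner_Integration.integral_sum) (auto intro!: sum.cong)
  also have "\<dots> = (\<integral> x. \<phi> x *\<^sub>R (\<Sum>e\<in>Basis. G e x *\<^sub>R e) \<partial>lborel)" by (simp add: scaleR_sum_right)
  also have "\<dots> = (\<integral> x. \<phi> x *\<^sub>R (\<Sum>e\<in>Basis. G e x *\<^sub>R e) \<partial>lebesgue)"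
    using Gm by (intro integral_completion[symmetric]) simp
  finally show "(\<integral> x. u x *\<^sub>R \<phi>' x \<partial>lebesgue) = - (\<integral> x. \<phi> x *\<^sub>R (\<Sum>e\<in>Basis. G e x *\<^sub>R e) \<partial>lebesgue)" .
qed

text \<open>Any number above the infimum is an essential bound. The added 1 provides such a number
  and also appears as a summand in the final estimate.\<close>

lemma Linf_norm_nonneg:
  assumes "Linf_on B u"
  shows "0 \<le> Linf_norm B u" "AE x in lebesgue. x \<in> B \<longrightarrow> \<bar>u x\<bar> \<le> Linf_norm B u + 1"
proof -
  let ?S = "{M. 0 \<le> M \<and> (AE x in lebesgue. x \<in> B \<longrightarrow> \<bar>u x\<bar> \<le> M)}"
  obtain M where "AE x in lebesgue. x \<in> B \<longrightarrow> \<bar>u x\<bar> \<le> M" using assms unfolding Linf_on_def by blast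
  then have "AE x in lebesgue. x \<in> B \<longrightarrow> \<bar>u x\<bar> \<le> \<bar>M\<bar>" by eventually_elim auto
  then have ne: "?S \<noteq> {}" by (auto intro: exI[of _ "\<bar>M\<bar>"])
  show "0 \<le> Linf_norm B u" unfolding Linf_norm_def using ne by (intro cInf_greatest) auto
  have "Inf ?S < Linf_norm B u + 1" by (simp add: Linf_norm_def)
  from cInf_lessD[OF ne this] obtain m where m: "AE x in lebesgue. x \<in> B \<longrightarrow> \<bar>u x\<bar> \<le> m" "m < Linf_norm B u + 1" by blast
  from m(1) show "AE x in lebesgue. x \<in> B \<longrightarrow> \<bar>u x\<bar> \<le> Linf_norm B u + 1" by eventually_elim (use m(2) in auto)
qed

text \<open>The gradient is built once, from the quotients of a single Borel representative, so the
  estimates on all balls concern the same function and no gluing is required. The factors N^q and N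
  come from passing from the components to the norm of the vector.\<close>

lemma weak_solution_has_gradient:
  fixes u :: "'a::euclidean_space \<Rightarrow> real"
  assumes dim: "2 \<le> DIM('a)" and s1: "0 < s1" "s1 < 1" and p: "1 < p" "p < 2" and sp: "0 < sp" "sp < 1" and q: "p \<le> q" and k1: "1 \<le> k"
    and k: "(\<integral>\<^sup>+ z. ennreal (1 / (1 + norm z) powr (real DIM('a) + s1)) \<partial>(lborel :: 'a measure)) \<le> ennreal k"
      "(\<integral>\<^sup>+ z. ennreal (1 / (1 + norm z) powr (real DIM('a) + sp * p)) \<partial>(lborel :: 'a measure)) \<le> ennreal k"
      "(\<integral>\<^sup>+ z. ennreal (norm z powr (1 - s1 - real DIM('a)) * indicator (cball 0 2) z) \<partial>(lborel :: 'a measure)) \<le> ennreal k"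
      "(\<integral>\<^sup>+ z. ennreal (norm z powr (p - sp * p - real DIM('a)) * indicator (cball 0 2) z) \<partial>(lborel :: 'a measure)) \<le> ennreal k"
    and C: "1 \<le> C" "0 \<le> \<kappa>" and g: "1 < g"
    and bd: "\<And>(u :: 'a \<Rightarrow> real) Z x0 R M r h. local_solution u Z x0 R M s1 sp p k \<Longrightarrow> 0 < r \<Longrightarrow> r < R \<Longrightarrow> h \<noteq> 0 \<Longrightarrow> norm h \<le> (R - r) / 32 \<Longrightarrow>
       (\<integral>\<^sup>+ x. ennreal (\<bar>(u (x + h + h) - u (x + h)) - (u (x + h) - u x)\<bar> powr q * indicator (ball x0 r) x) \<partial>lborel)
       \<le> ennreal ((C * M * (1 / (R - r)) powr \<kappa> * norm h powr g) powr q)"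
    and \<Omega>: "open \<Omega>" and sol: "weak_solution s1 sp p \<Omega> u" and lb: "locally_bounded \<Omega> u"
  defines "Cg \<equiv> 128 * (1 + unit_ball_vol DIM('a)) + C / (1 - 2 powr (1 - g))"
  shows "sobolev1_loc q \<Omega> u"
    and "\<exists>G0. weak_gradient \<Omega> u G0 \<and> (\<forall>x0 R r. cc_subset (ball x0 R) \<Omega> \<and> 0 < R \<and> R < 1 \<and> 0 < r \<and> r < R \<longrightarrow>
      (\<integral>\<^sup>+ x. ennreal (norm (G0 x) powr q) * indicator (ball x0 r) x \<partial>lebesgue)
      \<le> ennreal (real DIM('a) powr q * (real DIM('a) * ((Cg * (Linf_norm (ball x0 R) u + Tail sp p u x0 R + 1) * (1 / (R - r)) powr (\<kappa> + 1)) powr q))))"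
proof -
  have q1: "1 \<le> q" "0 \<le> q" using q p by auto
  have tl: "tail_space sp p u" using sol by (simp add: weak_solution_def)
  have um: "u \<in> borel_measurable lebesgue" by (rule tail_space_measurable[OF tl])
  obtain u0 where u0[measurable]: "u0 \<in> borel_measurable borel" and uu0: "AE x in lborel. u x = u0 x"
    using completion_ex_borel_measurable_real[OF um] by auto
  have uu: "AE x in lebesgue. u x = u0 x" using uu0 by (rule AE_completion)
  \<comment> \<open>This number is at least 1, bounds u almost everywhere on the ball and bounds the
    tail, as \<open>local_solution\<close> demands.\<close>
  define M where "M x R = Linf_norm (ball x R) u + Tail sp p u x R + 1" for x R
  have Tail0: "0 \<le> Tail sp p u x R" for x R by (simp add: Tail_def)
  have loc: "1 \<le> M x R \<and> (AE y in lebesgue. y \<in> ball x R \<longrightarrow> \<bar>u y\<bar> \<le> M x R) \<and>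
      (\<exists>v Z. local_solution v Z x R (M x R) s1 sp p k \<and> (AE y in lborel. v y = u0 y))"
    if cc: "cc_subset (ball x R) \<Omega>" and R: "0 < R" "R < 1" for x R
  proof -
    have L: "Linf_on (ball x R) u" using lb cc unfolding locally_bounded_def by blast
    have M1: "1 \<le> M x R" using Linf_norm_nonneg(1)[OF L] Tail0[of x R] by (simp add: M_def)
    have Mb: "AE y in lebesgue. y \<in> ball x R \<longrightarrow> \<bar>u y\<bar> \<le> M x R"
      using Linf_norm_nonneg(2)[OF L] by eventually_elim (use Tail0[of x R] in \<open>auto simp: M_def\<close>)
    have MT: "Tail sp p u x R \<le> M x R" using Linf_norm_nonneg(1)[OF L] by (simp add: M_def)
    from local_solution_of_weak_solution[OF dim s1 p sp k1 k sol cc R u0 uu M1 Mb MT] M1 Mb show ?thesis by blast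
  qed
  let ?G = "dyadic_derivative u0"
  have est: "(\<integral>\<^sup>+ y. ennreal (\<bar>?G e y\<bar> powr q) * indicator (ball x r) y \<partial>lborel) \<le> ennreal ((Cg * M x R * (1 / (R - r)) powr (\<kappa> + 1)) powr q)"
    and conv: "(\<lambda>n. \<integral>\<^sup>+ y. ennreal \<bar>diff_quotient u0 e n y - ?G e y\<bar> * indicator (ball x r) y \<partial>lborel) \<longlonglongrightarrow> 0"
    if cc: "cc_subset (ball x R) \<Omega>" and R: "0 < R" "R < 1" and r: "0 < r" "r < R" and e: "e \<in> Basis" for x R r e
  proof -
    obtain v Z where v: "local_solution v Z x R (M x R) s1 sp p k" "AE y in lborel. v y = u0 y" using loc[OF cc R] by blast
    have e1: "norm e = 1" using e by simp
    show "(\<integral>\<^sup>+ y. ennreal (\<bar>?G e y\<bar> powr q) * indicator (ball x r) y \<partial>lborel) \<le> ennreal ((Cg * M x R * (1 / (R - r)) powr (\<kappa> + 1)) powr q)"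
      unfolding Cg_def by (rule dyadic_derivative_local(1)[OF C g q1(1) _ v u0 r e1], rule bd)
    show "(\<lambda>n. \<integral>\<^sup>+ y. ennreal \<bar>diff_quotient u0 e n y - ?G e y\<bar> * indicator (ball x r) y \<partial>lborel) \<longlonglongrightarrow> 0"
      by (rule dyadic_derivative_local(2)[OF C g q1(1) _ v u0 r e1], rule bd)
  qed
  have "\<exists>\<rho>. 0 < \<rho> \<and> \<rho> < 1 \<and> cc_subset (ball x \<rho>) \<Omega>" if "x \<in> \<Omega>" for x
  proof -
    obtain d where d: "0 < d" "cball x d \<subseteq> \<Omega>" using open_contains_cball \<Omega> \<open>x \<in> \<Omega>\<close> by blast
    have "closure (ball x (min d (1 / 2))) = cball x (min d (1 / 2))" using d by (intro closure_ball) simp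
    moreover have "cball x (min d (1 / 2)) \<subseteq> \<Omega>" using d(2) by auto
    ultimately show ?thesis using d(1) by (intro exI[of _ "min d (1 / 2)"]) (simp add: cc_subset_def)
  qed
  then obtain \<rho> where \<rho>: "\<And>x. x \<in> \<Omega> \<Longrightarrow> 0 < \<rho> x" "\<And>x. x \<in> \<Omega> \<Longrightarrow> \<rho> x < 1" "\<And>x. x \<in> \<Omega> \<Longrightarrow> cc_subset (ball x (\<rho> x)) \<Omega>"
    by metis
  \<comment> \<open>Half radii, because the local estimates on a ball hold only for strictly smaller
    concentric balls.\<close>
  have cover: "\<exists>T. finite T \<and> T \<subseteq> \<Omega> \<and> K \<subseteq> (\<Union>x\<in>T. ball x (\<rho> x / 2))" if K: "compact K" "K \<subseteq> \<Omega>" for K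
  proof -
    have "K \<subseteq> (\<Union>x\<in>\<Omega>. ball x (\<rho> x / 2))" using K(2) \<rho>(1) by force
    from compactE_image[OF K(1) _ this] show ?thesis by (metis open_ball)
  qed
  have finite_on_compact: "(\<integral>\<^sup>+ y. f y * indicator K y \<partial>lborel) < \<infinity>"
    if f: "f \<in> borel_measurable borel" and K: "compact K" "K \<subseteq> \<Omega>"
      and fin: "\<And>x. x \<in> \<Omega> \<Longrightarrow> (\<integral>\<^sup>+ y. f y * indicator (ball x (\<rho> x / 2)) y \<partial>lborel) < \<infinity>" for f :: "'a \<Rightarrow> ennreal" and K
  proof -
    obtain T where T: "finite T" "T \<subseteq> \<Omega>" "K \<subseteq> (\<Union>x\<in>T. ball x (\<rho> x / 2))" using cover[OF K] by blast
    have "(\<Sum>x\<in>T. \<integral>\<^sup>+ y. f y * indicator (ball x (\<rho> x / 2)) y \<partial>lborel) < \<infinity>"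
      using fin T(1,2) by (auto simp: less_top)
    then show ?thesis using nn_integral_indicator_cover_le[OF f T(1,3)] by (rule order.strict_trans1[rotated])
  qed
  have half: "0 < \<rho> x / 2" "\<rho> x / 2 < \<rho> x" if "x \<in> \<Omega>" for x using \<rho>(1)[OF that] by auto
  have uq: "(\<integral>\<^sup>+ y. ennreal (\<bar>u0 y\<bar> powr q) * indicator K y \<partial>lborel) < \<infinity>" if K: "compact K" "K \<subseteq> \<Omega>" for K
  proof (rule finite_on_compact[OF _ K])
    fix x assume x: "x \<in> \<Omega>"
    have b: "AE y in lborel. y \<in> ball x (\<rho> x) \<longrightarrow> \<bar>u0 y\<bar> \<le> M x (\<rho> x)"
    proof -
      have "AE y in lebesgue. y \<in> ball x (\<rho> x) \<longrightarrow> \<bar>u y\<bar> \<le> M x (\<rho> x)" using loc[OF \<rho>(3)[OF x] \<rho>(1)[OF x] \<rho>(2)[OF x]] by blast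
      then have "AE y in lebesgue. y \<in> ball x (\<rho> x) \<longrightarrow> \<bar>u0 y\<bar> \<le> M x (\<rho> x)" using uu by eventually_elim simp
      then show ?thesis unfolding AE_completion_iff .
    qed
    have "(\<integral>\<^sup>+ y. ennreal (\<bar>u0 y\<bar> powr q) * indicator (ball x (\<rho> x / 2)) y \<partial>lborel)
      \<le> (\<integral>\<^sup>+ y. ennreal (M x (\<rho> x) powr q) * indicator (ball x (\<rho> x / 2)) y \<partial>lborel)"
    proof (rule nn_integral_mono_AE, use b in eventually_elim)
      fix y assume y: "y \<in> ball x (\<rho> x) \<longrightarrow> \<bar>u0 y\<bar> \<le> M x (\<rho> x)"
      show "ennreal (\<bar>u0 y\<bar> powr q) * indicator (ball x (\<rho> x / 2)) y \<le> ennreal (M x (\<rho> x) powr q) * indicator (ball x (\<rho> x / 2)) y"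
      proof (cases "y \<in> ball x (\<rho> x / 2)")
        case True
        then have "y \<in> ball x (\<rho> x)" using half[OF x] by auto
        then have "\<bar>u0 y\<bar> powr q \<le> M x (\<rho> x) powr q" using y q1 by (intro powr_mono2) auto
        then show ?thesis using True by (simp add: ennreal_leI)
      qed simp
    qed
    also have "\<dots> < \<infinity>" by (rule ball_const_finite)
    finally show "(\<integral>\<^sup>+ y. ennreal (\<bar>u0 y\<bar> powr q) * indicator (ball x (\<rho> x / 2)) y \<partial>lborel) < \<infinity>" .
  qed measurable
  have Gball: "(\<integral>\<^sup>+ y. ennreal (\<bar>?G e y\<bar> powr q) * indicator (ball x (\<rho> x / 2)) y \<partial>lborel) < \<infinity>" if "x \<in> \<Omega>" "e \<in> Basis" for x e
    using est[OF \<rho>(3) \<rho>(1) \<rho>(2) half, OF that(1) that(1) that(1) that(1) that(1) that(2)] by (rule order.strict_trans1) simp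
  have Gq: "(\<integral>\<^sup>+ y. ennreal (\<bar>?G e y\<bar> powr q) * indicator K y \<partial>lborel) < \<infinity>" if K: "compact K" "K \<subseteq> \<Omega>" and e: "e \<in> Basis" for K e
    by (rule finite_on_compact[OF _ K]) (measurable, rule Gball[OF _ e])
  have Gm[measurable]: "?G e \<in> borel_measurable borel" for e by measurable
  have Gloc: "loc_integrable \<Omega> (?G e)" if e: "e \<in> Basis" for e
    unfolding loc_integrable_def
  proof (intro allI impI, elim conjE)
    fix K :: "'a set" assume K: "compact K" "K \<subseteq> \<Omega>"
    show "(\<integral>\<^sup>+ x. ennreal \<bar>?G e x\<bar> * indicator K x \<partial>lborel) < \<infinity>"
      by (rule finite_on_compact[OF _ K]) (measurable, rule nn_integral_abs_le_powr[OF Gm q1(1) Gball[OF _ e]])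
  qed
  \<comment> \<open>Difference quotients involve u outside \<open>\<Omega>\<close> as well; there
    its integrability on bounded sets comes from the tail space.\<close>
  have uloc: "loc_integrable UNIV u0"
    unfolding loc_integrable_def
  proof (intro allI impI, elim conjE)
    fix K :: "'a set" assume K: "compact K"
    obtain b where b: "\<And>x. x \<in> K \<Longrightarrow> norm x < b"
      using compact_imp_bounded[OF K] unfolding bounded_pos by (metis gt_ex le_less_trans)
    have "Lq_on p (cball 0 b) u" using tl compact_cball unfolding tail_space_def by blast
    then have "(\<integral>\<^sup>+ x. ennreal (\<bar>u x\<bar> powr p) * indicator (cball 0 b) x \<partial>lebesgue) < \<infinity>" by (simp add: Lq_on_def)
    also have "(\<integral>\<^sup>+ x. ennreal (\<bar>u x\<bar> powr p) * indicator (cball 0 b) x \<partial>lebesgue) = (\<integral>\<^sup>+ x. ennreal (\<bar>u0 x\<bar> powr p) * indicator (cball 0 b) x \<partial>lborel)"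
      unfolding nn_integral_completion[symmetric, of lborel] by (intro nn_integral_cong_AE) (use uu in \<open>eventually_elim, simp\<close>)
    finally have c: "(\<integral>\<^sup>+ x. ennreal (\<bar>u0 x\<bar> powr p) * indicator (cball 0 b) x \<partial>lborel) < \<infinity>" .
    have "(\<integral>\<^sup>+ x. ennreal (\<bar>u0 x\<bar> powr p) * indicator (ball 0 b) x \<partial>lborel) \<le> (\<integral>\<^sup>+ x. ennreal (\<bar>u0 x\<bar> powr p) * indicator (cball 0 b) x \<partial>lborel)"
      by (intro nn_integral_mono) (auto simp: indicator_def)
    then have "(\<integral>\<^sup>+ x. ennreal (\<bar>u0 x\<bar> powr p) * indicator (ball 0 b) x \<partial>lborel) < \<infinity>" using c by (rule order.strict_trans1)
    from nn_integral_abs_le_powr[OF u0 less_imp_le[OF p(1)] this]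
    have f: "(\<integral>\<^sup>+ x. ennreal \<bar>u0 x\<bar> * indicator (ball 0 b) x \<partial>lborel) < \<infinity>" .
    have "(\<integral>\<^sup>+ x. ennreal \<bar>u0 x\<bar> * indicator K x \<partial>lborel) \<le> (\<integral>\<^sup>+ x. ennreal \<bar>u0 x\<bar> * indicator (ball 0 b) x \<partial>lborel)"
      using b by (intro nn_integral_mono) (auto simp: indicator_def)
    then show "(\<integral>\<^sup>+ x. ennreal \<bar>u0 x\<bar> * indicator K x \<partial>lborel) < \<infinity>" using f by (rule order.strict_trans1)
  qed
  have convK: "(\<lambda>n. \<integral>\<^sup>+ y. ennreal \<bar>diff_quotient u0 e n y - ?G e y\<bar> * indicator K y \<partial>lborel) \<longlonglongrightarrow> 0"
    if K: "compact K" "K \<subseteq> \<Omega>" and e: "e \<in> Basis" for K e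
  proof -
    obtain T where T: "finite T" "T \<subseteq> \<Omega>" "K \<subseteq> (\<Union>x\<in>T. ball x (\<rho> x / 2))" using cover[OF K] by blast
    have m: "(\<lambda>y. ennreal \<bar>diff_quotient u0 e n y - ?G e y\<bar>) \<in> borel_measurable borel" for n by measurable
    have "(\<lambda>n. \<Sum>x\<in>T. \<integral>\<^sup>+ y. ennreal \<bar>diff_quotient u0 e n y - ?G e y\<bar> * indicator (ball x (\<rho> x / 2)) y \<partial>lborel) \<longlonglongrightarrow> (\<Sum>x\<in>T. 0)"
    proof (rule tendsto_sum)
      fix x assume "x \<in> T"
      then have x: "x \<in> \<Omega>" using T by blast
      show "(\<lambda>n. \<integral>\<^sup>+ y. ennreal \<bar>diff_quotient u0 e n y - ?G e y\<bar> * indicator (ball x (\<rho> x / 2)) y \<partial>lborel) \<longlonglongrightarrow> 0"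
        by (rule conv[OF \<rho>(3)[OF x] \<rho>(1)[OF x] \<rho>(2)[OF x] half[OF x] e])
    qed
    then show ?thesis by (intro tendsto_0_of_le[OF nn_integral_indicator_cover_le[OF m T(1,3)]]) simp
  qed
  define G0 where "G0 x = (\<Sum>e\<in>Basis. ?G e x *\<^sub>R e)" for x
  have wg: "weak_gradient \<Omega> u G0"
    unfolding G0_def[abs_def]
  proof (rule weak_gradient_of_derivatives[OF u0 uu um uloc Gm Gloc])
    fix e :: 'a and \<phi> \<phi>' assume e: "e \<in> Basis" and t: "test_fun \<Omega> \<phi> \<phi>'"
    show "(\<integral> x. u0 x * (\<phi>' x \<bullet> e) \<partial>lborel) = - (\<integral> x. \<phi> x * ?G e x \<partial>lborel)"
      by (rule weak_derivative_of_quotients[OF u0 Gm uloc Gloc[OF e] _ _ t])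
        (use convK[OF _ _ e] e in \<open>simp_all add: diff_quotient_def\<close>)
  qed
  have G0m: "(\<lambda>x. norm (G0 x)) \<in> borel_measurable borel"
  proof -
    have "G0 \<in> borel_measurable borel"
      unfolding G0_def[abs_def] by (intro borel_measurable_sum borel_measurable_scaleR Gm) auto
    then show ?thesis by measurable
  qed
  show "sobolev1_loc q \<Omega> u"
    unfolding sobolev1_loc_def
  proof (intro conjI allI impI exI[of _ G0] wg; elim conjE)
    fix K :: "'a set" assume K: "compact K" "K \<subseteq> \<Omega>"
    have Kb: "K \<in> sets borel" using K(1) by (rule borel_compact)
    show "Lq_on q K u" by (rule Lq_on_of_borel[OF u0 um uu Kb uq[OF K]])
    have "(\<integral>\<^sup>+ x. ennreal (norm (G0 x) powr q) * indicator K x \<partial>lborel)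
       \<le> ennreal (real DIM('a) powr q) * (\<Sum>e\<in>Basis. \<integral>\<^sup>+ x. ennreal (\<bar>?G e x\<bar> powr q) * indicator K x \<partial>lborel)"
      unfolding G0_def by (rule nn_integral_norm_sum_Basis_le[OF Gm Kb q1(2)])
    also have "\<dots> < \<infinity>"
      using Gq[OF K] by (simp add: ennreal_mult_less_top less_top)
    finally show "Lq_on q K (\<lambda>x. norm (G0 x))"
      by (intro Lq_on_of_borel[OF G0m _ _ Kb]) (use G0m in \<open>simp_all add: measurable_completion\<close>)
  qed
  show "\<exists>G0. weak_gradient \<Omega> u G0 \<and> (\<forall>x0 R r. cc_subset (ball x0 R) \<Omega> \<and> 0 < R \<and> R < 1 \<and> 0 < r \<and> r < R \<longrightarrow>
      (\<integral>\<^sup>+ x. ennreal (norm (G0 x) powr q) * indicator (ball x0 r) x \<partial>lebesgue)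
      \<le> ennreal (real DIM('a) powr q * (real DIM('a) * ((Cg * (Linf_norm (ball x0 R) u + Tail sp p u x0 R + 1) * (1 / (R - r)) powr (\<kappa> + 1)) powr q))))"
  proof (intro exI[of _ G0] conjI wg allI impI; elim conjE)
    fix x0 R r assume cc: "cc_subset (ball x0 R) \<Omega>" and R: "0 < R" "R < (1::real)" and r: "0 < r" "r < R"
    let ?Y = "(Cg * M x0 R * (1 / (R - r)) powr (\<kappa> + 1)) powr q"
    have "(\<integral>\<^sup>+ x. ennreal (norm (G0 x) powr q) * indicator (ball x0 r) x \<partial>lebesgue)
       = (\<integral>\<^sup>+ x. ennreal (norm (G0 x) powr q) * indicator (ball x0 r) x \<partial>lborel)" by (rule nn_integral_completion)
    also have "\<dots> \<le> ennreal (real DIM('a) powr q) * (\<Sum>e\<in>Basis. \<integral>\<^sup>+ x. ennreal (\<bar>?G e x\<bar> powr q) * indicator (ball x0 r) x \<partial>lborel)"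
      unfolding G0_def by (rule nn_integral_norm_sum_Basis_le[OF Gm _ q1(2)]) simp
    also have "\<dots> \<le> ennreal (real DIM('a) powr q) * (\<Sum>e\<in>(Basis::'a set). ennreal ?Y)"
      by (intro mult_left_mono sum_mono est[OF cc R r]) auto
    also have "\<dots> = ennreal (real DIM('a) powr q * (real DIM('a) * ?Y))"
      by (simp add: ennreal_mult' ennreal_of_nat_eq_real_of_nat)
    finally show "(\<integral>\<^sup>+ x. ennreal (norm (G0 x) powr q) * indicator (ball x0 r) x \<partial>lebesgue)
      \<le> ennreal (real DIM('a) powr q * (real DIM('a) * ((Cg * (Linf_norm (ball x0 R) u + Tail sp p u x0 R + 1) * (1 / (R - r)) powr (\<kappa> + 1)) powr q)))"
      unfolding M_def .
  qed
qed

theorem theorem1p4: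
  fixes s1 sp p q :: real
  assumes "DIM('a::euclidean_space) \<ge> 2"
    and "0 < s1" "s1 < 1" "1 < p" "p < 2" "(p - 1) / p < sp" "sp < 1" "p \<le> q"
  shows "\<exists>C \<kappa> :: real. \<forall>(\<Omega> :: 'a set) u.
           open \<Omega> \<and> connected \<Omega> \<and> bounded \<Omega> \<and> weak_solution s1 sp p \<Omega> u \<and> locally_bounded \<Omega> u
           \<longrightarrow> sobolev1_loc q \<Omega> u \<and>
               (\<forall>G x0 R r. weak_gradient \<Omega> u G \<and> cc_subset (ball x0 R) \<Omega> \<and> 0 < R \<and> R < 1 \<and>
                    0 < r \<and> r < R \<longrightarrow>
                  (\<integral>\<^sup>+ x. ennreal (norm (G x) powr q) * indicator (ball x0 r) x \<partial>lebesgue)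
                  \<le> ennreal (C * (Linf_norm (ball x0 R) u + Tail sp p u x0 R
                                   + gagliardo sp p (ball x0 R) u + 1) powr q
                              / (R - r) powr \<kappa>))"
proof -
  have sp0: "0 < sp" using assms by (meson divide_pos_pos diff_gt_0_iff_gt less_trans zero_less_one)
  have dim: "2 \<le> DIM('a)" and q: "1 \<le> q" "0 \<le> q" using assms by auto
  obtain k where k1: "1 \<le> k" and k: "(\<integral>\<^sup>+ z. ennreal (1 / (1 + norm z) powr (real DIM('a) + s1)) \<partial>(lborel :: 'a measure)) \<le> ennreal k"
      "(\<integral>\<^sup>+ z. ennreal (1 / (1 + norm z) powr (real DIM('a) + sp * p)) \<partial>(lborel :: 'a measure)) \<le> ennreal k"
      "(\<integral>\<^sup>+ z. ennreal (norm z powr (1 - s1 - real DIM('a)) * indicator (cball 0 2) z) \<partial>(lborel :: 'a measure)) \<le> ennreal k"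
      "(\<integral>\<^sup>+ z. ennreal (norm z powr (p - sp * p - real DIM('a)) * indicator (cball 0 2) z) \<partial>(lborel :: 'a measure)) \<le> ennreal k"
    using kernel_constant_exists[OF dim assms(2-5) sp0 assms(7)] by blast
  obtain g where g: "1 < g" "second_diff_bound TYPE('a) s1 sp p k q g"
    using higher_differentiability[OF assms(4,6,8) k1] by blast
  obtain C \<kappa> where C: "1 \<le> C" "0 \<le> \<kappa>" and bd: "\<And>(u :: 'a \<Rightarrow> real) Z x0 R M r h. local_solution u Z x0 R M s1 sp p k \<Longrightarrow> 0 < r \<Longrightarrow> r < R \<Longrightarrow> h \<noteq> 0 \<Longrightarrow> norm h \<le> (R - r) / 32 \<Longrightarrow>
       (\<integral>\<^sup>+ x. ennreal (\<bar>(u (x + h + h) - u (x + h)) - (u (x + h) - u x)\<bar> powr q * indicator (ball x0 r) x) \<partial>lborel)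
       \<le> ennreal ((C * M * (1 / (R - r)) powr \<kappa> * norm h powr g) powr q)"
    using g(2) unfolding second_diff_bound_def by blast
  define Cg where "Cg = 128 * (1 + unit_ball_vol DIM('a)) + C / (1 - 2 powr (1 - g))"
  have Cg: "0 \<le> Cg"
  proof -
    have "2 powr (1 - g) \<le> 1" using g powr_mono[of "1 - g" 0 "2::real"] by simp
    then show ?thesis using C unfolding Cg_def by (intro add_nonneg_nonneg divide_nonneg_nonneg mult_nonneg_nonneg) auto
  qed
  let ?N = "real DIM('a)"
  show ?thesis
  \<comment> \<open>\<open>Cg\<close> is the constant for one component, before taking q-th powers;
    therefore it occurs as Cg^q and the exponent \<kappa> + 1 is multiplied by q.\<close>
  proof (rule exI[of _ "?N powr q * (?N * Cg powr q)"], rule exI[of _ "(\<kappa> + 1) * q"], intro allI impI, elim conjE)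
    fix \<Omega> :: "'a set" and u
    assume \<Omega>: "open \<Omega>" and sol: "weak_solution s1 sp p \<Omega> u" and lb: "locally_bounded \<Omega> u"
    have grad: "sobolev1_loc q \<Omega> u"
      by (rule weak_solution_has_gradient(1)[OF dim assms(2-5) sp0 assms(7,8) k1 k C g(1) _ \<Omega> sol lb], rule bd)
    obtain G0 where G0: "weak_gradient \<Omega> u G0" and est: "\<And>x0 R r. cc_subset (ball x0 R) \<Omega> \<Longrightarrow> 0 < R \<Longrightarrow> R < 1 \<Longrightarrow> 0 < r \<Longrightarrow> r < R \<Longrightarrow>
      (\<integral>\<^sup>+ x. ennreal (norm (G0 x) powr q) * indicator (ball x0 r) x \<partial>lebesgue)
      \<le> ennreal (?N powr q * (?N * ((Cg * (Linf_norm (ball x0 R) u + Tail sp p u x0 R + 1) * (1 / (R - r)) powr (\<kappa> + 1)) powr q)))"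
      using weak_solution_has_gradient(2)[OF dim assms(2-5) sp0 assms(7,8) k1 k C g(1) _ \<Omega> sol lb, folded Cg_def] bd by blast
    show "sobolev1_loc q \<Omega> u \<and>
               (\<forall>G x0 R r. weak_gradient \<Omega> u G \<and> cc_subset (ball x0 R) \<Omega> \<and> 0 < R \<and> R < 1 \<and>
                    0 < r \<and> r < R \<longrightarrow>
                  (\<integral>\<^sup>+ x. ennreal (norm (G x) powr q) * indicator (ball x0 r) x \<partial>lebesgue)
                  \<le> ennreal (?N powr q * (?N * Cg powr q) * (Linf_norm (ball x0 R) u + Tail sp p u x0 R
                                   + gagliardo sp p (ball x0 R) u + 1) powr q
                              / (R - r) powr ((\<kappa> + 1) * q)))"
    proof (intro conjI allI impI grad; elim conjE)
      fix G x0 R r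
      assume G: "weak_gradient \<Omega> u G" and cc: "cc_subset (ball x0 R) \<Omega>" and R: "0 < R" "R < (1::real)" and r: "0 < r" "r < R"
      let ?M = "Linf_norm (ball x0 R) u + Tail sp p u x0 R + 1"
      let ?M' = "Linf_norm (ball x0 R) u + Tail sp p u x0 R + gagliardo sp p (ball x0 R) u + 1"
      \<comment> \<open>The estimate is known for the constructed \<open>G0\<close>. As R > 0, the
        closed ball is the closure of the open one and lies in \<open>\<Omega>\<close>, so
        uniqueness identifies the given weak gradient with \<open>G0\<close> almost everywhere on
        the ball.\<close>
      have "cball x0 R \<subseteq> \<Omega>" using cc R unfolding cc_subset_def by simp
      from weak_gradient_unique[OF G G0 this]
      have eq: "AE x in lebesgue. x \<in> ball x0 R \<longrightarrow> G x = G0 x" .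
      have "(\<integral>\<^sup>+ x. ennreal (norm (G x) powr q) * indicator (ball x0 r) x \<partial>lebesgue)
          = (\<integral>\<^sup>+ x. ennreal (norm (G0 x) powr q) * indicator (ball x0 r) x \<partial>lebesgue)"
      proof (rule nn_integral_cong_AE, use eq in eventually_elim)
        fix x assume "x \<in> ball x0 R \<longrightarrow> G x = G0 x"
        then show "ennreal (norm (G x) powr q) * indicator (ball x0 r) x = ennreal (norm (G0 x) powr q) * indicator (ball x0 r) x"
          using r by (cases "x \<in> ball x0 r") auto
      qed
      also have "\<dots> \<le> ennreal (?N powr q * (?N * ((Cg * ?M * (1 / (R - r)) powr (\<kappa> + 1)) powr q)))"
        by (rule est[OF cc R r])
      also have "\<dots> \<le> ennreal (?N powr q * (?N * Cg powr q) * ?M' powr q / (R - r) powr ((\<kappa> + 1) * q))"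
      proof (rule ennreal_leI)
        have "Linf_on (ball x0 R) u" using lb cc unfolding locally_bounded_def by blast
        then have M: "0 \<le> ?M" "?M \<le> ?M'" using Linf_norm_nonneg(1) by (auto simp: Tail_def gagliardo_def intro!: add_nonneg_nonneg)
        have "(Cg * ?M * (1 / (R - r)) powr (\<kappa> + 1)) powr q = Cg powr q * ?M powr q * (1 / (R - r)) powr ((\<kappa> + 1) * q)"
          using Cg M(1) r by (simp add: powr_mult powr_powr)
        also have "\<dots> \<le> Cg powr q * ?M' powr q * (1 / (R - r)) powr ((\<kappa> + 1) * q)"
          using M q by (intro mult_right_mono mult_left_mono powr_mono2) auto
        also have "\<dots> = Cg powr q * ?M' powr q / (R - r) powr ((\<kappa> + 1) * q)" using r by (simp add: powr_divide)
        finally have "?N powr q * (?N * ((Cg * ?M * (1 / (R - r)) powr (\<kappa> + 1)) powr q)) \<le> ?N powr q * (?N * (Cg powr q * ?M' powr q / (R - r) powr ((\<kappa> + 1) * q)))"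
          by (intro mult_left_mono) auto
        then show "?N powr q * (?N * ((Cg * ?M * (1 / (R - r)) powr (\<kappa> + 1)) powr q)) \<le> ?N powr q * (?N * Cg powr q) * ?M' powr q / (R - r) powr ((\<kappa> + 1) * q)"
          by (simp add: mult_ac)
      qed
      finally show "(\<integral>\<^sup>+ x. ennreal (norm (G x) powr q) * indicator (ball x0 r) x \<partial>lebesgue)
                  \<le> ennreal (?N powr q * (?N * Cg powr q) * ?M' powr q / (R - r) powr ((\<kappa> + 1) * q))" .
    qed
  qed
qed

end
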